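(* The natural realization functor $|\!-\!|_{nat}$ from precubical sets to flows is an m-realization functor. For any precubical set $K$, the flow $|K|_{nat}$ is m-cofibrant.
   Context: Spaces. $\mathbf{Top}$ is the category of $\Delta$-generated spaces (topology final with respect to all continuous maps from $[0,1]$), or of $\Delta$-Hausdorff $\Delta$-generated spaces (those in which the image of every continuous map from $[0,1]$ is closed); either choice is allowed. Flows. A flow $X$ is a small semicategory (no identities required) enriched over $(\mathbf{Top},\times)$: a set $X^0$ of states, for each $(\alpha,\beta)\in X^0\times X^0$ a space $\mathbb{P}_{\alpha,\beta}X$ of execution paths, and continuous strictly associative compositions $*:\mathbb{P}_{\alpha,\beta}X\times\mathbb{P}_{\beta,\gamma}X\to\mathbb{P}_{\alpha,\gamma}X$. Maps of flows are enriched semifunctors; the category is $\mathbf{Flow}$. A poset is viewed as a flow with exactly one execution path from $\alpha$ to $\beta$ if $\alpha<\beta$ and none otherwise. The m-model structure (mixed) on $\mathbf{Flow}$: a map $f:X\to Y$ is a weak equivalence if $f^0:X^0\to Y^0$ is bijective and every $\mathbb{P}_{\alpha,\beta}X\to\mathbb{P}_{f(\alpha),f(\beta)}Y$ is a weak homotopy equivalence; it is a fibration if every such map of spaces is a Hurewicz fibration; m-cofibrations are the maps with the left lifting property against trivial fibrations. Precubical sets. $[n]=\{0,1\}^n$ (with $[0]=\{()\}$) with the product order. $\square$ is the subcategory of sets with objects $[n]$, $n\geq 0$, generated by the maps $\delta_i^\epsilon:[n-1]\to[n]$ inserting $\epsilon\in\{0,1\}$ in position $i$. A precubical set is a presheaf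 $K$ on $\square$; $\square[n]=\square(-,[n])$ and $\partial\square[n]$ is its subpresheaf of cubes of dimension $\leq n-1$. m-realization functor. A functor $F$ from precubical sets to flows is an m-realization functor if $F$ is colimit-preserving, for all $n\geq0$ the map $F(\partial\square[n])\to F(\square[n])$ is an m-cofibration, and there is an objectwise weak equivalence of cocubical flows (functors $\square\to\mathbf{Flow}$) $F(\square[*])\to\{0<1\}^*$ in the m-model structure. Natural realization. For $n\geq1$, $N_n$ is the set of tame natural $d$-paths of $[0,1]^n$, i.e. of continuous maps $\gamma=(\gamma_1,\dots,\gamma_n):[0,n]\to[0,1]^n$, nondecreasing in each coordinate, with $\gamma(0),\gamma(n)\in\{0,1\}^n$ and $t=\gamma_1(t)+\dots+\gamma_n(t)$ for all $t\in[0,n]$, with the compact-open topology. The flow $|\square[n]|_{nat}$ has set of states $\{0,1\}^n$; if $\alpha<\beta$ and $m$ is the number of coordinates where $\alpha,\beta$ differ, $\mathbb{P}_{\alpha,\beta}|\square[n]|_{nat}=N_m$, viewed as the space of tame natural $d$-paths in the $m$-dimensional subcube of $[0,1]^n$ from $\alpha$ to $\beta$; otherwise it is empty. Composition is Moore composition (concatenation, lengths add). A map $\phi$ of $\square$ acts on states by $\phi$ and on path spaces by the identity of $N_m$. The natural realization is the colimit-preserving functor $|K|_{nat}=\varinjlim_{\square[n]\to K}|\square[n]|_{nat}$ (colimit over the category of cubes of $K$). *)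

theory Defs
  imports "HOL-Analysis.Analysis"
begin

section \<open>Categories, functors, colimits\<close>

text \<open>\<open>Cmp C a b c g f\<close> is the composite of \<open>f : a \<rightarrow> b\<close> followed by \<open>g : b \<rightarrow> c\<close>. Arrows do not
  carry their source and target, so the hom-sets of distinct pairs of objects may overlap.\<close>

record ('o, 'm) cat =
  Ob :: "'o set"
  Hom :: "'o \<Rightarrow> 'o \<Rightarrow> 'm set"
  Cmp :: "'o \<Rightarrow> 'o \<Rightarrow> 'o \<Rightarrow> 'm \<Rightarrow> 'm \<Rightarrow> 'm"
  Idn :: "'o \<Rightarrow> 'm"

definition is_category :: "('o, 'm) cat \<Rightarrow> bool" where
  "is_category C \<longleftrightarrow>
     (\<forall>a\<in>Ob C. Idn C a \<in> Hom C a a) \<and>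
     (\<forall>a\<in>Ob C. \<forall>b\<in>Ob C. \<forall>c\<in>Ob C. \<forall>f\<in>Hom C a b. \<forall>g\<in>Hom C b c. Cmp C a b c g f \<in> Hom C a c) \<and>
     (\<forall>a\<in>Ob C. \<forall>b\<in>Ob C. \<forall>f\<in>Hom C a b.
        Cmp C a b b (Idn C b) f = f \<and> Cmp C a a b f (Idn C a) = f) \<and>
     (\<forall>a\<in>Ob C. \<forall>b\<in>Ob C. \<forall>c\<in>Ob C. \<forall>d\<in>Ob C.
        \<forall>f\<in>Hom C a b. \<forall>g\<in>Hom C b c. \<forall>h\<in>Hom C c d.
          Cmp C a c d h (Cmp C a b c g f) = Cmp C a b d (Cmp C b c d h g) f)"

record ('o, 'm, 'p, 'n) fctr =
  fob :: "'o \<Rightarrow> 'p"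
  fmor :: "'o \<Rightarrow> 'o \<Rightarrow> 'm \<Rightarrow> 'n"

definition is_functor :: "('o, 'm) cat \<Rightarrow> ('p, 'n) cat \<Rightarrow> ('o, 'm, 'p, 'n) fctr \<Rightarrow> bool" where
  "is_functor C D F \<longleftrightarrow>
     (\<forall>a\<in>Ob C. fob F a \<in> Ob D) \<and>
     (\<forall>a\<in>Ob C. \<forall>b\<in>Ob C. \<forall>f\<in>Hom C a b. fmor F a b f \<in> Hom D (fob F a) (fob F b)) \<and>
     (\<forall>a\<in>Ob C. fmor F a a (Idn C a) = Idn D (fob F a)) \<and>
     (\<forall>a\<in>Ob C. \<forall>b\<in>Ob C. \<forall>c\<in>Ob C. \<forall>f\<in>Hom C a b. \<forall>g\<in>Hom C b c.
        fmor F a c (Cmp C a b c g f) =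
          Cmp D (fob F a) (fob F b) (fob F c) (fmor F b c g) (fmor F a b f))"

definition fctr_comp ::
  "('p, 'n, 'q, 'k) fctr \<Rightarrow> ('o, 'm, 'p, 'n) fctr \<Rightarrow> ('o, 'm, 'q, 'k) fctr" where
  "fctr_comp G F =
     \<lparr> fob = (\<lambda>a. fob G (fob F a)),
       fmor = (\<lambda>a b f. fmor G (fob F a) (fob F b) (fmor F a b f)) \<rparr>"

definition is_cocone ::
  "('j, 'i) cat \<Rightarrow> ('o, 'm) cat \<Rightarrow> ('j, 'i, 'o, 'm) fctr \<Rightarrow> 'o \<Rightarrow> ('j \<Rightarrow> 'm) \<Rightarrow> bool" where
  "is_cocone J C D c \<iota> \<longleftrightarrow>
     c \<in> Ob C \<and> (\<forall>j\<in>Ob J. \<iota> j \<in> Hom C (fob D j) c) \<and>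
     (\<forall>j\<in>Ob J. \<forall>k\<in>Ob J. \<forall>u\<in>Hom J j k.
        Cmp C (fob D j) (fob D k) c (\<iota> k) (fmor D j k u) = \<iota> j)"

definition is_colimit ::
  "('j, 'i) cat \<Rightarrow> ('o, 'm) cat \<Rightarrow> ('j, 'i, 'o, 'm) fctr \<Rightarrow> 'o \<Rightarrow> ('j \<Rightarrow> 'm) \<Rightarrow> bool" where
  "is_colimit J C D c \<iota> \<longleftrightarrow>
     is_cocone J C D c \<iota> \<and>
     (\<forall>d \<mu>. is_cocone J C D d \<mu> \<longrightarrow>
        (\<exists>!h. h \<in> Hom C c d \<and> (\<forall>j\<in>Ob J. Cmp C (fob D j) c d h (\<iota> j) = \<mu> j)))"

definition lifts :: "('o, 'm) cat \<Rightarrow> 'o \<Rightarrow> 'o \<Rightarrow> 'm \<Rightarrow> 'o \<Rightarrow> 'o \<Rightarrow> 'm \<Rightarrow> bool" where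
  "lifts C A B i X Y p \<longleftrightarrow>
     (\<forall>u\<in>Hom C A X. \<forall>v\<in>Hom C B Y. Cmp C A X Y p u = Cmp C A B Y v i \<longrightarrow>
        (\<exists>h\<in>Hom C B X. Cmp C A B X h i = u \<and> Cmp C B X Y p h = v))"


section \<open>The category Top and the two notions of fibration and weak equivalence\<close>

definition delta_open :: "'a topology \<Rightarrow> 'a set \<Rightarrow> bool" where
  "delta_open X U \<longleftrightarrow> U \<subseteq> topspace X \<and>
     (\<forall>p. pathin X p \<longrightarrow> openin (top_of_set {0..1::real}) {t \<in> {0..1}. p t \<in> U})"

lemma istopology_delta_open: "istopology (delta_open X)"
  unfolding istopology_def
proof (intro conjI allI impI)
  fix S T assume S: "delta_open X S" and T: "delta_open X T"
  show "delta_open X (S \<inter> T)"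
    unfolding delta_open_def
  proof (intro conjI allI impI)
    show "S \<inter> T \<subseteq> topspace X" using S by (auto simp: delta_open_def)
    fix p assume "pathin X p"
    then have "openin (top_of_set {0..1::real}) ({t \<in> {0..1}. p t \<in> S} \<inter> {t \<in> {0..1}. p t \<in> T})"
      using S T by (intro openin_Int) (auto simp: delta_open_def)
    then show "openin (top_of_set {0..1::real}) {t \<in> {0..1}. p t \<in> S \<inter> T}"
      by (auto elim!: back_subst[of "openin (top_of_set {0..1::real})"])
  qed
next
  fix \<K> assume K: "\<forall>S\<in>\<K>. delta_open X S"
  show "delta_open X (\<Union>\<K>)"
    unfolding delta_open_def
  proof (intro conjI allI impI)
    show "\<Union>\<K> \<subseteq> topspace X" using K by (auto simp: delta_open_def)
    fix p assume "pathin X p"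
    then have "openin (top_of_set {0..1::real}) (\<Union>S\<in>\<K>. {t \<in> {0..1}. p t \<in> S})"
      using K by (intro openin_Union) (auto simp: delta_open_def)
    then show "openin (top_of_set {0..1::real}) {t \<in> {0..1}. p t \<in> \<Union>\<K>}"
      by (auto elim!: back_subst[of "openin (top_of_set {0..1::real})"])
  qed
qed

definition delta_ify :: "'a topology \<Rightarrow> 'a topology" where
  "delta_ify X = topology (delta_open X)"

lemma openin_delta_ify: "openin (delta_ify X) = delta_open X"
  by (simp add: delta_ify_def istopology_delta_open)

definition delta_generated :: "'a topology \<Rightarrow> bool" where
  "delta_generated X \<longleftrightarrow> (\<forall>U. openin X U \<longleftrightarrow> delta_open X U)"

definition delta_Hausdorff :: "'a topology \<Rightarrow> bool" where
  "delta_Hausdorff X \<longleftrightarrow> (\<forall>p. pathin X p \<longrightarrow> closedin X (p ` {0..1}))"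

text \<open>The Boolean selects between the two admissible choices of Top.\<close>

definition in_Top :: "bool \<Rightarrow> 'a topology \<Rightarrow> bool" where
  "in_Top haus X \<longleftrightarrow> delta_generated X \<and> (haus \<longrightarrow> delta_Hausdorff X)"

text \<open>The categorical product of Top (for both choices), which refines the product topology.\<close>

definition delta_prod :: "'a topology \<Rightarrow> 'b topology \<Rightarrow> ('a \<times> 'b) topology" where
  "delta_prod X Y = delta_ify (prod_topology X Y)"

text \<open>The homotopy lifting property against all spaces of Top. A definition cannot quantify over
  types; the type of \<open>Z\<close> is chosen so that it contains the universal test space, the pullback
  of \<open>p\<close> along evaluation at 0 of the path space of \<open>B\<close>, through which every lifting problem
  factors. So lifting for these \<open>Z\<close> implies lifting for \<open>Z\<close> of any type.\<close>

definition Hurewicz_fibration ::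
  "bool \<Rightarrow> 'e topology \<Rightarrow> 'b topology \<Rightarrow> ('e \<Rightarrow> 'b) \<Rightarrow> bool" where
  "Hurewicz_fibration haus E B p \<longleftrightarrow>
     continuous_map E B p \<and>
     (\<forall>(Z :: ('e \<times> (real \<Rightarrow> 'b)) topology) g H.
        in_Top haus Z \<and> continuous_map Z E g \<and>
        continuous_map (delta_prod Z (top_of_set {0..1::real})) B H \<and>
        (\<forall>z\<in>topspace Z. H (z, 0) = p (g z))
        \<longrightarrow> (\<exists>G. continuous_map (delta_prod Z (top_of_set {0..1::real})) E G \<and>
                 (\<forall>z\<in>topspace Z. G (z, 0) = g z) \<and>
                 (\<forall>z\<in>topspace Z. \<forall>t\<in>{0..1}. p (G (z, t)) = H (z, t))))"

text \<open>The cube $[0,1]^n$; its points are the functions on \<open>{..<n}\<close>, extended by \<open>undefined\<close>.\<close>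

definition cube_top :: "nat \<Rightarrow> (nat \<Rightarrow> real) topology" where
  "cube_top n = product_topology (\<lambda>_. top_of_set {0..1}) {..<n}"

definition cube_bdry :: "nat \<Rightarrow> (nat \<Rightarrow> real) set" where
  "cube_bdry n = {z \<in> topspace (cube_top n). \<exists>i<n. z i = 0 \<or> z i = 1}"

definition sphere_maps :: "nat \<Rightarrow> 'a topology \<Rightarrow> 'a \<Rightarrow> ((nat \<Rightarrow> real) \<Rightarrow> 'a) set" where
  "sphere_maps n X x = {g. continuous_map (cube_top n) X g \<and> (\<forall>z\<in>cube_bdry n. g z = x)}"

definition sphere_htpy ::
  "nat \<Rightarrow> 'a topology \<Rightarrow> 'a \<Rightarrow> (((nat \<Rightarrow> real) \<Rightarrow> 'a) \<times> ((nat \<Rightarrow> real) \<Rightarrow> 'a)) set" where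
  "sphere_htpy n X x =
     {(g, g'). g \<in> sphere_maps n X x \<and> g' \<in> sphere_maps n X x \<and>
        homotopic_with (\<lambda>k. \<forall>z\<in>cube_bdry n. k z = x) (cube_top n) X g g'}"

definition homotopy_classes :: "nat \<Rightarrow> 'a topology \<Rightarrow> 'a \<Rightarrow> ((nat \<Rightarrow> real) \<Rightarrow> 'a) set set" where
  "homotopy_classes n X x = sphere_maps n X x // sphere_htpy n X x"

text \<open>The maps induced on homotopy groups are group homomorphisms for every continuous \<open>f\<close>,
  so being an isomorphism just means being bijective.\<close>

definition weak_homotopy_equivalence :: "'a topology \<Rightarrow> 'b topology \<Rightarrow> ('a \<Rightarrow> 'b) \<Rightarrow> bool" where
  "weak_homotopy_equivalence X Y f \<longleftrightarrow>
     continuous_map X Y f \<and>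
     bij_betw (\<lambda>C. \<Union>x\<in>C. path_component_of_set Y (f x))
       (path_components_of X) (path_components_of Y) \<and>
     (\<forall>n\<ge>1. \<forall>x\<in>topspace X.
        bij_betw (\<lambda>C. sphere_htpy n Y (f x) `` ((\<lambda>g. f \<circ> g) ` C))
          (homotopy_classes n X x) (homotopy_classes n Y (f x)))"


section \<open>Flows\<close>

record ('s, 'p) flow =
  states :: "'s set"
  paths :: "'s \<Rightarrow> 's \<Rightarrow> 'p topology"
  pcomp :: "'s \<Rightarrow> 's \<Rightarrow> 's \<Rightarrow> 'p \<Rightarrow> 'p \<Rightarrow> 'p"

definition is_flow :: "bool \<Rightarrow> ('s, 'p) flow \<Rightarrow> bool" where
  "is_flow haus X \<longleftrightarrow>
     (\<forall>\<alpha>\<in>states X. \<forall>\<beta>\<in>states X. in_Top haus (paths X \<alpha> \<beta>)) \<and>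
     (\<forall>\<alpha>\<in>states X. \<forall>\<beta>\<in>states X. \<forall>\<gamma>\<in>states X.
        continuous_map (delta_prod (paths X \<alpha> \<beta>) (paths X \<beta> \<gamma>)) (paths X \<alpha> \<gamma>)
          (\<lambda>(p, q). pcomp X \<alpha> \<beta> \<gamma> p q)) \<and>
     (\<forall>\<alpha>\<in>states X. \<forall>\<beta>\<in>states X. \<forall>\<gamma>\<in>states X. \<forall>\<delta>\<in>states X.
        \<forall>p\<in>topspace (paths X \<alpha> \<beta>). \<forall>q\<in>topspace (paths X \<beta> \<gamma>). \<forall>r\<in>topspace (paths X \<gamma> \<delta>).
          pcomp X \<alpha> \<gamma> \<delta> (pcomp X \<alpha> \<beta> \<gamma> p q) r = pcomp X \<alpha> \<beta> \<delta> p (pcomp X \<beta> \<gamma> \<delta> q r))"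

text \<open>A map of flows is a map of states together with maps of path spaces. \<open>fmap_on\<close> sets both
  components to \<open>undefined\<close> off their domains, so that equality of maps is equality in HOL.\<close>

type_synonym ('s, 'p, 't, 'q) fmap = "('s \<Rightarrow> 't) \<times> ('s \<Rightarrow> 's \<Rightarrow> 'p \<Rightarrow> 'q)"

definition fmap_on :: "('s, 'p) flow \<Rightarrow> ('s, 'p, 't, 'q) fmap \<Rightarrow> ('s, 'p, 't, 'q) fmap" where
  "fmap_on X f =
     (restrict (fst f) (states X),
      \<lambda>\<alpha> \<beta> p. if \<alpha> \<in> states X \<and> \<beta> \<in> states X \<and> p \<in> topspace (paths X \<alpha> \<beta>)
               then snd f \<alpha> \<beta> p else undefined)"

definition is_flow_map :: "('s, 'p) flow \<Rightarrow> ('t, 'q) flow \<Rightarrow> ('s, 'p, 't, 'q) fmap \<Rightarrow> bool" where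
  "is_flow_map X Y f \<longleftrightarrow>
     fmap_on X f = f \<and>
     fst f \<in> states X \<rightarrow> states Y \<and>
     (\<forall>\<alpha>\<in>states X. \<forall>\<beta>\<in>states X.
        continuous_map (paths X \<alpha> \<beta>) (paths Y (fst f \<alpha>) (fst f \<beta>)) (snd f \<alpha> \<beta>)) \<and>
     (\<forall>\<alpha>\<in>states X. \<forall>\<beta>\<in>states X. \<forall>\<gamma>\<in>states X.
        \<forall>p\<in>topspace (paths X \<alpha> \<beta>). \<forall>q\<in>topspace (paths X \<beta> \<gamma>).
          snd f \<alpha> \<gamma> (pcomp X \<alpha> \<beta> \<gamma> p q) =
            pcomp Y (fst f \<alpha>) (fst f \<beta>) (fst f \<gamma>) (snd f \<alpha> \<beta> p) (snd f \<beta> \<gamma> q))"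

definition Flow :: "bool \<Rightarrow> (('s, 'p) flow, ('s, 'p, 's, 'p) fmap) cat" where
  "Flow haus =
     \<lparr> Ob = {X. is_flow haus X},
       Hom = (\<lambda>X Y. {f. is_flow_map X Y f}),
       Cmp = (\<lambda>X Y Z g f.
         fmap_on X (fst g \<circ> fst f, \<lambda>\<alpha> \<beta>. snd g (fst f \<alpha>) (fst f \<beta>) \<circ> snd f \<alpha> \<beta>)),
       Idn = (\<lambda>X. fmap_on X (id, \<lambda>_ _. id)) \<rparr>"

definition flow_weak_equivalence ::
  "('s, 'p) flow \<Rightarrow> ('s, 'p) flow \<Rightarrow> ('s, 'p, 's, 'p) fmap \<Rightarrow> bool" where
  "flow_weak_equivalence X Y f \<longleftrightarrow>
     bij_betw (fst f) (states X) (states Y) \<and>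
     (\<forall>\<alpha>\<in>states X. \<forall>\<beta>\<in>states X.
        weak_homotopy_equivalence (paths X \<alpha> \<beta>) (paths Y (fst f \<alpha>) (fst f \<beta>)) (snd f \<alpha> \<beta>))"

definition m_fibration ::
  "bool \<Rightarrow> ('s, 'p) flow \<Rightarrow> ('s, 'p) flow \<Rightarrow> ('s, 'p, 's, 'p) fmap \<Rightarrow> bool" where
  "m_fibration haus X Y f \<longleftrightarrow>
     (\<forall>\<alpha>\<in>states X. \<forall>\<beta>\<in>states X.
        Hurewicz_fibration haus (paths X \<alpha> \<beta>) (paths Y (fst f \<alpha>) (fst f \<beta>)) (snd f \<alpha> \<beta>))"

definition m_cofibration ::
  "bool \<Rightarrow> ('s, 'p) flow \<Rightarrow> ('s, 'p) flow \<Rightarrow> ('s, 'p, 's, 'p) fmap \<Rightarrow> bool" where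
  "m_cofibration haus A B i \<longleftrightarrow>
     A \<in> Ob (Flow haus) \<and> B \<in> Ob (Flow haus) \<and> i \<in> Hom (Flow haus) A B \<and>
     (\<forall>X\<in>Ob (Flow haus). \<forall>Y\<in>Ob (Flow haus). \<forall>p\<in>Hom (Flow haus) X Y.
        m_fibration haus X Y p \<and> flow_weak_equivalence X Y p \<longrightarrow>
        lifts (Flow haus) A B i X Y p)"

definition empty_flow :: "('s, 'p) flow" where
  "empty_flow =
     \<lparr> states = {}, paths = (\<lambda>_ _. discrete_topology {}), pcomp = (\<lambda>_ _ _ _ _. undefined) \<rparr>"

text \<open>The empty flow is initial; its unique map to \<open>X\<close> is \<open>undefined\<close> everywhere.\<close>

definition m_cofibrant :: "bool \<Rightarrow> ('s, 'p) flow \<Rightarrow> bool" where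
  "m_cofibrant haus X \<longleftrightarrow>
     m_cofibration haus empty_flow X (\<lambda>_. undefined, \<lambda>_ _ _. undefined)"


section \<open>The box category and precubical sets\<close>

text \<open>The set $[n] = \{0,1\}^n$, with its product order.\<close>

definition vert :: "nat \<Rightarrow> bool list set" where
  "vert n = {xs. length xs = n}"

definition vless :: "bool list \<Rightarrow> bool list \<Rightarrow> bool" where
  "vless \<alpha> \<beta> \<longleftrightarrow> list_all2 (\<le>) \<alpha> \<beta> \<and> \<alpha> \<noteq> \<beta>"

text \<open>Positions are counted from 0.\<close>

definition coface :: "nat \<Rightarrow> nat \<Rightarrow> bool \<Rightarrow> bool list \<Rightarrow> bool list" where
  "coface n i \<epsilon> = (\<lambda>xs\<in>vert n. take i xs @ \<epsilon> # drop i xs)"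

inductive box_map :: "nat \<Rightarrow> nat \<Rightarrow> (bool list \<Rightarrow> bool list) \<Rightarrow> bool" where
  ident: "box_map n n (\<lambda>xs\<in>vert n. xs)"
| face: "i \<le> n \<Longrightarrow> box_map n (Suc n) (coface n i \<epsilon>)"
| comp: "box_map l m f \<Longrightarrow> box_map m n g \<Longrightarrow> box_map l n (compose (vert l) g f)"

definition Box :: "(nat, bool list \<Rightarrow> bool list) cat" where
  "Box =
     \<lparr> Ob = UNIV,
       Hom = (\<lambda>m n. {f. box_map m n f}),
       Cmp = (\<lambda>l m n g f. compose (vert l) g f),
       Idn = (\<lambda>n. \<lambda>xs\<in>vert n. xs) \<rparr>"

text \<open>\<open>act K m n \<phi>\<close> is the structure map from the n-cubes to the m-cubes of \<open>K\<close> induced by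
  \<open>\<phi> : [m] \<rightarrow> [n]\<close>.\<close>

record 'u precub =
  cells :: "nat \<Rightarrow> 'u set"
  act :: "nat \<Rightarrow> nat \<Rightarrow> (bool list \<Rightarrow> bool list) \<Rightarrow> 'u \<Rightarrow> 'u"

definition is_precubical_set :: "'u precub \<Rightarrow> bool" where
  "is_precubical_set K \<longleftrightarrow>
     (\<forall>m n. \<forall>\<phi>\<in>Hom Box m n. act K m n \<phi> \<in> cells K n \<rightarrow> cells K m) \<and>
     (\<forall>n. \<forall>x\<in>cells K n. act K n n (Idn Box n) x = x) \<and>
     (\<forall>l m n. \<forall>\<phi>\<in>Hom Box l m. \<forall>\<psi>\<in>Hom Box m n. \<forall>x\<in>cells K n.
        act K l n (Cmp Box l m n \<psi> \<phi>) x = act K l m \<phi> (act K m n \<psi> x))"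

definition is_precub_map :: "'u precub \<Rightarrow> 'u precub \<Rightarrow> (nat \<Rightarrow> 'u \<Rightarrow> 'u) \<Rightarrow> bool" where
  "is_precub_map K L f \<longleftrightarrow>
     (\<forall>n. f n \<in> cells K n \<rightarrow>\<^sub>E cells L n) \<and>
     (\<forall>m n. \<forall>\<phi>\<in>Hom Box m n. \<forall>x\<in>cells K n. f m (act K m n \<phi> x) = act L m n \<phi> (f n x))"

definition PreCub :: "('u precub, nat \<Rightarrow> 'u \<Rightarrow> 'u) cat" where
  "PreCub =
     \<lparr> Ob = {K. is_precubical_set K},
       Hom = (\<lambda>K L. {f. is_precub_map K L f}),
       Cmp = (\<lambda>K L M g f. \<lambda>n. compose (cells K n) (g n) (f n)),
       Idn = (\<lambda>K. \<lambda>n. \<lambda>x\<in>cells K n. x) \<rparr>"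


section \<open>The universe\<close>

text \<open>\<open>'a univ set\<close> plays the role of the category of (small) sets: all precubical sets, flows and
  index categories below have their elements in \<open>'a univ\<close>, for an arbitrary type \<open>'a\<close>. The
  other constructors provide canonical copies of the cubes. If \<open>\<kappa>\<close> is the cardinality of
  \<open>'a univ\<close>, then \<open>\<kappa> * \<kappa> = \<kappa>\<close> and \<open>\<kappa>\<close> is at least the continuum, so colimits of diagrams over
  index categories in \<open>'a univ\<close>, both of precubical sets and of flows, have representatives
  in \<open>'a univ\<close>; hence a universal property tested inside \<open>'a univ\<close> is the unrestricted one. Up to
  isomorphism, any given objects and diagrams, of whatever size, occur for suitable \<open>'a\<close>.\<close>

datatype 'a univ =
    Label 'a
  | Vertex (unVertex: "bool list")
  | Face (unFace: "bool list \<Rightarrow> bool list")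
  | NPath (unNPath: "real \<Rightarrow> nat \<Rightarrow> real")

type_synonym 'a uprecub = "'a univ precub"
type_synonym 'a uflow = "('a univ, 'a univ) flow"
type_synonym 'a uflow_map = "('a univ, 'a univ, 'a univ, 'a univ) fmap"
type_synonym 'a upc_to_flow =
  "('a uprecub, nat \<Rightarrow> 'a univ \<Rightarrow> 'a univ, 'a uflow, 'a uflow_map) fctr"

definition std_cube :: "nat \<Rightarrow> 'a uprecub" where
  "std_cube n =
     \<lparr> cells = (\<lambda>m. Face ` Hom Box m n),
       act = (\<lambda>l m \<phi> x. Face (Cmp Box l m n (unFace x) \<phi>)) \<rparr>"

definition std_cube_bdry :: "nat \<Rightarrow> 'a uprecub" where
  "std_cube_bdry n = (std_cube n) \<lparr> cells := (\<lambda>m. if m < n then cells (std_cube n) m else {}) \<rparr>"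

definition bdry_incl :: "nat \<Rightarrow> nat \<Rightarrow> 'a univ \<Rightarrow> 'a univ" where
  "bdry_incl n = (\<lambda>m. \<lambda>x\<in>cells (std_cube_bdry n) m. x)"

text \<open>The Yoneda embedding.\<close>

definition yoneda ::
  "(nat, bool list \<Rightarrow> bool list, 'a uprecub, nat \<Rightarrow> 'a univ \<Rightarrow> 'a univ) fctr" where
  "yoneda =
     \<lparr> fob = std_cube,
       fmor = (\<lambda>m n \<phi>. \<lambda>k. \<lambda>x\<in>cells (std_cube m) k. Face (Cmp Box k m n \<phi> (unFace x))) \<rparr>"


section \<open>m-realization functors\<close>

text \<open>A poset as a flow; the unique execution path between comparable states is \<open>Vertex []\<close>.\<close>

definition poset_flow :: "'a univ set \<Rightarrow> ('a univ \<Rightarrow> 'a univ \<Rightarrow> bool) \<Rightarrow> 'a uflow" where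
  "poset_flow S lt =
     \<lparr> states = S,
       paths = (\<lambda>\<alpha> \<beta>. discrete_topology
                  (if \<alpha> \<in> S \<and> \<beta> \<in> S \<and> lt \<alpha> \<beta> then {Vertex []} else {})),
       pcomp = (\<lambda>_ _ _ _ _. Vertex []) \<rparr>"

text \<open>The cocubical flow $\{0<1\}^*$.\<close>

definition cube_poset :: "(nat, bool list \<Rightarrow> bool list, 'a uflow, 'a uflow_map) fctr" where
  "cube_poset =
     (let P = (\<lambda>n. poset_flow (Vertex ` vert n) (\<lambda>a b. vless (unVertex a) (unVertex b)))
      in \<lparr> fob = P,
           fmor = (\<lambda>m n \<phi>. fmap_on (P m) (\<lambda>a. Vertex (\<phi> (unVertex a)), \<lambda>_ _ p. p)) \<rparr>)"

definition colimit_preserving :: "bool \<Rightarrow> 'a upc_to_flow \<Rightarrow> bool" where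
  "colimit_preserving haus F \<longleftrightarrow>
     (\<forall>(J :: ('a univ, 'a univ) cat) D K \<iota>.
        is_category J \<and> is_functor J PreCub D \<and> is_colimit J PreCub D K \<iota> \<longrightarrow>
        is_colimit J (Flow haus) (fctr_comp F D) (fob F K) (\<lambda>j. fmor F (fob D j) K (\<iota> j)))"

definition m_realization_functor :: "bool \<Rightarrow> 'a upc_to_flow \<Rightarrow> bool" where
  "m_realization_functor haus F \<longleftrightarrow>
     is_functor PreCub (Flow haus) F \<and>
     colimit_preserving haus F \<and>
     (\<forall>n. m_cofibration haus (fob F (std_cube_bdry n)) (fob F (std_cube n))
            (fmor F (std_cube_bdry n) (std_cube n) (bdry_incl n))) \<and>
     (\<exists>\<tau>.
        (\<forall>n. \<tau> n \<in> Hom (Flow haus) (fob F (std_cube n)) (fob cube_poset n) \<and>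
             flow_weak_equivalence (fob F (std_cube n)) (fob cube_poset n) (\<tau> n)) \<and>
        (\<forall>m n. \<forall>\<phi>\<in>Hom Box m n.
           Cmp (Flow haus) (fob F (std_cube m)) (fob F (std_cube n)) (fob cube_poset n)
             (\<tau> n) (fmor (fctr_comp F yoneda) m n \<phi>) =
           Cmp (Flow haus) (fob F (std_cube m)) (fob cube_poset m) (fob cube_poset n)
             (fmor cube_poset m n \<phi>) (\<tau> m)))"


section \<open>The natural realization\<close>

definition compact_open :: "'a topology \<Rightarrow> 'b topology \<Rightarrow> ('a \<Rightarrow> 'b) topology" where
  "compact_open X Y = topology_generated_by
     {{f \<in> extensional (topspace X). continuous_map X Y f \<and> f ` C \<subseteq> U} | C U.
        compactin X C \<and> openin Y U}"

definition natural_dpaths :: "nat \<Rightarrow> (real \<Rightarrow> nat \<Rightarrow> real) set" where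
  "natural_dpaths n =
     {\<gamma> \<in> extensional {0..real n}.
        continuous_map (top_of_set {0..real n}) (cube_top n) \<gamma> \<and>
        (\<forall>i<n. mono_on {0..real n} (\<lambda>t. \<gamma> t i)) \<and>
        (\<forall>i<n. \<gamma> 0 i \<in> {0, 1} \<and> \<gamma> (real n) i \<in> {0, 1}) \<and>
        (\<forall>t\<in>{0..real n}. t = (\<Sum>i<n. \<gamma> t i))}"

definition N :: "nat \<Rightarrow> (real \<Rightarrow> nat \<Rightarrow> real) topology" where
  "N n = subtopology (compact_open (top_of_set {0..real n}) (cube_top n)) (natural_dpaths n)"

definition diff_coords :: "bool list \<Rightarrow> bool list \<Rightarrow> nat set" where
  "diff_coords \<alpha> \<beta> = {i. i < length \<alpha> \<and> \<alpha> ! i \<noteq> \<beta> ! i}"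

text \<open>An element of $N_m$ viewed as a path in the $m$-dimensional subcube from \<open>\<alpha>\<close> to \<open>\<beta>\<close>: its
  $k$-th component moves the $k$-th coordinate in which \<open>\<alpha>\<close> and \<open>\<beta>\<close> differ.\<close>

definition in_subcube ::
  "bool list \<Rightarrow> bool list \<Rightarrow> (real \<Rightarrow> nat \<Rightarrow> real) \<Rightarrow> real \<Rightarrow> nat \<Rightarrow> real" where
  "in_subcube \<alpha> \<beta> \<eta> =
     (\<lambda>t i. if i \<in> diff_coords \<alpha> \<beta> then \<eta> t (card (diff_coords \<alpha> \<beta> \<inter> {..<i}))
            else of_bool (\<alpha> ! i))"

text \<open>Moore composition, first in the ambient cube and then read off in the subcube from \<open>\<alpha>\<close>
  to \<open>\<gamma>\<close>.\<close>

definition moore ::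
  "real \<Rightarrow> (real \<Rightarrow> nat \<Rightarrow> real) \<Rightarrow> (real \<Rightarrow> nat \<Rightarrow> real) \<Rightarrow> real \<Rightarrow> nat \<Rightarrow> real" where
  "moore l p q = (\<lambda>t. if t \<le> l then p t else q (t - l))"

definition N_comp ::
  "bool list \<Rightarrow> bool list \<Rightarrow> bool list \<Rightarrow> (real \<Rightarrow> nat \<Rightarrow> real) \<Rightarrow> (real \<Rightarrow> nat \<Rightarrow> real) \<Rightarrow>
     real \<Rightarrow> nat \<Rightarrow> real" where
  "N_comp \<alpha> \<beta> \<gamma> \<eta> \<theta> =
     (\<lambda>t\<in>{0..real (card (diff_coords \<alpha> \<gamma>))}. \<lambda>k\<in>{..<card (diff_coords \<alpha> \<gamma>)}.
        moore (real (card (diff_coords \<alpha> \<beta>))) (in_subcube \<alpha> \<beta> \<eta>) (in_subcube \<beta> \<gamma> \<theta>)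
          t (sorted_list_of_set (diff_coords \<alpha> \<gamma>) ! k))"

definition nat_cube :: "nat \<Rightarrow> 'a uflow" where
  "nat_cube n =
     \<lparr> states = Vertex ` vert n,
       paths = (\<lambda>a b.
         if a \<in> Vertex ` vert n \<and> b \<in> Vertex ` vert n \<and> vless (unVertex a) (unVertex b)
         then let M = N (card (diff_coords (unVertex a) (unVertex b)))
              in pullback_topology (NPath ` topspace M) unNPath M
         else discrete_topology {}),
       pcomp = (\<lambda>a b c p q.
         NPath (N_comp (unVertex a) (unVertex b) (unVertex c) (unNPath p) (unNPath q))) \<rparr>"

definition nat_cube_map :: "nat \<Rightarrow> nat \<Rightarrow> (bool list \<Rightarrow> bool list) \<Rightarrow> 'a uflow_map" where
  "nat_cube_map m n \<phi> = fmap_on (nat_cube m) (\<lambda>a. Vertex (\<phi> (unVertex a)), \<lambda>_ _ p. p)"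

definition cubes_of :: "'u precub \<Rightarrow> (nat \<times> 'u, bool list \<Rightarrow> bool list) cat" where
  "cubes_of K =
     \<lparr> Ob = {(n, x). x \<in> cells K n},
       Hom = (\<lambda>(m, x) (n, y). {\<phi> \<in> Hom Box m n. act K m n \<phi> y = x}),
       Cmp = (\<lambda>(l, _) (m, _) (n, _) \<psi> \<phi>. Cmp Box l m n \<psi> \<phi>),
       Idn = (\<lambda>(n, _). Idn Box n) \<rparr>"

definition nat_diagram ::
  "(nat \<times> 'a univ, bool list \<Rightarrow> bool list, 'a uflow, 'a uflow_map) fctr" where
  "nat_diagram =
     \<lparr> fob = (\<lambda>(n, _). nat_cube n), fmor = (\<lambda>(m, _) (n, _) \<phi>. nat_cube_map m n \<phi>) \<rparr>"

text \<open>A chosen colimit cocone, for each \<open>K\<close>, and the functor it induces.\<close>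

definition nat_colimit :: "bool \<Rightarrow> 'a uprecub \<Rightarrow> 'a uflow \<times> (nat \<times> 'a univ \<Rightarrow> 'a uflow_map)" where
  "nat_colimit haus K =
     (SOME (X, \<iota>). is_colimit (cubes_of K) (Flow haus) nat_diagram X \<iota>)"

definition nat_realization :: "bool \<Rightarrow> 'a upc_to_flow" where
  "nat_realization haus =
     \<lparr> fob = (\<lambda>K. fst (nat_colimit haus K)),
       fmor = (\<lambda>K L f. THE h.
         h \<in> Hom (Flow haus) (fst (nat_colimit haus K)) (fst (nat_colimit haus L)) \<and>
         (\<forall>n. \<forall>x\<in>cells K n.
            Cmp (Flow haus) (nat_cube n) (fst (nat_colimit haus K)) (fst (nat_colimit haus L))
              h (snd (nat_colimit haus K) (n, x)) = snd (nat_colimit haus L) (n, f n x))) \<rparr>"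

end

theory Submission
  imports Defs
begin

text \<open>The category of flows has colimits: states and execution paths are represented by formal
  composites of those of the diagram, identified when they agree in all cocones, with the topology
  generated by the curves that are continuous in all cocones. So a map out of the realization of \<open>K\<close>
  is a compatible family of maps out of the flows of cubes, one for each cell of \<open>K\<close>
  (\<open>ex1_real_map\<close>). Functoriality is formal. So is the preservation of colimits, since a cocone of
  flows is a cocone of precubical sets over the presheaf of cubes in the target. The realization of
  the n-cube is the flow \<open>nat_cube n\<close> itself. Its nonempty path spaces \<open>N m\<close> are convex, hence their
  points are joined by paths that depend continuously on the ends, which makes all homotopy groups
  trivial; this gives the comparison with the posets \<open>{0<1}^n\<close>.

  The heart is that the boundary inclusion of the n-cube has the left lifting property against a trivial
  fibration of flows (\<open>cube_flow_lift\<close>). All path spaces of the n-cube but the one from the bottom to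
  the top vertex are path spaces of proper faces, so a lift is prescribed on them. On \<open>N n\<close> the
  compatibility with composition prescribes it exactly on the subspace \<open>broken n\<close> of the paths that
  pass through some other vertex; associativity makes the prescriptions agree. So it remains to
  lift a map from \<open>N n\<close> relatively to \<open>broken n\<close> through a map of spaces that is a Hurewicz fibration
  and a weak homotopy equivalence (\<open>rel_lifts_broken\<close>). Such a map has the relative lifting property
  for the boundary of a cube by the classical argument with homotopy groups, hence for subcomplexes
  of a subdivided cube. The times at which the coordinates of a path are traversed map \<open>N n\<close> to such a
  cube and \<open>broken n\<close> to a subcomplex; there is a map back that respects the subspaces, and the
  composite is homotopic to the identity of the pair through convex combinations. As \<open>broken n\<close> is a
  neighbourhood deformation retract in a weak sense, the homotopy lifting property carries a lift over the
  complex to one over \<open>N n\<close>. Cofibrancy of the realization of \<open>K\<close> follows by lifting over one dimension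
  after the other.\<close>

section \<open>Delta-generated spaces\<close>

abbreviation unit_ivl :: "real topology" where
  "unit_ivl \<equiv> top_of_set {0..1}"

abbreviation cmap :: "'a topology => 'b topology => ('a => 'b) => bool" where
  "cmap == continuous_map"

lemma continuous_map_funspace: "cmap X Y f ==> x : topspace X ==> f x : topspace Y"
  by (simp add: continuous_map_def Pi_iff)

lemma pathin_funspace: "pathin X p ==> t : {0..1} ==> p t : topspace X"
  unfolding pathin_def by (drule continuous_map_funspace) auto

lemma delta_open_topspace: "delta_open X (topspace X)"
proof -
  have "{t : {0..1}. p t : topspace X} = {0..1}" if "pathin X p" for p using pathin_funspace[OF that] by auto
  thus ?thesis by (auto simp: delta_open_def)
qed

lemma topspace_delta_ify [simp]: "topspace (delta_ify X) = topspace X"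
proof -
  have "U \<subseteq> topspace X" if "delta_open X U" for U using that by (simp add: delta_open_def)
  thus ?thesis unfolding topspace_def[of "delta_ify X"] openin_delta_ify using delta_open_topspace[of X] by blast
qed

lemma openin_imp_delta_open: assumes "openin X U" shows "delta_open X U" unfolding delta_open_def
proof (intro conjI allI impI)
  show "U \<subseteq> topspace X" using assms by (rule openin_subset)
  fix p assume "pathin X p"
  from openin_continuous_map_preimage[OF this[unfolded pathin_def] assms]
  show "openin unit_ivl {t : {0..1}. p t : U}" by simp
qed

lemma pathin_delta_ify [simp]: "pathin (delta_ify X) p \<longleftrightarrow> pathin X p"
proof
  assume p: "pathin X p"
  show "pathin (delta_ify X) p" unfolding pathin_def continuous_map_def
    using p pathin_funspace[OF p] by (auto simp: openin_delta_ify delta_open_def)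
next
  assume "pathin (delta_ify X) p"
  thus "pathin X p" unfolding pathin_def continuous_map_def openin_delta_ify by (simp add: openin_imp_delta_open)
qed

lemma delta_generated_delta_ify: "delta_generated (delta_ify X)"
  by (simp add: delta_generated_def delta_open_def openin_delta_ify)

lemma continuous_map_from_delta_ify:
  assumes "cmap X Y f" shows "cmap (delta_ify X) Y f"
  using assms by (auto simp: continuous_map_def openin_delta_ify intro: openin_imp_delta_open)

lemma continuous_map_on_paths:
  assumes "delta_generated X" "!!p. pathin X p ==> pathin Y (f \<circ> p)"
  shows "cmap X Y f" unfolding continuous_map_def
proof (intro conjI allI impI)
  show fX: "f : topspace X \<rightarrow> topspace Y"
  proof
    fix x assume "x : topspace X"
    hence "pathin Y (f \<circ> (%_. x))" by (intro assms(2)) (simp add: pathin_def)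
    from pathin_funspace[OF this, of 0] show "f x : topspace Y" by simp
  qed
  fix U assume U: "openin Y U"
  have "delta_open X {x : topspace X. f x : U}" unfolding delta_open_def
  proof (intro conjI allI impI)
    fix p assume p: "pathin X p"
    from openin_continuous_map_preimage[OF assms(2)[OF p, unfolded pathin_def] U]
    have "openin unit_ivl {t : {0..1}. f (p t) : U}" by simp
    also have "{t : {0..1}. f (p t) : U} = {t : {0..1}. p t : {x : topspace X. f x : U}}"
      using pathin_funspace[OF p] by auto
    finally show "openin unit_ivl {t : {0..1}. p t : {x : topspace X. f x : U}}" .
  qed auto
  thus "openin X {x : topspace X. f x : U}" using assms(1) by (simp add: delta_generated_def)
qed

lemma pathin_comp: "pathin X p ==> cmap X Y f ==> pathin Y (f \<circ> p)"
  unfolding pathin_def by (rule continuous_map_compose)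

lemma continuous_map_into_delta_ify:
  assumes "delta_generated X" "cmap X Y f"
  shows "cmap X (delta_ify Y) f" using assms by (intro continuous_map_on_paths) (auto intro: pathin_comp)

lemma topspace_delta_prod [simp]: "topspace (delta_prod X Y) = topspace X \<times> topspace Y"
  by (simp add: delta_prod_def)

lemma pathin_delta_prod:
  "pathin (delta_prod X Y) p \<longleftrightarrow> pathin X (fst \<circ> p) & pathin Y (snd \<circ> p)"
  by (simp add: delta_prod_def) (simp add: pathin_def continuous_map_pairwise)

lemma delta_generated_delta_prod: "delta_generated (delta_prod X Y)"
  by (simp add: delta_prod_def delta_generated_delta_ify)

lemma continuous_map_delta_prod_fst: "cmap (delta_prod X Y) X fst"
  by (simp add: delta_prod_def continuous_map_from_delta_ify continuous_map_fst)

lemma continuous_map_delta_prod_snd: "cmap (delta_prod X Y) Y snd"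
  by (simp add: delta_prod_def continuous_map_from_delta_ify continuous_map_snd)

lemma continuous_map_into_delta_prod:
  assumes "delta_generated Z" "cmap Z X f" "cmap Z Y g"
  shows "cmap Z (delta_prod X Y) (%z. (f z, g z))" unfolding delta_prod_def using assms
  by (intro continuous_map_into_delta_ify) (simp_all add: continuous_map_pairwise o_def)

lemma compact_path_image: "pathin X p ==> compactin X (p ` {0..1})" unfolding pathin_def
  by (erule image_compactin[rotated]) (simp add: compactin_subtopology del: subtopology_UNIV)

lemma Hausdorff_imp_delta_Hausdorff: "Hausdorff_space X ==> delta_Hausdorff X"
  by (simp add: delta_Hausdorff_def compact_path_image compactin_imp_closedin)

text \<open>A set that is open along all paths contains a tail of every sequence which some path runs
  through while converging to a point of the set. So paths that thread sequences chosen in the members of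
  a neighbourhood sequence detect openness.\<close>

lemma delta_generated_threaded:
  assumes "!!x. x : topspace X ==>
    \<exists>V :: nat => 'a set. (\<forall>k. openin X (V k) & x : V k) \<and>
      (\<forall>s. (\<forall>k. s k : V k) --> (\<exists>p. pathin X p & p 0 = x & (\<forall>k. p (inverse (real (Suc k))) = s k)))"
  shows "delta_generated X" unfolding delta_generated_def
proof (intro allI iffI)
  fix U assume U: "delta_open X U"
  show "openin X U"
  proof (subst openin_subopen, intro ballI)
    fix x assume x: "x : U"
    hence "x : topspace X" using U by (auto simp: delta_open_def)
    from assms[OF this] obtain V where V: "!!k::nat. openin X (V k)" "!!k. x : V k"
      and thread: "!!s. (!!k. s k : V k) ==>
        \<exists>p. pathin X p & p 0 = x & (\<forall>k. p (inverse (real (Suc k))) = s k)" by metis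
    show "\<exists>T. openin X T & x : T & T \<subseteq> U"
    proof (rule ccontr)
      assume *: "\<nexists>T. openin X T & x : T & T \<subseteq> U"
      have "\<exists>y. y : V k & y ~: U" for k using * V by blast
      then obtain s where s: "!!k. s k : V k" "!!k. s k ~: U" by metis
      from thread[OF s(1)] obtain p where p: "pathin X p" "p 0 = x"
        "!!k. p (inverse (real (Suc k))) = s k" by blast
      let ?W = "{t : {0..1}. p t : U}"
      have "openin unit_ivl ?W" using U p(1) by (simp add: delta_open_def)
      moreover have "0 : ?W" using p x by simp
      ultimately have "\<exists>e>0. \<forall>t\<in>{0..1}. dist t 0 < e --> t : ?W"
        unfolding openin_euclidean_subtopology_iff by blast
      then obtain e where e: "e > 0" "!!t. t : {0..1} ==> dist t 0 < e ==> t : ?W" by blast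
      obtain k where k: "inverse (real (Suc k)) < e" using reals_Archimedean[OF e(1)] by blast
      have "inverse (real (Suc k)) : ?W" using k by (intro e(2)) (auto simp: inverse_le_1_iff)
      thus False using p s by simp
    qed
  qed
qed (rule openin_imp_delta_open)

text \<open>The piecewise linear curve with value \<open>a k\<close> at \<open>1 / (k + 1)\<close>.\<close>

definition thread :: "(nat => real) => real => real => real" where
  "thread a l t = (if t <= 0 then l else
     (let r = inverse t - 1; k = nat \<lfloor>r\<rfloor> in (1 - frac r) * a k + frac r * a (Suc k)))"

lemma thread_0 [simp]: "thread a l 0 = l" by (simp add: thread_def)

lemma thread_inverse [simp]: "thread a l (inverse (real (Suc k))) = a k" by (simp add: thread_def Let_def frac_def)

lemma continuous_on_thread:
  assumes "a \<longlonglongrightarrow> l" shows "continuous_on {0..1} (thread a l)"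
proof -
  define f where "f r = (1 - frac r) * a (nat \<lfloor>r\<rfloor>) + frac r * a (Suc (nat \<lfloor>r\<rfloor>))" for r :: real
  have piece: "continuous_on {real k..real k + 1} f" for k
  proof (rule continuous_on_eq)
    show "continuous_on {real k..real k + 1} (%r. (1 - (r - real k)) * a k + (r - real k) * a (Suc k))"
      by (intro continuous_intros)
    fix r assume r: "r : {real k..real k + 1}"
    show "(1 - (r - real k)) * a k + (r - real k) * a (Suc k) = f r"
    proof (cases "r = real k + 1")
      case True
      hence "\<lfloor>r\<rfloor> = int k + 1" by (simp add: floor_eq_iff)
      thus ?thesis using True by (simp add: f_def frac_def nat_add_distrib)
    next
      case False
      hence "\<lfloor>r\<rfloor> = int k" using r by (simp add: floor_eq_iff)
      thus ?thesis by (simp add: f_def frac_def)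
    qed
  qed
  have cf: "continuous_on {0..real k} f" for k
  proof (induction k)
    case (Suc k)
    have "{0..real (Suc k)} = {0..real k} \<union> {real k..real k + 1}" by auto
    thus ?case using continuous_on_closed_Un[OF _ _ Suc piece[of k]] by simp
  qed (simp add: continuous_on_sing)
  have cf': "continuous_on {0..} f" unfolding continuous_on_eq_continuous_within
  proof
    fix r :: real assume r: "r : {0..}"
    obtain k where k: "r < real k" using reals_Archimedean2 by blast
    have "continuous (at r within {0..real k}) f"
      using cf[of k] r k by (auto simp: continuous_on_eq_continuous_within)
    moreover have "at r within {0..real k} = at r within {0..}"
      using k by (intro at_within_nhd[of _ "{..<real k}"]) auto
    ultimately show "continuous (at r within {0..}) f" by simp
  qed
  have flim: "(f \<longlongrightarrow> l) at_top"
  proof (rule tendstoI)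
    fix e :: real assume "e > 0"
    then obtain K where K: "!!k. k \<ge> K ==> dist (a k) l < e" using assms by (auto simp: lim_sequentially)
    have "dist (f r) l < e" if "r \<ge> real K" for r
    proof -
      have fr: "0 <= frac r" "frac r <= 1" using frac_lt_1[of r] by (auto simp: less_imp_le)
      have k: "nat \<lfloor>r\<rfloor> \<ge> K" using that by (simp add: le_nat_floor)
      have "f r : ball l e"
        using convexD_alt[OF convex_ball[of l e], of "a (nat \<lfloor>r\<rfloor>)" "a (Suc (nat \<lfloor>r\<rfloor>))" "frac r"]
          fr K[OF k] K[of "Suc (nat \<lfloor>r\<rfloor>)"] k by (simp add: f_def dist_commute)
      thus ?thesis by (simp add: dist_commute)
    qed
    thus "\<forall>\<^sub>F r in at_top. dist (f r) l < e" by (auto simp: eventually_at_top_linorder)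
  qed
  have eq: "thread a l t = f (inverse t - 1)" if "t > 0" for t using that by (simp add: thread_def f_def Let_def)
  show ?thesis unfolding continuous_on_eq_continuous_within
  proof
    fix t :: real assume t: "t : {0..1}"
    show "continuous (at t within {0..1}) (thread a l)"
    proof (cases "t = 0")
      case True
      have "filterlim (%t::real. inverse t - 1) at_top (at_right 0)"
        using filterlim_tendsto_add_at_top[OF tendsto_const[of "-1"] filterlim_inverse_at_top_right]
        by (simp add: add.commute)
      from filterlim_compose[OF flim this] have "((%t. f (inverse t - 1)) \<longlongrightarrow> l) (at_right 0)" .
      moreover have "\<forall>\<^sub>F t in at_right 0. f (inverse t - 1) = thread a l t"
        using eventually_at_right_less[of 0] by eventually_elim (simp add: eq)
      ultimately have "(thread a l \<longlongrightarrow> l) (at_right 0)" by (rule Lim_transform_eventually)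
      thus ?thesis using True unfolding continuous_within by (simp add: at_within_Icc_at_right)
    next
      case False
      hence "t > 0" using t by simp
      have "continuous_on {0<..1} (thread a l)"
      proof (rule continuous_on_eq)
        show "continuous_on {0<..1} (%t. f (inverse t - 1))"
          by (intro continuous_on_compose2[OF cf'] continuous_intros) (auto simp: one_le_inverse_iff)
      qed (auto simp: eq)
      hence "continuous (at t within {0<..1}) (thread a l)"
        using t \<open>t > 0\<close> by (auto simp: continuous_on_eq_continuous_within)
      moreover have "at t within {0<..1} = at t within {0..1}"
        using \<open>t > 0\<close> by (intro at_within_nhd[of _ "{0<..}"]) auto
      ultimately show ?thesis by simp
    qed
  qed
qed

lemma thread_mix: "0 < t ==> t <= 1 ==> \<exists>k c. 0 <= c & c <= 1 & (\<forall>a l. thread a l t = (1 - c) * a k + c * a (Suc k))"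
  by (rule exI[of _ "nat \<lfloor>inverse t - 1\<rfloor>"], rule exI[of _ "frac (inverse t - 1)"])
     (auto simp: thread_def Let_def less_imp_le frac_lt_1)

text \<open>In a convex space of real functions a sequence that converges to a point is threaded by the
  piecewise linear curve through it.\<close>

lemma delta_generated_convex:
  fixes ev :: "'i => 'a => real"
  assumes path: "!!p. (!!t. t : {0..1} ==> p t : topspace X) ==>
      (!!i. continuous_on {0..1} (%t. ev i (p t))) ==> pathin X p"
    and convex: "!!x y c. x : topspace X ==> y : topspace X ==> 0 <= c ==> c <= 1 ==>
      \<exists>z\<in>topspace X. \<forall>i. ev i z = (1 - c) * ev i x + c * ev i y"
    and inj: "!!x y. x : topspace X ==> y : topspace X ==> (!!i. ev i x = ev i y) ==> x = y"
    and nhds: "!!x. x : topspace X ==>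
      \<exists>V :: nat => 'a set. (\<forall>k. openin X (V k) & x : V k) \<and>
        (\<forall>s. (\<forall>k. s k : V k) --> (\<forall>i. (%k. ev i (s k)) \<longlonglongrightarrow> ev i x))"
  shows "delta_generated X"
proof (rule delta_generated_threaded)
  fix x assume x: "x : topspace X"
  from nhds[OF x] obtain V where V: "!!k::nat. openin X (V k)" "!!k. x : V k"
    and lim: "!!s i. (!!k. s k : V k) ==> (%k. ev i (s k)) \<longlonglongrightarrow> ev i x" by metis
  show "\<exists>V :: nat => 'a set. (\<forall>k. openin X (V k) & x : V k) \<and>
      (\<forall>s. (\<forall>k. s k : V k) --> (\<exists>p. pathin X p & p 0 = x & (\<forall>k. p (inverse (real (Suc k))) = s k)))"
  proof (intro exI[of _ V] conjI allI impI)
    fix s assume s: "\<forall>k. s k : V k"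
    have sX: "s k : topspace X" for k using s V(1) openin_subset by blast
    have "\<exists>z\<in>topspace X. \<forall>i. ev i z = thread (%k. ev i (s k)) (ev i x) t" if t: "t : {0..1}" for t
    proof (cases "t = 0")
      case False
      then obtain k c where "0 <= c" "c <= 1" "!!a l. thread a l t = (1 - c) * a k + c * a (Suc k)"
        using thread_mix[of t] t by auto
      thus ?thesis using convex[OF sX sX] by simp
    qed (use x in auto)
    then obtain p where p: "!!t. t : {0..1} ==> p t : topspace X"
      "!!t i. t : {0..1} ==> ev i (p t) = thread (%k. ev i (s k)) (ev i x) t" by metis
    have "pathin X p"
    proof (rule path[OF p(1)])
      fix i
      have "continuous_on {0..1} (thread (%k. ev i (s k)) (ev i x))"
        using lim s by (intro continuous_on_thread) auto
      thus "continuous_on {0..1} (%t. ev i (p t))" by (rule continuous_on_eq) (simp add: p(2))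
    qed
    moreover have "p 0 = x" using p x by (intro inj) auto
    moreover have "p (inverse (real (Suc k))) = s k" for k
    proof -
      have "inverse (real (Suc k)) : {0..1}" by (auto simp: inverse_le_1_iff)
      thus ?thesis using p sX by (intro inj) (auto simp del: of_nat_Suc)
    qed
    ultimately show "\<exists>p. pathin X p & p 0 = x & (\<forall>k. p (inverse (real (Suc k))) = s k)" by blast
  qed (use V in auto)
qed

lemma continuous_map_real_iff:
  "cmap X euclideanreal f \<longleftrightarrow>
     (\<forall>x\<in>topspace X. \<forall>e>0. \<exists>U. openin X U & x : U & (\<forall>y\<in>U. \<bar>f y - f x\<bar> < e))"
  using Met_TC.continuous_map_to_metric[of X f] by (simp add: dist_real_def abs_minus_commute)

text \<open>Continuity at each point is reduced to that of a majorant vanishing there.\<close>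

lemma continuous_map_real_dominated:
  assumes "!!x. x : topspace X ==> \<exists>g. cmap X euclideanreal g & g x = (0::real) \<and>
      (\<forall>y\<in>topspace X. \<bar>f y - f x\<bar> <= g y)"
  shows "cmap X euclideanreal f" unfolding continuous_map_real_iff
proof (intro ballI allI impI)
  fix x and e :: real assume x: "x : topspace X" and e: "e > 0"
  obtain g where g: "cmap X euclideanreal g" "g x = 0"
    "!!y. y : topspace X ==> \<bar>f y - f x\<bar> <= g y" using assms[OF x] by blast
  from g(1)[unfolded continuous_map_real_iff, rule_format, OF x e]
  obtain U where U: "openin X U" "x : U" "!!y. y : U ==> \<bar>g y - g x\<bar> < e" by auto
  have "\<bar>f y - f x\<bar> < e" if "y : U" for y
    using g(3)[of y] U(3)[OF that] openin_subset[OF U(1)] that g(2) by force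
  thus "\<exists>U. openin X U & x : U & (\<forall>y\<in>U. \<bar>f y - f x\<bar> < e)" using U by blast
qed

lemma continuous_map_unit_ivl:
  "cmap X unit_ivl f \<longleftrightarrow>
     cmap X euclideanreal f & (\<forall>x\<in>topspace X. 0 <= f x & f x <= 1)"
  by (auto simp: continuous_map_in_subtopology)

lemma topspace_cube_top: "topspace (cube_top n) = {..<n} \<rightarrow>\<^sub>E {0..1}" by (simp add: cube_top_def)

lemma continuous_map_cube_top:
  "cmap X (cube_top n) f \<longleftrightarrow>
     (\<forall>x\<in>topspace X. f x : topspace (cube_top n)) \<and>
     (\<forall>i<n. cmap X euclideanreal (%x. f x i))"
  unfolding cube_top_def continuous_map_componentwise continuous_map_unit_ivl
  by (auto simp: PiE_iff Pi_iff image_subset_iff)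

lemma continuous_map_cube_proj: "i < n ==> cmap (cube_top n) euclideanreal (%x. x i)"
  using continuous_map_cube_top[of "cube_top n" n "%x. x"] by simp

lemma Hausdorff_cube_top: "Hausdorff_space (cube_top n)"
  by (simp add: cube_top_def Hausdorff_space_product_topology Hausdorff_space_subtopology)

section \<open>Spaces of natural d-paths\<close>

lemma natural_dpaths_iff:
  "ga : natural_dpaths n \<longleftrightarrow> ga : extensional {0..real n} \<and>
     (\<forall>t\<in>{0..real n}. ga t : extensional {..<n} & (\<Sum>i<n. ga t i) = t & (\<forall>i<n. 0 <= ga t i & ga t i <= 1)) \<and>
     (\<forall>i<n. \<forall>s t. 0 <= s & s <= t & t <= real n --> ga s i <= ga t i)"
  (is "_ \<longleftrightarrow> ?E & ?V & ?M")
proof (intro iffI)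
  assume g: "ga : natural_dpaths n"
  hence c: "cmap (top_of_set {0..real n}) (cube_top n) ga" by (simp add: natural_dpaths_def)
  have "ga t : topspace (cube_top n)" if "t : {0..real n}" for t using continuous_map_funspace[OF c] that by simp
  hence ?V using g by (auto simp: natural_dpaths_def topspace_cube_top PiE_iff)
  moreover have ?M using g by (auto simp: natural_dpaths_def mono_on_def)
  ultimately show "?E & ?V & ?M" using g by (simp add: natural_dpaths_def)
next
  assume *: "?E & ?V & ?M"
  hence V: "!!t. t : {0..real n} ==> ga t : extensional {..<n}"
      "!!t. t : {0..real n} ==> (\<Sum>i<n. ga t i) = t"
      "!!t i. t : {0..real n} ==> i < n ==> 0 <= ga t i & ga t i <= 1"
    and M: "!!i s t. i < n ==> 0 <= s ==> s <= t ==> t <= real n ==> ga s i <= ga t i" and E: ?E by auto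
  have lip: "ga t i - ga s i <= t - s" if "i < n" "0 <= s" "s <= t" "t <= real n" for i s t
  proof -
    have "ga t i - ga s i <= (\<Sum>i<n. ga t i - ga s i)" using that M by (intro member_le_sum) auto
    also have "\<dots> = t - s" using V(2)[of s] V(2)[of t] that by (simp add: sum_subtractf)
    finally show ?thesis .
  qed
  have "cmap (top_of_set {0..real n}) (cube_top n) ga" unfolding continuous_map_cube_top
  proof (intro conjI ballI allI impI)
    fix t assume "t : topspace (top_of_set {0..real n})"
    thus "ga t : topspace (cube_top n)" using V(1)[of t] V(3)[of t] by (auto simp: topspace_cube_top PiE_iff)
  next
    fix i assume i: "i < n"
    show "cmap (top_of_set {0..real n}) euclideanreal (%t. ga t i)"
    proof (rule continuous_map_real_dominated, intro exI conjI ballI)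
      fix t assume t: "t : topspace (top_of_set {0..real n})"
      show "cmap (top_of_set {0..real n}) euclideanreal (%s. \<bar>s - t\<bar>)" by (simp, intro continuous_intros)
      fix s assume s: "s : topspace (top_of_set {0..real n})"
      show "\<bar>ga s i - ga t i\<bar> <= \<bar>s - t\<bar>"
        using lip[OF i, of s t] lip[OF i, of t s] M[OF i, of s t] M[OF i, of t s] s t by (cases "s <= t") auto
    qed simp
  qed
  moreover have "ga 0 i = 0" if "i < n" for i
  proof -
    have "(\<Sum>i<n. ga 0 i) = 0" using V(2)[of 0] by simp
    thus ?thesis using that V(3)[of 0] by (subst (asm) sum_nonneg_eq_0_iff) auto
  qed
  moreover have "ga (real n) i = 1" if "i < n" for i
  proof -
    have "(\<Sum>i<n. 1 - ga (real n) i) = 0" using V(2)[of "real n"] by (simp add: sum_subtractf)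
    thus ?thesis using that V(3)[of "real n"] by (subst (asm) sum_nonneg_eq_0_iff) auto
  qed
  ultimately show "ga : natural_dpaths n" using E V M by (auto simp: natural_dpaths_def mono_on_def)
qed

lemma natural_dpathsI:
  assumes "ga : extensional {0..real n}"
    and "!!t. 0 <= t ==> t <= real n ==> ga t : extensional {..<n}"
    and "!!t. 0 <= t ==> t <= real n ==> (\<Sum>i<n. ga t i) = t"
    and "!!t i. 0 <= t ==> t <= real n ==> i < n ==> 0 <= ga t i & ga t i <= 1"
    and "!!i s t. i < n ==> 0 <= s ==> s <= t ==> t <= real n ==> ga s i <= ga t i"
  shows "ga : natural_dpaths n" unfolding natural_dpaths_iff using assms by auto

context
  fixes ga n assumes g: "ga : natural_dpaths n"
begin

lemma ndp_ext: "ga : extensional {0..real n}" using g by (simp add: natural_dpaths_iff)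

lemma ndp_ext': "0 <= t ==> t <= real n ==> ga t : extensional {..<n}" using g by (simp add: natural_dpaths_iff)

lemma ndp_sum: "0 <= t ==> t <= real n ==> (\<Sum>i<n. ga t i) = t" using g by (simp add: natural_dpaths_iff)

lemma ndp_bounds: "0 <= t ==> t <= real n ==> i < n ==> 0 <= ga t i & ga t i <= 1"
  using g by (simp add: natural_dpaths_iff)

lemma ndp_mono: "i < n ==> 0 <= s ==> s <= t ==> t <= real n ==> ga s i <= ga t i"
  using g by (simp add: natural_dpaths_iff)

lemma ndp_0: assumes "i < n" shows "ga 0 i = 0"
proof -
  have "(\<Sum>i<n. ga 0 i) = 0" using ndp_sum[of 0] by simp
  thus ?thesis using assms ndp_bounds[of 0] by (subst (asm) sum_nonneg_eq_0_iff) auto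
qed

lemma ndp_1: assumes "i < n" shows "ga (real n) i = 1"
proof -
  have "(\<Sum>i<n. 1 - ga (real n) i) = 0" using ndp_sum[of "real n"] by (simp add: sum_subtractf)
  thus ?thesis using assms ndp_bounds[of "real n"] by (subst (asm) sum_nonneg_eq_0_iff) auto
qed

lemma ndp_lipschitz_mono: assumes "i < n" "0 <= s" "s <= t" "t <= real n" shows "ga t i - ga s i <= t - s"
proof -
  have "ga t i - ga s i <= (\<Sum>i<n. ga t i - ga s i)" using assms ndp_mono by (intro member_le_sum) auto
  also have "\<dots> = t - s" using ndp_sum[of s] ndp_sum[of t] assms by (simp add: sum_subtractf)
  finally show ?thesis .
qed

lemma ndp_lipschitz:
  assumes "i < n" "0 <= s" "s <= real n" "0 <= t" "t <= real n" shows "\<bar>ga t i - ga s i\<bar> <= \<bar>t - s\<bar>"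
  using ndp_lipschitz_mono[OF assms(1), of s t] ndp_lipschitz_mono[OF assms(1), of t s]
    ndp_mono[OF assms(1), of s t] ndp_mono[OF assms(1), of t s] assms by (cases "s <= t") auto

end

lemma ndp_eqI:
  assumes "ga : natural_dpaths n" "ga' : natural_dpaths n"
    "!!t i. 0 <= t ==> t <= real n ==> i < n ==> ga t i = ga' t i"
  shows "ga = ga'"
proof (rule extensionalityI[OF ndp_ext[OF assms(1)] ndp_ext[OF assms(2)]])
  fix t assume t: "t : {0..real n}"
  show "ga t = ga' t" using t assms by (intro extensionalityI[OF ndp_ext'[OF assms(1)] ndp_ext'[OF assms(2)]]) auto
qed

text \<open>Natural d-paths are 1-Lipschitz, so they form an equicontinuous family on a compact interval,
  on which the compact-open topology is the topology of pointwise convergence.\<close>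

lemma N_pointwise:
  "N n = subtopology (product_topology (%_. cube_top n) {0..real n}) (natural_dpaths n)" (is "_ = ?P")
proof -
  let ?I = "top_of_set {0..real n}"
  let ?S = "{{f : extensional (topspace ?I). cmap ?I (cube_top n) f & f ` C \<subseteq> U} | C U.
        compactin ?I C & openin (cube_top n) U}"
  have ndp: "ga : extensional (topspace ?I) & cmap ?I (cube_top n) ga"
    if "ga : natural_dpaths n" for ga using that by (simp add: natural_dpaths_def)
  have val: "ga t : topspace (cube_top n)" if "ga : natural_dpaths n" "t : {0..real n}" for ga t
    using continuous_map_funspace[OF conjunct2[OF ndp[OF that(1)]]] that(2) by simp
  define F where "F = {f : extensional (topspace ?I). cmap ?I (cube_top n) f}"
  have "F : ?S" by (intro CollectI exI[of _ "{}"] conjI) (simp_all add: F_def)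
  moreover have "W \<subseteq> F" if "W : ?S" for W using that unfolding F_def by blast
  ultimately have US: "\<Union>?S = F" by (intro equalityI Union_least Union_upper)
  have nF: "natural_dpaths n \<subseteq> F" using ndp by (auto simp: F_def)
  have "topspace (compact_open ?I (cube_top n)) = F"
    by (simp only: compact_open_def topology_generated_by_topspace US)
  hence tsN: "topspace (N n) = natural_dpaths n" using nF by (simp add: N_def Int_absorb1)
  have "natural_dpaths n \<subseteq> topspace (product_topology (%_. cube_top n) {0..real n})"
    by (intro subsetI) (use ndp val in \<open>simp add: PiE_iff\<close>)
  hence tsP: "topspace ?P = natural_dpaths n" by (simp add: Int_absorb1 del: topspace_product_topology)
  have 1: "cmap (N n) ?P (%ga. ga)" unfolding continuous_map_in_subtopology continuous_map_componentwise
  proof (intro conjI ballI)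
    fix t assume t: "t : {0..real n}"
    show "cmap (N n) (cube_top n) (%ga. ga t)" unfolding continuous_map_def
    proof (intro conjI allI impI)
      show "(%ga. ga t) : topspace (N n) \<rightarrow> topspace (cube_top n)" using val t tsN by auto
      fix U assume U: "openin (cube_top n) U"
      let ?W = "{f : extensional (topspace ?I). cmap ?I (cube_top n) f & f ` {t} \<subseteq> U}"
      have "?W : ?S" using U t by (intro CollectI exI[of _ "{t}"] exI[of _ U]) simp
      hence "openin (compact_open ?I (cube_top n)) ?W"
        unfolding compact_open_def by (rule topology_generated_by_Basis)
      moreover have "{ga : topspace (N n). ga t : U} = ?W \<inter> natural_dpaths n" using ndp tsN by auto
      ultimately show "openin (N n) {ga : topspace (N n). ga t : U}"
        unfolding N_def by (auto simp: openin_subtopology)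
    qed
  qed (use tsN ndp in \<open>auto simp del: topspace_product_topology\<close>)
  have ev: "cmap (prod_topology ?P ?I) (cube_top n) (%(ga, t). ga t)" unfolding continuous_map_cube_top
  proof (intro conjI ballI allI impI)
    fix x assume "x : topspace (prod_topology ?P ?I)"
    thus "(case x of (ga, t) => ga t) : topspace (cube_top n)"
      using val tsP by (auto simp del: topspace_product_topology topspace_subtopology)
  next
    fix i assume i: "i < n"
    show "cmap (prod_topology ?P ?I) euclideanreal (%x. (case x of (ga, t) => ga t) i)"
    proof (rule continuous_map_real_dominated)
      fix x assume "x : topspace (prod_topology ?P ?I)"
      then obtain ga t where x: "x = (ga, t)" "ga : natural_dpaths n" "0 <= t" "t <= real n"
        using tsP by (auto simp del: topspace_product_topology topspace_subtopology)
      let ?g = "%y. \<bar>fst y t i - ga t i\<bar> + \<bar>snd y - t\<bar>"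
      have "cmap ?P (cube_top n) (%ga. ga t)"
        using x by (intro continuous_map_from_subtopology continuous_map_product_projection) simp
      hence a: "cmap ?P euclideanreal (%ga. ga t i)" using i by (simp add: continuous_map_cube_top)
      have "cmap (prod_topology ?P ?I) euclideanreal ?g" using continuous_map_compose[OF continuous_map_fst a]
          continuous_map_into_fulltopology[OF continuous_map_snd[of ?P ?I]]
        by (intro continuous_intros) (simp_all add: o_def)
      moreover have "?g x = 0" using x by simp
      moreover have "\<bar>(case y of (ga, t) => ga t) i - (case x of (ga, t) => ga t) i\<bar> <= ?g y"
        if y: "y : topspace (prod_topology ?P ?I)" for y
      proof -
        obtain \<theta> s where y: "y = (\<theta>, s)" "\<theta> : natural_dpaths n" "0 <= s" "s <= real n"
          using y tsP by (auto simp del: topspace_product_topology topspace_subtopology)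
        thus ?thesis using x ndp_lipschitz[OF y(2) i, of t s] by auto
      qed
      ultimately show "\<exists>g. cmap (prod_topology ?P ?I) euclideanreal g & g x = 0 \<and>
         (\<forall>y\<in>topspace (prod_topology ?P ?I).
           \<bar>(case y of (ga, t) => ga t) i - (case x of (ga, t) => ga t) i\<bar> <= g y)" by blast
    qed
  qed
  have 2: "cmap ?P (N n) (%ga. ga)" unfolding N_def continuous_map_in_subtopology
  proof (intro conjI)
    show "cmap ?P (compact_open ?I (cube_top n)) (%ga. ga)" unfolding compact_open_def
    proof (rule continuous_on_generated_topo)
      show "(%ga. ga) ` topspace ?P \<subseteq> \<Union>?S" unfolding US tsP using nF by simp
      fix W assume "W : ?S"
      then obtain C U where W: "W = {f : extensional (topspace ?I). cmap ?I (cube_top n) f & f ` C \<subseteq> U}"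
        and C: "compactin ?I C" and U: "openin (cube_top n) U" by auto
      let ?Q = "prod_topology ?P (subtopology ?I C)"
      have "cmap ?Q (prod_topology ?P ?I) (%x. x)" unfolding continuous_map_pairwise o_def
        by (intro conjI continuous_map_fst continuous_map_into_fulltopology[OF continuous_map_snd])
      from continuous_map_compose[OF this ev]
      have evC: "cmap ?Q (cube_top n) (%(ga, t). ga t)" by (simp add: o_def)
      have "closedin ?Q {x : topspace ?Q. (case x of (ga, t) => ga t) : topspace (cube_top n) - U}"
        using evC U by (intro closedin_continuous_map_preimage) auto
      moreover have "compact_space (subtopology ?I C)" using C by (simp add: compactin_subspace)
      ultimately have cl: "closedin ?P (fst ` {x : topspace ?Q. (case x of (ga, t) => ga t) : topspace (cube_top n) - U})"
        using Abstract_Topological_Spaces.closed_map_fst unfolding closed_map_def by blast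
      have CI: "C \<subseteq> {0..real n}" using compactin_subset_topspace[OF C] by simp
      let ?bad = "{x : topspace ?Q. (case x of (ga, t) => ga t) : topspace (cube_top n) - U}"
      have tsQ: "topspace ?Q = natural_dpaths n \<times> C" using tsP CI by auto
      have "(%ga. ga) -` W \<inter> topspace ?P = topspace ?P - fst ` ?bad" unfolding tsQ tsP
      proof (intro equalityI subsetI)
        fix ga assume "ga : (%ga. ga) -` W \<inter> natural_dpaths n"
        thus "ga : natural_dpaths n - fst ` {x : natural_dpaths n \<times> C. (case x of (ga, t) => ga t) : topspace (cube_top n) - U}"
          unfolding W by (auto simp: image_subset_iff)
      next
        fix ga assume g: "ga : natural_dpaths n - fst ` {x : natural_dpaths n \<times> C. (case x of (ga, t) => ga t) : topspace (cube_top n) - U}"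
        have "ga t : U" if t: "t : C" for t
        proof (rule ccontr)
          assume "ga t ~: U"
          hence "(ga, t) : {x : natural_dpaths n \<times> C. (case x of (ga, t) => ga t) : topspace (cube_top n) - U}"
            using g val[of ga t] t CI by auto
          from imageI[OF this, of fst] show False using g by simp
        qed
        thus "ga : (%ga. ga) -` W \<inter> natural_dpaths n" unfolding W using ndp[of ga] g by auto
      qed
      with openin_diff[OF openin_topspace cl] show "openin ?P ((%ga. ga) -` W \<inter> topspace ?P)" by (simp only:)
    qed
  qed (unfold tsP, simp)
  show ?thesis unfolding topology_eq
  proof (intro allI iffI)
    fix U assume U: "openin (N n) U"
    have "{x : topspace ?P. x : U} = U" using openin_subset[OF U] tsN tsP by auto
    thus "openin ?P U" using 2 U unfolding continuous_map_def by force
  next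
    fix U assume U: "openin ?P U"
    have "{x : topspace (N n). x : U} = U" using openin_subset[OF U] tsN tsP by auto
    thus "openin (N n) U" using 1 U unfolding continuous_map_def by force
  qed
qed

lemma topspace_N [simp]: "topspace (N n) = natural_dpaths n"
proof -
  have "natural_dpaths n \<subseteq> {0..real n} \<rightarrow>\<^sub>E topspace (cube_top n)"
    unfolding topspace_cube_top
  proof
    fix ga assume g: "ga : natural_dpaths n"
    show "ga : {0..real n} \<rightarrow>\<^sub>E {..<n} \<rightarrow>\<^sub>E {0..1}"
      using ndp_ext[OF g] ndp_ext'[OF g] ndp_bounds[OF g] by (auto simp: PiE_iff)
  qed
  thus ?thesis by (auto simp: N_pointwise)
qed

lemma continuous_map_N:
  "cmap X (N n) f \<longleftrightarrow> (\<forall>x\<in>topspace X. f x : natural_dpaths n) \<and>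
     (\<forall>t\<in>{0..real n}. \<forall>i<n. cmap X euclideanreal (%x. f x t i))"
proof -
  have "f x t : topspace (cube_top n)" if "f x : natural_dpaths n" "t : {0..real n}" for x t
    using ndp_ext'[OF that(1)] ndp_bounds[OF that(1)] that(2) by (auto simp: topspace_cube_top PiE_iff)
  thus ?thesis
    unfolding N_pointwise continuous_map_in_subtopology continuous_map_componentwise continuous_map_cube_top
    by (auto simp: ndp_ext Pi_iff image_subset_iff)
qed

lemma continuous_map_N_ev:
  "t : {0..real n} ==> i < n ==> cmap (N n) euclideanreal (%ga. ga t i)"
  using continuous_map_N[of "N n" n "%x. x"] by simp

lemma Hausdorff_N: "Hausdorff_space (N n)"
  by (simp add: N_pointwise Hausdorff_space_product_topology Hausdorff_space_subtopology Hausdorff_cube_top)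

definition mix :: "nat => real => (real => nat => real) => (real => nat => real) => real => nat => real" where
  "mix n c ga \<theta> = (\<lambda>t\<in>{0..real n}. \<lambda>i\<in>{..<n}. (1 - c) * ga t i + c * \<theta> t i)"

lemma mix_natural:
  assumes g: "ga : natural_dpaths n" and h: "\<theta> : natural_dpaths n" and c: "0 <= c" "c <= 1"
  shows "mix n c ga \<theta> : natural_dpaths n"
proof (rule natural_dpathsI)
  fix t assume t: "0 <= t" "t <= real n"
  show "(\<Sum>i<n. mix n c ga \<theta> t i) = t" using t ndp_sum[OF g t] ndp_sum[OF h t]
    by (simp add: mix_def sum.distrib flip: sum_distrib_left) (simp add: algebra_simps)
  fix i assume i: "i < n"
  have "(1 - c) * ga t i + c * \<theta> t i <= (1 - c) * 1 + c * 1"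
    using ndp_bounds[OF g t i] ndp_bounds[OF h t i] c by (intro add_mono mult_left_mono) auto
  thus "0 <= mix n c ga \<theta> t i & mix n c ga \<theta> t i <= 1"
    using t i ndp_bounds[OF g t i] ndp_bounds[OF h t i] c by (simp add: mix_def)
next
  fix i s t assume "i < n" "0 <= s" "s <= t" "t <= real n"
  thus "mix n c ga \<theta> s i <= mix n c ga \<theta> t i"
    using c ndp_mono[OF g, of i s t] ndp_mono[OF h, of i s t]
    by (auto simp: mix_def intro!: add_mono mult_left_mono)
qed (auto simp: mix_def)

lemma delta_generated_N_convex:
  assumes S: "S \<subseteq> natural_dpaths n"
    and mix: "!!ga \<theta> c. ga : S ==> \<theta> : S ==> 0 <= c ==> c <= 1 ==> mix n c ga \<theta> : S"
  shows "delta_generated (subtopology (N n) S)"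
proof -
  define ev :: "real \<times> nat => (real => nat => real) => real"
    where "ev = (%(t, i) ga. if 0 <= t & t <= real n & i < n then ga t i else 0)"
  have ts: "topspace (subtopology (N n) S) = S" using S by auto
  show ?thesis
  proof (rule delta_generated_convex[where ev = ev], unfold ts)
    fix p :: "real => real => nat => real"
    assume p: "!!t. t : {0..1} ==> p t : S" and c: "!!i. continuous_on {0..1} (%t. ev i (p t))"
    have "continuous_on {0..1} (%x. p x t i)" if "0 <= t" "t <= real n" "i < n" for t i
      using c[of "(t, i)"] that by (simp add: ev_def)
    thus "pathin (subtopology (N n) S) p"
      using p S by (auto simp: pathin_def continuous_map_in_subtopology continuous_map_N)
  next
    fix x y and c :: real assume "x : S" "y : S" "0 <= c" "c <= 1"
    thus "\<exists>z\<in>S. \<forall>i. ev i z = (1 - c) * ev i x + c * ev i y"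
      by (intro bexI[of _ "mix n c x y"] mix) (auto simp: ev_def mix_def)
  next
    fix x y assume xy: "x : S" "y : S" "!!i. ev i x = ev i y"
    show "x = y"
    proof (rule ndp_eqI[of _ n])
      fix t i assume "0 <= t" "t <= real n" "i < n"
      thus "x t i = y t i" using xy(3)[of "(t, i)"] by (simp add: ev_def)
    qed (use xy S in auto)
  next
    fix x assume x: "x : S"
    define d where "d k ga = (\<Sum>j\<le>n * Suc k. \<Sum>i<n. \<bar>ga (real j / real (Suc k)) i - x (real j / real (Suc k)) i\<bar>)"
      for k and ga :: "real => nat => real"
    have jk: "real j / real (Suc k) : {0..real n}" if "j <= n * Suc k" for j k
      using that by (simp add: divide_le_eq del: of_nat_Suc mult_Suc_right flip: of_nat_mult)
    have "cmap (N n) euclideanreal (d k)" for k unfolding d_def using jk[of _ k]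
      by (intro continuous_intros continuous_map_N_ev) auto
    hence dc: "cmap (subtopology (N n) S) euclideanreal (d k)" for k by (rule continuous_map_from_subtopology)
    let ?V = "%k. {ga : S. d k ga < inverse (real (Suc k))}"
    have op: "openin (subtopology (N n) S) (?V k)" for k
    proof -
      have "openin (subtopology (N n) S) {ga : topspace (subtopology (N n) S). d k ga : {..<inverse (real (Suc k))}}"
        by (rule openin_continuous_map_preimage[OF dc]) simp
      thus ?thesis unfolding ts by simp
    qed
    have lim: "(%k. ev q (s k)) \<longlonglongrightarrow> ev q x" if s: "!!k. s k : ?V k" for s q
    proof (cases "0 <= fst q & fst q <= real n & snd q < n")
      case True
      then obtain t i where q: "q = (t, i)" "0 <= t" "t <= real n" "i < n" by (cases q) auto
      have "\<bar>s k t i - x t i\<bar> <= 3 * inverse (real (Suc k))" for k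
      proof -
        define j where "j = nat \<lfloor>t * real (Suc k)\<rfloor>"
        have jt: "real j <= t * real (Suc k)" "t * real (Suc k) < real j + 1"
        proof -
          have "0 <= t * real (Suc k)" using q by simp
          thus "real j <= t * real (Suc k)" "t * real (Suc k) < real j + 1" unfolding j_def by linarith+
        qed
        hence "j <= n * Suc k"
        proof -
          have "real j <= real n * real (Suc k)" using jt(1) mult_right_mono[OF q(3), of "real (Suc k)"] by linarith
          thus ?thesis by (simp only: of_nat_mult[symmetric] of_nat_le_iff)
        qed
        note jk' = jk[OF this]
        have "\<bar>s k (real j / real (Suc k)) i - x (real j / real (Suc k)) i\<bar> \<le>
            (\<Sum>i<n. \<bar>s k (real j / real (Suc k)) i - x (real j / real (Suc k)) i\<bar>)"
          using q(4) by (intro member_le_sum) auto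
        also have "\<dots> <= d k (s k)" unfolding d_def using \<open>j <= n * Suc k\<close>
          by (intro member_le_sum[of j _ "%j. \<Sum>i<n. \<bar>s k (real j / real (Suc k)) i - x (real j / real (Suc k)) i\<bar>"])
            (auto intro: sum_nonneg)
        also have "\<dots> < inverse (real (Suc k))" using s[of k] by simp
        finally have 1: "\<bar>s k (real j / real (Suc k)) i - x (real j / real (Suc k)) i\<bar> < inverse (real (Suc k))" .
        have "\<bar>t - real j / real (Suc k)\<bar> <= inverse (real (Suc k))"
        proof -
          have K: "0 < real (Suc k)" by simp
          have "real j / real (Suc k) <= t" "t < (real j + 1) / real (Suc k)"
            using jt by (simp_all only: pos_divide_le_eq[OF K] pos_less_divide_eq[OF K])
          thus ?thesis by (simp only: add_divide_distrib inverse_eq_divide)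
        qed
        moreover have "s k : natural_dpaths n" "x : natural_dpaths n" using s[of k] x S by auto
        ultimately show ?thesis using 1 ndp_lipschitz[of "s k" n i "real j / real (Suc k)" t]
            ndp_lipschitz[of x n i "real j / real (Suc k)" t] q jk' by auto
      qed
      hence "\<forall>\<^sub>F k in sequentially. norm (s k t i - x t i) <= 3 * inverse (real (Suc k))"
        by (simp del: of_nat_Suc)
      moreover have "(%k. 3 * inverse (real (Suc k))) \<longlonglongrightarrow> 0"
        using tendsto_mult_right_zero[OF LIMSEQ_inverse_real_of_nat] by blast
      ultimately have "(%k. s k t i - x t i) \<longlonglongrightarrow> 0" by (rule Lim_null_comparison)
      thus ?thesis using q by (simp add: ev_def LIM_zero_iff)
    qed (auto simp: ev_def split_beta)
    show "\<exists>V. (\<forall>k. openin (subtopology (N n) S) (V k) & x : V k) \<and>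
        (\<forall>s. (\<forall>k. s k : V k) --> (\<forall>i. (%k. ev i (s k)) \<longlonglongrightarrow> ev i x))"
      using op lim x by (intro exI[of _ ?V]) (auto simp: d_def)
  qed
qed

lemma delta_generated_N: "delta_generated (N n)" using delta_generated_N_convex[of "natural_dpaths n" n] mix_natural
  by (metis order_refl subtopology_topspace topspace_N)

lemma delta_generated_cube_top: "delta_generated (cube_top n)"
proof -
  define ev :: "nat => (nat => real) => real" where "ev i x = (if i < n then x i else 0)" for i x
  show ?thesis
  proof (rule delta_generated_convex[where ev = ev])
    fix p :: "real => nat => real"
    assume p: "!!t. t : {0..1} ==> p t : topspace (cube_top n)"
      and c: "!!i. continuous_on {0..1} (%t. ev i (p t))"
    have "continuous_on {0..1} (%x. p x i)" if "i < n" for i using c[of i] that by (simp add: ev_def)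
    thus "pathin (cube_top n) p" using p by (auto simp: pathin_def continuous_map_cube_top)
  next
    fix x y and c :: real assume xy: "x : topspace (cube_top n)" "y : topspace (cube_top n)" "0 <= c" "c <= 1"
    have "(1 - c) * x i + c * y i <= (1 - c) * 1 + c * 1" if "i < n" for i
      using xy that by (intro add_mono mult_left_mono) (auto simp: topspace_cube_top PiE_iff)
    thus "\<exists>z\<in>topspace (cube_top n). \<forall>i. ev i z = (1 - c) * ev i x + c * ev i y"
      using xy by (intro bexI[of _ "\<lambda>i\<in>{..<n}. (1 - c) * x i + c * y i"])
        (auto simp: ev_def topspace_cube_top PiE_iff)
  next
    fix x y assume xy: "x : topspace (cube_top n)" "y : topspace (cube_top n)" "!!i. ev i x = ev i y"
    show "x = y"
    proof (rule PiE_ext)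
      fix i assume "i : {..<n}"
      thus "x i = y i" using xy(3)[of i] by (simp add: ev_def)
    qed (use xy in \<open>simp_all add: topspace_cube_top\<close>)
  next
    fix x assume x: "x : topspace (cube_top n)"
    let ?d = "%y. \<Sum>i<n. \<bar>y i - x i\<bar>"
    have "cmap (cube_top n) euclideanreal ?d" by (intro continuous_intros continuous_map_cube_proj) auto
    hence op: "openin (cube_top n) {y : topspace (cube_top n). ?d y : {..<inverse (real (Suc k))}}" for k
      by (rule openin_continuous_map_preimage) simp
    have lim: "(%k. ev i (s k)) \<longlonglongrightarrow> ev i x" if s: "!!k. ?d (s k) < inverse (real (Suc k))" for s i
    proof (cases "i < n")
      case True
      have "\<bar>s k i - x i\<bar> <= inverse (real (Suc k))" for k
        using member_le_sum[of i "{..<n}" "%i. \<bar>s k i - x i\<bar>"] s[of k] True by (simp del: of_nat_Suc)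
      hence "(%k. s k i - x i) \<longlonglongrightarrow> 0"
        by (intro Lim_null_comparison[OF _ LIMSEQ_inverse_real_of_nat]) (auto simp del: of_nat_Suc)
      thus ?thesis using True by (simp add: ev_def LIM_zero_iff)
    qed (simp add: ev_def)
    show "\<exists>V. (\<forall>k. openin (cube_top n) (V k) & x : V k) \<and>
        (\<forall>s. (\<forall>k. s k : V k) --> (\<forall>i. (%k. ev i (s k)) \<longlonglongrightarrow> ev i x))"
      using op lim x by (intro exI[of _ "%k. {y : topspace (cube_top n). ?d y : {..<inverse (real (Suc k))}}"]) auto
  qed
qed

section \<open>Coordinates of faces and Moore composition\<close>

definition pos_in :: "nat set => nat => nat" where
  "pos_in D a = card (D \<inter> {..<a})"

context
  fixes D :: "nat set" assumes fin: "finite D"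
begin

lemma pos_in_nth:
  assumes k: "k < card D"
  shows "sorted_list_of_set D ! k : D" "pos_in D (sorted_list_of_set D ! k) = k"
proof -
  let ?xs = "sorted_list_of_set D"
  have len: "length ?xs = card D" by simp
  show "?xs ! k : D" using nth_mem[of k ?xs] k fin by simp
  have less: "?xs ! i < ?xs ! j \<longleftrightarrow> i < j" if "i < card D" "j < card D" for i j
    using that sorted_wrt_nth_less[OF strict_sorted_list_of_set[of D], of i j]
      sorted_wrt_nth_less[OF strict_sorted_list_of_set[of D], of j i] by (cases i j rule: linorder_cases) auto
  have "D \<inter> {..<?xs ! k} = (!) ?xs ` {..<k}"
  proof (intro equalityI subsetI)
    fix a assume a: "a : D \<inter> {..<?xs ! k}"
    then obtain j where "j < card D" "a = ?xs ! j"
      using fin len by (metis IntD1 in_set_conv_nth set_sorted_list_of_set)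
    thus "a : (!) ?xs ` {..<k}" using a less k by auto
  next
    fix a assume "a : (!) ?xs ` {..<k}"
    then obtain j where "j < k" "a = ?xs ! j" by auto
    thus "a : D \<inter> {..<?xs ! k}" using less[of j k] k nth_mem[of j ?xs] fin by simp
  qed
  moreover have "inj_on ((!) ?xs) {..<k}" by (rule inj_on_nth) (use k in auto)
  ultimately show "pos_in D (?xs ! k) = k" by (simp add: pos_in_def card_image)
qed

lemma sorted_nth_pos_in: assumes "a : D" shows "pos_in D a < card D" "sorted_list_of_set D ! pos_in D a = a"
proof -
  obtain k where "k < card D" "a = sorted_list_of_set D ! k"
    using assms fin by (metis in_set_conv_nth length_sorted_list_of_set set_sorted_list_of_set)
  thus "pos_in D a < card D" "sorted_list_of_set D ! pos_in D a = a" using pos_in_nth by auto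
qed

lemma bij_betw_sorted_nth: "bij_betw ((!) (sorted_list_of_set D)) {..<card D} D"
  using bij_betw_nth[of "sorted_list_of_set D" "{..<card D}" D] fin by simp

lemma bij_betw_pos_in: "bij_betw (pos_in D) D {..<card D}"
  by (rule bij_betw_byWitness[where f' = "(!) (sorted_list_of_set D)"])
    (auto simp: sorted_nth_pos_in pos_in_nth)

lemma sum_sorted_nth: "(\<Sum>k<card D. f (sorted_list_of_set D ! k)) = sum f D"
  by (rule sum.reindex_bij_betw[OF bij_betw_sorted_nth])

lemma sum_pos_in: "(\<Sum>a\<in>D. f (pos_in D a)) = (\<Sum>k<card D. f k)"
  by (rule sum.reindex_bij_betw[OF bij_betw_pos_in])

end

lemma pos_in_image:
  fixes g :: "nat => nat"
  assumes g: "strict_mono_on A g" and D: "D \<subseteq> A" and a: "a : A"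
  shows "pos_in (g ` D) (g a) = pos_in D a"
proof -
  have "g ` D \<inter> {..<g a} = g ` (D \<inter> {..<a})" using D a strict_mono_on_less[OF g] by auto
  moreover have "inj_on g (D \<inter> {..<a})"
    using D by (intro inj_on_subset[OF strict_mono_on_imp_inj_on[OF g]]) auto
  ultimately show ?thesis by (simp add: pos_in_def card_image)
qed

lemma sorted_nth_image:
  fixes D :: "nat set" and g :: "nat => nat"
  assumes g: "strict_mono_on A g" and D: "D \<subseteq> A" and fin: "finite D" and k: "k < card D"
  shows "sorted_list_of_set (g ` D) ! k = g (sorted_list_of_set D ! k)"
proof -
  have a: "sorted_list_of_set D ! k : D" using pos_in_nth[OF fin k] by simp
  have "pos_in (g ` D) (g (sorted_list_of_set D ! k)) = k"
    using pos_in_image[OF g D, of "sorted_list_of_set D ! k"] a D pos_in_nth[OF fin k] by auto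
  thus ?thesis using sorted_nth_pos_in[of "g ` D" "g (sorted_list_of_set D ! k)"] fin a by auto
qed

abbreviation rise :: "bool list => bool list => nat" where
  "rise al be == card (diff_coords al be)"

lemma finite_diff_coords [simp]: "finite (diff_coords al be)" by (simp add: diff_coords_def)

lemma diff_coords_less: "i : diff_coords al be ==> i < length al" by (simp add: diff_coords_def)

lemma vless_nth: "vless al be ==> i < length al ==> al ! i ==> be ! i"
  by (auto simp: vless_def list_all2_conv_all_nth)

lemma vless_length: "vless al be ==> length be = length al" by (auto simp: vless_def dest: list_all2_lengthD)

lemma vlessI: "length al = length be ==> (!!i. i < length al ==> al ! i ==> be ! i) ==> al ~= be ==> vless al be"
  by (auto simp: vless_def list_all2_conv_all_nth)

lemma vless_trans: assumes "vless al be" "vless be ga" shows "vless al ga"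
proof (rule vlessI)
  note len = vless_length[OF assms(1)] vless_length[OF assms(2)]
  show "length al = length ga" using len by simp
  show "ga ! i" if "i < length al" "al ! i" for i
    using vless_nth[OF assms(1) that] vless_nth[OF assms(2), of i] that len by simp
  show "al ~= ga"
  proof
    assume eq: "al = ga"
    have "al ! i = be ! i" if "i < length al" for i
      using vless_nth[OF assms(1) that] vless_nth[OF assms(2), of i] that len(1) eq by auto
    hence "al = be" using len(1) by (intro nth_equalityI) (simp_all only:)
    thus False using assms by (simp add: vless_def)
  qed
qed

lemma mem_diff_coords: "vless al be ==> i : diff_coords al be \<longleftrightarrow> i < length al & \<not> al ! i & be ! i"
  using vless_nth[of al be i] by (auto simp: diff_coords_def)

lemma card_diff_coords_pos: assumes "vless al be" shows "0 < rise al be"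
proof -
  have "diff_coords al be ~= {}"
    using assms vless_length[OF assms] by (auto simp: diff_coords_def vless_def intro!: nth_equalityI)
  thus ?thesis by (simp add: card_gt_0_iff)
qed

context
  fixes al be ga assumes ab: "vless al be" and bc: "vless be ga"
begin

lemma diff_coords_Un: "diff_coords al ga = diff_coords al be \<union> diff_coords be ga"
  using vless_nth[OF ab] vless_nth[OF bc] vless_length[OF ab] by (auto simp: diff_coords_def)

lemma diff_coords_Int: "diff_coords al be \<inter> diff_coords be ga = {}"
  using mem_diff_coords[OF ab] mem_diff_coords[OF bc] by auto

lemma card_diff_coords_add: "rise al ga = rise al be + rise be ga"
  using diff_coords_Un diff_coords_Int by (simp add: card_Un_disjoint)

lemma moore_subcube_fst:
  "a : diff_coords al be ==> moore l (in_subcube al be \<eta>) (in_subcube be ga \<theta>) t a =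
     (if t <= l then \<eta> t (pos_in (diff_coords al be) a) else 1)"
  using mem_diff_coords[OF ab, of a] mem_diff_coords[OF bc, of a]
  by (auto simp: moore_def in_subcube_def pos_in_def)

lemma moore_subcube_snd:
  "a : diff_coords be ga ==> moore l (in_subcube al be \<eta>) (in_subcube be ga \<theta>) t a =
     (if t <= l then 0 else \<theta> (t - l) (pos_in (diff_coords be ga) a))"
  using mem_diff_coords[OF ab, of a] mem_diff_coords[OF bc, of a] vless_nth[OF ab, of a]
    vless_length[OF ab] by (auto simp: moore_def in_subcube_def pos_in_def)

text \<open>The composite is defined in coordinates of the subcube; in the ambient cube it is the
  concatenation of the two paths.\<close>

lemma in_subcube_N_comp:
  assumes "0 <= t" "t <= real (rise al ga)" "i < length al"
  shows "in_subcube al ga (N_comp al be ga \<eta> \<theta>) t i =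
    moore (real (rise al be)) (in_subcube al be \<eta>) (in_subcube be ga \<theta>) t i"
proof (cases "i : diff_coords al ga")
  case True
  thus ?thesis using assms sorted_nth_pos_in[OF _ True]
    by (simp add: in_subcube_def[of al ga] N_comp_def flip: pos_in_def)
next
  case False
  hence "i ~: diff_coords al be" "i ~: diff_coords be ga" "al ! i = be ! i"
    using diff_coords_Un assms by (auto simp: diff_coords_def)
  thus ?thesis using False by (simp add: in_subcube_def moore_def)
qed

lemma N_comp_natural:
  assumes p: "\<eta> : natural_dpaths (rise al be)"
    and q: "\<theta> : natural_dpaths (rise be ga)"
  shows "N_comp al be ga \<eta> \<theta> : natural_dpaths (rise al ga)"
proof -
  let ?D = "diff_coords al ga" and ?D1 = "diff_coords al be" and ?D2 = "diff_coords be ga"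
  let ?l = "real (card ?D1)"
  let ?m = "moore ?l (in_subcube al be \<eta>) (in_subcube be ga \<theta>)"
  have len: "real (card ?D) = ?l + real (card ?D2)" by (simp add: card_diff_coords_add)
  have val: "N_comp al be ga \<eta> \<theta> t k = ?m t (sorted_list_of_set ?D ! k)"
    if "0 <= t" "t <= real (card ?D)" "k < card ?D" for t k using that by (simp add: N_comp_def)
  have bounds: "0 <= ?m t a & ?m t a <= 1" if "0 <= t" "t <= real (card ?D)" "a : ?D" for t a
  proof -
    have "a : ?D1 | a : ?D2" using that diff_coords_Un by blast
    thus ?thesis
    proof
      assume a: "a : ?D1"
      show ?thesis
        unfolding moore_subcube_fst[OF a] using ndp_bounds[OF p, of t] that sorted_nth_pos_in[OF _ a] by auto
    next
      assume a: "a : ?D2"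
      show ?thesis
        unfolding moore_subcube_snd[OF a] using ndp_bounds[OF q, of "t - ?l"] that len sorted_nth_pos_in[OF _ a] by auto
    qed
  qed
  have mono: "?m s a <= ?m t a" if "0 <= s" "s <= t" "t <= real (card ?D)" "a : ?D" for s t a
  proof -
    have "a : ?D1 | a : ?D2" using that diff_coords_Un by blast
    thus ?thesis
    proof
      assume a: "a : ?D1"
      show ?thesis unfolding moore_subcube_fst[OF a]
        using ndp_mono[OF p, of _ s t] ndp_bounds[OF p, of s] that sorted_nth_pos_in[OF _ a] by auto
    next
      assume a: "a : ?D2"
      show ?thesis unfolding moore_subcube_snd[OF a]
        using ndp_mono[OF q, of _ "s - ?l" "t - ?l"] ndp_bounds[OF q, of "t - ?l"] that len sorted_nth_pos_in[OF _ a]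
        by auto
    qed
  qed
  show ?thesis
  proof (rule natural_dpathsI)
    fix t assume t: "0 <= t" "t <= real (card ?D)"
    have "(\<Sum>k<card ?D. N_comp al be ga \<eta> \<theta> t k) = (\<Sum>k<card ?D. ?m t (sorted_list_of_set ?D ! k))"
      using t val by (intro sum.cong) auto
    also have "\<dots> = (\<Sum>a\<in>?D1. ?m t a) + (\<Sum>a\<in>?D2. ?m t a)"
      using diff_coords_Un diff_coords_Int by (simp add: sum_sorted_nth sum.union_disjoint)
    also have "\<dots> = (\<Sum>a\<in>?D1. if t <= ?l then \<eta> t (pos_in ?D1 a) else 1) +
        (\<Sum>a\<in>?D2. if t <= ?l then 0 else \<theta> (t - ?l) (pos_in ?D2 a))"
      by (intro arg_cong2[of _ _ _ _ "(+)"] sum.cong) (simp_all add: moore_subcube_fst moore_subcube_snd)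
    also have "\<dots> = t" using t len ndp_sum[OF p, of t] ndp_sum[OF q, of "t - ?l"]
      by (cases "t <= ?l") (simp_all add: sum_pos_in[of _ "%k. _ k"] sum_pos_in)
    finally show "(\<Sum>k<card ?D. N_comp al be ga \<eta> \<theta> t k) = t" .
    fix k assume k: "k < card ?D"
    show "0 <= N_comp al be ga \<eta> \<theta> t k & N_comp al be ga \<eta> \<theta> t k <= 1"
      using bounds[OF t] val[OF t k] pos_in_nth[OF _ k] by simp
  next
    fix k s t assume "k < card ?D" "0 <= s" "s <= t" "t <= real (card ?D)"
    thus "N_comp al be ga \<eta> \<theta> s k <= N_comp al be ga \<eta> \<theta> t k"
      using mono[of s t] val[of s k] val[of t k] pos_in_nth[of ?D k] by simp
  qed (auto simp: N_comp_def)
qed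

lemma continuous_map_N_comp:
  assumes f: "cmap X (N (rise al be)) f"
    and g: "cmap X (N (rise be ga)) g"
  shows "cmap X (N (rise al ga)) (%x. N_comp al be ga (f x) (g x))" unfolding continuous_map_N
proof (intro conjI ballI allI impI)
  fix x assume "x : topspace X"
  thus "N_comp al be ga (f x) (g x) : natural_dpaths (rise al ga)"
    using continuous_map_funspace[OF f] continuous_map_funspace[OF g] by (intro N_comp_natural) auto
next
  let ?D = "diff_coords al ga" and ?D1 = "diff_coords al be" and ?D2 = "diff_coords be ga"
  fix t k assume t: "t : {0..real (card ?D)}" and k: "k < card ?D"
  define a where "a = sorted_list_of_set ?D ! k"
  have val: "N_comp al be ga (f x) (g x) t k =
      moore (real (card ?D1)) (in_subcube al be (f x)) (in_subcube be ga (g x)) t a" for x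
    using t k by (simp add: N_comp_def a_def)
  have "a : ?D1 | a : ?D2" using pos_in_nth[OF _ k] diff_coords_Un by (auto simp: a_def)
  thus "cmap X euclideanreal (%x. N_comp al be ga (f x) (g x) t k)"
  proof
    assume a: "a : ?D1"
    show ?thesis unfolding val moore_subcube_fst[OF a]
      using f t sorted_nth_pos_in[OF _ a] by (auto simp: continuous_map_N)
  next
    assume a: "a : ?D2"
    show ?thesis unfolding val moore_subcube_snd[OF a]
      using g t sorted_nth_pos_in[OF _ a] by (auto simp: continuous_map_N card_diff_coords_add)
  qed
qed

end

lemma N_comp_assoc:
  assumes ab: "vless al be" and bc: "vless be ga" and cd: "vless ga de"
  shows "N_comp al ga de (N_comp al be ga p q) r = N_comp al be de p (N_comp be ga de q r)"
proof (intro ext)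
  note ac = vless_trans[OF ab bc] and bd = vless_trans[OF bc cd]
  fix t k
  let ?D = "diff_coords al de"
  let ?l1 = "real (rise al be)" and ?l2 = "real (rise be ga)"
    and ?l3 = "real (rise ga de)"
  show "N_comp al ga de (N_comp al be ga p q) r t k = N_comp al be de p (N_comp be ga de q r) t k"
  proof (cases "0 <= t & t <= real (card ?D) & k < card ?D")
    case True
    define a where "a = sorted_list_of_set ?D ! k"
    have aD: "a : ?D" unfolding a_def using True by (intro pos_in_nth(1)) auto
    hence aL: "a < length al" "a < length be" using diff_coords_less vless_length[OF ab] by auto
    have l: "real (rise al ga) = ?l1 + ?l2" "real (rise be de) = ?l2 + ?l3"
      "real (card ?D) = ?l1 + ?l2 + ?l3"
      using card_diff_coords_add[OF ab bc] card_diff_coords_add[OF bc cd] card_diff_coords_add[OF ab bd] by auto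
    have L: "moore (?l1 + ?l2) (in_subcube al ga (N_comp al be ga p q)) (in_subcube ga de r) t a =
        moore (?l1 + ?l2) (moore ?l1 (in_subcube al be p) (in_subcube be ga q)) (in_subcube ga de r) t a"
      unfolding moore_def[of "?l1 + ?l2"] using in_subcube_N_comp[OF ab bc _ _ aL(1), of t p q] True l by auto
    have R: "moore ?l1 (in_subcube al be p) (in_subcube be de (N_comp be ga de q r)) t a =
        moore ?l1 (in_subcube al be p) (moore ?l2 (in_subcube be ga q) (in_subcube ga de r)) t a"
      unfolding moore_def[of ?l1] using in_subcube_N_comp[OF bc cd _ _ aL(2), of "t - ?l1" q r] True l by auto
    have "moore (?l1 + ?l2) (moore ?l1 (in_subcube al be p) (in_subcube be ga q)) (in_subcube ga de r) t a =
        moore ?l1 (in_subcube al be p) (moore ?l2 (in_subcube be ga q) (in_subcube ga de r)) t a"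
      by (auto simp: moore_def diff_diff_eq algebra_simps)
    thus ?thesis using True L R l by (simp add: N_comp_def[of al ga de] N_comp_def[of al be de] flip: a_def)
  qed (auto simp: N_comp_def)
qed

section \<open>Maps of the box category\<close>

text \<open>Every map of the box category keeps its arguments as subsequence of coordinates, at the
  positions \<open>g\<close>, and fills the other positions by constants.\<close>

definition coords_at :: "nat => nat => (bool list => bool list) => (nat => nat) => bool" where
  "coords_at m n \<phi> g \<longleftrightarrow> strict_mono_on {..<m} g & g ` {..<m} \<subseteq> {..<n} \<and>
     (\<forall>xs\<in>vert m. \<phi> xs : vert n & (\<forall>i<m. \<phi> xs ! g i = xs ! i) \<and>
        (\<forall>ys\<in>vert m. \<forall>j<n. j ~: g ` {..<m} --> \<phi> xs ! j = \<phi> ys ! j))"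

context
  fixes m n \<phi> g assumes c: "coords_at m n \<phi> g"
begin

lemma coords_at_mono: "strict_mono_on {..<m} g" using c by (simp add: coords_at_def)

lemma coords_at_inj: "inj_on g {..<m}" using coords_at_mono by (rule strict_mono_on_imp_inj_on)

lemma coords_at_less: "i < m ==> g i < n" using c unfolding coords_at_def by blast

lemma coords_at_vert: "xs : vert m ==> \<phi> xs : vert n" using c unfolding coords_at_def by blast

lemma coords_at_nth: "xs : vert m ==> i < m ==> \<phi> xs ! g i = xs ! i" using c unfolding coords_at_def by blast

lemma coords_at_const:
  "xs : vert m ==> ys : vert m ==> j < n ==> j ~: g ` {..<m} ==> \<phi> xs ! j = \<phi> ys ! j"
  using c unfolding coords_at_def by blast

end

lemma coords_at_coface:
  assumes "i <= n" shows "coords_at n (Suc n) (coface n i \<epsilon>) (%j. if j < i then j else Suc j)"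
  unfolding coords_at_def
proof (intro conjI ballI allI impI)
  fix xs ys :: "bool list" assume xs: "xs : vert n" and ys: "ys : vert n"
  show "coface n i \<epsilon> xs : vert (Suc n)" using xs assms by (simp add: coface_def vert_def)
  show "coface n i \<epsilon> xs ! (if j < i then j else Suc j) = xs ! j" if "j < n" for j
    using xs assms that by (auto simp: coface_def vert_def nth_append nth_Cons' Suc_diff_le)
  fix j assume "j < Suc n" "j ~: (%j. if j < i then j else Suc j) ` {..<n}"
  hence ne: "j ~= (if k < i then k else Suc k)" if "k < n" for k using that by blast
  have "j = i"
  proof (rule ccontr)
    assume "j ~= i"
    then consider "j < i" | k where "j = Suc k" "i <= k" by (cases j) (auto simp: not_less_eq linorder_neq_iff)
    thus False using ne[of j] ne[of "j - 1"] \<open>j < Suc n\<close> assms by cases auto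
  qed
  thus "coface n i \<epsilon> xs ! j = coface n i \<epsilon> ys ! j"
    using xs ys assms by (simp add: coface_def vert_def nth_append)
qed (auto simp: strict_mono_on_def)

lemma coords_at_comp:
  assumes f: "coords_at l m \<phi> f" and g: "coords_at m n \<psi> g"
  shows "coords_at l n (compose (vert l) \<psi> \<phi>) (g \<circ> f)"
proof -
  note fm = coords_at_mono[OF f] coords_at_less[OF f] coords_at_vert[OF f] coords_at_nth[OF f] coords_at_const[OF f]
  note gm = coords_at_mono[OF g] coords_at_less[OF g] coords_at_vert[OF g] coords_at_nth[OF g] coords_at_const[OF g]
  have "strict_mono_on {..<l} (g \<circ> f)" using fm(1,2) gm(1) by (auto simp: strict_mono_on_def)
  moreover have "\<psi> (\<phi> xs) ! j = \<psi> (\<phi> ys) ! j"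
    if xs: "xs : vert l" and ys: "ys : vert l" and j: "j < n" "j ~: (g \<circ> f) ` {..<l}" for xs ys j
  proof (cases "j : g ` {..<m}")
    case True
    then obtain i where i: "i < m" "j = g i" by auto
    hence "i ~: f ` {..<l}" using j by auto
    thus ?thesis using fm(5)[OF xs ys i(1)] gm(4)[OF fm(3)[OF xs] i(1)] gm(4)[OF fm(3)[OF ys] i(1)] i by simp
  next
    case False
    thus ?thesis using gm(5)[OF fm(3)[OF xs] fm(3)[OF ys] j(1)] by simp
  qed
  ultimately have *: "strict_mono_on {..<l} (g \<circ> f)" "!!xs ys j. xs : vert l ==> ys : vert l ==> j < n ==>
      j ~: (g \<circ> f) ` {..<l} ==> \<psi> (\<phi> xs) ! j = \<psi> (\<phi> ys) ! j" by blast+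
  show ?thesis unfolding coords_at_def
  proof (intro conjI ballI allI impI)
    show "(g \<circ> f) ` {..<l} \<subseteq> {..<n}" using fm(2) gm(2) by auto
    fix xs assume xs: "xs : vert l"
    show "compose (vert l) \<psi> \<phi> xs : vert n" using gm(3)[OF fm(3)[OF xs]] xs by (simp add: compose_def)
    show "compose (vert l) \<psi> \<phi> xs ! (g \<circ> f) i = xs ! i" if "i < l" for i
      using gm(4)[OF fm(3)[OF xs] fm(2)[OF that]] fm(4)[OF xs that] xs by (simp add: compose_def)
    fix ys j assume "ys : vert l" "j < n" "j ~: (g \<circ> f) ` {..<l}"
    thus "compose (vert l) \<psi> \<phi> xs ! j = compose (vert l) \<psi> \<phi> ys ! j"
      using *(2)[OF xs] xs by (simp add: compose_def)
  qed (rule *(1))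
qed

lemma box_map_coords: "box_map m n \<phi> ==> \<exists>g. coords_at m n \<phi> g"
proof (induction rule: box_map.induct)
  case (ident n)
  thus ?case by (intro exI[of _ id]) (auto simp: coords_at_def strict_mono_on_def)
next
  case (face i n \<epsilon>)
  show ?case by (rule exI) (rule coords_at_coface[OF face])
next
  case (comp l m f n g)
  then obtain f' g' where "coords_at l m f f'" "coords_at m n g g'" by blast
  thus ?case by (intro exI) (rule coords_at_comp)
qed

lemma box_map_ext: "box_map m n \<phi> ==> \<phi> : extensional (vert m)" by (induction rule: box_map.induct)
    (auto simp: coface_def compose_def restrict_def extensional_def)

lemma box_map_vert: "box_map m n \<phi> ==> xs : vert m ==> \<phi> xs : vert n"
  using box_map_coords coords_at_vert by blast

lemma box_map_le: assumes "box_map m n \<phi>" shows "m <= n"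
proof -
  obtain g where g: "coords_at m n \<phi> g" using box_map_coords[OF assms] by blast
  have "card {..<m} <= card {..<n}"
    using coords_at_less[OF g] by (intro card_inj_on_le[OF coords_at_inj[OF g]]) auto
  thus ?thesis by simp
qed

lemma strict_mono_on_eq_nth:
  fixes g :: "nat => nat"
  assumes "strict_mono_on {..<m} g" "i < m" shows "g i = sorted_list_of_set (g ` {..<m}) ! i"
  using sorted_nth_image[OF assms(1) order_refl, of i] assms by (simp add: lessThan_atLeast0)

definition bot_vert :: "nat => bool list" where "bot_vert n = replicate n False"
definition top_vert :: "nat => bool list" where "top_vert n = replicate n True"

lemma bot_top_vert [simp]: "bot_vert n : vert n" "top_vert n : vert n"
  "i < n ==> \<not> bot_vert n ! i" "i < n ==> top_vert n ! i" by (auto simp: bot_vert_def top_vert_def vert_def)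

lemma diff_coords_coords_at:
  assumes g: "coords_at m n \<phi> g" and a: "a : vert m" and b: "b : vert m"
  shows "diff_coords (\<phi> a) (\<phi> b) = g ` diff_coords a b"
proof (intro equalityI subsetI)
  have len: "length a = m" "length b = m" "length (\<phi> a) = n" "length (\<phi> b) = n"
    using a b coords_at_vert[OF g a] coords_at_vert[OF g b] by (auto simp: vert_def)
  {
    fix j assume j: "j : diff_coords (\<phi> a) (\<phi> b)"
    hence jn: "j < n" "\<phi> a ! j ~= \<phi> b ! j" using len by (auto simp: diff_coords_def)
    hence "j : g ` {..<m}" using coords_at_const[OF g a b] by blast
    then obtain i where i: "i < m" "j = g i" by auto
    thus "j : g ` diff_coords a b"
      using jn coords_at_nth[OF g a i(1)] coords_at_nth[OF g b i(1)] len by (simp add: diff_coords_def)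
  next
    fix j assume "j : g ` diff_coords a b"
    then obtain i where i: "i < m" "j = g i" "a ! i ~= b ! i" using len by (auto simp: diff_coords_def)
    thus "j : diff_coords (\<phi> a) (\<phi> b)"
      using coords_at_nth[OF g a i(1)] coords_at_nth[OF g b i(1)] coords_at_less[OF g i(1)] len
      by (simp add: diff_coords_def)
  }
qed

text \<open>The images of the extreme vertices determine the directions of a face and its constant
  coordinates.\<close>

lemma box_map_eqI:
  assumes f: "box_map m n \<phi>" and h: "box_map m n \<psi>"
    and bot: "\<phi> (bot_vert m) = \<psi> (bot_vert m)" and top: "\<phi> (top_vert m) = \<psi> (top_vert m)"
  shows "\<phi> = \<psi>"
proof (rule extensionalityI[OF box_map_ext[OF f] box_map_ext[OF h]])
  obtain g g' where g: "coords_at m n \<phi> g" and g': "coords_at m n \<psi> g'"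
    using box_map_coords[OF f] box_map_coords[OF h] by blast
  have D: "diff_coords (bot_vert m) (top_vert m) = {..<m}" by (auto simp: diff_coords_def bot_vert_def top_vert_def)
  have img: "g ` {..<m} = g' ` {..<m}" using diff_coords_coords_at[OF g, of "bot_vert m" "top_vert m"]
      diff_coords_coords_at[OF g', of "bot_vert m" "top_vert m"] bot top D by simp
  have eq: "g i = g' i" if "i < m" for i using strict_mono_on_eq_nth[OF coords_at_mono[OF g] that]
      strict_mono_on_eq_nth[OF coords_at_mono[OF g'] that] img by simp
  fix xs assume xs: "xs : vert m"
  show "\<phi> xs = \<psi> xs"
  proof (rule nth_equalityI)
    show "length (\<phi> xs) = length (\<psi> xs)" using coords_at_vert[OF g xs] coords_at_vert[OF g' xs] by (simp add: vert_def)
    fix j assume "j < length (\<phi> xs)"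
    hence j: "j < n" using coords_at_vert[OF g xs] by (simp add: vert_def)
    show "\<phi> xs ! j = \<psi> xs ! j"
    proof (cases "j : g ` {..<m}")
      case True
      then obtain i where "i < m" "j = g i" by auto
      thus ?thesis using coords_at_nth[OF g xs] coords_at_nth[OF g' xs] eq by simp
    next
      case False
      hence "\<phi> xs ! j = \<phi> (bot_vert m) ! j" "\<psi> xs ! j = \<psi> (bot_vert m) ! j"
        using coords_at_const[OF g xs bot_top_vert(1) j] coords_at_const[OF g' xs bot_top_vert(1) j] img by auto
      thus ?thesis using bot by simp
    qed
  qed
qed

lemma box_map_endo: assumes f: "box_map n n \<phi>" shows "\<phi> = (\<lambda>xs\<in>vert n. xs)"
proof (rule extensionalityI[OF box_map_ext[OF f]])
  obtain g where g: "coords_at n n \<phi> g" using box_map_coords[OF f] by blast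
  have "g ` {..<n} = {..<n}"
    using coords_at_less[OF g] by (intro card_subset_eq) (auto simp: card_image[OF coords_at_inj[OF g]])
  hence gi: "g i = i" if "i < n" for i
    using strict_mono_on_eq_nth[OF coords_at_mono[OF g] that] that by (simp add: lessThan_atLeast0)
  fix xs :: "bool list" assume xs: "xs : vert n"
  have "\<phi> xs = xs"
    using coords_at_vert[OF g xs] coords_at_nth[OF g xs] gi xs by (auto simp: vert_def intro!: nth_equalityI)
  thus "\<phi> xs = (\<lambda>xs\<in>vert n. xs) xs" using xs by simp
qed auto

lemma box_map_Cons:
  "box_map m n \<phi> ==> box_map (Suc m) (Suc n) (\<lambda>xs\<in>vert (Suc m). hd xs # \<phi> (tl xs))"
proof (induction rule: box_map.induct)
  case (ident n)
  have "(\<lambda>xs\<in>vert (Suc n). hd xs # (\<lambda>xs\<in>vert n. xs) (tl xs)) = (\<lambda>xs\<in>vert (Suc n). xs)"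
    by (rule restrict_ext) (auto simp: vert_def length_Suc_conv)
  thus ?case using box_map.ident[of "Suc n"] by (simp only:)
next
  case (face i n \<epsilon>)
  have "(\<lambda>xs\<in>vert (Suc n). hd xs # coface n i \<epsilon> (tl xs)) = coface (Suc n) (Suc i) \<epsilon>"
    unfolding coface_def
  proof (rule restrict_ext)
    fix xs :: "bool list" assume "xs : vert (Suc n)"
    thus "hd xs # (\<lambda>xs\<in>vert n. take i xs @ \<epsilon> # drop i xs) (tl xs) = take (Suc i) xs @ \<epsilon> # drop (Suc i) xs"
      by (cases xs) (simp_all add: vert_def)
  qed
  moreover have "box_map (Suc n) (Suc (Suc n)) (coface (Suc n) (Suc i) \<epsilon>)"
    using face by (intro box_map.face) simp
  ultimately show ?case by (simp only:)
next
  case (comp l m f n g)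
  have "(\<lambda>xs\<in>vert (Suc l). hd xs # compose (vert l) g f (tl xs)) =
      compose (vert (Suc l)) (\<lambda>xs\<in>vert (Suc m). hd xs # g (tl xs)) (\<lambda>xs\<in>vert (Suc l). hd xs # f (tl xs))"
    unfolding compose_def
  proof (rule restrict_ext)
    fix xs :: "bool list" assume xs: "xs : vert (Suc l)"
    hence t: "tl xs : vert l" by (simp add: vert_def)
    hence "hd xs # f (tl xs) : vert (Suc m)" using box_map_vert[OF comp.hyps(1)] by (simp add: vert_def)
    thus "hd xs # (\<lambda>x\<in>vert l. g (f x)) (tl xs) =
        (\<lambda>xs\<in>vert (Suc m). hd xs # g (tl xs)) ((\<lambda>xs\<in>vert (Suc l). hd xs # f (tl xs)) xs)"
      using xs t by simp
  qed
  thus ?case using box_map.comp[OF comp.IH] by (simp only:)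
qed

text \<open>Rebuilds a vertex of the subcube from \<open>al\<close> to \<open>be\<close> by reading the free coordinates off a list.\<close>

fun fill :: "bool list => bool list => bool list => bool list" where
  "fill (a # al) (b # be) xs = (if a = b then a # fill al be xs else hd xs # fill al be (tl xs))"
| "fill _ _ _ = []"

definition face_map :: "bool list => bool list => bool list => bool list" where
  "face_map al be = restrict (fill al be) (vert (rise al be))"

lemma card_diff_coords_Cons:
  "rise (a # al) (b # be) = (if a = b then 0 else 1) + rise al be"
proof -
  have "diff_coords (a # al) (b # be) = (if a = b then {} else {0}) \<union> Suc ` diff_coords al be"
  proof (rule set_eqI)
    fix j
    show "j : diff_coords (a # al) (b # be) \<longleftrightarrow> j : (if a = b then {} else {0}) \<union> Suc ` diff_coords al be"
      by (cases j) (auto simp: diff_coords_def)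
  qed
  thus ?thesis by (simp add: card_image)
qed

lemma box_map_face_map:
  "length al = length be ==> box_map (rise al be) (length al) (face_map al be)"
proof (induction rule: list_induct2)
  case Nil
  have "face_map [] [] = (\<lambda>xs\<in>vert 0. xs)"
    unfolding face_map_def by (simp add: diff_coords_def vert_def) (rule restrict_ext, simp)
  thus ?case using box_map.ident[of 0] by (simp add: diff_coords_def del: restrict_apply)
next
  case (Cons a al b be)
  let ?m = "rise al be" and ?n = "length al"
  show ?case
  proof (cases "a = b")
    case True
    have "face_map (a # al) (b # be) = compose (vert ?m) (coface ?n 0 a) (face_map al be)"
    proof -
      have "fill (a # al) (b # be) xs = coface ?n 0 a (face_map al be xs)" if "xs : vert ?m" for xs
        using that True box_map_vert[OF Cons.IH that] by (simp add: coface_def) (simp add: face_map_def)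
      note fill_eq = this
      have c: "rise (a # al) (b # be) = ?m" using True by (simp add: card_diff_coords_Cons)
      show ?thesis unfolding face_map_def[of "a # al"] compose_def c by (rule restrict_ext) (rule fill_eq)
    qed
    thus ?thesis using box_map.comp[OF Cons.IH box_map.face[of 0 ?n a]] True by (simp add: card_diff_coords_Cons)
  next
    case False
    have "face_map (a # al) (b # be) = (\<lambda>xs\<in>vert (Suc ?m). hd xs # face_map al be (tl xs))"
    proof -
      have "fill (a # al) (b # be) xs = hd xs # face_map al be (tl xs)" if "xs : vert (Suc ?m)" for xs
        using that False by (simp add: face_map_def vert_def)
      note fill_eq = this
      have c: "rise (a # al) (b # be) = Suc ?m" using False by (simp add: card_diff_coords_Cons)
      show ?thesis unfolding face_map_def[of "a # al"] c by (rule restrict_ext) (rule fill_eq)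
    qed
    thus ?thesis using box_map_Cons[OF Cons.IH] False by (simp add: card_diff_coords_Cons del: restrict_apply)
  qed
qed

lemma fill_bot_top:
  assumes "vless al be | al = be"
  shows "fill al be (bot_vert (rise al be)) = al"
    "fill al be (top_vert (rise al be)) = be"
proof -
  have "list_all2 (\<le>) al be" using assms by (auto simp: vless_def list_all2_refl)
  thus "fill al be (bot_vert (rise al be)) = al"
      "fill al be (top_vert (rise al be)) = be"
    by (induction rule: list_all2_induct) (auto simp: card_diff_coords_Cons bot_vert_def top_vert_def)
qed

lemma face_map_bot_top:
  assumes "vless al be"
  shows "face_map al be (bot_vert (rise al be)) = al"
    "face_map al be (top_vert (rise al be)) = be" using fill_bot_top[of al be] assms by (simp_all add: face_map_def)

lemma vless_coords_at:
  assumes g: "coords_at m n \<phi> g" and a: "a : vert m" and b: "b : vert m"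
  shows "vless (\<phi> a) (\<phi> b) \<longleftrightarrow> vless a b"
proof
  have len: "length (\<phi> a) = n" "length (\<phi> b) = n" "length a = m" "length b = m"
    using a b coords_at_vert[OF g a] coords_at_vert[OF g b] by (auto simp: vert_def)
  {
    assume v: "vless a b"
    show "vless (\<phi> a) (\<phi> b)"
    proof (rule vlessI)
      show "length (\<phi> a) = length (\<phi> b)" using len by simp
      show "\<phi> a ~= \<phi> b"
      proof
        assume "\<phi> a = \<phi> b"
        hence "diff_coords (\<phi> a) (\<phi> b) = {}" by (simp add: diff_coords_def)
        hence "diff_coords a b = {}" unfolding diff_coords_coords_at[OF g a b] by simp
        thus False using card_diff_coords_pos[OF v] by simp
      qed
      fix j assume j: "j < length (\<phi> a)" "\<phi> a ! j"
      show "\<phi> b ! j"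
      proof (rule ccontr)
        assume "\<not> \<phi> b ! j"
        hence "j : diff_coords (\<phi> a) (\<phi> b)" using j by (simp add: diff_coords_def)
        then obtain i where i: "i : diff_coords a b" "j = g i" using diff_coords_coords_at[OF g a b] by auto
        hence "\<phi> a ! j = a ! i" using coords_at_nth[OF g a, of i] len by (simp add: diff_coords_def)
        thus False using i j mem_diff_coords[OF v] by simp
      qed
    qed
  next
    assume v: "vless (\<phi> a) (\<phi> b)"
    show "vless a b"
    proof (rule vlessI)
      show "a ~= b" using v by (auto simp: vless_def)
      fix i assume i: "i < length a" "a ! i"
      thus "b ! i" using vless_nth[OF v, of "g i"] coords_at_nth[OF g a, of i] coords_at_nth[OF g b, of i]
          coords_at_less[OF g, of i] len by simp
    qed (simp add: len)
  }
qed

lemma card_diff_coords_coords_at: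
  assumes g: "coords_at m n \<phi> g" and a: "a : vert m" and b: "b : vert m"
  shows "rise (\<phi> a) (\<phi> b) = rise a b"
proof -
  have "inj_on g (diff_coords a b)"
    using a by (intro inj_on_subset[OF coords_at_inj[OF g]]) (auto simp: diff_coords_def vert_def)
  thus ?thesis using diff_coords_coords_at[OF g a b] by (simp add: card_image)
qed

lemma in_subcube_coords_at:
  assumes g: "coords_at m n \<phi> g" and a: "a : vert m" and b: "b : vert m" and i: "i < m"
  shows "in_subcube (\<phi> a) (\<phi> b) \<eta> t (g i) = in_subcube a b \<eta> t i"
proof -
  note mono = coords_at_mono[OF g]
  have sub: "diff_coords a b \<subseteq> {..<m}" using a by (auto simp: diff_coords_def vert_def)
  have "g i : g ` diff_coords a b \<longleftrightarrow> i : diff_coords a b"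
    using inj_on_image_mem_iff[OF strict_mono_on_imp_inj_on[OF mono]] i sub by auto
  moreover have "pos_in (g ` diff_coords a b) (g i) = pos_in (diff_coords a b) i"
    using pos_in_image[OF mono sub] i by simp
  moreover have "\<phi> a ! g i = a ! i" using coords_at_nth[OF g a i] .
  ultimately show ?thesis unfolding in_subcube_def diff_coords_coords_at[OF g a b] by (simp flip: pos_in_def)
qed

lemma N_comp_coords_at:
  assumes g: "coords_at m n \<phi> g" and a: "a : vert m" and b: "b : vert m" and c: "c : vert m"
  shows "N_comp (\<phi> a) (\<phi> b) (\<phi> c) = N_comp a b c"
proof (intro ext)
  fix \<eta> \<theta> t k
  note mono = coords_at_mono[OF g]
  have sub: "diff_coords a c \<subseteq> {..<m}" using a by (auto simp: diff_coords_def vert_def)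
  note cards = card_diff_coords_coords_at[OF g]
  show "N_comp (\<phi> a) (\<phi> b) (\<phi> c) \<eta> \<theta> t k = N_comp a b c \<eta> \<theta> t k"
  proof (cases "t : {0..real (rise a c)} & k < rise a c")
    case True
    let ?i = "sorted_list_of_set (diff_coords a c) ! k"
    have "?i : diff_coords a c" using True by (intro pos_in_nth(1)) auto
    hence i: "?i < m" using sub by auto
    have s: "sorted_list_of_set (diff_coords (\<phi> a) (\<phi> c)) ! k = g ?i"
      unfolding diff_coords_coords_at[OF g a c] using True by (intro sorted_nth_image[OF mono sub]) auto
    show ?thesis unfolding N_comp_def cards[OF a c] cards[OF a b] using True s
      by (simp add: moore_def in_subcube_coords_at[OF g a b i] in_subcube_coords_at[OF g b c i])
  qed (auto simp: N_comp_def cards[OF a c])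
qed

section \<open>Flows and their maps\<close>

lemma delta_generated_discrete: "delta_generated (discrete_topology A)" unfolding delta_generated_def
proof (intro allI iffI)
  show "openin (discrete_topology A) U" if "delta_open (discrete_topology A) U" for U
    using that by (simp add: delta_open_def)
qed (rule openin_imp_delta_open)

lemma in_Top_discrete: "in_Top haus (discrete_topology A)"
  by (simp add: in_Top_def delta_generated_discrete Hausdorff_imp_delta_Hausdorff)

lemma in_TopI: "delta_generated X ==> Hausdorff_space X ==> in_Top haus X"
  by (simp add: in_Top_def Hausdorff_imp_delta_Hausdorff)

lemma delta_generated_homeomorphic_maps:
  assumes h: "homeomorphic_maps X Y f g" and X: "delta_generated X"
  shows "delta_generated Y" unfolding delta_generated_def
proof (intro allI iffI)
  fix U assume U: "delta_open Y U"
  have f: "cmap X Y f" and g: "cmap Y X g"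
    and gf: "!!y. y : topspace Y ==> f (g y) = y" using h by (auto simp: homeomorphic_maps_def)
  have "delta_open X {x : topspace X. f x : U}" unfolding delta_open_def
  proof (intro conjI allI impI)
    fix p assume p: "pathin X p"
    have "{t : {0..1}. p t : {x : topspace X. f x : U}} = {t : {0..1}. (f \<circ> p) t : U}"
      using pathin_funspace[OF p] by auto
    thus "openin unit_ivl {t : {0..1}. p t : {x : topspace X. f x : U}}"
      using U pathin_comp[OF p f] unfolding delta_open_def by (simp only:)
  qed auto
  hence "openin X {x : topspace X. f x : U}" using X by (simp add: delta_generated_def)
  from openin_continuous_map_preimage[OF g this]
  have "openin Y {y : topspace Y. g y : {x : topspace X. f x : U}}" .
  moreover have "{y : topspace Y. g y : {x : topspace X. f x : U}} = U"
  proof -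
    have "U \<subseteq> topspace Y" using U by (simp add: delta_open_def)
    thus ?thesis using gf continuous_map_funspace[OF g] by auto
  qed
  ultimately show "openin Y U" by simp
qed (rule openin_imp_delta_open)

definition npath_top :: "(real => nat => real) topology => 'a univ topology" where
  "npath_top M = pullback_topology (NPath ` topspace M) unNPath M"

lemma topspace_npath_top [simp]: "topspace (npath_top M) = NPath ` topspace M"
  by (auto simp: npath_top_def topspace_pullback_topology)

lemma homeomorphic_maps_npath_top: "homeomorphic_maps M (npath_top M) NPath unNPath"
proof -
  have "cmap (npath_top M) M (id \<circ> unNPath)" unfolding npath_top_def by (rule continuous_map_pullback) simp
  moreover have "cmap M (npath_top M) NPath"
    unfolding npath_top_def by (rule continuous_map_pullback') (auto simp: o_def)
  ultimately show ?thesis by (auto simp: homeomorphic_maps_def)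
qed

lemma continuous_map_unNPath: "cmap (npath_top M) M unNPath"
  by (rule homeomorphic_maps_npath_top[unfolded homeomorphic_maps_def, THEN conjunct2, THEN conjunct1])

lemma continuous_map_NPath: "cmap M (npath_top M) NPath"
  by (rule homeomorphic_maps_npath_top[unfolded homeomorphic_maps_def, THEN conjunct1])

lemma in_Top_npath_N: "in_Top haus (npath_top (N m))"
proof (rule in_TopI)
  show "delta_generated (npath_top (N m))"
    by (rule delta_generated_homeomorphic_maps[OF homeomorphic_maps_npath_top delta_generated_N])
  show "Hausdorff_space (npath_top (N m))"
    using homeomorphic_Hausdorff_space[of "N m" "npath_top (N m)"] Hausdorff_N homeomorphic_maps_npath_top
      homeomorphic_space_def by blast
qed

lemma Ob_Flow [simp]: "X : Ob (Flow haus) \<longleftrightarrow> is_flow haus X" by (simp add: Flow_def)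

lemma Hom_Flow [simp]: "f : Hom (Flow haus) X Y \<longleftrightarrow> is_flow_map X Y f" by (simp add: Flow_def)

definition fcomp ::
  "('s, 'p) flow => ('t, 'q, 'u, 'r) fmap => ('s, 'p, 't, 'q) fmap => ('s, 'p, 'u, 'r) fmap" where
  "fcomp X g f = fmap_on X (fst g \<circ> fst f, %al be. snd g (fst f al) (fst f be) \<circ> snd f al be)"

lemma Cmp_Flow [simp]: "Cmp (Flow haus) X Y Z g f = fcomp X g f" by (simp add: Flow_def fcomp_def)

lemma Idn_Flow [simp]: "Idn (Flow haus) X = fmap_on X (id, %_ _. id)" by (simp add: Flow_def)

lemma fmap_on_fst [simp]: "al : states X ==> fst (fmap_on X f) al = fst f al" by (simp add: fmap_on_def)

lemma fmap_on_snd [simp]: "al : states X ==> be : states X ==> p : topspace (paths X al be) ==>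
    snd (fmap_on X f) al be p = snd f al be p" by (simp add: fmap_on_def)

lemma fmap_on_idem [simp]: "fmap_on X (fmap_on X f) = fmap_on X f"
  by (auto simp: fmap_on_def fun_eq_iff restrict_def)

lemma fmap_on_cong:
  assumes "!!al. al : states X ==> fst f al = fst g al"
    "!!al be p. al : states X ==> be : states X ==> p : topspace (paths X al be) ==> snd f al be p = snd g al be p"
  shows "fmap_on X f = fmap_on X g" using assms by (auto simp: fmap_on_def fun_eq_iff restrict_def)

context
  fixes X :: "('s, 'p) flow" and Y :: "('t, 'q) flow" and f assumes f: "is_flow_map X Y f"
begin

lemma flow_map_on: "fmap_on X f = f" using f by (simp add: is_flow_map_def)

lemma flow_map_state: "al : states X ==> fst f al : states Y" using f unfolding is_flow_map_def by blast

lemma flow_map_cont: "al : states X ==> be : states X ==>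
    cmap (paths X al be) (paths Y (fst f al) (fst f be)) (snd f al be)" using f unfolding is_flow_map_def by blast

lemma flow_map_path: "al : states X ==> be : states X ==> p : topspace (paths X al be) ==>
    snd f al be p : topspace (paths Y (fst f al) (fst f be))" by (rule continuous_map_funspace[OF flow_map_cont])

lemma flow_map_pcomp: "al : states X ==> be : states X ==> ga : states X ==>
    p : topspace (paths X al be) ==> q : topspace (paths X be ga) ==>
    snd f al ga (pcomp X al be ga p q) =
      pcomp Y (fst f al) (fst f be) (fst f ga) (snd f al be p) (snd f be ga q)"
  using f unfolding is_flow_map_def by blast

end

lemma flow_map_eqI:
  assumes "is_flow_map X Y f" "is_flow_map X Y' g"
    "!!al. al : states X ==> fst f al = fst g al"
    "!!al be p. al : states X ==> be : states X ==> p : topspace (paths X al be) ==> snd f al be p = snd g al be p"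
  shows "f = g" using fmap_on_cong[of X f g] assms flow_map_on[OF assms(1)] flow_map_on[OF assms(2)] by simp

context
  fixes X :: "('s, 'p) flow" and haus assumes X: "is_flow haus X"
begin

lemma flow_in_Top: "al : states X ==> be : states X ==> in_Top haus (paths X al be)"
  using X unfolding is_flow_def by blast

lemma flow_delta_generated: "al : states X ==> be : states X ==> delta_generated (paths X al be)"
  using flow_in_Top by (simp add: in_Top_def)

lemma flow_pcomp_cont: "al : states X ==> be : states X ==> ga : states X ==>
    cmap (delta_prod (paths X al be) (paths X be ga)) (paths X al ga) (%(p, q). pcomp X al be ga p q)"
  using X unfolding is_flow_def by blast

lemma flow_pcomp_path: "al : states X ==> be : states X ==> ga : states X ==>
    p : topspace (paths X al be) ==> q : topspace (paths X be ga) ==> pcomp X al be ga p q : topspace (paths X al ga)"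
  using continuous_map_funspace[OF flow_pcomp_cont, of al be ga "(p, q)"] by simp

lemma flow_pcomp_assoc: "al : states X ==> be : states X ==> ga : states X ==> de : states X ==>
    p : topspace (paths X al be) ==> q : topspace (paths X be ga) ==> r : topspace (paths X ga de) ==>
    pcomp X al ga de (pcomp X al be ga p q) r = pcomp X al be de p (pcomp X be ga de q r)"
  using X unfolding is_flow_def by blast

end

lemma is_flow_map_fmap_on:
  assumes X: "is_flow haus X"
    and "!!al. al : states X ==> fst f al : states Y"
    and cont: "!!al be. al : states X ==> be : states X ==>
      cmap (paths X al be) (paths Y (fst f al) (fst f be)) (snd f al be)"
    and "!!al be ga p q. al : states X ==> be : states X ==> ga : states X ==>
      p : topspace (paths X al be) ==> q : topspace (paths X be ga) ==>
      snd f al ga (pcomp X al be ga p q) =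
        pcomp Y (fst f al) (fst f be) (fst f ga) (snd f al be p) (snd f be ga q)"
  shows "is_flow_map X Y (fmap_on X f)" unfolding is_flow_map_def
proof (intro conjI ballI)
  show "fst (fmap_on X f) : states X \<rightarrow> states Y" using assms(2) by simp
  fix al be assume ab: "al : states X" "be : states X"
  show "cmap (paths X al be) (paths Y (fst (fmap_on X f) al) (fst (fmap_on X f) be)) (snd (fmap_on X f) al be)"
    using continuous_map_eq[OF cont[OF ab], of "snd (fmap_on X f) al be"] ab by simp
  fix ga p q assume "ga : states X" "p : topspace (paths X al be)" "q : topspace (paths X be ga)"
  thus "snd (fmap_on X f) al ga (pcomp X al be ga p q) =
      pcomp Y (fst (fmap_on X f) al) (fst (fmap_on X f) be) (fst (fmap_on X f) ga)
        (snd (fmap_on X f) al be p) (snd (fmap_on X f) be ga q)"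
    using ab assms(4)[of al be ga p q] flow_pcomp_path[OF X ab, of ga p q] by simp
qed simp

lemma fcomp_fst [simp]: "al : states X ==> fst (fcomp X g f) al = fst g (fst f al)" by (simp add: fcomp_def)

lemma fcomp_snd [simp]: "al : states X ==> be : states X ==> p : topspace (paths X al be) ==>
    snd (fcomp X g f) al be p = snd g (fst f al) (fst f be) (snd f al be p)" by (simp add: fcomp_def)

lemma is_flow_map_fcomp:
  assumes X: "is_flow haus X" and f: "is_flow_map X Y f" and g: "is_flow_map Y Z g"
  shows "is_flow_map X Z (fcomp X g f)" unfolding fcomp_def
proof (rule is_flow_map_fmap_on[OF X])
  fix al be assume ab: "al : states X" "be : states X"
  show "cmap (paths X al be)
     (paths Z (fst (fst g \<circ> fst f, %al be. snd g (fst f al) (fst f be) \<circ> snd f al be) al)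
       (fst (fst g \<circ> fst f, %al be. snd g (fst f al) (fst f be) \<circ> snd f al be) be))
     (snd (fst g \<circ> fst f, %al be. snd g (fst f al) (fst f be) \<circ> snd f al be) al be)"
    using continuous_map_compose[OF flow_map_cont[OF f ab]
        flow_map_cont[OF g flow_map_state[OF f ab(1)] flow_map_state[OF f ab(2)]]] by simp
qed (simp_all add: flow_map_state[OF f] flow_map_state[OF g] flow_map_pcomp[OF f] flow_map_pcomp[OF g] flow_map_path[OF f])

lemma fcomp_assoc:
  assumes f: "is_flow_map X Y f"
  shows "fcomp X h (fcomp X g f) = fcomp X (fcomp Y h g) f"
  unfolding fcomp_def[of X h] fcomp_def[of X "fcomp Y h g"]
  by (rule fmap_on_cong) (simp_all add: flow_map_state[OF f] flow_map_path[OF f])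

lemma is_flow_map_id: "is_flow haus X ==> is_flow_map X X (fmap_on X (id, %_ _. id))"
  by (rule is_flow_map_fmap_on) simp_all

lemma fcomp_id_left: assumes f: "is_flow_map X Y f" shows "fcomp X (fmap_on Y (id, %_ _. id)) f = f"
proof -
  have "fcomp X (fmap_on Y (id, %_ _. id)) f = fmap_on X f"
    unfolding fcomp_def by (rule fmap_on_cong) (simp_all add: flow_map_state[OF f] flow_map_path[OF f])
  thus ?thesis by (simp add: flow_map_on[OF f])
qed

lemma fcomp_id_right: assumes f: "is_flow_map X Y f" shows "fcomp X f (fmap_on X (id, %_ _. id)) = f"
proof -
  have "fcomp X f (fmap_on X (id, %_ _. id)) = fmap_on X f" unfolding fcomp_def by (rule fmap_on_cong) simp_all
  thus ?thesis by (simp add: flow_map_on[OF f])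
qed

section \<open>The flows of natural d-paths of the cubes\<close>

lemma states_nat_cube [simp]: "states (nat_cube n) = Vertex ` vert n" by (simp add: nat_cube_def)

lemma paths_nat_cube:
  "paths (nat_cube n) (Vertex al) (Vertex be) =
     (if al : vert n & be : vert n & vless al be then npath_top (N (rise al be))
      else discrete_topology {})" by (auto simp: nat_cube_def npath_top_def Let_def)

lemma topspace_paths_nat_cube:
  "topspace (paths (nat_cube n) (Vertex al) (Vertex be)) =
     (if al : vert n & be : vert n & vless al be then NPath ` natural_dpaths (rise al be) else {})"
  by (simp add: paths_nat_cube)

lemma pcomp_nat_cube:
  "pcomp (nat_cube n) (Vertex al) (Vertex be) (Vertex ga) p q = NPath (N_comp al be ga (unNPath p) (unNPath q))"
  by (simp add: nat_cube_def)

lemma continuous_map_from_empty: "topspace X = {} ==> cmap X Y f" by (simp add: continuous_map_def)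

lemma is_flow_nat_cube: "is_flow haus (nat_cube n :: 'a uflow)" unfolding is_flow_def
proof (intro conjI ballI)
  let ?C = "nat_cube n :: 'a uflow"
  fix a b :: "'a univ" assume "a : states ?C" "b : states ?C"
  then obtain al be where ab: "a = Vertex al" "b = Vertex be" "al : vert n" "be : vert n" by auto
  show "in_Top haus (paths ?C a b)" unfolding ab paths_nat_cube by (simp add: in_Top_npath_N in_Top_discrete)
  fix c :: "'a univ" assume "c : states ?C"
  then obtain ga where c: "c = Vertex ga" "ga : vert n" by auto
  let ?P = "delta_prod (paths ?C a b) (paths ?C b c)"
  show "cmap ?P (paths ?C a c) (%(p, q). pcomp ?C a b c p q)"
  proof (cases "vless al be & vless be ga")
    case True
    hence v: "vless al be" "vless be ga" "vless al ga" using vless_trans by blast+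
    have P: "?P = delta_prod (npath_top (N (rise al be))) (npath_top (N (rise be ga)))"
      using ab c v by (simp add: paths_nat_cube)
    have "cmap ?P (N (rise al ga))
        (%x. N_comp al be ga ((unNPath \<circ> fst) x) ((unNPath \<circ> snd) x))" unfolding P
      by (intro continuous_map_N_comp[OF v(1,2)]
        continuous_map_compose[OF continuous_map_delta_prod_fst continuous_map_unNPath]
        continuous_map_compose[OF continuous_map_delta_prod_snd continuous_map_unNPath])
    from continuous_map_compose[OF this continuous_map_NPath[where 'a = 'a]]
    show ?thesis using v ab c by (simp add: paths_nat_cube pcomp_nat_cube o_def case_prod_beta')
  next
    case False
    thus ?thesis using ab c by (intro continuous_map_from_empty) (auto simp: topspace_paths_nat_cube)
  qed
  fix d p q r :: "'a univ" assume "d : states ?C" and pqr: "p : topspace (paths ?C a b)"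
    "q : topspace (paths ?C b c)" "r : topspace (paths ?C c d)"
  then obtain de where d: "d = Vertex de" "de : vert n" by auto
  have "vless al be" "vless be ga" "vless ga de"
    using pqr unfolding ab c d by (auto simp: topspace_paths_nat_cube split: if_splits)
  thus "pcomp ?C a c d (pcomp ?C a b c p q) r =
      pcomp ?C a b d p (pcomp ?C b c d q r)" unfolding ab c d by (simp add: pcomp_nat_cube N_comp_assoc)
qed

lemma nat_cube_map_fst: "al : vert m ==> fst (nat_cube_map m n \<phi>) (Vertex al) = Vertex (\<phi> al)"
  by (simp add: nat_cube_map_def)

lemma nat_cube_map_snd:
  "al : vert m ==> be : vert m ==> p : topspace (paths (nat_cube m) (Vertex al) (Vertex be)) ==>
    snd (nat_cube_map m n \<phi>) (Vertex al) (Vertex be) p = p" by (simp add: nat_cube_map_def)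

lemma paths_nat_cube_face:
  assumes "box_map m n \<phi>" "al : vert m" "be : vert m"
  shows "paths (nat_cube n) (Vertex (\<phi> al)) (Vertex (\<phi> be)) = paths (nat_cube m) (Vertex al) (Vertex be)"
proof -
  obtain g where g: "coords_at m n \<phi> g" using box_map_coords[OF assms(1)] by blast
  show ?thesis
    using vless_coords_at[OF g assms(2,3)] card_diff_coords_coords_at[OF g assms(2,3)] coords_at_vert[OF g] assms
    by (simp add: paths_nat_cube)
qed

lemma is_flow_map_nat_cube_map:
  assumes f: "box_map m n \<phi>"
  shows "is_flow_map (nat_cube m :: 'a uflow) (nat_cube n :: 'a uflow) (nat_cube_map m n \<phi> :: 'a uflow_map)"
  unfolding nat_cube_map_def
proof (rule is_flow_map_fmap_on[OF is_flow_nat_cube])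
  fix a :: "'a univ" assume "a : states (nat_cube m :: 'a uflow)"
  thus "fst (%a. Vertex (\<phi> (unVertex a)), %_ _ p. p) a : states (nat_cube n :: 'a uflow)"
    using box_map_vert[OF f] by auto
next
  fix a b :: "'a univ" assume "a : states (nat_cube m :: 'a uflow)" "b : states (nat_cube m :: 'a uflow)"
  thus "cmap (paths (nat_cube m :: 'a uflow) a b)
     (paths (nat_cube n :: 'a uflow) (fst (%a. Vertex (\<phi> (unVertex a)), %_ _ p. p) a)
       (fst (%a. Vertex (\<phi> (unVertex a)), %_ _ p. p) b))
     (snd (%a. Vertex (\<phi> (unVertex a)), %_ _ p. p) a b)" by (auto simp: paths_nat_cube_face[OF f])
next
  obtain g where g: "coords_at m n \<phi> g" using box_map_coords[OF f] by blast
  fix a b c p q :: "'a univ" assume "a : states (nat_cube m :: 'a uflow)" "b : states (nat_cube m :: 'a uflow)" "c : states (nat_cube m :: 'a uflow)"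
  thus "snd (%a. Vertex (\<phi> (unVertex a)), %_ _ p. p) a c (pcomp (nat_cube m :: 'a uflow) a b c p q) =
       pcomp (nat_cube n :: 'a uflow) (fst (%a. Vertex (\<phi> (unVertex a)), %_ _ p. p) a)
        (fst (%a. Vertex (\<phi> (unVertex a)), %_ _ p. p) b) (fst (%a. Vertex (\<phi> (unVertex a)), %_ _ p. p) c)
        (snd (%a. Vertex (\<phi> (unVertex a)), %_ _ p. p) a b p)
        (snd (%a. Vertex (\<phi> (unVertex a)), %_ _ p. p) b c q)"
    using N_comp_coords_at[OF g] by (auto simp: pcomp_nat_cube)
qed

lemma nat_cube_map_comp:
  assumes f: "box_map l m \<phi>" and h: "box_map m n \<psi>"
  shows "(nat_cube_map l n (compose (vert l) \<psi> \<phi>) :: 'a uflow_map) = fcomp (nat_cube l) (nat_cube_map m n \<psi>) (nat_cube_map l m \<phi>)"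
proof (rule flow_map_eqI)
  note F = is_flow_map_nat_cube_map[OF f]
  show "is_flow_map (nat_cube l :: 'a uflow) (nat_cube n) (nat_cube_map l n (compose (vert l) \<psi> \<phi>))"
    by (rule is_flow_map_nat_cube_map[OF box_map.comp[OF f h]])
  show "is_flow_map (nat_cube l :: 'a uflow) (nat_cube n) (fcomp (nat_cube l) (nat_cube_map m n \<psi>) (nat_cube_map l m \<phi>))"
    by (rule is_flow_map_fcomp[OF is_flow_nat_cube F is_flow_map_nat_cube_map[OF h]])
  fix a :: "'a univ" assume a: "a : states (nat_cube l :: 'a uflow)"
  then obtain al where al: "a = Vertex al" "al : vert l" by auto
  show "fst (nat_cube_map l n (compose (vert l) \<psi> \<phi>)) a =
      fst (fcomp (nat_cube l) (nat_cube_map m n \<psi>) (nat_cube_map l m \<phi>)) a"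
    using al box_map_vert[OF f] by (simp add: nat_cube_map_fst compose_def)
  fix b p :: "'a univ" assume b: "b : states (nat_cube l :: 'a uflow)" and p: "p : topspace (paths (nat_cube l :: 'a uflow) a b)"
  then obtain be where be: "b = Vertex be" "be : vert l" by auto
  have "p : topspace (paths (nat_cube m :: 'a uflow) (Vertex (\<phi> al)) (Vertex (\<phi> be)))"
    unfolding paths_nat_cube_face[OF f al(2) be(2)] using p al be by simp
  thus "snd (nat_cube_map l n (compose (vert l) \<psi> \<phi>)) a b p =
      snd (fcomp (nat_cube l) (nat_cube_map m n \<psi>) (nat_cube_map l m \<phi>)) a b p"
    using a b p al be box_map_vert[OF f] by (simp add: nat_cube_map_snd nat_cube_map_fst)
qed

lemma nat_cube_map_id: "nat_cube_map n n (\<lambda>xs\<in>vert n. xs) = fmap_on (nat_cube n) (id, %_ _. id)"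
  unfolding nat_cube_map_def by (rule fmap_on_cong) auto

section \<open>Lifting against Hurewicz fibrations\<close>

lemma pullback_homeomorphic_maps:
  assumes "inj_on j (topspace Z)"
  shows "homeomorphic_maps Z (pullback_topology (j ` topspace Z) (inv_into (topspace Z) j) Z)
     j (inv_into (topspace Z) j)"
proof -
  let ?k = "inv_into (topspace Z) j"
  let ?Z' = "pullback_topology (j ` topspace Z) ?k Z"
  have "cmap ?Z' Z (id \<circ> ?k)" by (rule continuous_map_pullback) simp
  moreover have "cmap Z ?Z' j"
  proof (rule continuous_map_pullback')
    show "cmap Z Z (?k \<circ> j)" by (rule continuous_map_eq[OF continuous_map_id]) (simp add: assms)
  qed auto
  ultimately show ?thesis by (auto simp: homeomorphic_maps_def topspace_pullback_topology assms f_inv_into_f)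
qed

text \<open>The test spaces of the homotopy lifting property live on one fixed type; a space of another type
  can be used when its points inject into that type.\<close>

lemma hurewicz_lift:
  fixes E :: "'e topology" and B :: "'b topology" and Z :: "'z topology"
    and j :: "'z => 'e \<times> (real => 'b)"
  assumes p: "Hurewicz_fibration haus E B p" and dZ: "delta_generated Z" and hZ: "Hausdorff_space Z"
    and inj: "inj j" and g: "cmap Z E g"
    and H: "cmap (prod_topology Z unit_ivl) B H"
    and H0: "!!z. z : topspace Z ==> H (z, 0) = p (g z)"
  obtains G where "cmap (delta_prod Z unit_ivl) E G"
    "!!z. z : topspace Z ==> G (z, 0) = g z"
    "!!z t. z : topspace Z ==> 0 <= t ==> t <= 1 ==> p (G (z, t)) = H (z, t)"
proof -
  let ?k = "inv_into (topspace Z) j"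
  let ?Z' = "pullback_topology (j ` topspace Z) ?k Z"
  have injZ: "inj_on j (topspace Z)" using inj by (rule inj_on_subset) simp
  note homeo = pullback_homeomorphic_maps[OF injZ]
  have j: "cmap Z ?Z' j" and k: "cmap ?Z' Z ?k"
    and kj: "!!z. z : topspace Z ==> ?k (j z) = z" using homeo by (auto simp: homeomorphic_maps_def)
  have "in_Top haus ?Z'"
  proof (rule in_TopI)
    show "delta_generated ?Z'" by (rule delta_generated_homeomorphic_maps[OF homeo dZ])
    show "Hausdorff_space ?Z'" using homeomorphic_Hausdorff_space[of Z ?Z'] hZ homeo homeomorphic_space_def by blast
  qed
  moreover have "cmap ?Z' E (g \<circ> ?k)" by (rule continuous_map_compose[OF k g])
  moreover have "cmap (delta_prod ?Z' unit_ivl) B (H \<circ> (%x. (?k (fst x), snd x)))" unfolding delta_prod_def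
  proof (intro continuous_map_from_delta_ify continuous_map_compose[OF _ H])
    show "cmap (prod_topology ?Z' unit_ivl) (prod_topology Z unit_ivl) (%x. (?k (fst x), snd x))"
      using continuous_map_compose[OF continuous_map_fst k] continuous_map_snd[of ?Z' unit_ivl]
      by (simp add: continuous_map_pairwise o_def)
  qed
  moreover have "\<forall>z\<in>topspace ?Z'. (H \<circ> (%x. (?k (fst x), snd x))) (z, 0) = p ((g \<circ> ?k) z)"
    using H0 continuous_map_funspace[OF k] by simp
  ultimately have "in_Top haus ?Z' & cmap ?Z' E (g \<circ> ?k) \<and>
      cmap (delta_prod ?Z' unit_ivl) B (H \<circ> (%x. (?k (fst x), snd x))) \<and>
      (\<forall>z\<in>topspace ?Z'. (H \<circ> (%x. (?k (fst x), snd x))) (z, 0) = p ((g \<circ> ?k) z))" by (intro conjI)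
  from p[unfolded Hurewicz_fibration_def, THEN conjunct2, THEN spec, THEN spec, THEN spec, THEN mp, OF this]
  obtain G where G: "cmap (delta_prod ?Z' unit_ivl) E G"
    and G0: "\<forall>z\<in>topspace ?Z'. G (z, 0) = (g \<circ> ?k) z"
    and pG: "\<forall>z\<in>topspace ?Z'. \<forall>t\<in>{0..1}. p (G (z, t)) = (H \<circ> (%x. (?k (fst x), snd x))) (z, t)"
    by (elim exE conjE)
  have "cmap (delta_prod Z unit_ivl) (delta_prod ?Z' unit_ivl) (%x. ((j \<circ> fst) x, snd x))"
    by (intro continuous_map_into_delta_prod delta_generated_delta_prod
      continuous_map_compose[OF continuous_map_delta_prod_fst j] continuous_map_delta_prod_snd)
  from continuous_map_compose[OF this G] have "cmap (delta_prod Z unit_ivl) E (%x. G (j (fst x), snd x))"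
    by (simp add: o_def)
  thus ?thesis using that[of "%x. G (j (fst x), snd x)"] G0 pG kj continuous_map_funspace[OF j] by simp
qed

text \<open>The homotopy pushes the points where \<open>d <= 1\<close> into \<open>A\<close> within time \<open>d\<close>, so that it does
  not move \<open>A\<close> in time \<open>d = 0\<close>. It need not fix \<open>A\<close> at later times.\<close>

definition ndr :: "'z topology => 'z set => ('z \<times> real => 'z) => ('z => real) => bool" where
  "ndr Z A H d \<longleftrightarrow> A \<subseteq> topspace Z & cmap (prod_topology Z unit_ivl) Z H \<and>
     cmap Z euclideanreal d \<and>
     (\<forall>z\<in>topspace Z. H (z, 0) = z & 0 <= d z & (d z <= 1 --> H (z, d z) : A)) & (\<forall>z\<in>A. d z = 0)"

lemma continuous_map_pair_unit:
  assumes "cmap X Z f" "cmap X euclideanreal r" "!!x. x : topspace X ==> 0 <= r x & r x <= 1"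
  shows "cmap X (prod_topology Z unit_ivl) (%x. (f x, r x))"
  using assms by (simp add: continuous_map_pairwise o_def continuous_map_unit_ivl)

text \<open>A homotopy \<open>K\<close> is lifted with prescribed lift \<open>y\<close> at time 0 and \<open>g\<close> over \<open>A\<close>. Running the
  deformation backwards connects each point to a point where the lift is prescribed, in a time
  that vanishes on \<open>A\<close>; the homotopy lifting property is applied to these connecting paths.\<close>

lemma relative_lift:
  fixes E :: "'e topology" and B :: "'b topology" and Z :: "'z topology"
    and j :: "'z => 'e \<times> (real => 'b)"
  assumes p: "Hurewicz_fibration haus E B p" and dZ: "delta_generated Z" and hZ: "Hausdorff_space Z"
    and inj: "inj j" and ndr: "ndr Z A H d"
    and K: "cmap (prod_topology Z unit_ivl) B K"
    and y: "cmap Z E y" and y0: "!!z. z : topspace Z ==> p (y z) = K (z, 0)"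
    and g: "cmap (prod_topology (subtopology Z A) unit_ivl) E g"
    and g0: "!!a. a : A ==> g (a, 0) = y a"
    and pg: "!!a t. a : A ==> 0 <= t ==> t <= 1 ==> p (g (a, t)) = K (a, t)"
  obtains y1 where "cmap Z E y1" "!!z. z : topspace Z ==> p (y1 z) = K (z, 1)"
    "!!a. a : A ==> y1 a = g (a, 1)"
proof -
  have A: "A \<subseteq> topspace Z" and H: "cmap (prod_topology Z unit_ivl) Z H"
    and d: "cmap Z euclideanreal d"
    and H0: "!!z. z : topspace Z ==> H (z, 0) = z" and d0: "!!z. z : topspace Z ==> 0 <= d z"
    and HA: "!!z. z : topspace Z ==> d z <= 1 ==> H (z, d z) : A" and dA: "!!z. z : A ==> d z = 0"
    using ndr by (auto simp: ndr_def)
  \<comment> \<open>Start where the deformation reaches \<open>A\<close>, or where it ends if it does not get there.\<close>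
  define y' where "y' z = (if d z <= 1 then g (H (z, d z), 1 - d z) else y (H (z, 1)))" for z
  have y': "cmap Z E y'" unfolding y'_def
  proof (rule continuous_map_cases_le)
    let ?S = "subtopology Z {x : topspace Z. d x <= 1}"
    have idS: "cmap ?S Z (%x. x)" by (simp add: continuous_map_from_subtopology)
    have dS: "cmap ?S euclideanreal d" by (rule continuous_map_from_subtopology[OF d])
    have "cmap ?S (prod_topology Z unit_ivl) (%x. (x, d x))"
      by (rule continuous_map_pair_unit[OF idS dS]) (simp add: d0)
    from continuous_map_compose[OF this H] have "cmap ?S Z (%x. H (x, d x))" by (simp add: o_def)
    hence "cmap ?S (subtopology Z A) (%x. H (x, d x))"
      using HA by (simp add: continuous_map_in_subtopology image_subset_iff)
    moreover have "cmap ?S euclideanreal (%x. 1 - d x)" using dS by (intro continuous_intros)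
    ultimately have "cmap ?S (prod_topology (subtopology Z A) unit_ivl) (%x. (H (x, d x), 1 - d x))"
      by (rule continuous_map_pair_unit) (simp add: d0)
    from continuous_map_compose[OF this g] show "cmap ?S E (%x. g (H (x, d x), 1 - d x))" by (simp add: o_def)
    have "cmap Z (prod_topology Z unit_ivl) (%x. (x, 1))" by (rule continuous_map_pair_unit) simp_all
    from continuous_map_compose[OF continuous_map_compose[OF this H] y]
    have "cmap Z E (%x. y (H (x, 1)))" by (simp add: o_def)
    thus "cmap (subtopology Z {x : topspace Z. 1 <= d x}) E (%x. y (H (x, 1)))"
      by (rule continuous_map_from_subtopology)
    fix x assume x: "x : topspace Z" "d x = 1"
    thus "g (H (x, d x), 1 - d x) = y (H (x, 1))" using HA[of x] g0[of "H (x, 1)"] by simp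
  qed (use d in simp_all)
  define m where "m z = min (d z) 1" for z
  have m: "cmap Z euclideanreal m" unfolding m_def using d by (intro continuous_intros) simp_all
  have m01: "0 <= m z & m z <= 1" if "z : topspace Z" for z using d0[OF that] by (simp add: m_def)
  define r where "r x = max (m (fst x) - snd x) 0" for x
  let ?P = "prod_topology Z unit_ivl"
  have snd': "cmap ?P euclideanreal snd" by (rule continuous_map_into_fulltopology[OF continuous_map_snd])
  have r: "cmap ?P euclideanreal r" unfolding r_def using continuous_map_compose[OF continuous_map_fst m] snd'
    by (intro continuous_intros) (simp_all add: o_def)
  have r01: "0 <= r x & r x <= 1" if "x : topspace ?P" for x using m01[of "fst x"] that by (auto simp: r_def)
  \<comment> \<open>Follow the deformation back to \<open>z\<close> while the time of \<open>K\<close> runs up to 1; on \<open>A\<close> the whole way is constant.\<close>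
  define L where "L x = K (H (fst x, r x), 1 - r x)" for x
  have "cmap ?P ?P (%x. (fst x, r x))" by (rule continuous_map_pair_unit[OF continuous_map_fst r r01])
  from continuous_map_compose[OF this H] have "cmap ?P Z (%x. H (fst x, r x))" by (simp add: o_def)
  moreover have "cmap ?P euclideanreal (%x. 1 - r x)" using r by (intro continuous_intros)
  ultimately have "cmap ?P ?P (%x. (H (fst x, r x), 1 - r x))" by (rule continuous_map_pair_unit) (use r01 in simp)
  from continuous_map_compose[OF this K] have L: "cmap ?P B L" unfolding L_def by (simp add: o_def)
  have L0: "L (z, 0) = p (y' z)" if z: "z : topspace Z" for z
  proof (cases "d z <= 1")
    case True
    thus ?thesis using pg[OF HA[OF z True], of "1 - d z"] d0[OF z] by (simp add: L_def r_def m_def y'_def)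
  next
    case False
    have "H (z, 1) : topspace Z" using continuous_map_funspace[OF H, of "(z, 1)"] z by simp
    thus ?thesis using False y0 by (simp add: L_def r_def m_def y'_def)
  qed
  obtain G where G: "cmap (delta_prod Z unit_ivl) E G"
    and G0: "!!z. z : topspace Z ==> G (z, 0) = y' z"
    and pG: "!!z t. z : topspace Z ==> 0 <= t ==> t <= 1 ==> p (G (z, t)) = L (z, t)"
    using hurewicz_lift[OF p dZ hZ inj y' L L0] by blast
  have "cmap Z unit_ivl m" using m m01 by (simp add: continuous_map_unit_ivl)
  hence "cmap Z (delta_prod Z unit_ivl) (%z. (z, m z))" by (intro continuous_map_into_delta_prod dZ) simp_all
  from continuous_map_compose[OF this G] have "cmap Z E (%z. G (z, m z))" by (simp add: o_def)
  moreover have "p (G (z, m z)) = K (z, 1)" if "z : topspace Z" for z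
    using pG[OF that, of "m z"] m01[OF that] H0[OF that] by (simp add: L_def r_def)
  moreover have "G (a, m a) = g (a, 1)" if a: "a : A" for a
    using G0[of a] dA[OF a] H0[of a] a A by (auto simp: m_def y'_def)
  ultimately show ?thesis by (rule that)
qed

definition lift_problem ::
  "'z topology => 'z set => 'e topology => 'b topology => ('e => 'b) => ('z => 'e) => ('z => 'b) => bool" where
  "lift_problem Z A E B p u v \<longleftrightarrow>
     cmap (subtopology Z A) E u & cmap Z B v & (\<forall>a\<in>A. p (u a) = v a)"

definition solvable ::
  "'z topology => 'z set => 'e topology => ('e => 'b) => ('z => 'e) => ('z => 'b) => bool" where
  "solvable Z A E p u v \<longleftrightarrow>
     (\<exists>h. cmap Z E h & (\<forall>a\<in>A. h a = u a) & (\<forall>z\<in>topspace Z. p (h z) = v z))"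

definition rel_lifts :: "'z topology => 'z set => 'e topology => 'b topology => ('e => 'b) => bool" where
  "rel_lifts Z A E B p \<longleftrightarrow> (\<forall>u v. lift_problem Z A E B p u v --> solvable Z A E p u v)"

text \<open>A homotopy of pairs turns a solution at its end into an initial value for relative lifting, along
  the reversed homotopy.\<close>

lemma solvable_homotopy:
  fixes E :: "'e topology" and B :: "'b topology" and Z :: "'z topology"
    and j :: "'z => 'e \<times> (real => 'b)"
  assumes p: "Hurewicz_fibration haus E B p" and dZ: "delta_generated Z" and hZ: "Hausdorff_space Z"
    and inj: "inj j" and ndr: "ndr Z A H d"
    and uv: "lift_problem Z A E B p u v"
    and G: "cmap (prod_topology Z unit_ivl) Z G"
    and GA: "!!a t. a : A ==> 0 <= t ==> t <= 1 ==> G (a, t) : A"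
    and sol: "solvable Z A E p (%a. u (G (a, 1))) (%z. v (G (z, 1)))"
  shows "solvable Z A E p (%a. u (G (a, 0))) (%z. v (G (z, 0)))"
proof -
  obtain h where h: "cmap Z E h" "!!a. a : A ==> h a = u (G (a, 1))"
    "!!z. z : topspace Z ==> p (h z) = v (G (z, 1))" using sol by (auto simp: solvable_def)
  have A: "A \<subseteq> topspace Z" using ndr by (simp add: ndr_def)
  have u: "cmap (subtopology Z A) E u" and v: "cmap Z B v"
    and puv: "!!a. a : A ==> p (u a) = v a" using uv by (auto simp: lift_problem_def)
  let ?P = "prod_topology Z unit_ivl" and ?Q = "prod_topology (subtopology Z A) unit_ivl"
  have rev: "cmap (prod_topology W unit_ivl) (prod_topology W unit_ivl) (%x. (fst x, 1 - snd x))"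
    for W :: "'z topology"
  proof (rule continuous_map_pair_unit[OF continuous_map_fst])
    show "cmap (prod_topology W unit_ivl) euclideanreal (%x. 1 - snd x)"
      by (intro continuous_intros continuous_map_into_fulltopology[OF continuous_map_snd]) simp
  qed auto
  have K: "cmap ?P B (%x. v (G (fst x, 1 - snd x)))"
    using continuous_map_compose[OF continuous_map_compose[OF rev G] v] by (simp add: o_def)
  have QP: "cmap ?Q ?P (%x. x)"
    using continuous_map_into_fulltopology[OF continuous_map_fst[of "subtopology Z A" unit_ivl]]
      continuous_map_snd[of "subtopology Z A" unit_ivl] by (simp add: continuous_map_pairwise o_def)
  have "cmap ?Q Z (%x. G (fst x, 1 - snd x))"
    using continuous_map_compose[OF continuous_map_compose[OF rev QP] G] by (simp add: o_def)
  hence "cmap ?Q (subtopology Z A) (%x. G (fst x, 1 - snd x))"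
    using GA by (auto simp: continuous_map_in_subtopology image_subset_iff)
  from continuous_map_compose[OF this u]
  have g: "cmap ?Q E (%x. u (G (fst x, 1 - snd x)))" by (simp add: o_def)
  obtain y1 where y1: "cmap Z E y1"
    "!!z. z : topspace Z ==> p (y1 z) = (%x. v (G (fst x, 1 - snd x))) (z, 1)"
    "!!a. a : A ==> y1 a = (%x. u (G (fst x, 1 - snd x))) (a, 1)"
  proof (rule relative_lift[OF p dZ hZ inj ndr K h(1) _ g])
    show "p (h z) = v (G (fst (z, 0::real), 1 - snd (z, 0)))" if "z : topspace Z" for z using h(3)[OF that] by simp
    show "u (G (fst (a, 0::real), 1 - snd (a, 0))) = h a" if "a : A" for a using h(2)[OF that] by simp
    show "p (u (G (fst (a, t), 1 - snd (a, t)))) = v (G (fst (a, t), 1 - snd (a, t)))"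
      if "a : A" "0 <= t" "t <= 1" for a t using puv[OF GA[of a "1 - t"]] that by simp
  qed blast
  thus ?thesis by (auto simp: solvable_def intro!: exI[of _ y1])
qed

section \<open>Trivial fibrations lift against the inclusions of the boundaries of cubes\<close>

lemma continuous_map_Min:
  assumes "finite I" "!!i. i : I ==> cmap X euclideanreal (f i)"
  shows "cmap X euclideanreal (%x. Min (insert c ((%i. f i x) ` I)))" using assms
proof (induction I rule: finite_induct)
  case (insert j I)
  have "Min (insert c ((%i. f i x) ` insert j I)) = min (f j x) (Min (insert c ((%i. f i x) ` I)))" for x
    using insert.hyps Min_insert[of "insert c ((%i. f i x) ` I)" "f j x"] by (simp add: insert_commute)
  thus ?case using insert by (simp only:) (intro continuous_intros, auto)
qed simp

lemma continuous_map_Max: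
  assumes "finite I" "!!i. i : I ==> cmap X euclideanreal (f i)"
  shows "cmap X euclideanreal (%x. Max (insert c ((%i. f i x) ` I)))" using assms
proof (induction I rule: finite_induct)
  case (insert j I)
  have "Max (insert c ((%i. f i x) ` insert j I)) = max (f j x) (Max (insert c ((%i. f i x) ` I)))" for x
    using insert.hyps Max_insert[of "insert c ((%i. f i x) ` I)" "f j x"] by (simp add: insert_commute)
  thus ?case using insert by (simp only:) (intro continuous_intros, auto)
qed simp

text \<open>Moves the points of $[0,1]$ within distance \<open>e\<close> of an end to that end.\<close>

definition squeeze :: "real => real => real" where
  "squeeze e x = max 0 (min 1 ((x - e) / (1 - 2 * e)))"

lemma squeeze_bounds: "0 <= squeeze e x & squeeze e x <= 1" by (simp add: squeeze_def)

lemma squeeze_0 [simp]: "0 <= x ==> x <= 1 ==> squeeze 0 x = x" by (simp add: squeeze_def)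

lemma squeeze_low: "e <= 1/4 ==> x <= e ==> squeeze e x = 0"
  using divide_nonpos_pos[of "x - e" "1 - 2 * e"] by (simp add: squeeze_def)

lemma squeeze_high: "e <= 1/4 ==> 1 - e <= x ==> squeeze e x = 1"
  by (simp add: squeeze_def max_def min_def divide_le_eq le_divide_eq)

lemma squeeze_mono: "e <= 1/4 ==> x <= y ==> squeeze e x <= squeeze e y"
  unfolding squeeze_def by (intro max.mono min.mono divide_right_mono) auto

lemma continuous_map_squeeze:
  assumes "cmap X euclideanreal e" "cmap X euclideanreal f"
    "!!x. x : topspace X ==> e x <= 1/4"
  shows "cmap X euclideanreal (%x. squeeze (e x) (f x))" unfolding squeeze_def using assms(3)
  by (intro continuous_intros assms(1,2) continuous_map_real_divide) fastforce+

lemma cube_bdry_sub: "cube_bdry n \<subseteq> topspace (cube_top n)" by (auto simp: cube_bdry_def)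

lemma cube_coord: "x : topspace (cube_top n) ==> i < n ==> 0 <= x i & x i <= 1"
  by (auto simp: topspace_cube_top PiE_iff)

lemma restrict_cube: "(!!i. i < n ==> 0 <= f i & f i <= 1) ==> (\<lambda>i\<in>{..<n}. f i) : topspace (cube_top n)"
  by (auto simp: topspace_cube_top)

lemma continuous_map_restrict_cube:
  assumes "!!i. i < n ==> cmap X euclideanreal (%x. f x i)"
    "!!x i. x : topspace X ==> i < n ==> 0 <= f x i & f x i <= 1"
  shows "cmap X (cube_top n) (%x. \<lambda>i\<in>{..<n}. f x i)"
  unfolding continuous_map_cube_top using assms by (auto intro!: restrict_cube)

lemma continuous_map_cube_coord:
  "cmap X (cube_top n) f ==> i < n ==> cmap X euclideanreal (%x. f x i)" by (simp add: continuous_map_cube_top)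

lemma continuous_map_prod_coord:
  "i < n ==> cmap (prod_topology (cube_top n) T) euclideanreal (%x. fst x i)"
  by (rule continuous_map_cube_coord[OF continuous_map_fst])

lemma continuous_map_prod_time:
  "cmap (prod_topology T unit_ivl) euclideanreal snd"
  by (rule continuous_map_into_fulltopology[OF continuous_map_snd])

lemma ndr_cube:
  "ndr (cube_top n) (cube_bdry n) (%(x, r). \<lambda>i\<in>{..<n}. squeeze (r / 4) (x i))
     (%x. 4 * Min (insert 1 ((%i. min (x i) (1 - x i)) ` {..<n})))" unfolding ndr_def
proof (intro conjI ballI impI)
  let ?P = "prod_topology (cube_top n) unit_ivl"
  let ?d = "%x. 4 * Min (insert 1 ((%i. min (x i) (1 - x i)) ` {..<n}))"
  have "cmap ?P (cube_top n) (%x. \<lambda>i\<in>{..<n}. squeeze (snd x / 4) (fst x i))"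
  proof (rule continuous_map_restrict_cube)
    fix i assume i: "i < n"
    show "cmap ?P euclideanreal (%x. squeeze (snd x / 4) (fst x i))"
      by (intro continuous_map_squeeze continuous_map_prod_coord[OF i] continuous_map_real_divide
        continuous_map_prod_time) auto
  qed (simp add: squeeze_bounds)
  thus "cmap ?P (cube_top n) (%(x, r). \<lambda>i\<in>{..<n}. squeeze (r / 4) (x i))" by (simp add: case_prod_beta')
  show "cmap (cube_top n) euclideanreal ?d"
    by (intro continuous_intros continuous_map_Min continuous_map_cube_proj) auto
  show "cube_bdry n \<subseteq> topspace (cube_top n)" by (rule cube_bdry_sub)
  fix x assume x: "x : topspace (cube_top n)"
  show "(%(x, r). \<lambda>i\<in>{..<n}. squeeze (r / 4) (x i)) (x, 0) = x"
    using x by (auto simp: topspace_cube_top PiE_iff extensional_def fun_eq_iff)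
  show "0 <= ?d x" using cube_coord[OF x] by simp
  assume d: "?d x <= 1"
  let ?M = "Min (insert 1 ((%i. min (x i) (1 - x i)) ` {..<n}))"
  have "?M : insert 1 ((%i. min (x i) (1 - x i)) ` {..<n})" by (rule Min_in) auto
  then obtain i where i: "i < n" "?M = min (x i) (1 - x i)" using d by auto
  hence "x i <= ?M | 1 - ?M <= x i" by linarith
  hence "squeeze ?M (x i) = 0 | squeeze ?M (x i) = 1"
    using squeeze_low[of ?M "x i"] squeeze_high[of ?M "x i"] d by linarith
  thus "(%(x, r). \<lambda>i\<in>{..<n}. squeeze (r / 4) (x i)) (x, ?d x) : cube_bdry n"
    using i squeeze_bounds by (auto simp: cube_bdry_def intro!: restrict_cube exI[of _ i])
next
  fix x assume x: "x : cube_bdry n"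
  then obtain i where i: "i < n" "x i = 0 | x i = 1" by (auto simp: cube_bdry_def)
  have "Min (insert 1 ((%i. min (x i) (1 - x i)) ` {..<n})) <= min (x i) (1 - x i)" using i by (intro Min_le) auto
  moreover have "min (x i) (1 - x i) = 0" using i by auto
  moreover have "0 <= Min (insert 1 ((%i. min (x i) (1 - x i)) ` {..<n}))"
    using cube_coord[of x n] x cube_bdry_sub by auto
  ultimately show "4 * Min (insert 1 ((%i. min (x i) (1 - x i)) ` {..<n})) = 0" by linarith
qed

definition front :: "nat => (nat => real) => nat => real" where
  "front d x = restrict x {..<d}"

definition glue :: "nat => (nat => real) => real => nat => real" where
  "glue d y s = (\<lambda>i\<in>{..<Suc d}. if i < d then y i else s)"

lemma glue_in: "y : topspace (cube_top d) ==> 0 <= s ==> s <= 1 ==> glue d y s : topspace (cube_top (Suc d))"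
  unfolding glue_def by (rule restrict_cube) (simp add: cube_coord)

lemma front_in: "x : topspace (cube_top (Suc d)) ==> front d x : topspace (cube_top d)"
  unfolding front_def by (rule restrict_cube) (simp add: cube_coord)

lemma glue_front: "x : topspace (cube_top (Suc d)) ==> glue d (front d x) (x d) = x"
  by (auto simp: glue_def front_def fun_eq_iff topspace_cube_top PiE_iff extensional_def less_Suc_eq)

lemma front_glue: "y : topspace (cube_top d) ==> front d (glue d y s) = y"
  by (auto simp: glue_def front_def fun_eq_iff topspace_cube_top PiE_iff extensional_def)

lemma glue_last [simp]: "glue d y s d = s" by (simp add: glue_def)

lemma cube_bdry_Suc:
  "x : cube_bdry (Suc d) \<longleftrightarrow> x : topspace (cube_top (Suc d)) & (front d x : cube_bdry d | x d = 0 | x d = 1)"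
  using front_in[of x d] by (auto simp: cube_bdry_def front_def less_Suc_eq)

lemma glue_bdry:
  assumes "y : topspace (cube_top d)" "0 <= s" "s <= 1" "y : cube_bdry d | s = 0 | s = 1"
  shows "glue d y s : cube_bdry (Suc d)"
  using assms glue_in[OF assms(1-3)] front_glue[OF assms(1), of s] by (simp add: cube_bdry_Suc)

lemma continuous_map_glue:
  assumes "cmap X (cube_top d) f" "cmap X euclideanreal r"
    "!!x. x : topspace X ==> 0 <= r x & r x <= 1"
  shows "cmap X (cube_top (Suc d)) (%x. glue d (f x) (r x))" unfolding glue_def
proof (rule continuous_map_restrict_cube)
  fix i assume "i < Suc d"
  thus "cmap X euclideanreal (%x. if i < d then f x i else r x)"
    using assms by (simp add: continuous_map_cube_coord)
next
  fix x i assume x: "x : topspace X" and "i < Suc d"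
  thus "0 <= (if i < d then f x i else r x) & (if i < d then f x i else r x) <= 1"
    using assms(3)[OF x] cube_coord[OF continuous_map_funspace[OF assms(1) x], of i] by simp
qed

lemma continuous_map_front:
  assumes "cmap X (cube_top (Suc d)) f" shows "cmap X (cube_top d) (%x. front d (f x))" unfolding front_def
proof (rule continuous_map_restrict_cube)
  fix i assume i: "i < d"
  thus "cmap X euclideanreal (%x. f x i)" by (intro continuous_map_cube_coord[OF assms]) simp
  fix x assume "x : topspace X"
  thus "0 <= f x i & f x i <= 1" using cube_coord[OF continuous_map_funspace[OF assms], of x i] i by simp
qed

lemma continuous_map_front_id: "cmap (cube_top (Suc d)) (cube_top d) (front d)"
  using continuous_map_front[OF continuous_map_id] by (simp add: id_def)

lemma equiv_sphere_htpy: "equiv (sphere_maps n X x) (sphere_htpy n X x)"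
proof (rule equivI)
  show "refl_on (sphere_maps n X x) (sphere_htpy n X x)" by (auto simp: refl_on_def sphere_htpy_def sphere_maps_def)
  show "sphere_htpy n X x \<subseteq> sphere_maps n X x \<times> sphere_maps n X x" by (auto simp: sphere_htpy_def)
  show "sym (sphere_htpy n X x)" by (auto simp: sym_def sphere_htpy_def intro: homotopic_with_symD)
  show "trans (sphere_htpy n X x)" unfolding trans_def sphere_htpy_def by (auto intro: homotopic_with_trans)
qed

lemma trans_sphere_htpy: "trans (sphere_htpy n X x)" by (rule equivE[OF equiv_sphere_htpy])

lemma sphere_maps_comp:
  "cmap E B p ==> g : sphere_maps n E e ==> p \<circ> g : sphere_maps n B (p e)"
  by (auto simp: sphere_maps_def intro: continuous_map_compose)

lemma sphere_htpy_comp: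
  assumes p: "cmap E B p" and gg: "(g, g') : sphere_htpy n E e"
  shows "(p \<circ> g, p \<circ> g') : sphere_htpy n B (p e)"
proof -
  have "homotopic_with (%k. \<forall>z\<in>cube_bdry n. k z = p e) (cube_top n) B (p \<circ> g) (p \<circ> g')"
    using gg by (intro homotopic_with_compose_continuous_map_left[OF _ p, of "%k. \<forall>z\<in>cube_bdry n. k z = e"])
      (auto simp: sphere_htpy_def)
  thus ?thesis using gg sphere_maps_comp[OF p] by (auto simp: sphere_htpy_def)
qed

context
  fixes E :: "'e topology" and B :: "'b topology" and p assumes w: "weak_homotopy_equivalence E B p"
begin

lemma weak_equivalence_cont: "cmap E B p" using w by (simp add: weak_homotopy_equivalence_def)

lemma class_image:
  assumes g: "g : sphere_maps n E e"
  shows "sphere_htpy n B (p e) `` ((%g. p \<circ> g) ` (sphere_htpy n E e `` {g})) = sphere_htpy n B (p e) `` {p \<circ> g}"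
proof -
  have gg: "g : sphere_htpy n E e `` {g}" using equiv_class_self[OF equiv_sphere_htpy g] .
  show ?thesis
  proof (intro equalityI subsetI)
    fix h assume "h : sphere_htpy n B (p e) `` ((%g. p \<circ> g) ` (sphere_htpy n E e `` {g}))"
    then obtain g' where "(g, g') : sphere_htpy n E e" "(p \<circ> g', h) : sphere_htpy n B (p e)" by auto
    thus "h : sphere_htpy n B (p e) `` {p \<circ> g}"
      using transD[OF trans_sphere_htpy sphere_htpy_comp[OF weak_equivalence_cont]] by blast
  next
    fix h assume "h : sphere_htpy n B (p e) `` {p \<circ> g}"
    thus "h : sphere_htpy n B (p e) `` ((%g. p \<circ> g) ` (sphere_htpy n E e `` {g}))" using gg by blast
  qed
qed

lemma pi_inj:
  assumes n: "n \<ge> 1" and e: "e : topspace E" and g: "g : sphere_maps n E e" and h: "h : sphere_maps n E e"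
    and htpy: "(p \<circ> g, p \<circ> h) : sphere_htpy n B (p e)"
  shows "(g, h) : sphere_htpy n E e"
proof -
  have "bij_betw (%C. sphere_htpy n B (p e) `` ((%g. p \<circ> g) ` C)) (homotopy_classes n E e) (homotopy_classes n B (p e))"
    using w n e by (simp add: weak_homotopy_equivalence_def)
  hence "inj_on (%C. sphere_htpy n B (p e) `` ((%g. p \<circ> g) ` C)) (homotopy_classes n E e)"
    by (rule bij_betw_imp_inj_on)
  moreover have "sphere_htpy n E e `` {k} : homotopy_classes n E e" if "k : sphere_maps n E e" for k
    unfolding homotopy_classes_def by (rule quotientI[OF that])
  moreover have "sphere_htpy n B (p e) `` {p \<circ> g} = sphere_htpy n B (p e) `` {p \<circ> h}"
    by (rule equiv_class_eq[OF equiv_sphere_htpy htpy])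
  ultimately have "sphere_htpy n E e `` {g} = sphere_htpy n E e `` {h}"
    using class_image[OF g] class_image[OF h] g h by (simp add: inj_on_def)
  thus ?thesis using eq_equiv_class[OF _ equiv_sphere_htpy h] by blast
qed

lemma pi_surj:
  assumes n: "n \<ge> 1" and e: "e : topspace E" and h: "h : sphere_maps n B (p e)"
  obtains g where "g : sphere_maps n E e" "(p \<circ> g, h) : sphere_htpy n B (p e)"
proof -
  have "bij_betw (%C. sphere_htpy n B (p e) `` ((%g. p \<circ> g) ` C)) (homotopy_classes n E e) (homotopy_classes n B (p e))"
    using w n e by (simp add: weak_homotopy_equivalence_def)
  hence "(%C. sphere_htpy n B (p e) `` ((%g. p \<circ> g) ` C)) ` homotopy_classes n E e = homotopy_classes n B (p e)"
    by (rule bij_betw_imp_surj_on)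
  moreover have "sphere_htpy n B (p e) `` {h} : homotopy_classes n B (p e)"
    unfolding homotopy_classes_def by (rule quotientI[OF h])
  ultimately have "\<exists>C\<in>homotopy_classes n E e. sphere_htpy n B (p e) `` {h} = sphere_htpy n B (p e) `` ((%g. p \<circ> g) ` C)"
    by (simp add: image_iff[symmetric])
  then obtain C where C: "C : homotopy_classes n E e"
    "sphere_htpy n B (p e) `` {h} = sphere_htpy n B (p e) `` ((%g. p \<circ> g) ` C)" by blast
  from C(1) obtain g where g: "g : sphere_maps n E e" "C = sphere_htpy n E e `` {g}"
    unfolding homotopy_classes_def by (rule quotientE)
  have "sphere_htpy n B (p e) `` {p \<circ> g} = sphere_htpy n B (p e) `` {h}"
    using C(2) g class_image[OF g(1)] by simp
  hence "(p \<circ> g, h) : sphere_htpy n B (p e)" using eq_equiv_class[OF _ equiv_sphere_htpy h] by blast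
  thus ?thesis using g that by blast
qed

lemma component_image:
  assumes "e : topspace E"
  shows "(\<Union>x\<in>path_component_of_set E e. path_component_of_set B (p x)) = path_component_of_set B (p e)"
proof -
  have "path_component_of_set B (p x) = path_component_of_set B (p e)" if x: "path_component_of E e x" for x
  proof -
    have "path_component_of B (p e) (p x)"
      using x pathin_comp[OF _ weak_equivalence_cont] unfolding path_component_of_def by fastforce
    thus ?thesis by (simp add: path_component_of_equiv)
  qed
  moreover have "path_component_of E e e" using assms by (simp add: path_component_of_refl)
  ultimately show ?thesis by blast
qed

lemma pi0_inj:
  assumes e: "e : topspace E" "e' : topspace E" and c: "path_component_of B (p e) (p e')"
  shows "path_component_of E e e'"
proof -
  have "inj_on (%C. \<Union>x\<in>C. path_component_of_set B (p x)) (path_components_of E)"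
    using w by (auto simp: weak_homotopy_equivalence_def bij_betw_def)
  moreover have "path_component_of_set E x : path_components_of E" if "x : topspace E" for x
    using that by (simp add: path_components_of_def)
  ultimately have "path_component_of_set E e = path_component_of_set E e'"
    using e c component_image by (simp add: inj_on_def path_component_of_equiv)
  hence "path_component_of E e = path_component_of E e'" by (simp only: Collect_inj)
  thus ?thesis using e by (intro path_component_of_equiv[THEN iffD2]) simp
qed

lemma pi0_surj:
  assumes b: "b : topspace B"
  obtains e where "e : topspace E" "path_component_of B (p e) b"
proof -
  have "path_component_of_set B b : (%C. \<Union>x\<in>C. path_component_of_set B (p x)) ` path_components_of E"
    using w b by (simp add: weak_homotopy_equivalence_def bij_betw_def path_components_of_def)
  then obtain e where e: "e : topspace E" "path_component_of_set B b = path_component_of_set B (p e)"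
    using component_image by (auto simp: path_components_of_def)
  hence "path_component_of B (p e) = path_component_of B b" by (simp only: Collect_inj)
  hence "path_component_of B (p e) b"
    using b continuous_map_funspace[OF weak_equivalence_cont e(1)] by (intro path_component_of_equiv[THEN iffD2]) simp
  thus ?thesis using e that by blast
qed

end

lemma sphere_htpyD:
  assumes "(g, h) : sphere_htpy n X x"
  obtains k where "cmap (prod_topology unit_ivl (cube_top n)) X k"
    "!!z. k (0, z) = g z" "!!z. k (1, z) = h z"
    "!!t z. 0 <= t ==> t <= 1 ==> z : cube_bdry n ==> k (t, z) = x"
proof -
  have "homotopic_with (%k. \<forall>z\<in>cube_bdry n. k z = x) (cube_top n) X g h"
    using assms by (simp add: sphere_htpy_def)
  then obtain k where k: "cmap (prod_topology unit_ivl (cube_top n)) X k"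
    "\<forall>z. k (0, z) = g z" "\<forall>z. k (1, z) = h z" "\<forall>t\<in>{0..1}. \<forall>z\<in>cube_bdry n. k (t, z) = x"
    unfolding homotopic_with_def by blast
  show ?thesis by (rule that[OF k(1)]) (use k(2-4) in auto)
qed

lemma sphere_htpyI:
  assumes k: "cmap (prod_topology unit_ivl (cube_top n)) X k"
    and "!!z. z : topspace (cube_top n) ==> k (0, z) = g z" "!!z. z : topspace (cube_top n) ==> k (1, z) = h z"
    and bdry: "!!t z. 0 <= t ==> t <= 1 ==> z : cube_bdry n ==> k (t, z) = x"
    and g: "g : sphere_maps n X x" and h: "h : sphere_maps n X x"
  shows "(g, h) : sphere_htpy n X x"
proof -
  have "homotopic_with (%k. \<forall>z\<in>cube_bdry n. k z = x) (cube_top n) X g h"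
  proof (subst homotopic_with)
    show "(\<forall>z\<in>cube_bdry n. h z = x) = (\<forall>z\<in>cube_bdry n. k z = x)"
      if "!!y. y : topspace (cube_top n) ==> h y = k y" for h k :: "(nat => real) => 'a"
      using that cube_bdry_sub[of n] by (metis subsetD)
    show "\<exists>h'. cmap (prod_topology unit_ivl (cube_top n)) X h' \<and>
        (\<forall>x\<in>topspace (cube_top n). h' (0, x) = g x) & (\<forall>x\<in>topspace (cube_top n). h' (1, x) = h x) \<and>
        (\<forall>t\<in>{0..1}. \<forall>z\<in>cube_bdry n. h' (t, z) = x)"
      using assms(1-4) by (intro exI[of _ k]) auto
  qed
  thus ?thesis using g h by (simp add: sphere_htpy_def)
qed

text \<open>Points of cubes and d-paths inject into the type of the test spaces.\<close>

definition inj_cube :: "(nat => real) => 'a univ \<times> (real => 'a univ)" where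
  "inj_cube x = (NPath (%_. x), %_. Vertex [])"

lemma inj_inj_cube: "inj inj_cube" by (rule injI) (auto simp: inj_cube_def fun_eq_iff)

definition inj_npath :: "(real => nat => real) => 'a univ \<times> (real => 'a univ)" where
  "inj_npath x = (NPath x, %_. Vertex [])"

lemma inj_inj_npath: "inj inj_npath" by (rule injI) (auto simp: inj_npath_def)

context
  fixes E B :: "'a univ topology" and p and haus :: bool
  assumes fib: "Hurewicz_fibration haus E B p" and weq: "weak_homotopy_equivalence E B p"
begin

lemmas cube_relative_lift = relative_lift[OF fib delta_generated_cube_top Hausdorff_cube_top inj_inj_cube ndr_cube]
lemmas cube_solvable_homotopy = solvable_homotopy[OF fib delta_generated_cube_top Hausdorff_cube_top inj_inj_cube ndr_cube]

lemma rel_lifts_cube_0: "rel_lifts (cube_top 0) (cube_bdry 0) E B p" unfolding rel_lifts_def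
proof (intro allI impI)
  fix u v assume "lift_problem (cube_top 0) (cube_bdry 0) E B p u v"
  hence v: "cmap (cube_top 0) B v" by (simp add: lift_problem_def)
  have b0: "cube_bdry 0 = {}" by (simp add: cube_bdry_def)
  obtain c where c: "topspace (cube_top 0) = {c}" by (simp add: topspace_cube_top)
  obtain e where e: "e : topspace E" "path_component_of B (p e) (v c)"
    using pi0_surj[OF weq continuous_map_funspace[OF v, of c]] c by auto
  from e(2) obtain q where q: "pathin B q" "q 0 = p e" "q 1 = v c" by (auto simp: path_component_of_def)
  have K: "cmap (prod_topology (cube_top 0) unit_ivl) B (q \<circ> snd)"
    using continuous_map_compose[OF continuous_map_snd q(1)[unfolded pathin_def]] .
  have y: "cmap (cube_top 0) E (%_. e)" using e by simp
  have g: "cmap (prod_topology (subtopology (cube_top 0) (cube_bdry 0)) unit_ivl) E (%_. e)" using e by simp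
  obtain y1 where "cmap (cube_top 0) E y1"
    "!!z. z : topspace (cube_top 0) ==> p (y1 z) = (q \<circ> snd) (z, 1)"
  proof (rule cube_relative_lift[OF K y _ g])
    show "p e = (q \<circ> snd) (z, 0)" for z :: "nat => real" using q by simp
  qed (auto simp: b0)
  thus "solvable (cube_top 0) (cube_bdry 0) E p u v" using q c by (auto simp: solvable_def b0 intro!: exI[of _ y1])
qed

text \<open>Outside the interior of the top face \<open>u\<close> is constant, so that \<open>u\<close> is a sphere on the top face and
  \<open>v\<close> contracts its image under \<open>p\<close>. Injectivity on \<open>\<pi>\<^sub>d\<close> contracts the sphere itself.\<close>

lemma extend_over_cube:
  assumes uv: "lift_problem (cube_top (Suc d)) (cube_bdry (Suc d)) E B p u v"
    and J: "!!x. x : cube_bdry (Suc d) ==> x d = 0 | front d x : cube_bdry d ==> u x = e"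
    and e: "e : topspace E"
  obtains w where "cmap (cube_top (Suc d)) E w" "!!x. x : cube_bdry (Suc d) ==> w x = u x"
proof -
  have u: "cmap (subtopology (cube_top (Suc d)) (cube_bdry (Suc d))) E u"
    and v: "cmap (cube_top (Suc d)) B v"
    and puv: "!!a. a : cube_bdry (Suc d) ==> p (u a) = v a" using uv by (auto simp: lift_problem_def)
  have top: "cmap (cube_top d) (subtopology (cube_top (Suc d)) (cube_bdry (Suc d))) (%y. glue d y 1)"
    using glue_bdry[of _ d 1]
    by (auto simp: continuous_map_in_subtopology image_subset_iff intro!: continuous_map_glue[OF continuous_map_id[unfolded id_def]])
  from continuous_map_compose[OF top u] have g: "cmap (cube_top d) E (%y. u (glue d y 1))" by (simp add: o_def)
  define h where "h x = v (glue d (snd x) (fst x))" for x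
  have h: "cmap (prod_topology unit_ivl (cube_top d)) B h"
  proof -
    have "cmap (prod_topology unit_ivl (cube_top d)) (cube_top (Suc d)) (%x. glue d (snd x) (fst x))"
      by (intro continuous_map_glue continuous_map_snd continuous_map_into_fulltopology[OF continuous_map_fst]) auto
    from continuous_map_compose[OF this v] show ?thesis by (simp add: o_def h_def[abs_def])
  qed
  have h0: "h (0, y) = p e" if "y : topspace (cube_top d)" for y
    using puv[OF glue_bdry[OF that, of 0]] J[OF glue_bdry[OF that, of 0]] by (simp add: h_def)
  have h1: "h (1, y) = p (u (glue d y 1))" if "y : topspace (cube_top d)" for y
    using puv[OF glue_bdry[OF that, of 1]] by (simp add: h_def)
  obtain k where k: "cmap (prod_topology unit_ivl (cube_top d)) E k"
    and k0: "!!y. y : topspace (cube_top d) ==> k (0, y) = e"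
    and k1: "!!y. y : topspace (cube_top d) ==> k (1, y) = u (glue d y 1)"
    and kb: "!!t y. 0 <= t ==> t <= 1 ==> y : cube_bdry d ==> k (t, y) = e"
  proof (cases "d = 0")
    case True
    obtain c where c: "topspace (cube_top d) = {c}" using True by (simp add: topspace_cube_top)
    have "cmap unit_ivl (prod_topology unit_ivl (cube_top d)) (%t. (t, c))"
      using c by (simp add: continuous_map_pairwise o_def)
    from continuous_map_compose[OF this h] have "pathin B (%t. h (t, c))" by (simp add: pathin_def o_def)
    hence "path_component_of B (p e) (p (u (glue d c 1)))"
      using h0[of c] h1[of c] c unfolding path_component_of_def by (intro exI[of _ "%t. h (t, c)"]) simp
    hence "path_component_of E e (u (glue d c 1))"
      using continuous_map_funspace[OF g, of c] c by (intro pi0_inj[OF weq e]) simp_all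
    then obtain q where q: "pathin E q" "q 0 = e" "q 1 = u (glue d c 1)" by (auto simp: path_component_of_def)
    show ?thesis
    proof (rule that[of "q \<circ> fst"])
      show "cmap (prod_topology unit_ivl (cube_top d)) E (q \<circ> fst)"
        using continuous_map_compose[OF continuous_map_fst q(1)[unfolded pathin_def]] .
      show "(q \<circ> fst) (t, y) = e" if "y : cube_bdry d" for t y using that True by (simp add: cube_bdry_def)
    qed (use q c in auto)
  next
    case False
    have ge: "(%y. u (glue d y 1)) : sphere_maps d E e" and ce: "(%_. e) : sphere_maps d E e"
    proof -
      have "u (glue d y 1) = e" if y: "y : cube_bdry d" for y
      proof -
        have y': "y : topspace (cube_top d)" using y cube_bdry_sub by blast
        show ?thesis using J[OF glue_bdry[OF y', of 1]] y front_glue[OF y'] by simp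
      qed
      thus "(%y. u (glue d y 1)) : sphere_maps d E e" using g by (simp add: sphere_maps_def)
    qed (use e in \<open>simp add: sphere_maps_def\<close>)
    have "(p \<circ> (%_. e), p \<circ> (%y. u (glue d y 1))) : sphere_htpy d B (p e)"
    proof (rule sphere_htpyI[OF h])
      fix t :: real and y assume t: "0 <= t" "t <= 1" and y: "y : cube_bdry d"
      have y': "y : topspace (cube_top d)" using y cube_bdry_sub by blast
      have b: "glue d y t : cube_bdry (Suc d)" using glue_bdry[OF y' t] y by simp
      show "h (t, y) = p e" using puv[OF b] J[OF b] y front_glue[OF y'] by (simp add: h_def)
    qed (use h0 h1 sphere_maps_comp[OF weak_equivalence_cont[OF weq] ge]
          sphere_maps_comp[OF weak_equivalence_cont[OF weq] ce] in \<open>simp_all add: comp_def\<close>)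
    from pi_inj[OF weq _ e ce ge this] False
    have "(%_. e, %y. u (glue d y 1)) : sphere_htpy d E e" by simp
    then obtain k where k: "cmap (prod_topology unit_ivl (cube_top d)) E k"
      "!!y. k (0, y) = e" "!!y. k (1, y) = u (glue d y 1)"
      "!!t y. 0 <= t ==> t <= 1 ==> y : cube_bdry d ==> k (t, y) = e" by (rule sphere_htpyD) blast
    show ?thesis by (rule that[OF k(1)]) (use k(2-4) in auto)
  qed
  define w where "w x = k (x d, front d x)" for x
  have "cmap (cube_top (Suc d)) (prod_topology unit_ivl (cube_top d)) (%x. (x d, front d x))"
    using continuous_map_front_id cube_coord[of _ "Suc d" d] continuous_map_cube_proj[of d "Suc d"]
    by (auto simp: continuous_map_pairwise o_def continuous_map_unit_ivl)
  from continuous_map_compose[OF this k] have "cmap (cube_top (Suc d)) E w" by (simp add: o_def w_def[abs_def])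
  moreover have "w x = u x" if x: "x : cube_bdry (Suc d)" for x
  proof -
    have x': "x : topspace (cube_top (Suc d))" using x cube_bdry_sub by blast
    note f = front_in[OF x'] and xd = cube_coord[OF x', of d]
    consider "x d = 1" | "x d = 0" | "front d x : cube_bdry d" using x by (auto simp: cube_bdry_Suc)
    thus ?thesis
    proof cases
      case 1
      thus ?thesis using k1[OF f] glue_front[OF x'] by (simp add: w_def)
    next
      case 2
      thus ?thesis using k0[OF f] J[OF x] by (simp add: w_def)
    next
      case 3
      thus ?thesis using kb[OF _ _ 3, of "x d"] xd J[OF x] by (simp add: w_def)
    qed
  qed
  ultimately show ?thesis by (rule that)
qed

text \<open>The extension \<open>w\<close> of \<open>u\<close> need not lie over \<open>v\<close>. Over $C$, which runs through \<open>p w\<close> upwards and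
  then through \<open>v\<close> downwards, the difference of the two is a sphere; surjectivity on the next
  homotopy group lifts it to \<open>g\<close>. Walking back along \<open>w\<close> and then along \<open>g\<close> gives a lift of a
  map homotopic to \<open>v\<close>, and the homotopy is lifted relatively to the boundary.\<close>

lemma solvable_crushed:
  assumes uv: "lift_problem (cube_top (Suc d)) (cube_bdry (Suc d)) E B p u v"
    and J: "!!x. x : cube_bdry (Suc d) ==> x d = 0 | front d x : cube_bdry d ==> u x = e"
    and e: "e : topspace E"
  shows "solvable (cube_top (Suc d)) (cube_bdry (Suc d)) E p u v"
proof -
  let ?Z = "cube_top (Suc d)" and ?A = "cube_bdry (Suc d)"
  have v: "cmap ?Z B v" and puv: "!!a. a : ?A ==> p (u a) = v a" using uv by (auto simp: lift_problem_def)
  obtain w where w: "cmap ?Z E w" and wu: "!!x. x : ?A ==> w x = u x" using extend_over_cube[OF uv J e] by blast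
  have pc: "cmap E B p" using weak_equivalence_cont[OF weq] .
  have pw: "cmap ?Z B (%x. p (w x))" using continuous_map_compose[OF w pc] by (simp add: o_def)
  have uJ: "u (glue d y s) = e" if "y : topspace (cube_top d)" "0 <= s" "s <= 1" "y : cube_bdry d | s = 0" for y s
    using J[OF glue_bdry[OF that(1-3)]] that front_glue[OF that(1)] by auto
  have wJ: "w (glue d y s) = e" if "y : topspace (cube_top d)" "0 <= s" "s <= 1" "y : cube_bdry d | s = 0" for y s
    using wu[OF glue_bdry[OF that(1-3)]] uJ[OF that] that by auto
  have vJ: "v (glue d y s) = p e" if "y : topspace (cube_top d)" "0 <= s" "s <= 1" "y : cube_bdry d | s = 0" for y s
    using puv[OF glue_bdry[OF that(1-3)]] uJ[OF that] that by auto
  have wtop: "w (glue d y 1) = u (glue d y 1)" "p (w (glue d y 1)) = v (glue d y 1)" if "y : topspace (cube_top d)" for y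
    using wu[OF glue_bdry[OF that, of 1]] puv[OF glue_bdry[OF that, of 1]] by auto
  define C where "C y r = (if r <= 0 then p (w (glue d y (1 + r))) else v (glue d y (1 - r)))" for y and r :: real
  have Cb: "C y r = p e" if "y : topspace (cube_top d)" "-1 <= r" "r <= 1" "y : cube_bdry d | r = -1 | r = 1" for y r
    using that wJ[of y "1 + r"] vJ[of y "1 - r"] by (auto simp: C_def)
  have C: "cmap X B (%x. C (f x) (r x))"
    if f: "cmap X (cube_top d) f" and r: "cmap X euclideanreal r"
      and r1: "!!x. x : topspace X ==> -1 <= r x & r x <= 1" for X :: "'x topology" and f r unfolding C_def
  proof (rule continuous_map_cases_le[OF r])
    have r1': "0 <= 1 + r x" "0 <= 1 - r x" if "x : topspace X" for x using r1[OF that] by auto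
    let ?X1 = "subtopology X {x : topspace X. r x <= 0}" and ?X2 = "subtopology X {x : topspace X. 0 <= r x}"
    have "cmap ?X1 ?Z (%x. glue d (f x) (1 + r x))"
      using r1' by (intro continuous_map_glue continuous_intros continuous_map_from_subtopology[OF f]
        continuous_map_from_subtopology[OF r]) auto
    from continuous_map_compose[OF this pw] show "cmap ?X1 B (%x. p (w (glue d (f x) (1 + r x))))"
      by (simp add: o_def)
    have "cmap ?X2 ?Z (%x. glue d (f x) (1 - r x))"
      using r1' by (intro continuous_map_glue continuous_intros continuous_map_from_subtopology[OF f]
        continuous_map_from_subtopology[OF r]) auto
    from continuous_map_compose[OF this v] show "cmap ?X2 B (%x. v (glue d (f x) (1 - r x)))" by (simp add: o_def)
    fix x assume "x : topspace X" "r x = 0"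
    thus "p (w (glue d (f x) (1 + r x))) = v (glue d (f x) (1 - r x))"
      using wtop(2)[OF continuous_map_funspace[OF f]] by simp
  qed simp
  have last: "cmap ?Z euclideanreal (%x. x d)" by (rule continuous_map_cube_proj) simp
  have x01: "0 <= x d & x d <= 1" if "x : topspace ?Z" for x using cube_coord[OF that, of d] by simp
  define D where "D x = C (front d x) (2 * x d - 1)" for x
  have Db: "D x = p e" if "x : ?A" for x
  proof -
    have x: "x : topspace ?Z" using that cube_bdry_sub by blast
    show ?thesis unfolding D_def using that x01[OF x] by (intro Cb front_in x) (auto simp: cube_bdry_Suc)
  qed
  have "cmap ?Z B D"
    unfolding D_def by (rule C[OF continuous_map_front_id]) (use last x01 in \<open>auto intro!: continuous_intros\<close>)
  hence Dm: "D : sphere_maps (Suc d) B (p e)" using Db by (simp add: sphere_maps_def)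
  have one: "1 <= Suc d" by simp
  obtain g where g: "g : sphere_maps (Suc d) E e" "(p \<circ> g, D) : sphere_htpy (Suc d) B (p e)"
    by (rule pi_surj[OF weq one e Dm])
  from g(1) have gc: "cmap ?Z E g" and gb: "!!x. x : ?A ==> g x = e" by (auto simp: sphere_maps_def)
  obtain k where k: "cmap (prod_topology unit_ivl ?Z) B k"
    and k0: "!!x. k (0, x) = p (g x)" and k1: "!!x. k (1, x) = D x"
    and kb: "!!t x. 0 <= t ==> t <= 1 ==> x : ?A ==> k (t, x) = p e"
  proof -
    obtain k where k: "cmap (prod_topology unit_ivl ?Z) B k"
      "!!x. k (0, x) = (p \<circ> g) x" "!!x. k (1, x) = D x"
      "!!t x. 0 <= t ==> t <= 1 ==> x : ?A ==> k (t, x) = p e" by (rule sphere_htpyD[OF g(2)]) blast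
    show ?thesis by (rule that[OF k(1)]) (use k(2-4) in auto)
  qed
  define y where "y x = (if x d <= 1/3 then w (glue d (front d x) (1 - 3 * x d))
      else g (glue d (front d x) ((3 * x d - 1) / 2)))" for x
  have lo: "cmap X ?Z (%x. glue d (front d (f x)) (1 - 3 * f x d))"
    if f: "cmap X ?Z f" and f3: "!!x. x : topspace X ==> f x d <= 1/3" for X :: "'x topology" and f
  proof (rule continuous_map_glue[OF continuous_map_front[OF f]])
    show "cmap X euclideanreal (%x. 1 - 3 * f x d)"
      by (intro continuous_intros continuous_map_cube_coord[OF f]) auto
    show "0 <= 1 - 3 * f x d & 1 - 3 * f x d <= 1" if "x : topspace X" for x
      using f3[OF that] x01[OF continuous_map_funspace[OF f that]] by simp
  qed
  have hi: "cmap X ?Z (%x. glue d (front d (f x)) ((3 * f x d - 1) / 2))"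
    if f: "cmap X ?Z f" and f3: "!!x. x : topspace X ==> 1/3 <= f x d" for X :: "'x topology" and f
  proof (rule continuous_map_glue[OF continuous_map_front[OF f]])
    have "cmap X euclideanreal (%x. (3 * f x d - 1) * (1/2))"
      by (intro continuous_intros continuous_map_cube_coord[OF f]) auto
    thus "cmap X euclideanreal (%x. (3 * f x d - 1) / 2)" by simp
    show "0 <= (3 * f x d - 1) / 2 & (3 * f x d - 1) / 2 <= 1" if "x : topspace X" for x
      using f3[OF that] x01[OF continuous_map_funspace[OF f that]] by simp
  qed
  have idsub: "cmap (subtopology X S) X (%x. x)" for X :: "'x topology" and S
    by (simp add: continuous_map_from_subtopology)
  have y: "cmap ?Z E y" unfolding y_def
  proof (rule continuous_map_cases_le[OF last])
    let ?X1 = "subtopology ?Z {x : topspace ?Z. x d <= 1/3}" and ?X2 = "subtopology ?Z {x : topspace ?Z. 1/3 <= x d}"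
    have "cmap ?X1 ?Z (%x. glue d (front d x) (1 - 3 * x d))" by (rule lo[OF idsub]) simp
    from continuous_map_compose[OF this w] show "cmap ?X1 E (%x. w (glue d (front d x) (1 - 3 * x d)))"
      by (simp add: o_def)
    have "cmap ?X2 ?Z (%x. glue d (front d x) ((3 * x d - 1) / 2))" by (rule hi[OF idsub]) simp
    from continuous_map_compose[OF this gc]
    show "cmap ?X2 E (%x. g (glue d (front d x) ((3 * x d - 1) / 2)))" by (simp add: o_def)
    fix x assume x: "x : topspace ?Z" "x d = 1/3"
    show "w (glue d (front d x) (1 - 3 * x d)) = g (glue d (front d x) ((3 * x d - 1) / 2))"
    proof -
      have eq: "1 - 3 * x d = 0" "(3 * x d - 1) / 2 = 0" using x by simp_all
      show ?thesis unfolding eq using wJ[OF front_in[OF x(1)], of 0] gb[OF glue_bdry[OF front_in[OF x(1)], of 0]] by simp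
    qed
  qed simp
  have yA: "y x = (if x d = 0 then u (glue d (front d x) 1) else e)" if x: "x : ?A" for x
  proof -
    have x': "x : topspace ?Z" using x cube_bdry_sub by blast
    note f = front_in[OF x'] and xd = x01[OF x']
    show ?thesis
    proof (cases "x d <= 1/3")
      case True
      hence "x d = 0 | front d x : cube_bdry d" using x by (auto simp: cube_bdry_Suc)
      thus ?thesis using True xd wtop(1)[OF f] wJ[OF f, of "1 - 3 * x d"] uJ[OF f, of 1] by (auto simp: y_def)
    next
      case False
      have "g (glue d (front d x) ((3 * x d - 1) / 2)) = e"
        using x xd False by (intro gb glue_bdry f) (auto simp: cube_bdry_Suc)
      thus ?thesis using False by (auto simp: y_def)
    qed
  qed
  \<comment> \<open>The position in \<open>C\<close> over which the lift \<open>y\<close> lies after the sphere has been moved to \<open>D\<close>: down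
    from 0 to -1, then up to 1.\<close>
  define z where "z s = max (- 3 * s) (3 * s - 2)" for s :: real
  let ?P = "prod_topology ?Z unit_ivl"
  have fst': "cmap ?P ?Z fst" by (rule continuous_map_fst)
  note plast = continuous_map_cube_coord[OF fst', of d, simplified]
  note ptime = continuous_map_prod_time[of ?Z]
  have p01: "0 <= fst x d & fst x d <= 1" "0 <= snd x & snd x <= 1" if "x : topspace ?P" for x
    using that x01[of "fst x"] by auto
  define K1 where "K1 x = (if fst x d <= 1/3 then p (w (glue d (front d (fst x)) (1 - 3 * fst x d)))
      else k (snd x, glue d (front d (fst x)) ((3 * fst x d - 1) / 2)))" for x
  have K1: "cmap ?P B K1" unfolding K1_def
  proof (rule continuous_map_cases_le[OF plast])
    let ?X1 = "subtopology ?P {x : topspace ?P. fst x d <= 1/3}" and ?X2 = "subtopology ?P {x : topspace ?P. 1/3 <= fst x d}"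
    have "cmap ?X1 ?Z (%x. glue d (front d (fst x)) (1 - 3 * fst x d))"
      by (rule lo[OF continuous_map_from_subtopology[OF fst']]) simp
    from continuous_map_compose[OF this pw]
    show "cmap ?X1 B (%x. p (w (glue d (front d (fst x)) (1 - 3 * fst x d))))" by (simp add: o_def)
    have "cmap ?X2 ?Z (%x. glue d (front d (fst x)) ((3 * fst x d - 1) / 2))"
      by (rule hi[OF continuous_map_from_subtopology[OF fst']]) simp
    hence "cmap ?X2 (prod_topology unit_ivl ?Z) (%x. (snd x, glue d (front d (fst x)) ((3 * fst x d - 1) / 2)))"
      using continuous_map_from_subtopology[OF continuous_map_snd[of ?Z unit_ivl]]
      by (simp add: continuous_map_pairwise o_def)
    from continuous_map_compose[OF this k]
    show "cmap ?X2 B (%x. k (snd x, glue d (front d (fst x)) ((3 * fst x d - 1) / 2)))" by (simp add: o_def)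
    fix x assume x: "x : topspace ?P" "fst x d = 1/3"
    hence f: "front d (fst x) : topspace (cube_top d)" by (auto intro: front_in)
    show "p (w (glue d (front d (fst x)) (1 - 3 * fst x d))) = k (snd x, glue d (front d (fst x)) ((3 * fst x d - 1) / 2))"
    proof -
      have eq: "1 - 3 * fst x d = 0" "(3 * fst x d - 1) / 2 = 0" using x by simp_all
      show ?thesis unfolding eq using p01[OF x(1)] wJ[OF f, of 0] kb[OF _ _ glue_bdry[OF f, of 0], of "snd x"] by simp
    qed
  qed simp
  have gA: "cmap (prod_topology (subtopology ?Z ?A) unit_ivl) E (%x. y' (fst x))"
    if "cmap ?Z E y'" for y'
    using continuous_map_compose[OF continuous_map_fst continuous_map_from_subtopology[OF that]] by (simp add: o_def)
  obtain y1 where y1: "cmap ?Z E y1" "!!x. x : topspace ?Z ==> p (y1 x) = K1 (x, 1)" "!!x. x : ?A ==> y1 x = y x"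
  proof (rule cube_relative_lift[OF K1 y _ gA[OF y]])
    show py: "p (y x) = K1 (x, 0)" for x by (simp add: y_def K1_def k0)
    fix x and t :: real assume x: "x : ?A" and t: "0 <= t" "t <= 1"
    have x': "x : topspace ?Z" using x cube_bdry_sub by blast
    show "p (y (fst (x, t))) = K1 (x, t)"
    proof (cases "x d <= 1/3")
      case False
      have b: "glue d (front d x) ((3 * x d - 1) / 2) : ?A"
        using x x01[OF x'] False by (intro glue_bdry front_in[OF x']) (auto simp: cube_bdry_Suc)
      show ?thesis using False kb[OF t b] gb[OF b] by (simp add: y_def K1_def)
    qed (simp add: y_def K1_def)
  qed auto
  have K11: "K1 (x, 1) = C (front d x) (z (x d))" if x: "x : topspace ?Z" for x
  proof (cases "x d <= 1/3")
    case True
    hence "z (x d) = - 3 * x d" using x01[OF x] by (simp add: z_def)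
    thus ?thesis using True x01[OF x] by (simp add: K1_def C_def)
  next
    case False
    have "D (glue d (front d x) ((3 * x d - 1) / 2)) = C (front d x) (z (x d))"
    proof -
      have "2 * ((3 * x d - 1) / 2) - 1 = z (x d)" using False by (simp add: z_def field_simps)
      thus ?thesis by (simp add: D_def front_glue[OF front_in[OF x]])
    qed
    thus ?thesis using False by (simp add: K1_def k1)
  qed
  \<comment> \<open>The back and forth of \<open>z\<close> is straightened to the path from 0 to 1, which runs through \<open>v\<close>.\<close>
  define K2 where "K2 x = C (front d (fst x)) ((1 - snd x) * z (fst x d) + snd x * fst x d)" for x
  have zb: "-1 <= z s & z s <= 1" if "0 <= s" "s <= 1" for s using that by (auto simp: z_def)
  have mixb: "-1 <= (1 - t) * z s + t * s & (1 - t) * z s + t * s <= 1"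
    if "0 <= s" "s <= 1" "0 <= t" "t <= 1" for s t
    using convexD_alt[OF convex_real_interval(5)[of "-1" 1], of "z s" s t] zb[OF that(1,2)] that by simp
  have K2: "cmap ?P B K2" unfolding K2_def
  proof (rule C[OF continuous_map_front[OF fst']])
    show "cmap ?P euclideanreal (%x. (1 - snd x) * z (fst x d) + snd x * fst x d)"
      unfolding z_def by (intro continuous_intros plast ptime) auto
  qed (use mixb p01 in auto)
  obtain y2 where y2: "cmap ?Z E y2" "!!x. x : topspace ?Z ==> p (y2 x) = K2 (x, 1)" "!!x. x : ?A ==> y2 x = y x"
  proof (rule cube_relative_lift[OF K2 y1(1) _ gA[OF y1(1)]])
    show "p (y1 x) = K2 (x, 0)" if "x : topspace ?Z" for x using y1(2)[OF that] K11[OF that] by (simp add: K2_def)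
    fix x and t :: real assume x: "x : ?A" and t: "0 <= t" "t <= 1"
    have x': "x : topspace ?Z" using x cube_bdry_sub by blast
    note f = front_in[OF x'] and xd = x01[OF x']
    have "C (front d x) (z (x d)) = C (front d x) ((1 - t) * z (x d) + t * x d)"
    proof (cases "front d x : cube_bdry d")
      case True
      thus ?thesis using Cb[OF f, of "z (x d)"] Cb[OF f, of "(1 - t) * z (x d) + t * x d"] zb mixb xd t by simp
    next
      case False
      hence "x d = 0 | x d = 1" using x by (simp add: cube_bdry_Suc)
      hence "z (x d) = x d" by (auto simp: z_def)
      thus ?thesis by (simp add: algebra_simps)
    qed
    thus "p (y1 (fst (x, t))) = K2 (x, t)" using y1(2)[OF x'] K11[OF x'] by (simp add: K2_def)
  next
    fix y2 assume "cmap ?Z E y2" "!!x. x : topspace ?Z ==> p (y2 x) = K2 (x, 1)"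
      "!!x. x : ?A ==> y2 x = y1 (fst (x, 1))"
    thus thesis using that y1(3) by simp
  qed auto
  define h where "h x = y2 (glue d (front d x) (1 - x d))" for x
  have "cmap ?Z ?Z (%x. glue d (front d x) (1 - x d))"
    using x01 by (intro continuous_map_glue continuous_map_front_id continuous_intros last) auto
  from continuous_map_compose[OF this y2(1)] have "cmap ?Z E h" by (simp add: o_def h_def[abs_def])
  moreover have "p (h x) = v x" if x: "x : topspace ?Z" for x
  proof -
    note f = front_in[OF x] and xd = x01[OF x]
    have "p (h x) = C (front d x) (1 - x d)"
      using y2(2)[OF glue_in[OF f, of "1 - x d"]] xd by (simp add: h_def K2_def front_glue[OF f])
    also have "\<dots> = v (glue d (front d x) (x d))" using xd wtop(2)[OF f] by (auto simp: C_def)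
    finally show ?thesis by (simp add: glue_front[OF x])
  qed
  moreover have "h x = u x" if x: "x : ?A" for x
  proof -
    have x': "x : topspace ?Z" using x cube_bdry_sub by blast
    note f = front_in[OF x'] and xd = x01[OF x']
    have b: "glue d (front d x) (1 - x d) : ?A" using x xd by (intro glue_bdry f) (auto simp: cube_bdry_Suc)
    have "h x = (if x d = 1 then u (glue d (front d x) 1) else e)"
      using y2(3)[OF b] yA[OF b] by (simp add: h_def front_glue[OF f])
    also have "\<dots> = u x" using J[OF x] glue_front[OF x'] x by (auto simp: cube_bdry_Suc)
    finally show ?thesis .
  qed
  ultimately show ?thesis by (auto simp: solvable_def)
qed

text \<open>Three homotopies of the cube, each preserving the boundary, end in a map that is constant on the
  complement of the top face in the boundary. Coordinates are taken relative to the centre, \<open>m\<close>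
  measures the distance to the bottom and the sides. The first one expands the cube
  horizontally by the factor 3. Then the collar where \<open>m\<close> is at least 1/3 is moved to the bottom, and
  finally pulled along the bottom to its centre.\<close>

lemma rel_lifts_cube_Suc: "rel_lifts (cube_top (Suc d)) (cube_bdry (Suc d)) E B p" unfolding rel_lifts_def
proof (intro allI impI)
  fix u v assume uv: "lift_problem (cube_top (Suc d)) (cube_bdry (Suc d)) E B p u v"
  let ?Z = "cube_top (Suc d)" and ?A = "cube_bdry (Suc d)"
  let ?P = "prod_topology ?Z unit_ivl"
  define cl :: "real => real" where "cl r = max (-1/2) (min (1/2) r)" for r
  define nrm where "nrm x = Max (insert 0 ((%i. \<bar>x i - 1/2\<bar>) ` {..<d}))" for x :: "nat => real"
  define m where "m x = max (nrm x) ((1 - x d) / 2)" for x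
  define b where "b x = max 0 (min 1 (2 - 6 * m x))" for x
  define a where "a x = max 0 (min 1 (3 - 6 * m x))" for x
  have fst': "cmap ?P ?Z fst" by (rule continuous_map_fst)
  note ptime = continuous_map_prod_time[of ?Z]
  have crd: "cmap ?P euclideanreal (%x. fst x i)" if "i < Suc d" for i
    using that by (rule continuous_map_cube_coord[OF fst'])
  have m: "cmap ?P euclideanreal (%x. m (fst x))"
  proof -
    have "cmap ?P euclideanreal (%x. nrm (fst x))"
      unfolding nrm_def by (intro continuous_map_Max continuous_intros crd) auto
    moreover have "cmap ?P euclideanreal (%x. (1 - fst x d) / 2)"
      by (intro continuous_map_real_divide continuous_intros crd) auto
    ultimately show ?thesis unfolding m_def by (rule continuous_map_real_max)
  qed
  have bc: "cmap ?P euclideanreal (%x. b (fst x))" and ac: "cmap ?P euclideanreal (%x. a (fst x))"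
    unfolding a_def b_def by (intro continuous_intros m; simp)+
  have a01: "0 <= a x & a x <= 1" and b01: "0 <= b x & b x <= 1" for x by (auto simp: a_def b_def)
  have clb: "- 1/2 <= cl r & cl r <= 1/2" for r by (auto simp: cl_def)
  have scale: "- 1/2 <= c * cl r & c * cl r <= 1/2" if "0 <= c" "c <= 1" for c r
    using that clb[of r] mult_left_mono[of "- 1/2" "cl r" c] mult_left_mono[of "cl r" "1/2" c] by auto
  have mixb: "0 <= (1 - t) * s + t * r & (1 - t) * s + t * r <= 1"
    if "0 <= s" "s <= 1" "0 <= r" "r <= 1" "0 <= t" "t <= 1" for s r t :: real
    using convexD_alt[OF convex_real_interval(5)[of 0 1], of s r t] that by simp
  define G1 where "G1 x = (\<lambda>i\<in>{..<Suc d}. if i < d then 1/2 + cl ((1 + 2 * snd x) * (fst x i - 1/2)) else fst x d)"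
    for x :: "(nat => real) \<times> real"
  define G2 where "G2 x = (\<lambda>i\<in>{..<Suc d}. if i < d then 1/2 + cl (3 * (fst x i - 1/2))
      else (1 - snd x) * fst x d + snd x * b (fst x))" for x :: "(nat => real) \<times> real"
  define G3 where "G3 x = (\<lambda>i\<in>{..<Suc d}. if i < d then 1/2 + ((1 - snd x) * 1 + snd x * a (fst x)) * cl (3 * (fst x i - 1/2))
      else b (fst x))" for x :: "(nat => real) \<times> real"
  have P: "fst x : topspace ?Z" "0 <= snd x" "snd x <= 1" "0 <= fst x d" "fst x d <= 1" if "x : topspace ?P" for x
    using that cube_coord[of "fst x" "Suc d" d] by auto
  have G1c: "cmap ?P ?Z G1" unfolding G1_def
  proof (rule continuous_map_restrict_cube)
    fix i assume i: "i < Suc d"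
    have "cmap ?P euclideanreal (%x. 1/2 + cl ((1 + 2 * snd x) * (fst x i - 1/2)))"
      unfolding cl_def by (intro continuous_intros crd[OF i] ptime) auto
    thus "cmap ?P euclideanreal (%x. if i < d then 1/2 + cl ((1 + 2 * snd x) * (fst x i - 1/2)) else fst x d)"
      using crd[of d] by simp
    show "0 <= (if i < d then 1/2 + cl ((1 + 2 * snd x) * (fst x i - 1/2)) else fst x d) \<and>
        (if i < d then 1/2 + cl ((1 + 2 * snd x) * (fst x i - 1/2)) else fst x d) <= 1" if "x : topspace ?P" for x
      using clb[of "(1 + 2 * snd x) * (fst x i - 1/2)"] P[OF that] by auto
  qed
  have G2c: "cmap ?P ?Z G2" unfolding G2_def
  proof (rule continuous_map_restrict_cube)
    fix i assume i: "i < Suc d"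
    have "cmap ?P euclideanreal (%x. 1/2 + cl (3 * (fst x i - 1/2)))"
      unfolding cl_def by (intro continuous_intros crd[OF i]) auto
    moreover have "cmap ?P euclideanreal (%x. (1 - snd x) * fst x d + snd x * b (fst x))"
      by (intro continuous_intros crd ptime bc) auto
    ultimately show "cmap ?P euclideanreal (%x. if i < d then 1/2 + cl (3 * (fst x i - 1/2))
        else (1 - snd x) * fst x d + snd x * b (fst x))" by simp
    show "0 <= (if i < d then 1/2 + cl (3 * (fst x i - 1/2)) else (1 - snd x) * fst x d + snd x * b (fst x)) \<and>
        (if i < d then 1/2 + cl (3 * (fst x i - 1/2)) else (1 - snd x) * fst x d + snd x * b (fst x)) <= 1"
      if "x : topspace ?P" for x
      using clb[of "3 * (fst x i - 1/2)"] P[OF that] mixb[of "fst x d" "b (fst x)" "snd x"] b01[of "fst x"] by auto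
  qed
  have sc01: "0 <= (1 - t) * 1 + t * a x & (1 - t) * 1 + t * a x <= 1" if "0 <= t" "t <= 1" for t x
    using mixb[of 1 "a x" t] a01[of x] that by simp
  have G3c: "cmap ?P ?Z G3" unfolding G3_def
  proof (rule continuous_map_restrict_cube)
    fix i assume i: "i < Suc d"
    have "cmap ?P euclideanreal (%x. 1/2 + ((1 - snd x) * 1 + snd x * a (fst x)) * cl (3 * (fst x i - 1/2)))"
      unfolding cl_def by (intro continuous_intros crd[OF i] ptime ac) auto
    thus "cmap ?P euclideanreal (%x. if i < d then 1/2 + ((1 - snd x) * 1 + snd x * a (fst x)) * cl (3 * (fst x i - 1/2))
        else b (fst x))" using bc by simp
    show "0 <= (if i < d then 1/2 + ((1 - snd x) * 1 + snd x * a (fst x)) * cl (3 * (fst x i - 1/2)) else b (fst x)) \<and>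
        (if i < d then 1/2 + ((1 - snd x) * 1 + snd x * a (fst x)) * cl (3 * (fst x i - 1/2)) else b (fst x)) <= 1"
      if "x : topspace ?P" for x
    proof (cases "i < d")
      case True
      thus ?thesis
        using scale[of "(1 - snd x) * 1 + snd x * a (fst x)" "3 * (fst x i - 1/2)"] sc01[of "snd x" "fst x"] P[OF that]
        by simp
    qed (use b01 in simp)
  qed
  have inA: "y : ?A" if "y : topspace ?Z" "i < d & (y i = 0 | y i = 1) | y d = 0 | y d = 1" for y i
  proof -
    have "\<exists>i<Suc d. y i = 0 | y i = 1" using that(2) less_SucI[of i d] by blast
    thus ?thesis using that(1) by (simp add: cube_bdry_def)
  qed
  have nrm_ge: "\<bar>x i - 1/2\<bar> <= nrm x" if "i < d" for x i
    unfolding nrm_def using that by (intro Max_ge) auto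
  have nrm_attained: "\<exists>i<d. \<bar>x i - 1/2\<bar> = nrm x" if "nrm x ~= 0" for x
  proof -
    have "nrm x : insert 0 ((%i. \<bar>x i - 1/2\<bar>) ` {..<d})" unfolding nrm_def by (rule Max_in) auto
    thus ?thesis using that by auto
  qed
  have nrm0: "0 <= nrm x" for x unfolding nrm_def by (intro Max_ge) auto
  have cl3: "cl (3 * (r - 1/2)) = 1/2 | cl (3 * (r - 1/2)) = -1/2" if "1/6 <= \<bar>r - 1/2\<bar>" for r
    using that by (auto simp: cl_def max_def min_def abs_if split: if_splits)
  have bdry_cases: "(\<exists>i<d. \<bar>x i - 1/2\<bar> = 1/2) | x d = 0 | x d = 1" if "x : ?A" for x
    using that by (auto simp: cube_bdry_def less_Suc_eq)
  have m_low: "1/2 <= m x" if "(\<exists>i<d. \<bar>x i - 1/2\<bar> = 1/2) | x d = 0" for x using that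
  proof
    assume "\<exists>i<d. \<bar>x i - 1/2\<bar> = 1/2"
    then obtain i where "i < d" "\<bar>x i - 1/2\<bar> = 1/2" by blast
    hence "1/2 <= nrm x" using nrm_ge[of i x] by simp
    thus ?thesis unfolding m_def by linarith
  qed (simp add: m_def)
  have m_top: "m x = nrm x" if "x d = 1" for x using that nrm0[of x] by (simp add: m_def)
  have G1A: "G1 (x, t) : ?A" if x: "x : ?A" and t: "0 <= t" "t <= 1" for x t
  proof -
    have xt: "(x, t) : topspace ?P" using x t cube_bdry_sub by auto
    from bdry_cases[OF x] consider i where "i < d" "\<bar>x i - 1/2\<bar> = 1/2" | "x d = 0 | x d = 1" by blast
    thus ?thesis
    proof cases
      case 1
      hence "x i - 1/2 = 1/2 | x i - 1/2 = -1/2" by linarith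
      hence "cl ((1 + 2 * t) * (x i - 1/2)) = 1/2 | cl ((1 + 2 * t) * (x i - 1/2)) = -1/2"
        using t by (auto simp: cl_def)
      thus ?thesis using 1(1) by (intro inA[of _ i] continuous_map_funspace[OF G1c xt]) (auto simp: G1_def)
    next
      case 2
      thus ?thesis by (intro inA[of _ 0] continuous_map_funspace[OF G1c xt]) (auto simp: G1_def)
    qed
  qed
  have G2A: "G2 (x, t) : ?A" if x: "x : ?A" and t: "0 <= t" "t <= 1" for x t
  proof -
    have xt: "(x, t) : topspace ?P" using x t cube_bdry_sub by auto
    show ?thesis
    proof (cases "\<exists>i<d. 1/6 <= \<bar>x i - 1/2\<bar>")
      case True
      then obtain i where i: "i < d" "1/6 <= \<bar>x i - 1/2\<bar>" by blast
      show ?thesis using i(1) cl3[OF i(2)]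
        by (intro inA[of _ i] continuous_map_funspace[OF G2c xt]) (auto simp: G2_def)
    next
      case False
      hence small: "nrm x < 1/6" using nrm_attained[of x] by force
      have "x d = 0 | x d = 1" using bdry_cases[OF x] False by fastforce
      hence "(1 - t) * x d + t * b x = 0 | (1 - t) * x d + t * b x = 1"
      proof
        assume 0: "x d = 0"
        thus ?thesis using m_low[of x] by (simp add: b_def)
      next
        assume 1: "x d = 1"
        thus ?thesis using m_top[of x] small by (simp add: b_def)
      qed
      thus ?thesis by (intro inA[of _ 0] continuous_map_funspace[OF G2c xt]) (auto simp: G2_def)
    qed
  qed
  have G3A: "G3 (x, t) : ?A" if x: "x : ?A" and t: "0 <= t" "t <= 1" for x t
  proof -
    have xt: "(x, t) : topspace ?P" using x t cube_bdry_sub by auto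
    show ?thesis
    proof (cases "b x = 0 | b x = 1")
      case True
      thus ?thesis by (intro inA[of _ 0] continuous_map_funspace[OF G3c xt]) (auto simp: G3_def)
    next
      case False
      hence mb: "1/6 < m x" "m x < 1/3" by (auto simp: b_def max_def min_def split: if_splits)
      hence "x d = 1" using bdry_cases[OF x] m_low[of x] by fastforce
      hence n: "m x = nrm x" by (rule m_top)
      then obtain i where i: "i < d" "\<bar>x i - 1/2\<bar> = m x" using nrm_attained[of x] mb by auto
      have "a x = 1" using mb by (simp add: a_def)
      thus ?thesis using i cl3[of "x i"] mb
        by (intro inA[of _ i] continuous_map_funspace[OF G3c xt]) (auto simp: G3_def)
    qed
  qed
  let ?c = "\<lambda>i\<in>{..<Suc d}. if i < d then 1/2 else (0::real)"
  have crush: "G3 (x, 1) = ?c" if "(\<exists>i<d. \<bar>x i - 1/2\<bar> = 1/2) | x d = 0" for x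
    using m_low[OF that] by (auto simp: G3_def a_def b_def fun_eq_iff)
  have step: "solvable ?Z ?A E p (%x. u (G (x, 0))) (%x. v (G (x, 0)))"
    if "cmap ?P ?Z G" "!!x t. x : ?A ==> 0 <= t ==> t <= 1 ==> G (x, t) : ?A"
      "solvable ?Z ?A E p (%x. u (G (x, 1))) (%x. v (G (x, 1)))" for G by (rule cube_solvable_homotopy[OF uv that])
  have slice: "cmap ?Z ?Z (%x. G3 (x, 1))"
  proof -
    have "cmap ?Z ?P (%x. (x, 1))" by (rule continuous_map_pair_unit) simp_all
    from continuous_map_compose[OF this G3c] show ?thesis by (simp add: o_def)
  qed
  have u: "cmap (subtopology ?Z ?A) E u" and v: "cmap ?Z B v"
    and puv: "!!x. x : ?A ==> p (u x) = v x" using uv by (auto simp: lift_problem_def)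
  have sliceA: "cmap (subtopology ?Z ?A) (subtopology ?Z ?A) (%x. G3 (x, 1))"
    using continuous_map_from_subtopology[OF slice] G3A[of _ 1] by (simp add: continuous_map_in_subtopology image_subset_iff)
  have cA: "?c : ?A" by (intro inA[of _ 0] restrict_cube) auto
  have s3: "solvable ?Z ?A E p (%x. u (G3 (x, 1))) (%x. v (G3 (x, 1)))"
  proof (rule solvable_crushed)
    show "lift_problem ?Z ?A E B p (%x. u (G3 (x, 1))) (%x. v (G3 (x, 1)))"
      using continuous_map_compose[OF sliceA u] continuous_map_compose[OF slice v] puv G3A[of _ 1]
      by (simp add: lift_problem_def o_def)
    show "u (G3 (x, 1)) = u ?c" if x: "x : ?A" and "x d = 0 | front d x : cube_bdry d" for x
    proof -
      have "(\<exists>i<d. \<bar>x i - 1/2\<bar> = 1/2) | x d = 0"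
        using that(2) by (auto simp: cube_bdry_def front_def)
      from crush[OF this] show ?thesis by simp
    qed
    show "u ?c : topspace E" using continuous_map_funspace[OF u, of ?c] cA cube_bdry_sub[of "Suc d"] by auto
  qed
  have "G2 (x, 1) = G3 (x, 0)" for x by (simp add: G2_def G3_def cong: if_cong)
  moreover have "G1 (x, 1) = G2 (x, 0)" for x by (simp add: G1_def G2_def cong: if_cong)
  ultimately have "solvable ?Z ?A E p (%x. u (G1 (x, 0))) (%x. v (G1 (x, 0)))"
    using step[OF G1c G1A] step[OF G2c G2A] step[OF G3c G3A s3] by simp
  moreover have "G1 (x, 0) = x" if "x : topspace ?Z" for x
  proof -
    have "cl (x i - 1/2) = x i - 1/2" if "i < d" for i
      using cube_coord[OF \<open>x : topspace ?Z\<close>, of i] that by (simp add: cl_def)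
    thus ?thesis using that by (auto simp: G1_def fun_eq_iff topspace_cube_top PiE_iff extensional_def less_Suc_eq)
  qed
  ultimately show "solvable ?Z ?A E p u v" using cube_bdry_sub[of "Suc d"] by (auto simp: solvable_def subset_iff)
qed

lemma rel_lifts_cube: "rel_lifts (cube_top n) (cube_bdry n) E B p"
  using rel_lifts_cube_0 rel_lifts_cube_Suc by (cases n) auto

end

section \<open>Lifting over cubical complexes\<close>

lemma rel_lifts_homeomorphic:
  assumes h: "homeomorphic_maps Z Z' f g" and A: "A \<subseteq> topspace Z" and lifts: "rel_lifts Z A E B p"
  shows "rel_lifts Z' (f ` A) E B p" unfolding rel_lifts_def
proof (intro allI impI)
  fix u v assume uv: "lift_problem Z' (f ` A) E B p u v"
  have f: "cmap Z Z' f" and g: "cmap Z' Z g"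
    and gf: "!!z. z : topspace Z ==> g (f z) = z" and fg: "!!z. z : topspace Z' ==> f (g z) = z"
    using h by (auto simp: homeomorphic_maps_def)
  have u: "cmap (subtopology Z' (f ` A)) E u" and v: "cmap Z' B v"
    and puv: "!!a. a : A ==> p (u (f a)) = v (f a)" using uv by (auto simp: lift_problem_def)
  have "cmap (subtopology Z A) (subtopology Z' (f ` A)) f"
    using continuous_map_from_subtopology[OF f, of A] by (auto simp: continuous_map_in_subtopology)
  from continuous_map_compose[OF this u] continuous_map_compose[OF f v]
  have "lift_problem Z A E B p (u \<circ> f) (v \<circ> f)" using puv by (simp add: lift_problem_def)
  hence "solvable Z A E p (u \<circ> f) (v \<circ> f)" using lifts by (simp add: rel_lifts_def)
  then obtain k where k: "cmap Z E k" "!!a. a : A ==> k a = u (f a)"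
    "!!z. z : topspace Z ==> p (k z) = v (f z)" by (auto simp: solvable_def)
  have "cmap Z' E (k \<circ> g)" by (rule continuous_map_compose[OF g k(1)])
  moreover have "(k \<circ> g) a = u a" if "a : f ` A" for a using that k(2) gf A by auto
  moreover have "p ((k \<circ> g) z) = v z" if "z : topspace Z'" for z
    using k(3)[OF continuous_map_funspace[OF g that]] fg[OF that] by simp
  ultimately show "solvable Z' (f ` A) E p u v" unfolding solvable_def by blast
qed

definition grid_top :: "nat => nat => (nat => real) topology" where
  "grid_top n L = product_topology (%_. top_of_set {0..real L}) {..<n}"

lemma topspace_grid_top: "topspace (grid_top n L) = {..<n} \<rightarrow>\<^sub>E {0..real L}"
  by (simp add: grid_top_def)

lemma continuous_map_grid_top:
  "cmap X (grid_top n L) f \<longleftrightarrow>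
     (\<forall>x\<in>topspace X. f x : topspace (grid_top n L)) \<and>
     (\<forall>i<n. cmap X euclideanreal (%x. f x i))"
  unfolding grid_top_def continuous_map_componentwise continuous_map_in_subtopology
  by (auto simp: PiE_iff Pi_iff image_subset_iff)

lemma continuous_map_grid_proj: "i < n ==> cmap (grid_top n L) euclideanreal (%x. x i)"
  using continuous_map_grid_top[of "grid_top n L" n L "%x. x"] by simp

text \<open>The face with lowest vertex \<open>b\<close> in the directions \<open>D\<close> of the subdivision into unit cubes.\<close>

definition gcell :: "nat => (nat => nat) => nat set => (nat => real) set" where
  "gcell n b D = {x : extensional {..<n}. \<forall>i<n.
     (if i : D then real (b i) <= x i & x i <= real (b i) + 1 else x i = real (b i))}"

definition gbdry :: "nat => (nat => nat) => nat set => (nat => real) set" where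
  "gbdry n b D = {x : gcell n b D. \<exists>i\<in>D. x i = real (b i) | x i = real (b i) + 1}"

definition gcells :: "nat => nat => ((nat => nat) \<times> nat set) set" where
  "gcells n L = {(b, D). b : {..<n} \<rightarrow>\<^sub>E {..L} & D \<subseteq> {..<n} & (\<forall>i\<in>D. b i < L)}"

lemma finite_gcells: "finite (gcells n L)"
proof (rule finite_subset)
  show "gcells n L \<subseteq> ({..<n} \<rightarrow>\<^sub>E {..L}) \<times> Pow {..<n}" by (auto simp: gcells_def)
  show "finite (({..<n} \<rightarrow>\<^sub>E {..L}) \<times> Pow {..<n})"
    by (intro finite_cartesian_product finite_PiE) auto
qed

lemma gcell_in_grid: assumes "(b, D) : gcells n L" shows "gcell n b D \<subseteq> topspace (grid_top n L)"
proof
  fix x assume x: "x : gcell n b D"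
  have "0 <= x i & x i <= real L" if i: "i < n" for i
  proof (cases "i : D")
    case True
    hence "b i + 1 <= L" using assms by (auto simp: gcells_def)
    hence "real (b i) + 1 <= real L" by linarith
    thus ?thesis using x i True by (auto simp: gcell_def)
  next
    case False
    thus ?thesis using x i assms by (auto simp: gcell_def gcells_def PiE_iff)
  qed
  thus "x : topspace (grid_top n L)" using x by (auto simp: topspace_grid_top PiE_iff gcell_def)
qed

lemma closedin_gcell:
  assumes "(b, D) : gcells n L" shows "closedin (grid_top n L) (gcell n b D)"
proof -
  define f where "f x = (\<Sum>i<n. if i : D then max 0 (real (b i) - x i) + max 0 (x i - (real (b i) + 1)) else \<bar>x i - real (b i)\<bar>)"
    for x :: "nat => real"
  have "cmap (grid_top n L) euclideanreal
      (%x. if i : D then max 0 (real (b i) - x i) + max 0 (x i - (real (b i) + 1)) else \<bar>x i - real (b i)\<bar>)"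
    if "i < n" for i
  proof (cases "i : D")
    case True
    thus ?thesis by (simp only: if_True) (intro continuous_intros continuous_map_grid_proj that; simp)
  next
    case False
    thus ?thesis by (simp only: if_False) (intro continuous_intros continuous_map_grid_proj that; simp)
  qed
  hence "cmap (grid_top n L) euclideanreal f" unfolding f_def by (intro continuous_map_sum) auto
  hence "closedin (grid_top n L) {x : topspace (grid_top n L). f x : {0}}"
    by (rule closedin_continuous_map_preimage) simp
  moreover have "{x : topspace (grid_top n L). f x : {0}} = gcell n b D"
  proof -
    have nonneg: "0 <= (if i : D then max 0 (real (b i) - x i) + max 0 (x i - (real (b i) + 1)) else \<bar>x i - real (b i)\<bar>)"
      for x i by simp
    have iff: "f x = 0 \<longleftrightarrow> (\<forall>i<n. (if i : D then real (b i) <= x i & x i <= real (b i) + 1 else x i = real (b i)))" for x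
    proof -
      have "(if i : D then max 0 (real (b i) - x i) + max 0 (x i - (real (b i) + 1)) else \<bar>x i - real (b i)\<bar>) = 0 \<longleftrightarrow>
          (if i : D then real (b i) <= x i & x i <= real (b i) + 1 else x i = real (b i))" for i
        by (cases "i : D") (simp_all, linarith)
      thus ?thesis
        unfolding f_def by (subst sum_nonneg_eq_0_iff[OF _ nonneg]) (simp_all only: finite_lessThan ball_simps lessThan_iff Ball_def)
    qed
    show ?thesis using gcell_in_grid[OF assms] iff by (auto simp: gcell_def topspace_grid_top PiE_iff)
  qed
  ultimately show ?thesis by simp
qed

text \<open>In the interior of a face the free coordinates are not integers, so the other face must extend in
  these directions as well, over the same unit intervals.\<close>

lemma gcell_interior:
  assumes D: "D \<subseteq> {..<n}" "D' \<subseteq> {..<n}" and x: "x : gcell n b D" "x ~: gbdry n b D" "x : gcell n b' D'"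
  shows "D \<subseteq> D'" "gcell n b D \<subseteq> gcell n b' D'" "D' \<subseteq> D ==> i < n ==> b' i = b i"
proof -
  have inD: "i : D' & b' i = b i" if i: "i : D" for i
  proof -
    have n: "i < n" using i D by auto
    have lt: "real (b i) < x i" "x i < real (b i) + 1" using x(1,2) i n by (auto simp: gcell_def gbdry_def less_le)
    have "i : D'"
    proof (rule ccontr)
      assume "i ~: D'"
      hence "x i = real (b' i)" using x(3) n by (auto simp: gcell_def)
      hence "real (b i) < real (b' i)" "real (b' i) < real (b i + 1)" using lt by simp_all
      thus False by (simp only: of_nat_less_iff)
    qed
    moreover have "real (b' i) <= x i" "x i <= real (b' i) + 1" using x(3) n calculation by (auto simp: gcell_def)
    hence "real (b i) < real (b' i + 1)" "real (b' i) < real (b i + 1)" using lt by simp_all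
    hence "b' i = b i" by (simp only: of_nat_less_iff)
    ultimately show ?thesis by simp
  qed
  thus "D \<subseteq> D'" by blast
  have outD: "x i = real (b i)" if "i < n" "i ~: D" for i using x(1) that by (auto simp: gcell_def)
  show "gcell n b D \<subseteq> gcell n b' D'"
  proof
    fix y assume y: "y : gcell n b D"
    have "if i : D' then real (b' i) <= y i & y i <= real (b' i) + 1 else y i = real (b' i)" if i: "i < n" for i
    proof (cases "i : D")
      case True
      thus ?thesis using inD[OF True] y i by (auto simp: gcell_def)
    next
      case False
      hence "y i = x i" using y i outD[OF i False] by (auto simp: gcell_def)
      thus ?thesis using x(3) i by (auto simp: gcell_def)
    qed
    thus "y : gcell n b' D'" using y by (auto simp: gcell_def)
  qed
  show "b' i = b i" if "D' \<subseteq> D" "i < n"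
  proof (cases "i : D")
    case False
    hence "i ~: D'" using that by blast
    hence "x i = real (b' i)" using x(3) that by (auto simp: gcell_def)
    thus ?thesis using outD[OF that(2) False] by simp
  qed (use inD in blast)
qed

lemma gbdry_lower_face:
  assumes c: "(b, D) : gcells n L" and x: "x : gbdry n b D"
  obtains b' D' where "(b', D') : gcells n L" "card D' < card D" "x : gcell n b' D'"
proof -
  obtain i where i: "i : D" "x i = real (b i) | x i = real (b i) + 1" using x by (auto simp: gbdry_def)
  have D: "D \<subseteq> {..<n}" and b: "b : {..<n} \<rightarrow>\<^sub>E {..L}" and bL: "!!i. i : D ==> b i < L"
    using c by (auto simp: gcells_def)
  have xc: "x : gcell n b D" using x by (simp add: gbdry_def)
  define b' where "b' = (if x i = real (b i) then b else b(i := Suc (b i)))"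
  have fin: "finite D" using D finite_subset by blast
  have "(b', D - {i}) : gcells n L"
    using D b bL i(1) by (auto simp: gcells_def b'_def PiE_iff extensional_def Suc_le_eq)
  moreover have "card (D - {i}) < card D" using fin i(1) by (rule card_Diff1_less)
  moreover have "x : gcell n b' (D - {i})" using xc i D unfolding gcell_def b'_def by auto
  ultimately show ?thesis by (rule that)
qed

lemma gcells_cover:
  assumes x: "x : topspace (grid_top n L)"
  obtains b D where "(b, D) : gcells n L" "x : gcell n b D"
proof -
  define b where "b = (\<lambda>i\<in>{..<n}. nat \<lfloor>x i\<rfloor>)"
  define D where "D = {i. i < n & x i ~= real (b i)}"
  have x01: "0 <= x i" "x i <= real L" if "i < n" for i using x that by (auto simp: topspace_grid_top PiE_iff)
  have b: "real (b i) <= x i" "x i < real (b i) + 1" if "i < n" for i using x01[OF that] that by (auto simp: b_def)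
  have bL: "b i <= L" if "i < n" for i using b(1)[OF that] x01(2)[OF that] by linarith
  have "b i < L" if "i : D" for i
  proof -
    have "real (b i) < real L" using b[of i] x01[of i] that unfolding D_def by fastforce
    thus ?thesis by simp
  qed
  hence "(b, D) : gcells n L" using bL by (auto simp: gcells_def D_def b_def)
  moreover have "x : gcell n b D" using b x less_imp_le by (auto simp: gcell_def D_def topspace_grid_top PiE_iff)
  ultimately show ?thesis by (rule that)
qed

lemma homeomorphic_maps_gcell:
  assumes c: "(b, D) : gcells n L"
  shows "homeomorphic_maps (cube_top (card D)) (subtopology (grid_top n L) (gcell n b D))
      (%y. \<lambda>i\<in>{..<n}. if i : D then real (b i) + y (pos_in D i) else real (b i))
      (%x. \<lambda>k\<in>{..<card D}. x (sorted_list_of_set D ! k) - real (b (sorted_list_of_set D ! k)))"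
    (is "homeomorphic_maps ?Z ?Z' ?f ?g")
  and "(%y. \<lambda>i\<in>{..<n}. if i : D then real (b i) + y (pos_in D i) else real (b i)) ` cube_bdry (card D) = gbdry n b D"
proof -
  let ?s = "%k. sorted_list_of_set D ! k"
  have D: "D \<subseteq> {..<n}" using c by (auto simp: gcells_def)
  hence fin: "finite D" using finite_subset by blast
  note s = pos_in_nth[OF fin] and q = sorted_nth_pos_in[OF fin]
  have fcell: "?f y : gcell n b D" if "y : topspace ?Z" for y using cube_coord[OF that] q by (auto simp: gcell_def)
  have gcube: "?g x : topspace ?Z" if x: "x : gcell n b D" for x
  proof (rule restrict_cube)
    fix k assume "k < card D"
    hence "?s k : D" "?s k < n" using s(1)[of k] D by auto
    thus "0 <= x (?s k) - real (b (?s k)) & x (?s k) - real (b (?s k)) <= 1" using x by (auto simp: gcell_def)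
  qed
  have gf: "?g (?f y) = y" if y: "y : topspace ?Z" for y
  proof (rule PiE_ext[of _ "{..<card D}" "%_. {0..1}"])
    fix k assume "k : {..<card D}"
    hence k: "k < card D" by simp
    thus "?g (?f y) k = y k" using s[OF k] D by auto
  qed (use y gcube[OF fcell[OF y]] topspace_cube_top in auto)
  have fg: "?f (?g x) = x" if x: "x : gcell n b D" for x
  proof (rule extensionalityI[of _ "{..<n}"])
    fix i assume "i : {..<n}"
    thus "?f (?g x) i = x i" using q[of i] x by (auto simp: gcell_def)
  qed (use x in \<open>auto simp: gcell_def\<close>)
  have "cmap ?Z (grid_top n L) ?f" unfolding continuous_map_grid_top
  proof (intro conjI ballI allI impI)
    fix y assume "y : topspace ?Z"
    thus "?f y : topspace (grid_top n L)" using fcell gcell_in_grid[OF c] by blast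
  next
    fix i assume i: "i < n"
    show "cmap ?Z euclideanreal (%y. ?f y i)"
    proof (cases "i : D")
      case True
      have "cmap ?Z euclideanreal (%y. real (b i) + y (pos_in D i))"
        by (intro continuous_intros continuous_map_cube_proj q(1)[OF True]) simp
      thus ?thesis using i True by simp
    next
      case False
      thus ?thesis using i by simp
    qed
  qed
  hence f: "cmap ?Z ?Z' ?f" using fcell by (auto simp: continuous_map_in_subtopology)
  have g: "cmap ?Z' ?Z ?g"
  proof (rule continuous_map_restrict_cube)
    fix k assume k: "k < card D"
    hence "?s k < n" using s(1)[OF k] D by auto
    thus "cmap ?Z' euclideanreal (%x. x (?s k) - real (b (?s k)))"
      by (intro continuous_intros continuous_map_from_subtopology continuous_map_grid_proj) simp_all
    show "0 <= x (?s k) - real (b (?s k)) & x (?s k) - real (b (?s k)) <= 1" if "x : topspace ?Z'" for x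
      using cube_coord[OF gcube k, of x] that k by simp
  qed
  show "homeomorphic_maps ?Z ?Z' ?f ?g" unfolding homeomorphic_maps_def using f g gf fg by auto
  show "?f ` cube_bdry (card D) = gbdry n b D"
  proof (intro equalityI subsetI)
    fix x assume "x : ?f ` cube_bdry (card D)"
    then obtain y k where y: "y : topspace ?Z" "x = ?f y" "k < card D" "y k = 0 | y k = 1"
      by (auto simp: cube_bdry_def)
    hence "?s k : D" "x (?s k) = real (b (?s k)) | x (?s k) = real (b (?s k)) + 1" using s[OF y(3)] D by auto
    thus "x : gbdry n b D" using fcell[OF y(1)] y(2) unfolding gbdry_def by blast
  next
    fix x assume x: "x : gbdry n b D"
    then obtain i where i: "i : D" "x i = real (b i) | x i = real (b i) + 1" by (auto simp: gbdry_def)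
    have xc: "x : gcell n b D" using x by (simp add: gbdry_def)
    have "?g x (pos_in D i) = 0 | ?g x (pos_in D i) = 1" using q[OF i(1)] i(2) by auto
    hence "?g x : cube_bdry (card D)" using gcube[OF xc] q(1)[OF i(1)] unfolding cube_bdry_def by blast
    from imageI[OF this, of ?f] show "x : ?f ` cube_bdry (card D)" by (simp only: fg[OF xc])
  qed
qed

context
  fixes E B :: "'a univ topology" and p and haus :: bool
  assumes fib: "Hurewicz_fibration haus E B p" and weq: "weak_homotopy_equivalence E B p"
begin

lemma rel_lifts_gcell:
  assumes c: "(b, D) : gcells n L"
  shows "rel_lifts (subtopology (grid_top n L) (gcell n b D)) (gbdry n b D) E B p"
  using rel_lifts_homeomorphic[OF homeomorphic_maps_gcell(1)[OF c] cube_bdry_sub rel_lifts_cube[OF fib weq]]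
  unfolding homeomorphic_maps_gcell(2)[OF c] .

text \<open>Two faces meet in a common face, so that a face meets the part treated before it in its boundary or
  lies in it. This allows induction on the dimension.\<close>

lemma rel_lifts_grid:
  assumes LL: "\<L> \<subseteq> gcells n L"
  shows "rel_lifts (grid_top n L) (\<Union>(b, D)\<in>\<L>. gcell n b D) E B p" unfolding rel_lifts_def
proof (intro allI impI)
  let ?Z = "grid_top n L" and ?A = "\<Union>(b, D)\<in>\<L>. gcell n b D"
  fix u v assume uv: "lift_problem ?Z ?A E B p u v"
  hence u: "cmap (subtopology ?Z ?A) E u" and v: "cmap ?Z B v"
    and puv: "!!a. a : ?A ==> p (u a) = v a" by (auto simp: lift_problem_def)
  define low where "low d = {(b, D) : gcells n L. card D < d}" for d
  define X where "X d = (\<Union>(b, D)\<in>\<L> \<union> low d. gcell n b D)" for d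
  have XZ: "X d \<subseteq> topspace ?Z" for d using LL gcell_in_grid by (fastforce simp: X_def low_def)
  have closedX: "closedin ?Z (X d)" for d unfolding X_def
  proof (rule closedin_Union)
    have "\<L> \<union> low d \<subseteq> gcells n L" using LL by (auto simp: low_def)
    hence "finite (\<L> \<union> low d)" by (rule finite_subset[OF _ finite_gcells])
    thus "finite ((%(b, D). gcell n b D) ` (\<L> \<union> low d))" by simp
    show "closedin ?Z S" if "S : (%(b, D). gcell n b D) ` (\<L> \<union> low d)" for S
      using that LL by (auto simp: low_def intro: closedin_gcell)
  qed
  have lift: "\<exists>h. cmap (subtopology ?Z (X d)) E h & (\<forall>a\<in>?A. h a = u a) & (\<forall>z\<in>X d. p (h z) = v z)" for d
  proof (induction d)
    case 0
    have "X 0 = ?A" by (simp add: X_def low_def)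
    thus ?case by (simp only:) (intro exI[of _ u] conjI ballI u refl puv)
  next
    case (Suc d)
    then obtain h where h: "cmap (subtopology ?Z (X d)) E h" and hu: "!!a. a : ?A ==> h a = u a"
      and ph: "!!z. z : X d ==> p (h z) = v z" by blast
    define new where "new = {(b, D) : gcells n L. card D = d & \<not> gcell n b D \<subseteq> X d}"
    have bdry: "gbdry n b D \<subseteq> X d" if c: "(b, D) : new" for b D
    proof
      fix x assume "x : gbdry n b D"
      moreover have "(b, D) : gcells n L" "card D = d" using c by (auto simp: new_def)
      ultimately obtain b' D' where "(b', D') : gcells n L" "card D' < d" "x : gcell n b' D'"
        using gbdry_lower_face by blast
      thus "x : X d" by (auto simp: X_def low_def)
    qed
    have int: "x : gbdry n b D" if c: "(b, D) : new" and x: "x : gcell n b D" "x : X d" for b D x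
    proof (rule ccontr)
      assume nb: "x ~: gbdry n b D"
      obtain b' D' where c': "(b', D') : \<L> \<union> low d" "x : gcell n b' D'" using x(2) by (auto simp: X_def)
      have D: "D \<subseteq> {..<n}" "D' \<subseteq> {..<n}" using c c' LL by (auto simp: new_def low_def gcells_def)
      have "gcell n b D \<subseteq> gcell n b' D'" using gcell_interior(2)[OF D x(1) nb c'(2)] .
      hence "gcell n b D \<subseteq> X d" using c'(1) by (auto simp: X_def)
      thus False using c by (simp add: new_def)
    qed
    have "\<exists>k. cmap (subtopology ?Z (gcell n b D)) E k & (\<forall>a\<in>gbdry n b D. k a = h a) \<and>
        (\<forall>z\<in>gcell n b D. p (k z) = v z)" if c: "(b, D) : new" for b D
    proof -
      have cg: "(b, D) : gcells n L" using c by (simp add: new_def)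
      have bc: "gbdry n b D \<subseteq> gcell n b D" by (auto simp: gbdry_def)
      have "lift_problem (subtopology ?Z (gcell n b D)) (gbdry n b D) E B p h v" unfolding lift_problem_def
      proof (intro conjI ballI)
        have "subtopology (subtopology ?Z (gcell n b D)) (gbdry n b D) = subtopology (subtopology ?Z (X d)) (gbdry n b D)"
          using bc bdry[OF c] by (simp add: subtopology_subtopology Int_absorb1 Int_absorb2)
        thus "cmap (subtopology (subtopology ?Z (gcell n b D)) (gbdry n b D)) E h"
          using continuous_map_from_subtopology[OF h] by simp
        show "cmap (subtopology ?Z (gcell n b D)) B v" by (rule continuous_map_from_subtopology[OF v])
        show "p (h a) = v a" if "a : gbdry n b D" for a using ph bdry[OF c] that by blast
      qed
      hence "solvable (subtopology ?Z (gcell n b D)) (gbdry n b D) E p h v"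
        using rel_lifts_gcell[OF cg] by (simp add: rel_lifts_def)
      moreover have "topspace (subtopology ?Z (gcell n b D)) = gcell n b D" using gcell_in_grid[OF cg] by auto
      ultimately show ?thesis by (simp add: solvable_def)
    qed
    hence "\<forall>c. \<exists>k. c : new --> cmap (subtopology ?Z (gcell n (fst c) (snd c))) E k \<and>
        (\<forall>a\<in>gbdry n (fst c) (snd c). k a = h a) & (\<forall>z\<in>gcell n (fst c) (snd c). p (k z) = v z)"
      by (simp add: split_paired_all)
    then obtain k where "\<forall>c. c : new --> cmap (subtopology ?Z (gcell n (fst c) (snd c))) E (k c) \<and>
        (\<forall>a\<in>gbdry n (fst c) (snd c). k c a = h a) & (\<forall>z\<in>gcell n (fst c) (snd c). p (k c z) = v z)"
      by (rule choice[THEN exE])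
    hence k: "!!b D. (b, D) : new ==> cmap (subtopology ?Z (gcell n b D)) E (k (b, D))"
      "!!b D a. (b, D) : new ==> a : gbdry n b D ==> k (b, D) a = h a"
      "!!b D z. (b, D) : new ==> z : gcell n b D ==> p (k (b, D) z) = v z" by force+
    define T where "T c = (case c of None => X d | Some (b, D) => gcell n b D)" for c
    define f where "f c = (case c of None => h | Some c => k c)" for c
    let ?I = "insert None (Some ` new)"
    have XS: "X (Suc d) = (\<Union>c\<in>?I. T c)"
    proof (intro equalityI subsetI)
      fix x assume "x : X (Suc d)"
      then obtain b D where c: "(b, D) : \<L> \<union> low (Suc d)" "x : gcell n b D" by (auto simp: X_def)
      show "x : (\<Union>c\<in>?I. T c)"
      proof (cases "x : X d")
        case True
        thus ?thesis by (auto simp: T_def)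
      next
        case False
        hence "(b, D) : new" using c by (auto simp: X_def low_def new_def less_Suc_eq)
        hence "x : T (Some (b, D))" "Some (b, D) : ?I" using c by (auto simp: T_def)
        thus ?thesis by blast
      qed
    next
      fix x assume "x : (\<Union>c\<in>?I. T c)"
      hence "x : X d | (\<exists>b D. (b, D) : new & x : gcell n b D)" by (auto simp: T_def)
      thus "x : X (Suc d)" by (auto simp: X_def low_def new_def)
    qed
    have Tsub: "T c \<subseteq> X (Suc d)" if "c : ?I" for c using XS that by blast
    let ?Y = "subtopology ?Z (X (Suc d))"
    have tsY: "topspace ?Y = X (Suc d)" using XZ[of "Suc d"] by auto
    have agree: "k c x = h x" if "c : new" "x : T (Some c)" "x : X d" for c x
      using that k(2)[OF _ int, of "fst c" "snd c" x] by (cases c) (auto simp: T_def)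
    obtain h' where h': "cmap ?Y E h'" "!!x c. c : ?I ==> x : topspace ?Y \<inter> T c ==> h' x = f c x"
    proof (rule pasting_lemma_exists_closed[of ?I ?Y T E f])
      have "finite new" using finite_subset[OF _ finite_gcells, of new n L] by (auto simp: new_def)
      thus "finite ?I" by simp
      show "topspace ?Y \<subseteq> (\<Union>c\<in>?I. T c)" using tsY XS by simp
      show "closedin ?Y (T c)" if c: "c : ?I" for c
      proof -
        have "closedin ?Z (T c)" using c closedX by (auto simp: T_def new_def closedin_gcell)
        thus ?thesis using Tsub[OF c] by (simp add: closedin_subset_topspace)
      qed
      show "cmap (subtopology ?Y (T c)) E (f c)" if c: "c : ?I" for c
      proof -
        have "subtopology ?Y (T c) = subtopology ?Z (T c)"
          using Tsub[OF c] by (simp add: subtopology_subtopology Int_absorb1)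
        thus ?thesis using c h k(1) by (auto simp: T_def f_def)
      qed
      show "f c x = f c' x" if c: "c : ?I" "c' : ?I" and x: "x : topspace ?Y \<inter> T c \<inter> T c'" for c c' x
      proof (cases c)
        case None
        thus ?thesis using c x agree by (cases c') (auto simp: f_def T_def)
      next
        case (Some e)
        show ?thesis
        proof (cases c')
          case None
          thus ?thesis using Some c x agree[of e x] by (auto simp: f_def T_def)
        next
          case (Some e')
          obtain b D b' D' where e: "e = (b, D)" "e' = (b', D')" by (cases e; cases e') auto
          have new: "(b, D) : new" "(b', D') : new" using c \<open>c = Some e\<close> Some e by auto
          have xc: "x : gcell n b D" "x : gcell n b' D'" using x \<open>c = Some e\<close> Some e by (auto simp: T_def)
          have cg: "(b, D) : gcells n L" "(b', D') : gcells n L" "card D = card D'" using new by (auto simp: new_def)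
          hence Ds: "D \<subseteq> {..<n}" "D' \<subseteq> {..<n}" by (auto simp: gcells_def)
          have same: "(b, D) = (b', D')"
            if "x : gcell n b D" "x ~: gbdry n b D" "x : gcell n b' D'" "(b, D) : gcells n L" "(b', D') : gcells n L"
              "card D = card D'" "D \<subseteq> {..<n}" "D' \<subseteq> {..<n}" for b D b' D'
          proof -
            have "D \<subseteq> D'" by (rule gcell_interior(1)[OF that(7,8,1,2,3)])
            hence DD: "D = D'" using that(6,8) by (intro card_subset_eq finite_subset[OF that(8)]) auto
            have "b i = b' i" if "i < n" for i
              using gcell_interior(3)[OF \<open>D \<subseteq> {..<n}\<close> \<open>D' \<subseteq> {..<n}\<close> \<open>x : gcell n b D\<close> \<open>x ~: gbdry n b D\<close> \<open>x : gcell n b' D'\<close> _ that] DD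
              by simp
            hence "b = b'" using that(4,5) by (intro PiE_ext[of b "{..<n}" "%_. {..L}"]) (auto simp: gcells_def)
            thus ?thesis using DD by simp
          qed
          show ?thesis
          proof (cases "x : gbdry n b D & x : gbdry n b' D'")
            case True
            thus ?thesis using k(2) new \<open>c = Some e\<close> Some e by (simp add: f_def)
          next
            case False
            then consider "x ~: gbdry n b D" | "x ~: gbdry n b' D'" by blast
            hence "(b, D) = (b', D')"
            proof cases
              case 1
              thus ?thesis by (rule same[OF xc(1) _ xc(2) cg Ds])
            next
              case 2
              thus ?thesis by (rule same[OF xc(2) _ xc(1) cg(2,1) cg(3)[symmetric] Ds(2,1), symmetric])
            qed
            thus ?thesis using \<open>c = Some e\<close> Some e by simp
          qed
        qed
      qed
    next
      fix g assume "cmap ?Y E g" "!!x i. [|i : ?I; x : topspace ?Y \<inter> T i|] ==> g x = f i x"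
      thus thesis by (rule that)
    qed
    have h'f: "h' x = f c x" if "c : ?I" "x : T c" for c x
    proof (rule h'(2)[OF that(1)])
      show "x : topspace ?Y \<inter> T c" unfolding tsY using that Tsub[OF that(1)] by blast
    qed
    have "h' a = u a" if a: "a : ?A" for a
    proof -
      have "a : T None" using a by (auto simp: X_def T_def)
      thus ?thesis using h'f[of None a] hu[OF a] by (simp add: f_def)
    qed
    moreover have "p (h' z) = v z" if z: "z : X (Suc d)" for z
    proof -
      obtain c where c: "c : ?I" "z : T c" using z XS by blast
      hence "h' z = f c z" by (rule h'f)
      moreover have "p (f c z) = v z" using c ph k(3) by (auto simp: f_def T_def)
      ultimately show ?thesis by simp
    qed
    ultimately show ?case using h'(1) by blast
  qed
  have top: "X (Suc n) = topspace ?Z"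
  proof (intro equalityI XZ subsetI)
    fix x assume "x : topspace ?Z"
    then obtain b D where c: "(b, D) : gcells n L" "x : gcell n b D" by (rule gcells_cover)
    have "card D <= n" using c(1) card_mono[of "{..<n}" D] by (auto simp: gcells_def)
    thus "x : X (Suc n)" using c by (auto simp: X_def low_def)
  qed
  obtain h where "cmap (subtopology ?Z (topspace ?Z)) E h" "\<forall>a\<in>?A. h a = u a"
    "\<forall>z\<in>topspace ?Z. p (h z) = v z" using lift[of "Suc n"] unfolding top by (elim exE conjE)
  thus "solvable ?Z ?A E p u v" unfolding solvable_def subtopology_topspace by (intro exI[of _ h] conjI)
qed

end

section \<open>Lifting over the space of natural d-paths\<close>

definition monotone_dpath :: "nat => (real => nat => real) => bool" where
  "monotone_dpath n de \<longleftrightarrow> (\<forall>i<n. continuous_on {0..real n} (%t. de t i) \<and>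
     (\<forall>s t. 0 <= s & s <= t & t <= real n --> de s i <= de t i) & de 0 i = 0 & de (real n) i = 1)"

text \<open>The values of a d-path with increasing coordinates at two times with the same sum of coordinates
  are equal, so that the choice does not matter.\<close>

definition reparam :: "nat => (real => nat => real) => real => nat => real" where
  "reparam n de = (\<lambda>t\<in>{0..real n}. \<lambda>i\<in>{..<n}. de (SOME s. 0 <= s & s <= real n & (\<Sum>i<n. de s i) = t) i)"

context
  fixes n de assumes d: "monotone_dpath n de"
begin

lemma monotone_dpath_mono: "i < n ==> 0 <= s ==> s <= t ==> t <= real n ==> de s i <= de t i"
  using d by (simp add: monotone_dpath_def)

lemma monotone_dpath_bounds: "i < n ==> 0 <= s ==> s <= real n ==> 0 <= de s i & de s i <= 1"
  using monotone_dpath_mono[of i 0 s] monotone_dpath_mono[of i s "real n"] d by (simp add: monotone_dpath_def)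

lemma monotone_dpath_sum_mono:
  "0 <= s ==> s <= t ==> t <= real n ==> (\<Sum>i<n. de s i) <= (\<Sum>i<n. de t i)"
  using monotone_dpath_mono by (intro sum_mono) auto

lemma monotone_dpath_sum_bounds: "0 <= s ==> s <= real n ==> 0 <= (\<Sum>i<n. de s i) & (\<Sum>i<n. de s i) <= real n"
  using monotone_dpath_sum_mono[of 0 s] monotone_dpath_sum_mono[of s "real n"] d by (simp add: monotone_dpath_def)

lemma monotone_dpath_eq:
  assumes "0 <= s" "s <= real n" "0 <= t" "t <= real n" "(\<Sum>i<n. de s i) = (\<Sum>i<n. de t i)" "i < n"
  shows "de s i = de t i"
proof -
  have *: "de s i = de t i" if st: "0 <= s" "s <= t" "t <= real n" "(\<Sum>i<n. de s i) = (\<Sum>i<n. de t i)" for s t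
  proof -
    have "(\<Sum>i<n. de t i - de s i) = 0" using st by (simp add: sum_subtractf)
    moreover have "0 <= de t j - de s j" if "j : {..<n}" for j using monotone_dpath_mono[of j s t] st that by simp
    ultimately have "\<forall>j\<in>{..<n}. de t j - de s j = 0" by (subst (asm) sum_nonneg_eq_0_iff) auto
    thus ?thesis using assms(6) by auto
  qed
  show ?thesis
  proof (cases "s <= t")
    case True
    thus ?thesis using *[of s t] assms by simp
  next
    case False
    thus ?thesis using *[of t s] assms by simp
  qed
qed

lemma reparam_at:
  assumes "0 <= s" "s <= real n" "i < n" shows "reparam n de (\<Sum>i<n. de s i) i = de s i"
proof -
  let ?P = "%r. 0 <= r & r <= real n & (\<Sum>i<n. de r i) = (\<Sum>i<n. de s i)"
  have "?P (SOME r. ?P r)" by (rule someI[of ?P s]) (use assms in simp)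
  hence "de (SOME r. ?P r) i = de s i" using monotone_dpath_eq[of "SOME r. ?P r" s i] assms by simp
  thus ?thesis using assms monotone_dpath_sum_bounds[OF assms(1,2)] by (simp add: reparam_def)
qed

lemma monotone_dpath_surj:
  assumes "0 <= t" "t <= real n" obtains s where "0 <= s" "s <= real n" "(\<Sum>i<n. de s i) = t"
proof -
  have "continuous_on {0..real n} (%s. \<Sum>i<n. de s i)"
    using d by (intro continuous_on_sum) (auto simp: monotone_dpath_def)
  moreover have "(\<Sum>i<n. de 0 i) = 0" "(\<Sum>i<n. de (real n) i) = real n" using d by (simp_all add: monotone_dpath_def)
  ultimately show ?thesis using IVT'[of "%s. \<Sum>i<n. de s i" 0 t "real n"] assms that by auto
qed

lemma reparam_natural: "reparam n de : natural_dpaths n"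
proof (rule natural_dpathsI)
  fix t assume t: "0 <= t" "t <= real n"
  obtain s where s: "0 <= s" "s <= real n" "(\<Sum>i<n. de s i) = t" using monotone_dpath_surj[OF t] .
  have v: "reparam n de t i = de s i" if "i < n" for i using reparam_at[OF s(1,2) that] s(3) by simp
  show "(\<Sum>i<n. reparam n de t i) = t" using v s(3) by simp
  show "0 <= reparam n de t i & reparam n de t i <= 1" if "i < n" for i
    using v[OF that] monotone_dpath_bounds[OF that s(1,2)] by simp
next
  fix i t t' assume i: "i < n" and t: "0 <= t" "t <= t'" "t' <= real n"
  obtain s where s: "0 <= s" "s <= real n" "(\<Sum>i<n. de s i) = t" using monotone_dpath_surj[of t] t by auto
  obtain s' where s': "0 <= s'" "s' <= real n" "(\<Sum>i<n. de s' i) = t'" using monotone_dpath_surj[of t'] t by auto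
  have "de s i <= de s' i"
  proof (cases "s <= s'")
    case False
    hence "t = t'" using monotone_dpath_sum_mono[of s' s] s s' t by simp
    thus ?thesis using monotone_dpath_eq[OF s(1,2) s'(1,2) _ i] s s' by simp
  qed (use monotone_dpath_mono[OF i s(1) _ s'(2)] in simp)
  thus "reparam n de t i <= reparam n de t' i" using reparam_at[OF s(1,2) i] reparam_at[OF s'(1,2) i] s s' by simp
qed (auto simp: reparam_def)

end

text \<open>Natural d-paths are 1-Lipschitz, so the value of \<open>reparam n de\<close> at a time \<open>t\<close> is close to that
  of \<open>de\<close> at any \<open>s\<close> for which the sum of the coordinates of \<open>de s\<close> is close to \<open>t\<close>. The single
  time \<open>s\<close> belonging to \<open>t\<close> for a given \<open>de\<close> serves all nearby paths, so that pointwise continuity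
  of the family is enough.\<close>

lemma continuous_map_reparam:
  assumes d: "!!x. x : topspace X ==> monotone_dpath n (de x)"
    and c: "!!t i. 0 <= t ==> t <= real n ==> i < n ==> cmap X euclideanreal (%x. de x t i)"
  shows "cmap X (N n) (%x. reparam n (de x))" unfolding continuous_map_N
proof (intro conjI ballI allI impI)
  show "reparam n (de x) : natural_dpaths n" if "x : topspace X" for x by (rule reparam_natural[OF d[OF that]])
  fix t i assume "t : {0..real n}" and i: "i < n"
  hence t: "0 <= t" "t <= real n" by auto
  show "cmap X euclideanreal (%x. reparam n (de x) t i)"
  proof (rule continuous_map_real_dominated)
    fix x assume x: "x : topspace X"
    obtain s where s: "0 <= s" "s <= real n" "(\<Sum>i<n. de x s i) = t" using monotone_dpath_surj[OF d[OF x] t] .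
    let ?g = "%y. \<bar>t - (\<Sum>i<n. de y s i)\<bar> + \<bar>de y s i - de x s i\<bar>"
    have "cmap X euclideanreal (%y. \<Sum>i<n. de y s i)" by (rule continuous_map_sum) (auto intro: c[OF s(1,2)])
    hence "cmap X euclideanreal ?g" by (intro continuous_intros) (auto intro: c[OF s(1,2)] i)
    moreover have "?g x = 0" using s(3) by simp
    moreover have "\<bar>reparam n (de y) t i - reparam n (de x) t i\<bar> <= ?g y" if y: "y : topspace X" for y
    proof -
      have "reparam n (de x) t i = de x s i" using reparam_at[OF d[OF x] s(1,2) i] s(3) by simp
      moreover have "reparam n (de y) (\<Sum>i<n. de y s i) i = de y s i" by (rule reparam_at[OF d[OF y] s(1,2) i])
      moreover have "\<bar>reparam n (de y) t i - reparam n (de y) (\<Sum>i<n. de y s i) i\<bar> <= \<bar>t - (\<Sum>i<n. de y s i)\<bar>"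
        using ndp_lipschitz[OF reparam_natural[OF d[OF y]] i _ _ t] monotone_dpath_sum_bounds[OF d[OF y] s(1,2)] by simp
      ultimately show ?thesis by linarith
    qed
    ultimately show "\<exists>g. cmap X euclideanreal g & g x = 0 \<and>
        (\<forall>y\<in>topspace X. \<bar>reparam n (de y) t i - reparam n (de x) t i\<bar> <= g y)" by (intro exI[of _ ?g] conjI ballI)
  qed
qed

lemma natural_monotone_dpath: assumes g: "ga : natural_dpaths n" shows "monotone_dpath n ga"
proof -
  have "cmap (top_of_set {0..real n}) (cube_top n) ga" using g by (simp add: natural_dpaths_def)
  hence "continuous_on {0..real n} (%t. ga t i)" if "i < n" for i using that by (simp add: continuous_map_cube_top)
  thus ?thesis using ndp_mono[OF g] ndp_0[OF g] ndp_1[OF g] by (simp add: monotone_dpath_def)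
qed

lemma reparam_id: assumes g: "ga : natural_dpaths n" shows "reparam n ga = ga"
proof (rule ndp_eqI[OF reparam_natural[OF natural_monotone_dpath[OF g]] g])
  fix t i assume "0 <= t" "t <= real n" "i < n"
  thus "reparam n ga t i = ga t i" using reparam_at[OF natural_monotone_dpath[OF g], of t i] ndp_sum[OF g, of t] by simp
qed

lemma squeeze_monotone_dpath:
  assumes g: "ga : natural_dpaths n" and e: "0 <= e" "e <= 1/4"
  shows "monotone_dpath n (%t i. squeeze e (ga t i))" unfolding monotone_dpath_def
proof (intro allI impI conjI)
  fix i assume i: "i < n"
  have "continuous_on {0..real n} (%t. ga t i)"
    using natural_monotone_dpath[OF g] i by (simp add: monotone_dpath_def)
  thus "continuous_on {0..real n} (%t. squeeze e (ga t i))"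
    unfolding squeeze_def using e by (intro continuous_intros) auto
  show "squeeze e (ga s i) <= squeeze e (ga t i)" if "0 <= s & s <= t & t <= real n" for s t
    using squeeze_mono[OF e(2)] ndp_mono[OF g i] that by simp
  show "squeeze e (ga 0 i) = 0" using squeeze_low[OF e(2)] ndp_0[OF g i] e by simp
  show "squeeze e (ga (real n) i) = 1" using squeeze_high[OF e(2)] ndp_1[OF g i] e by simp
qed

text \<open>The sum of the coordinates is the time, so a natural d-path can only be at a vertex at integer times.\<close>

definition broken :: "nat => (real => nat => real) set" where
  "broken n = {ga : natural_dpaths n. \<exists>k\<in>{1..<n}. \<forall>i<n. ga (real k) i = 0 | ga (real k) i = 1}"

definition through :: "nat => nat set => (real => nat => real) set" where
  "through n S = {ga : natural_dpaths n. \<forall>i<n. ga (real (card S)) i = of_bool (i : S)}"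

lemma brokenE:
  assumes "ga : broken n"
  obtains S where "S \<subseteq> {..<n}" "card S : {1..<n}" "ga : through n S"
proof -
  obtain k where g: "ga : natural_dpaths n" and k: "k : {1..<n}"
    and v: "!!i. i < n ==> ga (real k) i = 0 | ga (real k) i = 1" using assms by (auto simp: broken_def)
  define S where "S = {i. i < n & ga (real k) i = 1}"
  have ob: "ga (real k) i = of_bool (i : S)" if "i < n" for i using v[OF that] that by (auto simp: S_def)
  have "real k = (\<Sum>i<n. ga (real k) i)" using ndp_sum[OF g, of "real k"] k by simp
  also have "\<dots> = (\<Sum>i<n. of_bool (i : S))" using ob by (intro sum.cong) auto
  also have "\<dots> = real (card ({..<n} \<inter> S))" by (simp add: sum_of_bool_eq)
  also have "{..<n} \<inter> S = S" by (auto simp: S_def)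
  finally have c: "card S = k" by simp
  have "ga : through n S" using g ob by (simp add: through_def c)
  moreover have "S \<subseteq> {..<n}" by (auto simp: S_def)
  ultimately show ?thesis using k c by (intro that[of S]) simp_all
qed

lemma through_broken: "card S : {1..<n} ==> ga : through n S ==> ga : broken n"
  by (auto simp: broken_def through_def intro!: bexI[of _ "card S"])

lemma reparam_through:
  assumes d: "monotone_dpath n de" and s: "0 <= s" "s <= real n" and S: "S \<subseteq> {..<n}"
    and v: "!!i. i < n ==> de s i = of_bool (i : S)"
  shows "reparam n de : through n S"
proof -
  have "(\<Sum>i<n. de s i) = (\<Sum>i<n. of_bool (i : S))" using v by (intro sum.cong) auto
  also have "\<dots> = real (card ({..<n} \<inter> S))" by (simp add: sum_of_bool_eq)
  also have "{..<n} \<inter> S = S" using S by auto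
  finally show ?thesis using reparam_at[OF d s] reparam_natural[OF d] v by (simp add: through_def)
qed

text \<open>Squeezing the coordinates of a path by \<open>e\<close> and making it natural again moves it to a path through
  every vertex within distance \<open>e\<close> at integer time.\<close>

lemma ndr_broken:
  "ndr (N n) (broken n) (%(ga, r). reparam n (%t i. squeeze (r / 4) (ga t i)))
     (%ga. 4 * Min (insert 1 ((%k. \<Sum>i<n. min (ga (real k) i) (1 - ga (real k) i)) ` {1..<n})))"
  unfolding ndr_def
proof (intro conjI ballI impI)
  let ?P = "prod_topology (N n) unit_ivl"
  let ?f = "%ga k. \<Sum>i<n. min (ga (real k) i) (1 - ga (real k) i)"
  let ?M = "%ga. Min (insert 1 (?f ga ` {1..<n}))"
  have "cmap ?P (N n) (%x. reparam n (%t i. squeeze (snd x / 4) (fst x t i)))"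
  proof (rule continuous_map_reparam)
    fix x assume "x : topspace ?P"
    thus "monotone_dpath n (%t i. squeeze (snd x / 4) (fst x t i))" by (intro squeeze_monotone_dpath) auto
  next
    fix t i assume ti: "0 <= t" "t <= real n" "i < n"
    have "cmap ?P euclideanreal (%x. fst x t i)"
      using continuous_map_compose[OF continuous_map_fst continuous_map_N_ev[of t n i]] ti by (simp add: o_def)
    thus "cmap ?P euclideanreal (%x. squeeze (snd x / 4) (fst x t i))"
      by (intro continuous_map_squeeze continuous_map_real_divide continuous_map_prod_time) auto
  qed
  thus "cmap ?P (N n) (%(ga, r). reparam n (%t i. squeeze (r / 4) (ga t i)))" by (simp add: case_prod_beta')
  have "cmap (N n) euclideanreal ?M"
    by (intro continuous_map_Min continuous_map_sum continuous_intros continuous_map_N_ev) auto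
  thus "cmap (N n) euclideanreal (%ga. 4 * ?M ga)" by (intro continuous_intros) auto
  show "broken n \<subseteq> topspace (N n)" by (auto simp: broken_def)
  have nonneg: "0 <= ?M ga" if g: "ga : natural_dpaths n" for ga using ndp_bounds[OF g] by (auto intro!: sum_nonneg)
  fix ga assume "ga : topspace (N n)"
  hence g: "ga : natural_dpaths n" by simp
  have "reparam n (%t i. squeeze 0 (ga t i)) = reparam n ga"
  proof (rule ndp_eqI[of _ n])
    have m: "monotone_dpath n (%t i. squeeze 0 (ga t i))" by (rule squeeze_monotone_dpath[OF g]) auto
    show "reparam n (%t i. squeeze 0 (ga t i)) : natural_dpaths n" by (rule reparam_natural[OF m])
    show "reparam n ga : natural_dpaths n" using reparam_id[OF g] g by simp
    fix t i assume ti: "0 <= t" "t <= real n" "i < n"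
    have "(\<Sum>i<n. squeeze 0 (ga t i)) = (\<Sum>i<n. ga t i)" using ndp_bounds[OF g ti(1,2)] by (intro sum.cong) auto
    thus "reparam n (%t i. squeeze 0 (ga t i)) t i = reparam n ga t i"
      using reparam_at[OF m ti] ndp_sum[OF g ti(1,2)] ndp_bounds[OF g ti] reparam_id[OF g] by simp
  qed
  thus "(%(ga, r). reparam n (%t i. squeeze (r / 4) (ga t i))) (ga, 0) = ga" using reparam_id[OF g] by simp
  show "0 <= 4 * ?M ga" using nonneg[OF g] by simp
  assume d: "4 * ?M ga <= 1"
  define e where "e = ?M ga"
  have e: "0 <= e" "e <= 1/4" using d nonneg[OF g] by (auto simp: e_def)
  have "e : insert 1 (?f ga ` {1..<n})" unfolding e_def by (rule Min_in) auto
  then obtain k where k: "k : {1..<n}" "e = ?f ga k" using e by auto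
  have tk: "0 <= real k" "real k <= real n" using k by auto
  note b = ndp_bounds[OF g tk]
  have le: "min (ga k i) (1 - ga k i) <= e" if "i < n" for i
    unfolding k(2) using that b by (intro member_le_sum[of i "{..<n}" "%i. min (ga k i) (1 - ga k i)"]) auto
  define S where "S = {i. i < n & squeeze e (ga k i) = 1}"
  have sq: "squeeze e (ga k i) = of_bool (i : S) & \<bar>ga k i - of_bool (i : S)\<bar> <= min (ga k i) (1 - ga k i)" if i: "i < n" for i
  proof -
    have "ga k i <= e | 1 - e <= ga k i" using le[OF i] by linarith
    thus ?thesis
    proof
      assume "ga k i <= e"
      thus ?thesis using squeeze_low[OF e(2)] i e b[OF i] by (simp add: S_def min_def)
    next
      assume "1 - e <= ga k i"
      thus ?thesis using squeeze_high[OF e(2)] i e b[OF i] by (simp add: S_def min_def)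
    qed
  qed
  have S: "S \<subseteq> {..<n}" by (auto simp: S_def)
  have "\<bar>real k - real (card S)\<bar> = \<bar>\<Sum>i<n. ga k i - of_bool (i : S)\<bar>"
    using ndp_sum[OF g tk] S by (simp add: sum_subtractf sum_of_bool_eq Int_absorb1)
  also have "\<dots> <= (\<Sum>i<n. \<bar>ga k i - of_bool (i : S)\<bar>)" by (rule sum_abs)
  also have "\<dots> <= e" unfolding k(2) using sq by (intro sum_mono) auto
  finally have "k = card S" using e by linarith
  moreover have "reparam n (%t i. squeeze e (ga t i)) : through n S"
    using sq by (intro reparam_through[OF squeeze_monotone_dpath[OF g e] tk S]) auto
  ultimately have "reparam n (%t i. squeeze e (ga t i)) : broken n" using k by (intro through_broken[of S]) auto
  thus "(%(ga, r). reparam n (%t i. squeeze (r / 4) (ga t i))) (ga, 4 * ?M ga) : broken n" by (simp add: e_def)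
next
  let ?f = "%ga k. \<Sum>i<n. min (ga (real k) i) (1 - ga (real k) i)"
  fix ga assume "ga : broken n"
  then obtain k where g: "ga : natural_dpaths n" and k: "k : {1..<n}"
    and v: "!!i. i < n ==> ga (real k) i = 0 | ga (real k) i = 1" by (auto simp: broken_def)
  have "Min (insert 1 (?f ga ` {1..<n})) <= ?f ga k" using k by (intro Min_le) auto
  moreover have "?f ga k = 0" using v by (intro sum.neutral) fastforce
  moreover have "0 <= Min (insert 1 (?f ga ` {1..<n}))" using ndp_bounds[OF g] by (auto intro!: sum_nonneg)
  ultimately show "4 * Min (insert 1 (?f ga ` {1..<n})) = 0" by linarith
qed

text \<open>The time at which a coordinate is traversed is measured by a sum that approximates the area above its
  graph; conversely, a point of the grid is a list of starting times. The factor 3 leaves a gap of 1 between the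
  coordinates traversed before and after a vertex when a point is moved within a unit face of the grid.\<close>

definition arrival :: "nat => (real => nat => real) => nat => real" where
  "arrival n ga = (\<lambda>i\<in>{..<n}. \<Sum>k\<in>{1..<n}. 3 * (1 - ga (real k) i))"

text \<open>The time scale is such that a coordinate that starts last, at \<open>3 * n\<close>, has arrived at time \<open>n\<close>.\<close>

definition departing :: "nat => (nat => real) => real => nat => real" where
  "departing n \<tau> t i = max 0 (min 1 (t * ((3 * real n + 1) / real n) - \<tau> i))"

definition gap :: "nat => real => nat set => (nat => real) => bool" where
  "gap n c S \<tau> \<longleftrightarrow> (\<forall>i\<in>S. \<forall>j\<in>{..<n} - S. \<tau> j - \<tau> i \<ge> c)"

lemma arrival_in_grid:
  assumes g: "ga : natural_dpaths n" shows "arrival n ga : topspace (grid_top n (3 * n))"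
proof -
  have "0 <= (\<Sum>k\<in>{1..<n}. 3 * (1 - ga (real k) i)) & (\<Sum>k\<in>{1..<n}. 3 * (1 - ga (real k) i)) <= 3 * real n" if i: "i < n" for i
  proof
    have b: "0 <= ga (real k) i & ga (real k) i <= 1" if "k : {1..<n}" for k
      using ndp_bounds[OF g _ _ i, of "real k"] that by simp
    show "0 <= (\<Sum>k\<in>{1..<n}. 3 * (1 - ga (real k) i))" using b by (intro sum_nonneg) auto
    have "(\<Sum>k\<in>{1..<n}. 3 * (1 - ga (real k) i)) <= (\<Sum>k\<in>{1..<n}. 3)" using b by (intro sum_mono) auto
    also have "\<dots> <= 3 * real n" by simp
    finally show "(\<Sum>k\<in>{1..<n}. 3 * (1 - ga (real k) i)) <= 3 * real n" .
  qed
  thus ?thesis by (auto simp: arrival_def topspace_grid_top)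
qed

lemma continuous_map_arrival: "cmap (N n) (grid_top n (3 * n)) (arrival n)" unfolding continuous_map_grid_top
proof (intro conjI ballI allI impI)
  fix i assume "i < n"
  thus "cmap (N n) euclideanreal (%ga. arrival n ga i)"
    by (simp add: arrival_def) (intro continuous_map_sum continuous_intros continuous_map_N_ev; simp)
qed (simp add: arrival_in_grid)

lemma departing_monotone_dpath:
  assumes n: "n \<ge> 1" and t: "\<tau> : topspace (grid_top n (3 * n))"
  shows "monotone_dpath n (departing n \<tau>)" unfolding monotone_dpath_def
proof (intro allI impI conjI)
  fix i assume i: "i < n"
  have ti: "0 <= \<tau> i" "\<tau> i <= 3 * real n" using t i by (auto simp: topspace_grid_top PiE_iff)
  show "continuous_on {0..real n} (%t. departing n \<tau> t i)" unfolding departing_def by (intro continuous_intros)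
  show "departing n \<tau> 0 i = 0" using ti by (simp add: departing_def)
  have "real n * ((3 * real n + 1) / real n) = 3 * real n + 1" using n by simp
  thus "departing n \<tau> (real n) i = 1" using ti by (simp add: departing_def)
  show "departing n \<tau> s i <= departing n \<tau> t i" if st: "0 <= s & s <= t & t <= real n" for s t
  proof -
    have "s * ((3 * real n + 1) / real n) <= t * ((3 * real n + 1) / real n)"
      using st by (intro mult_right_mono) auto
    thus ?thesis unfolding departing_def by (intro max.mono min.mono) auto
  qed
qed

lemma continuous_map_departing:
  assumes n: "n \<ge> 1" shows "cmap (grid_top n (3 * n)) (N n) (%\<tau>. reparam n (departing n \<tau>))"
proof (rule continuous_map_reparam[OF departing_monotone_dpath[OF n]])
  fix t i assume "i < n"
  thus "cmap (grid_top n (3 * n)) euclideanreal (%\<tau>. departing n \<tau> t i)"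
    unfolding departing_def by (intro continuous_intros continuous_map_grid_proj) auto
qed

text \<open>When the coordinates in \<open>S\<close> have been traversed, the others have not yet started.\<close>

lemma departing_through:
  assumes n: "n \<ge> 1" and t: "\<tau> : topspace (grid_top n (3 * n))"
    and S: "S \<subseteq> {..<n}" "S ~= {}" and g: "gap n 1 S \<tau>"
  shows "reparam n (departing n \<tau>) : through n S"
proof -
  have fin: "finite S" using S finite_subset by blast
  define m where "m = Max (\<tau> ` S)"
  have "m : \<tau> ` S" unfolding m_def using fin S by (intro Max_in) auto
  then obtain a where a: "a : S" "\<tau> a = m" by auto
  have mle: "\<tau> i <= m" if "i : S" for i unfolding m_def using fin that by (intro Max_ge) auto
  have "0 <= m" "m <= 3 * real n" using a S t by (auto simp: topspace_grid_top PiE_iff)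
  define r where "r = (m + 1) / ((3 * real n + 1) / real n)"
  have c: "0 < (3 * real n + 1) / real n" using n by simp
  have r0: "0 <= r" using \<open>0 <= m\<close> c by (simp add: r_def)
  have rc: "r * ((3 * real n + 1) / real n) = m + 1"
  proof -
    have "(m + 1) / c * c = m + 1" if "0 < c" for c :: real using that by simp
    from this[OF c] show ?thesis unfolding r_def .
  qed
  have "r <= real n"
  proof -
    have "r * ((3 * real n + 1) / real n) <= real n * ((3 * real n + 1) / real n)"
      using rc \<open>m <= 3 * real n\<close> n by simp
    thus ?thesis using c by (rule mult_right_le_imp_le)
  qed
  have dep: "departing n \<tau> r i = max 0 (min 1 (m + 1 - \<tau> i))" for i by (simp only: departing_def rc)
  have "departing n \<tau> r i = of_bool (i : S)" if i: "i < n" for i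
  proof (cases "i : S")
    case True
    thus ?thesis using mle[OF True] by (simp add: dep)
  next
    case False
    hence "\<tau> i - m \<ge> 1" using g a i by (auto simp: gap_def)
    thus ?thesis using False by (simp add: dep)
  qed
  thus ?thesis by (rule reparam_through[OF departing_monotone_dpath[OF n t] r0 \<open>r <= real n\<close> S(1)])
qed

lemma arrival_gap:
  assumes S: "S \<subseteq> {..<n}" "card S : {1..<n}" and g: "ga : through n S"
  shows "gap n 3 S (arrival n ga)" unfolding gap_def
proof (intro ballI)
  fix i j assume i: "i : S" and j: "j : {..<n} - S"
  have gn: "ga : natural_dpaths n" and v: "!!i. i < n ==> ga (real (card S)) i = of_bool (i : S)"
    using g by (auto simp: through_def)
  have ij: "i < n" "j < n" using i j S by auto
  have nonneg: "0 <= ga (real k) i - ga (real k) j" if k: "k : {1..<n}" for k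
  proof (cases "k <= card S")
    case True
    hence "ga (real k) j <= ga (real (card S)) j" using k S(2) ij by (intro ndp_mono[OF gn]) auto
    thus ?thesis using v[OF ij(2)] j ndp_bounds[OF gn _ _ ij(1), of "real k"] k by auto
  next
    case False
    hence "ga (real (card S)) i <= ga (real k) i" using k S(2) ij by (intro ndp_mono[OF gn]) auto
    thus ?thesis using v[OF ij(1)] i ndp_bounds[OF gn _ _ ij(2), of "real k"] k by auto
  qed
  have "3 = 3 * (ga (real (card S)) i - ga (real (card S)) j)" using v i j ij by simp
  also have "\<dots> <= (\<Sum>k\<in>{1..<n}. 3 * (ga (real k) i - ga (real k) j))"
    using nonneg S(2) by (intro member_le_sum[of "card S" "{1..<n}" "%k. 3 * (ga (real k) i - ga (real k) j)"]) auto
  also have "\<dots> = arrival n ga j - arrival n ga i"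
    using ij by (simp add: arrival_def algebra_simps flip: sum_subtractf)
  finally show "3 <= arrival n ga j - arrival n ga i" .
qed

definition split_cells :: "nat => ((nat => nat) \<times> nat set) set" where
  "split_cells n = {(b, D) : gcells n (3 * n). \<exists>\<tau>\<in>gcell n b D. \<exists>S\<subseteq>{..<n}. card S : {1..<n} & gap n 3 S \<tau>}"

lemma arrival_split:
  assumes "ga : broken n" shows "arrival n ga : (\<Union>(b, D)\<in>split_cells n. gcell n b D)"
proof -
  obtain S where S: "S \<subseteq> {..<n}" "card S : {1..<n}" "ga : through n S" using assms by (rule brokenE)
  have "ga : natural_dpaths n" using S(3) by (simp add: through_def)
  then obtain b D where c: "(b, D) : gcells n (3 * n)" "arrival n ga : gcell n b D"
    using gcells_cover[OF arrival_in_grid] by blast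
  have "(b, D) : split_cells n" using c S arrival_gap[OF S] by (auto simp: split_cells_def)
  thus ?thesis using c(2) by blast
qed

text \<open>Within a face of the grid the differences of coordinates vary by at most 2, so that a gap of 3
  leaves one of at least 1 everywhere.\<close>

lemma departing_broken:
  assumes n: "n \<ge> 1" and t: "\<tau> : (\<Union>(b, D)\<in>split_cells n. gcell n b D)"
  shows "reparam n (departing n \<tau>) : broken n"
proof -
  obtain b D \<tau>' S where c: "(b, D) : gcells n (3 * n)" "\<tau> : gcell n b D" "\<tau>' : gcell n b D"
    and S: "S \<subseteq> {..<n}" "card S : {1..<n}" "gap n 3 S \<tau>'" using t by (auto simp: split_cells_def)
  have near: "\<bar>\<tau> i - \<tau>' i\<bar> <= 1" if i: "i < n" for i
  proof (cases "i : D")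
    case True
    thus ?thesis using c(2,3) i by (auto simp: gcell_def abs_le_iff) (smt (verit))+
  next
    case False
    thus ?thesis using c(2,3) i by (auto simp: gcell_def)
  qed
  have "gap n 1 S \<tau>" unfolding gap_def
  proof (intro ballI)
    fix i j assume ij: "i : S" "j : {..<n} - S"
    hence "3 <= \<tau>' j - \<tau>' i" using S(3) by (auto simp: gap_def)
    moreover have "\<bar>\<tau> i - \<tau>' i\<bar> <= 1" "\<bar>\<tau> j - \<tau>' j\<bar> <= 1" using near ij S(1) by auto
    ultimately show "1 <= \<tau> j - \<tau> i" by linarith
  qed
  moreover have "S ~= {}" using S(2) by auto
  ultimately have "reparam n (departing n \<tau>) : through n S"
    using gcell_in_grid[OF c(1)] c(2) S(1) by (intro departing_through[OF n]) auto
  thus ?thesis by (rule through_broken[OF S(2)])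
qed

lemma mix_through:
  "ga : through n S ==> \<theta> : through n S ==> S \<subseteq> {..<n} ==> 0 <= c ==> c <= 1 ==> mix n c ga \<theta> : through n S"
  using card_mono[of "{..<n}" S] by (auto simp: through_def mix_natural) (auto simp: mix_def algebra_simps)

lemma continuous_map_mix:
  assumes f: "cmap X (N n) f" and g: "cmap X (N n) g" and c: "cmap X euclideanreal c"
    and c01: "!!x. x : topspace X ==> 0 <= c x & c x <= 1"
  shows "cmap X (N n) (%x. mix n (c x) (f x) (g x))" unfolding continuous_map_N
proof (intro conjI ballI allI impI)
  fix x assume "x : topspace X"
  thus "mix n (c x) (f x) (g x) : natural_dpaths n"
    using c01 continuous_map_funspace[OF f] continuous_map_funspace[OF g] by (intro mix_natural) auto
next
  fix t i assume ti: "t : {0..real n}" "i < n"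
  have "cmap X euclideanreal (%x. (1 - c x) * f x t i + c x * g x t i)"
    using f g ti by (intro continuous_intros c) (auto simp: continuous_map_N)
  thus "cmap X euclideanreal (%x. mix n (c x) (f x) (g x) t i)" using ti by (simp add: mix_def)
qed

lemma mix_0: assumes "ga : natural_dpaths n" "\<theta> : natural_dpaths n" shows "mix n 0 ga \<theta> = ga"
  by (rule ndp_eqI[OF mix_natural[OF assms] assms(1)]) (auto simp: mix_def)

lemma mix_1: assumes "ga : natural_dpaths n" "\<theta> : natural_dpaths n" shows "mix n 1 ga \<theta> = \<theta>"
  by (rule ndp_eqI[OF mix_natural[OF assms] assms(2)]) (auto simp: mix_def)

context
  fixes E B :: "'a univ topology" and p and haus :: bool
  assumes fib: "Hurewicz_fibration haus E B p" and weq: "weak_homotopy_equivalence E B p"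
begin

text \<open>The pair is dominated by a pair of cubical complexes. A lift exists for the composite through the
  complex, which is homotopic to the identity as a map of pairs.\<close>

lemma rel_lifts_broken:
  assumes n: "n \<ge> 1" shows "rel_lifts (N n) (broken n) E B p" unfolding rel_lifts_def
proof (intro allI impI)
  fix u v assume uv: "lift_problem (N n) (broken n) E B p u v"
  hence u: "cmap (subtopology (N n) (broken n)) E u" and v: "cmap (N n) B v"
    and puv: "!!a. a : broken n ==> p (u a) = v a" by (auto simp: lift_problem_def)
  let ?s = "%\<tau>. reparam n (departing n \<tau>)" and ?T = "grid_top n (3 * n)"
  let ?A = "\<Union>(b, D)\<in>split_cells n. gcell n b D"
  have s: "cmap ?T (N n) ?s" by (rule continuous_map_departing[OF n])
  have "split_cells n \<subseteq> gcells n (3 * n)" by (auto simp: split_cells_def)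
  from rel_lifts_grid[OF fib weq this] have "rel_lifts ?T ?A E B p" .
  moreover have "lift_problem ?T ?A E B p (u \<circ> ?s) (v \<circ> ?s)" unfolding lift_problem_def
  proof (intro conjI ballI)
    have "cmap (subtopology ?T ?A) (subtopology (N n) (broken n)) ?s"
      using continuous_map_from_subtopology[OF s, of ?A] departing_broken[OF n]
      by (simp add: continuous_map_in_subtopology image_subset_iff)
    from continuous_map_compose[OF this u] show "cmap (subtopology ?T ?A) E (u \<circ> ?s)" .
    show "cmap ?T B (v \<circ> ?s)" by (rule continuous_map_compose[OF s v])
    show "p ((u \<circ> ?s) a) = (v \<circ> ?s) a" if "a : ?A" for a using puv[OF departing_broken[OF n that]] by simp
  qed
  ultimately have "solvable ?T ?A E p (u \<circ> ?s) (v \<circ> ?s)" by (simp add: rel_lifts_def)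
  then obtain k where k: "cmap ?T E k" "!!a. a : ?A ==> k a = u (?s a)"
    "!!z. z : topspace ?T ==> p (k z) = v (?s z)" unfolding solvable_def comp_def by blast
  let ?P = "prod_topology (N n) unit_ivl"
  define G where "G x = mix n (snd x) (fst x) (?s (arrival n (fst x)))" for x
  have sa: "cmap (N n) (N n) (%ga. ?s (arrival n ga))"
    using continuous_map_compose[OF continuous_map_arrival s] by (simp add: o_def)
  have G: "cmap ?P (N n) G" unfolding G_def
  proof (rule continuous_map_mix[OF continuous_map_fst _ continuous_map_prod_time])
    show "cmap ?P (N n) (%x. ?s (arrival n (fst x)))"
      using continuous_map_compose[OF continuous_map_fst sa] by (simp add: o_def)
  qed auto
  have san: "?s (arrival n ga) : natural_dpaths n" if "ga : natural_dpaths n" for ga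
    using continuous_map_funspace[OF sa] that by simp
  have GA: "G (a, t) : broken n" if a: "a : broken n" and t: "0 <= t" "t <= 1" for a t
  proof -
    obtain S where S: "S \<subseteq> {..<n}" "card S : {1..<n}" "a : through n S" using a by (rule brokenE)
    have an: "a : natural_dpaths n" using S by (simp add: through_def)
    have "gap n 1 S (arrival n a)" using arrival_gap[OF S] by (force simp: gap_def)
    moreover have "S ~= {}" using S(2) by auto
    ultimately have "?s (arrival n a) : through n S" by (intro departing_through[OF n arrival_in_grid[OF an] S(1)])
    thus ?thesis unfolding G_def using S t by (intro through_broken[OF S(2)] mix_through) auto
  qed
  have brn: "a : natural_dpaths n" if "a : broken n" for a using that by (simp add: broken_def)
  have G1: "G (ga, 1) = ?s (arrival n ga)" and G0: "G (ga, 0) = ga" if "ga : natural_dpaths n" for ga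
    using mix_0[OF that san[OF that]] mix_1[OF that san[OF that]] by (simp_all add: G_def)
  have "solvable (N n) (broken n) E p (%a. u (G (a, 1))) (%z. v (G (z, 1)))" unfolding solvable_def
  proof (intro exI[of _ "k \<circ> arrival n"] conjI ballI)
    show "cmap (N n) E (k \<circ> arrival n)" by (rule continuous_map_compose[OF continuous_map_arrival k(1)])
    show "(k \<circ> arrival n) a = u (G (a, 1))" if "a : broken n" for a
      using k(2)[OF arrival_split[OF that]] G1[OF brn[OF that]] by simp
    show "p ((k \<circ> arrival n) z) = v (G (z, 1))" if "z : topspace (N n)" for z
      using k(3)[OF arrival_in_grid, of z] G1[of z] that by simp
  qed
  from solvable_homotopy[OF fib delta_generated_N Hausdorff_N inj_inj_npath ndr_broken uv G GA this]
  have "solvable (N n) (broken n) E p (%a. u (G (a, 0))) (%z. v (G (z, 0)))" .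
  thus "solvable (N n) (broken n) E p u v" using G0 brn by (auto simp: solvable_def)
qed

lemma rel_lifts_npath_broken:
  assumes "n \<ge> 1" shows "rel_lifts (npath_top (N n) :: 'a univ topology) (NPath ` broken n) E B p"
  by (rule rel_lifts_homeomorphic[OF homeomorphic_maps_npath_top _ rel_lifts_broken[OF assms]])
    (auto simp: broken_def)

end

section \<open>Colimits of flows\<close>

lemma infinite_univ: "infinite (UNIV :: 'a univ set)"
proof -
  have "inj (%n. Vertex (replicate n True) :: 'a univ)" by (rule injI) (simp add: replicate_eq_replicate)
  thus ?thesis using finite_imageD[of "%n. Vertex (replicate n True) :: 'a univ" UNIV] infinite_UNIV_nat
    by (meson finite_subset subset_UNIV)
qed

lemma ex_inj_pair: "\<exists>f :: 'a univ \<times> 'a univ => 'a univ. inj f"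
proof -
  have "\<exists>f :: 'a univ \<times> 'a univ => 'a univ. bij_betw f (UNIV \<times> UNIV) UNIV"
    using card_of_Times_same_infinite[OF infinite_univ] card_of_ordIso by blast
  then obtain f :: "'a univ \<times> 'a univ => 'a univ" where "bij_betw f (UNIV \<times> UNIV) UNIV" by blast
  hence "inj f" by (simp add: bij_betw_def)
  thus ?thesis by blast
qed

definition upair :: "'a univ => 'a univ => 'a univ" where
  "upair x y = (SOME f. inj f) (x, y)"

lemma upair_eq_iff [simp]: "upair x y = upair x' y' \<longleftrightarrow> x = x' & y = y'"
  using someI_ex[OF ex_inj_pair] by (auto simp: upair_def inj_def)

text \<open>The final topology with respect to a family of curves.\<close>

definition curve_top :: "'a set => (real => 'a) set => 'a topology" where
  "curve_top S \<P> = topology (%U. U \<subseteq> S & (\<forall>p\<in>\<P>. openin unit_ivl {t : {0..1}. p t : U}))"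

lemma openin_curve_top:
  "openin (curve_top S \<P>) U \<longleftrightarrow> U \<subseteq> S & (\<forall>p\<in>\<P>. openin unit_ivl {t : {0..1}. p t : U})"
proof -
  have "istopology (%U. U \<subseteq> S & (\<forall>p\<in>\<P>. openin unit_ivl {t : {0..1}. p t : U}))"
    unfolding istopology_def
  proof (intro conjI allI impI ballI)
    fix U V p assume U: "U \<subseteq> S & (\<forall>p\<in>\<P>. openin unit_ivl {t : {0..1}. p t : U})"
      and V: "V \<subseteq> S & (\<forall>p\<in>\<P>. openin unit_ivl {t : {0..1}. p t : V})" and p: "p : \<P>"
    have "openin unit_ivl ({t : {0..1}. p t : U} \<inter> {t : {0..1}. p t : V})"
      using U V p by (intro openin_Int) auto
    moreover have "{t : {0..1}. p t : U} \<inter> {t : {0..1}. p t : V} = {t : {0..1}. p t : U \<inter> V}" by auto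
    ultimately show "openin unit_ivl {t : {0..1}. p t : U \<inter> V}" by simp
  next
    fix \<K> p assume K: "\<forall>U\<in>\<K>. U \<subseteq> S & (\<forall>p\<in>\<P>. openin unit_ivl {t : {0..1}. p t : U})" and p: "p : \<P>"
    have "openin unit_ivl (\<Union>U\<in>\<K>. {t : {0..1}. p t : U})" using K p by (intro openin_Union) auto
    moreover have "(\<Union>U\<in>\<K>. {t : {0..1}. p t : U}) = {t : {0..1}. p t : \<Union>\<K>}" by auto
    ultimately show "openin unit_ivl {t : {0..1}. p t : \<Union>\<K>}" by simp
  qed blast+
  thus ?thesis unfolding curve_top_def by (simp add: topology_inverse')
qed

context
  fixes S :: "'a set" and \<P> :: "(real => 'a) set" assumes PS: "!!p t. p : \<P> ==> t : {0..1} ==> p t : S"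
begin

lemma topspace_curve_top [simp]: "topspace (curve_top S \<P>) = S"
proof -
  have "{t : {0..1}. p t : S} = {0..1}" if "p : \<P>" for p using PS[OF that] by auto
  hence "openin (curve_top S \<P>) S" by (simp add: openin_curve_top)
  thus ?thesis using openin_subset openin_curve_top[of S \<P>] by (metis openin_topspace subset_antisym)
qed

lemma curve_pathin: "p : \<P> ==> pathin (curve_top S \<P>) p"
  unfolding pathin_def continuous_map_def using PS by (auto simp: openin_curve_top)

lemma delta_generated_curve_top: "delta_generated (curve_top S \<P>)" unfolding delta_generated_def
proof (intro allI iffI)
  fix U assume "delta_open (curve_top S \<P>) U"
  thus "openin (curve_top S \<P>) U" unfolding openin_curve_top using curve_pathin by (simp add: delta_open_def)
qed (rule openin_imp_delta_open)

lemma continuous_map_curve_top: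
  assumes "!!x. x : S ==> f x : topspace Y" "!!p. p : \<P> ==> pathin Y (f \<circ> p)"
  shows "cmap (curve_top S \<P>) Y f" unfolding continuous_map_def topspace_curve_top
proof (intro conjI allI impI)
  show "f : S \<rightarrow> topspace Y" using assms(1) by simp
  fix V assume V: "openin Y V"
  show "openin (curve_top S \<P>) {x : S. f x : V}" unfolding openin_curve_top
  proof (intro conjI ballI)
    fix p assume p: "p : \<P>"
    have "openin unit_ivl {t : topspace unit_ivl. (f \<circ> p) t : V}"
      using assms(2)[OF p] V unfolding pathin_def by (rule openin_continuous_map_preimage)
    moreover have "{t : topspace unit_ivl. (f \<circ> p) t : V} = {t : {0..1}. p t : {x : S. f x : V}}"
      using PS[OF p] by auto
    ultimately show "openin unit_ivl {t : {0..1}. p t : {x : S. f x : V}}" by simp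
  qed auto
qed

end

text \<open>In a delta-Hausdorff space the points are closed, and so are the images of the subintervals under
  a path. Two paths that disagree at \<open>s\<close> and \<open>t\<close> disagree nearby: \<open>p s\<close> avoids the image
  under \<open>q\<close> of a small interval around \<open>t\<close>, and that image is closed.\<close>

lemma delta_Hausdorff_equalizer:
  assumes X: "delta_Hausdorff X" and p: "pathin X p" and q: "pathin X q"
  shows "closedin (prod_topology unit_ivl unit_ivl) {x : {0..1} \<times> {0..1}. p (fst x) = q (snd x)}"
proof -
  let ?I = "prod_topology unit_ivl unit_ivl"
  have "openin ?I {x : {0..1} \<times> {0..1}. p (fst x) ~= q (snd x)}"
  proof (subst openin_subopen, intro ballI)
    fix x assume "x : {x : {0..1} \<times> {0..1}. p (fst x) ~= q (snd x)}"
    then obtain s t where x: "x = (s, t)" and st: "s : {0..1}" "t : {0..1}" "p s ~= q t" by auto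
    have "pathin X (%_. p s)" using pathin_funspace[OF p st(1)] by (simp add: pathin_def)
    hence "closedin X ((%_. p s) ` {0..1::real})" using X by (simp add: delta_Hausdorff_def)
    moreover have "(%_. p s) ` {0..1::real} = {p s}" by (rule image_constant[of 0]) simp
    ultimately have "openin X (topspace X - {p s})" by (metis openin_diff openin_topspace)
    from openin_continuous_map_preimage[OF q[unfolded pathin_def] this]
    have "openin unit_ivl {r : {0..1}. q r : topspace X - {p s}}" by simp
    moreover have "t : {r : {0..1}. q r : topspace X - {p s}}" using st pathin_funspace[OF q st(2)] by auto
    ultimately have "\<exists>e>0. \<forall>r\<in>{0..1}. dist r t < e --> r : {r : {0..1}. q r : topspace X - {p s}}"
      unfolding openin_euclidean_subtopology_iff by blast
    then obtain e where e: "e > 0" "!!r. r : {0..1} ==> dist r t < e ==> q r ~= p s" by blast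
    define a b where "a = max 0 (t - e/2)" and "b = min 1 (t + e/2)"
    have ab: "0 <= a" "a <= b" "b <= 1" using st e(1) by (auto simp: a_def b_def)
    define l where "l r = a + r * (b - a)" for r :: real
    have l01: "l r : {a..b}" if "r : {0..1}" for r
    proof -
      have "0 <= r * (b - a)" "r * (b - a) <= b - a" using that ab mult_right_mono[of r 1 "b - a"] by auto
      thus ?thesis by (simp add: l_def)
    qed
    have img: "l ` {0..1} = {a..b}"
    proof (intro equalityI subsetI)
      fix c assume c: "c : {a..b}"
      show "c : l ` {0..1}"
      proof (cases "a = b")
        case True
        thus ?thesis using c by (intro image_eqI[of _ _ 0]) (auto simp: l_def)
      next
        case False
        hence "a < b" using ab by simp
        thus ?thesis using c by (intro image_eqI[of _ _ "(c - a) / (b - a)"]) (auto simp: l_def field_simps)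
      qed
    qed (use l01 in auto)
    have "cmap unit_ivl unit_ivl l"
      using l01 ab by (auto simp: continuous_map_in_subtopology l_def intro!: continuous_intros) force+
    from continuous_map_compose[OF this q[unfolded pathin_def]] have "pathin X (q \<circ> l)" by (simp add: pathin_def)
    hence "closedin X ((q \<circ> l) ` {0..1})" using X unfolding delta_Hausdorff_def by blast
    hence cl: "closedin X (q ` {a..b})" unfolding image_comp[symmetric] img .
    hence "openin X (topspace X - q ` {a..b})" by blast
    from openin_continuous_map_preimage[OF p[unfolded pathin_def] this]
    have W: "openin unit_ivl {r : {0..1}. p r : topspace X - q ` {a..b}}" (is "openin _ ?W") by simp
    have V: "openin unit_ivl ({0..1} \<inter> {t - e/2<..<t + e/2})" (is "openin _ ?V") by (simp add: openin_open_Int)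
    have "openin ?I (?W \<times> ?V)" unfolding openin_prod_Times_iff using W V by blast
    moreover have "x : ?W \<times> ?V"
    proof -
      have "p s ~: q ` {a..b}"
      proof
        assume "p s : q ` {a..b}"
        then obtain r where r: "r : {a..b}" "p s = q r" by blast
        have "dist r t < e" using r(1) e(1) by (auto simp: a_def b_def dist_real_def abs_if)
        thus False using e(2)[of r] r ab by auto
      qed
      thus ?thesis using x st e(1) pathin_funspace[OF p st(1)] by auto
    qed
    moreover have "?W \<times> ?V \<subseteq> {x : {0..1} \<times> {0..1}. p (fst x) ~= q (snd x)}"
    proof
      fix y assume y: "y : ?W \<times> ?V"
      hence "snd y : {a..b}" by (auto simp: a_def b_def)
      hence "q (snd y) : q ` {a..b}" by (rule imageI)
      thus "y : {x : {0..1} \<times> {0..1}. p (fst x) ~= q (snd x)}" using y by auto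
    qed
    ultimately show "\<exists>T. openin ?I T & x : T & T \<subseteq> {x : {0..1} \<times> {0..1}. p (fst x) ~= q (snd x)}" by blast
  qed
  moreover have "topspace ?I - {x : {0..1} \<times> {0..1}. p (fst x) = q (snd x)} =
      {x : {0..1} \<times> {0..1}. p (fst x) ~= q (snd x)}" by auto
  ultimately show ?thesis unfolding closedin_def by auto
qed

text \<open>The execution paths of a colimit are composites of those of the flows in the diagram. Formal
  composites have codes in the universe, so that a colimit can be built there.\<close>

datatype ('j, 's) word = Gen 'j 's 's 's | Join "('j, 's) word" "('j, 's) word"

locale flow_diagram =
  fixes haus :: bool and J :: "('j, 'i) cat" and D :: "('j, 'i, 'a uflow, 'a uflow_map) fctr"
    and cj :: "'j => 'a univ"
  assumes inj_cj: "inj cj"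
    and flow: "!!j. j : Ob J ==> is_flow haus (fob D j)"
    and maps: "!!j k u. j : Ob J ==> k : Ob J ==> u : Hom J j k ==> is_flow_map (fob D j) (fob D k) (fmor D j k u)"
begin

definition cocones :: "('a uflow \<times> ('j => 'a uflow_map)) set" where
  "cocones = {c. is_cocone J (Flow haus) D (fst c) (snd c)}"

text \<open>States and paths of the colimit are the families of their values in all cocones. Two formal
  composites are thus identified exactly when no cocone separates them, for both choices of the
  category of spaces.\<close>

definition gst :: "'j => 'a univ => 'a uflow \<times> ('j => 'a uflow_map) => 'a univ" where
  "gst j a = (\<lambda>c\<in>cocones. fst (snd c j) a)"

fun src where
  "src (Gen j a b p) = gst j a"
| "src (Join s t) = src s"

fun tgt where
  "tgt (Gen j a b p) = gst j b"
| "tgt (Join s t) = tgt t"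

definition cjoin where
  "cjoin x y z \<theta> \<theta>' = (\<lambda>c\<in>cocones. pcomp (fst c) (x c) (y c) (z c) (\<theta> c) (\<theta>' c))"

fun val where
  "val (Gen j a b p) = (\<lambda>c\<in>cocones. snd (snd c j) a b p)"
| "val (Join s t) = cjoin (src s) (tgt s) (tgt t) (val s) (val t)"

fun ok where
  "ok (Gen j a b p) \<longleftrightarrow> j : Ob J & a : states (fob D j) & b : states (fob D j) & p : topspace (paths (fob D j) a b)"
| "ok (Join s t) \<longleftrightarrow> ok s & ok t & tgt s = src t"

fun enc :: "('j, 'a univ) word => 'a univ" where
  "enc (Gen j a b p) = upair (Vertex []) (upair (cj j) (upair a (upair b p)))"
| "enc (Join s t) = upair (Vertex [True]) (upair (enc s) (enc t))"

lemma inj_enc: "enc s = enc t ==> s = t"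
proof (induction s arbitrary: t)
  case (Gen j a b p)
  thus ?case using injD[OF inj_cj] by (cases t) auto
next
  case (Join s1 s2)
  thus ?case by (cases t) auto
qed

definition tri where "tri t = (src t, tgt t, val t)"

definition rep where "rep q = enc (SOME t. ok t & tri t = q)"

definition unrep where "unrep u = tri (SOME t. ok t & rep (tri t) = u)"

lemma rep_inj: assumes "ok s" "ok t" "rep (tri s) = rep (tri t)" shows "tri s = tri t"
proof -
  define a where "a = (SOME r. ok r & tri r = tri s)"
  define b where "b = (SOME r. ok r & tri r = tri t)"
  have a: "ok a & tri a = tri s" unfolding a_def by (rule someI[of _ s]) (simp add: assms)
  have b: "ok b & tri b = tri t" unfolding b_def by (rule someI[of _ t]) (simp add: assms)
  have "a = b" unfolding a_def b_def by (rule inj_enc[OF assms(3)[unfolded rep_def]])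
  thus ?thesis using a b by simp
qed

lemma unrep_rep [simp]: assumes "ok t" shows "unrep (rep (tri t)) = tri t"
proof -
  define s where "s = (SOME s. ok s & rep (tri s) = rep (tri t))"
  have s: "ok s & rep (tri s) = rep (tri t)" unfolding s_def by (rule someI[of _ t]) (simp add: assms)
  have "tri s = tri t" by (rule rep_inj[OF conjunct1[OF s] assms conjunct2[OF s]])
  thus ?thesis unfolding unrep_def s_def .
qed

definition stset where "stset = {x. \<exists>j a. j : Ob J & a : states (fob D j) & x = gst j a}"

definition est where
  "est x = (let ja = SOME ja. fst ja : Ob J & snd ja : states (fob D (fst ja)) & x = gst (fst ja) (snd ja)
    in upair (cj (fst ja)) (snd ja))"

definition unst where "unst = inv_into stset est"

lemma inj_est: "inj_on est stset"
proof (rule inj_onI)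
  fix x y assume x: "x : stset" and y: "y : stset" and e: "est x = est y"
  let ?P = "%x ja. fst ja : Ob J & snd ja : states (fob D (fst ja)) & x = gst (fst ja) (snd ja)"
  define A where "A = (SOME ja. ?P x ja)"
  define B where "B = (SOME ja. ?P y ja)"
  have ex: "\<exists>ja. ?P x ja" "\<exists>ja. ?P y ja" using x y by (auto simp: stset_def)
  have AB: "?P x A" "?P y B" unfolding A_def B_def by (rule someI_ex[OF ex(1)], rule someI_ex[OF ex(2)])
  have "upair (cj (fst A)) (snd A) = upair (cj (fst B)) (snd B)" using e unfolding est_def Let_def A_def B_def .
  hence "fst A = fst B" "snd A = snd B" using injD[OF inj_cj] by auto
  thus "x = y" using AB by simp
qed

lemma unst_est [simp]: "x : stset ==> unst (est x) = x" by (simp add: unst_def inj_est)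

lemma gst_in: "j : Ob J ==> a : states (fob D j) ==> gst j a : stset" by (auto simp: stset_def)

lemma src_tgt_in: "ok t ==> src t : stset & tgt t : stset" by (induction t) (auto intro: gst_in)

lemma cocone_flow: "c : cocones ==> is_flow haus (fst c)" by (simp add: cocones_def is_cocone_def)

lemma cocone_map: "c : cocones ==> j : Ob J ==> is_flow_map (fob D j) (fst c) (snd c j)"
  by (simp add: cocones_def is_cocone_def)

lemma cocone_comp: "c : cocones ==> j : Ob J ==> k : Ob J ==> u : Hom J j k ==>
    fcomp (fob D j) (snd c k) (fmor D j k u) = snd c j" by (simp add: cocones_def is_cocone_def)

lemma stset_states: assumes "x : stset" "c : cocones" shows "x c : states (fst c)"
  using assms flow_map_state[OF cocone_map[OF assms(2)]] by (auto simp: stset_def gst_def)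

lemma val_in: "ok t ==> c : cocones ==> val t c : topspace (paths (fst c) (src t c) (tgt t c))"
proof (induction t)
  case (Gen j a b p)
  thus ?case using flow_map_path[OF cocone_map[OF Gen(2)], of j a b p] by (simp add: gst_def)
next
  case (Join s t)
  hence ok: "ok s" "ok t" and e: "tgt s = src t" by auto
  have st: "src s c : states (fst c)" "tgt s c : states (fst c)" "tgt t c : states (fst c)"
    using src_tgt_in[OF ok(1)] src_tgt_in[OF ok(2)] by (auto intro: stset_states[OF _ Join.prems(2)])
  have "val t c : topspace (paths (fst c) (tgt s c) (tgt t c))"
    using Join.IH(2)[OF ok(2) Join.prems(2)] by (simp add: e)
  from flow_pcomp_path[OF cocone_flow[OF Join.prems(2)] st Join.IH(1)[OF ok(1) Join.prems(2)] this]
  show ?case using Join.prems(2) by (simp add: cjoin_def)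
qed

lemma val_ext: "val t : extensional cocones" by (cases t) (auto simp: cjoin_def)

definition pset where "pset A B = {u. \<exists>t. ok t & u = rep (tri t) & est (src t) = A & est (tgt t) = B}"

definition pval where "pval u = snd (snd (unrep u))"

lemma pval_rep [simp]: "ok t ==> pval (rep (tri t)) = val t" by (simp add: pval_def) (simp add: tri_def)

definition curves where
  "curves A B = {p. (\<forall>t\<in>{0..1}. p t : pset A B) \<and>
     (\<forall>c\<in>cocones. pathin (paths (fst c) (unst A c) (unst B c)) (%t::real. pval (p t) c))}"

definition colim :: "'a uflow" where
  "colim = \<lparr> states = est ` stset, paths = (%A B. curve_top (pset A B) (curves A B)),
     pcomp = (%A B C u v. rep (unst A, unst C, cjoin (unst A) (unst B) (unst C) (pval u) (pval v))) \<rparr>"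

definition leg :: "'j => 'a uflow_map" where
  "leg j = fmap_on (fob D j) (%a. est (gst j a), %a b p. rep (tri (Gen j a b p)))"

definition desc :: "'a uflow \<times> ('j => 'a uflow_map) => 'a uflow_map" where
  "desc c = fmap_on colim (%A. unst A c, %A B u. pval u c)"

lemma psetE:
  assumes "u : pset A B"
  obtains t where "ok t" "u = rep (tri t)" "A = est (src t)" "B = est (tgt t)"
    "unst A = src t" "unst B = tgt t" "pval u = val t" using assms src_tgt_in by (auto simp: pset_def)

lemma pset_eqI:
  assumes u: "u : pset A B" and v: "v : pset A B" and e: "!!c. c : cocones ==> pval u c = pval v c"
  shows "u = v"
proof -
  obtain s where s: "ok s" "u = rep (tri s)" "unst A = src s" "unst B = tgt s" "pval u = val s" using u by (rule psetE)
  obtain t where t: "ok t" "v = rep (tri t)" "unst A = src t" "unst B = tgt t" "pval v = val t" using v by (rule psetE)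
  have "val s = val t" using e s(5) t(5) by (intro extensionalityI[OF val_ext val_ext]) auto
  hence "tri s = tri t" using s t by (simp add: tri_def)
  thus ?thesis using s t by simp
qed

lemma pval_in:
  assumes "u : pset A B" "c : cocones" shows "pval u c : topspace (paths (fst c) (unst A c) (unst B c))"
  using assms(1) by (rule psetE) (use val_in assms(2) in auto)

lemma curves_in: "p : curves A B ==> t : {0..1} ==> p t : pset A B" by (simp add: curves_def)

lemma topspace_colim [simp]: "topspace (paths colim A B) = pset A B"
  unfolding colim_def flow.simps by (rule topspace_curve_top) (rule curves_in)

lemma delta_generated_colim: "delta_generated (paths colim A B)"
  unfolding colim_def flow.simps by (rule delta_generated_curve_top) (rule curves_in)

lemma continuous_map_pval:
  assumes "c : cocones"
  shows "cmap (paths colim A B) (paths (fst c) (unst A c) (unst B c)) (%u. pval u c)" unfolding colim_def flow.simps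
proof (rule continuous_map_curve_top)
  show "p t : pset A B" if "p : curves A B" "t : {0..1}" for p t using that by (rule curves_in)
  show "pathin (paths (fst c) (unst A c) (unst B c)) ((%u. pval u c) \<circ> p)" if "p : curves A B" for p
    using that assms by (simp add: curves_def o_def)
qed (rule pval_in[OF _ assms])

lemma pathin_colim: "pathin (paths colim A B) p \<longleftrightarrow> p : curves A B"
proof
  assume p: "pathin (paths colim A B) p"
  have "pathin (paths (fst c) (unst A c) (unst B c)) (%t. pval (p t) c)" if "c : cocones" for c
    using pathin_comp[OF p continuous_map_pval[OF that]] by (simp add: o_def)
  thus "p : curves A B" using pathin_funspace[OF p] by (simp add: curves_def)
next
  assume "p : curves A B"
  thus "pathin (paths colim A B) p" unfolding colim_def flow.simps
    by (intro curve_pathin[of "curves A B"] curves_in)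
qed

text \<open>The pairs of times at which two paths agree in one cocone form a closed set. Their intersection over all
  cocones is compact, and its projection is the set of times at which one path is in the image of the
  other.\<close>

lemma colim_delta_Hausdorff:
  assumes A: "A : states colim" and B: "B : states colim" and haus
  shows "delta_Hausdorff (paths colim A B)" unfolding delta_Hausdorff_def
proof (intro allI impI)
  let ?X = "paths colim A B" and ?I = "prod_topology unit_ivl unit_ivl"
  fix p assume p: "pathin ?X p"
  have pin: "p t : pset A B" if "t : {0..1}" for t using pathin_funspace[OF p that] by simp
  have ABs: "unst A : stset" "unst B : stset" using A B by (auto simp: colim_def)
  have "openin ?X (pset A B - p ` {0..1})"
    unfolding delta_generated_colim[unfolded delta_generated_def, rule_format] delta_open_def topspace_colim
  proof (intro conjI allI impI)
    fix q assume q: "pathin ?X q"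
    have qin: "q t : pset A B" if "t : {0..1}" for t using pathin_funspace[OF q that] by simp
    let ?eq = "%c. {x : {0..1} \<times> {0..1}. pval (p (fst x)) c = pval (q (snd x)) c}"
    have "closedin ?I (?eq c)" if c: "c : cocones" for c
    proof (rule delta_Hausdorff_equalizer)
      show "delta_Hausdorff (paths (fst c) (unst A c) (unst B c))"
        using flow_in_Top[OF cocone_flow[OF c] stset_states[OF ABs(1) c] stset_states[OF ABs(2) c]] \<open>haus\<close>
        by (simp add: in_Top_def)
      show "pathin (paths (fst c) (unst A c) (unst B c)) (%t. pval (p t) c)"
        "pathin (paths (fst c) (unst A c) (unst B c)) (%t. pval (q t) c)"
        using p q c by (auto simp: pathin_colim curves_def)
    qed
    hence "closedin ?I (\<Inter> (insert (topspace ?I) (?eq ` cocones)))" by (intro closedin_Inter) auto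
    hence "closedin unit_ivl (snd ` \<Inter> (insert (topspace ?I) (?eq ` cocones)))"
      using Abstract_Topological_Spaces.closed_map_snd[of unit_ivl unit_ivl]
      by (simp add: closed_map_def compact_space_subtopology)
    moreover have "snd ` \<Inter> (insert (topspace ?I) (?eq ` cocones)) = {t : {0..1}. q t : p ` {0..1}}"
    proof (intro equalityI subsetI)
      fix t assume "t : snd ` \<Inter> (insert (topspace ?I) (?eq ` cocones))"
      then obtain s where st: "s : {0..1}" "t : {0..1}" "!!c. c : cocones ==> pval (p s) c = pval (q t) c" by force
      hence "p s = q t" by (intro pset_eqI[OF pin qin]) auto
      thus "t : {t : {0..1}. q t : p ` {0..1}}" using st by (metis (mono_tags, lifting) image_eqI mem_Collect_eq)
    next
      fix t assume "t : {t : {0..1}. q t : p ` {0..1}}"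
      then obtain s where st: "s : {0..1}" "t : {0..1}" "q t = p s" by auto
      hence "(s, t) : \<Inter> (insert (topspace ?I) (?eq ` cocones))" by auto
      from imageI[OF this, of snd] show "t : snd ` \<Inter> (insert (topspace ?I) (?eq ` cocones))" by simp
    qed
    ultimately have "closedin unit_ivl {t : {0..1}. q t : p ` {0..1}}" by simp
    hence "openin unit_ivl (topspace unit_ivl - {t : {0..1}. q t : p ` {0..1}})" by blast
    moreover have "topspace unit_ivl - {t : {0..1}. q t : p ` {0..1}} = {t : {0..1}. q t : pset A B - p ` {0..1}}"
      using qin by auto
    ultimately show "openin unit_ivl {t : {0..1}. q t : pset A B - p ` {0..1}}" by simp
  qed auto
  thus "closedin ?X (p ` {0..1})" using pin by (auto simp: closedin_def)
qed

lemma pcomp_colim: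
  assumes "ok s" "ok t" "tgt s = src t"
  shows "pcomp colim (est (src s)) (est (tgt s)) (est (tgt t)) (rep (tri s)) (rep (tri t)) = rep (tri (Join s t))"
  using assms src_tgt_in[OF assms(1)] src_tgt_in[OF assms(2)] by (simp add: colim_def) (simp add: tri_def)

lemma pval_pcomp:
  assumes u: "u : pset A B" and v: "v : pset B C" and c: "c : cocones"
  shows "pcomp colim A B C u v : pset A C"
    "pval (pcomp colim A B C u v) c = pcomp (fst c) (unst A c) (unst B c) (unst C c) (pval u c) (pval v c)"
proof -
  obtain s where s: "ok s" "u = rep (tri s)" "A = est (src s)" "B = est (tgt s)" "unst A = src s" "unst B = tgt s" "pval u = val s"
    using u by (rule psetE)
  obtain t where t: "ok t" "v = rep (tri t)" "B = est (src t)" "C = est (tgt t)" "unst B = src t" "unst C = tgt t" "pval v = val t"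
    using v by (rule psetE)
  have e: "tgt s = src t" using s(6) t(5) by simp
  have ok: "ok (Join s t)" using s t e by simp
  have *: "pcomp colim A B C u v = rep (tri (Join s t))" using pcomp_colim[OF s(1) t(1) e] s(2-4) t(2,4) by simp
  show "pcomp colim A B C u v : pset A C"
    unfolding * pset_def using ok s(3) t(4) by (intro CollectI exI[of _ "Join s t"]) simp
  show "pval (pcomp colim A B C u v) c = pcomp (fst c) (unst A c) (unst B c) (unst C c) (pval u c) (pval v c)"
    unfolding * pval_rep[OF ok] using s t c by (simp add: cjoin_def)
qed

lemma pcomp_in:
  assumes u: "u : pset A B" and v: "v : pset B C" shows "pcomp colim A B C u v : pset A C"
proof -
  obtain s where s: "ok s" "u = rep (tri s)" "A = est (src s)" "B = est (tgt s)" "unst B = tgt s" using u by (rule psetE)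
  obtain t where t: "ok t" "v = rep (tri t)" "C = est (tgt t)" "unst B = src t" using v by (rule psetE)
  have e: "tgt s = src t" using s(5) t(4) by simp
  have "ok (Join s t)" using s t e by simp
  thus ?thesis unfolding pset_def using pcomp_colim[OF s(1) t(1) e] s(2-4) t(2,3)
    by (intro CollectI exI[of _ "Join s t"]) simp
qed

lemma is_flow_colim: "is_flow haus colim" unfolding is_flow_def
proof (intro conjI ballI)
  fix A B assume AB: "A : states colim" "B : states colim"
  show "in_Top haus (paths colim A B)"
    using delta_generated_colim colim_delta_Hausdorff[OF AB] by (simp add: in_Top_def)
  fix C assume Cs: "C : states colim"
  have st: "unst A : stset" "unst B : stset" "unst C : stset" using AB Cs by (auto simp: colim_def)
  let ?P = "delta_prod (paths colim A B) (paths colim B C)"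
  show "cmap ?P (paths colim A C) (%(p, q). pcomp colim A B C p q)"
  proof (rule continuous_map_on_paths[OF delta_generated_delta_prod])
    fix r assume r: "pathin ?P r"
    hence r12: "pathin (paths colim A B) (fst \<circ> r)" "pathin (paths colim B C) (snd \<circ> r)"
      by (simp_all add: pathin_delta_prod)
    have rin: "fst (r t) : pset A B" "snd (r t) : pset B C" if "t : {0..1}" for t
      using pathin_funspace[OF r12(1) that] pathin_funspace[OF r12(2) that] by simp_all
    show "pathin (paths colim A C) ((%(p, q). pcomp colim A B C p q) \<circ> r)" unfolding pathin_colim curves_def
    proof (intro CollectI conjI ballI)
      fix t :: real assume t: "t : {0..1}"
      show "((%(p, q). pcomp colim A B C p q) \<circ> r) t : pset A C"
        using pcomp_in[OF rin[OF t]] by (simp add: case_prod_beta')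
    next
      fix c assume c: "c : cocones"
      have "pathin (delta_prod (paths (fst c) (unst A c) (unst B c)) (paths (fst c) (unst B c) (unst C c)))
          (%t. (pval (fst (r t)) c, pval (snd (r t)) c))"
        using pathin_comp[OF r12(1) continuous_map_pval[OF c]] pathin_comp[OF r12(2) continuous_map_pval[OF c]]
        by (simp add: pathin_delta_prod o_def)
      from pathin_comp[OF this flow_pcomp_cont[OF cocone_flow[OF c] stset_states[OF st(1) c] stset_states[OF st(2) c] stset_states[OF st(3) c]]]
      have P: "pathin (paths (fst c) (unst A c) (unst C c))
          (%t. pcomp (fst c) (unst A c) (unst B c) (unst C c) (pval (fst (r t)) c) (pval (snd (r t)) c))"
        by (simp add: o_def)
      have eq: "pval (((%(p, q). pcomp colim A B C p q) \<circ> r) t) c =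
          pcomp (fst c) (unst A c) (unst B c) (unst C c) (pval (fst (r t)) c) (pval (snd (r t)) c)" if "t : {0..1}" for t
        using pval_pcomp(2)[OF rin[OF that] c] by (simp add: case_prod_beta')
      show "pathin (paths (fst c) (unst A c) (unst C c)) (%t. pval (((%(p, q). pcomp colim A B C p q) \<circ> r) t) c)"
        using P unfolding pathin_def by (rule continuous_map_eq) (use eq in simp)
    qed
  qed
  fix F p q r assume Fs: "F : states colim" and pqr: "p : topspace (paths colim A B)" "q : topspace (paths colim B C)"
    "r : topspace (paths colim C F)"
  hence pqr: "p : pset A B" "q : pset B C" "r : pset C F" by simp_all
  have sF: "unst F : stset" using Fs by (auto simp: colim_def)
  show "pcomp colim A C F (pcomp colim A B C p q) r = pcomp colim A B F p (pcomp colim B C F q r)"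
  proof (rule pset_eqI)
    show "pcomp colim A C F (pcomp colim A B C p q) r : pset A F" "pcomp colim A B F p (pcomp colim B C F q r) : pset A F"
      using pqr by (auto intro: pcomp_in)
    fix c assume c: "c : cocones"
    note m = stset_states[OF st(1) c] stset_states[OF st(2) c] stset_states[OF st(3) c] stset_states[OF sF c]
    show "pval (pcomp colim A C F (pcomp colim A B C p q) r) c = pval (pcomp colim A B F p (pcomp colim B C F q r)) c"
      unfolding pval_pcomp(2)[OF pcomp_in[OF pqr(1,2)] pqr(3) c] pval_pcomp(2)[OF pqr(1,2) c]
        pval_pcomp(2)[OF pqr(1) pcomp_in[OF pqr(2,3)] c] pval_pcomp(2)[OF pqr(2,3) c]
      by (rule flow_pcomp_assoc[OF cocone_flow[OF c] m pval_in[OF pqr(1) c] pval_in[OF pqr(2) c] pval_in[OF pqr(3) c]])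
  qed
qed

lemma gen_in: "ok (Gen j a b p) ==> rep (tri (Gen j a b p)) : pset (est (gst j a)) (est (gst j b))"
  unfolding pset_def by (intro CollectI exI[of _ "Gen j a b p"]) simp

lemma is_flow_map_leg: assumes j: "j : Ob J" shows "is_flow_map (fob D j) colim (leg j)" unfolding leg_def
proof (rule is_flow_map_fmap_on[OF flow[OF j]], unfold fst_conv snd_conv)
  fix a assume a: "a : states (fob D j)"
  thus "est (gst j a) : states colim" using gst_in[OF j] by (simp add: colim_def)
  fix b assume b: "b : states (fob D j)"
  note st = unst_est[OF gst_in[OF j a]] unst_est[OF gst_in[OF j b]]
  show "cmap (paths (fob D j) a b) (paths colim (est (gst j a)) (est (gst j b))) (%p. rep (tri (Gen j a b p)))"
  proof (rule continuous_map_on_paths[OF flow_delta_generated[OF flow[OF j] a b]])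
    fix q assume q: "pathin (paths (fob D j) a b) q"
    have ok: "ok (Gen j a b (q t))" if "t : {0..1}" for t using pathin_funspace[OF q that] a b j by simp
    show "pathin (paths colim (est (gst j a)) (est (gst j b))) ((%p. rep (tri (Gen j a b p))) \<circ> q)"
      unfolding pathin_colim curves_def st
    proof (intro CollectI conjI ballI)
      show "((%p. rep (tri (Gen j a b p))) \<circ> q) t : pset (est (gst j a)) (est (gst j b))" if "t : {0..1}" for t
        using gen_in[OF ok[OF that]] by simp
      fix c assume c: "c : cocones"
      have "pathin (paths (fst c) (gst j a c) (gst j b c)) (snd (snd c j) a b \<circ> q)"
        using pathin_comp[OF q flow_map_cont[OF cocone_map[OF c j] a b]] c by (simp add: gst_def)
      thus "pathin (paths (fst c) (gst j a c) (gst j b c)) (%t. pval (((%p. rep (tri (Gen j a b p))) \<circ> q) t) c)"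
        unfolding pathin_def by (rule continuous_map_eq) (use pval_rep[OF ok] c in simp)
    qed
  qed
  fix e p q assume e: "e : states (fob D j)" and p: "p : topspace (paths (fob D j) a b)"
    and q: "q : topspace (paths (fob D j) b e)"
  have ok: "ok (Gen j a b p)" "ok (Gen j b e q)" "ok (Gen j a e (pcomp (fob D j) a b e p q))"
    using j a b e p q flow_pcomp_path[OF flow[OF j] a b e p q] by simp_all
  have "tri (Gen j a e (pcomp (fob D j) a b e p q)) = tri (Join (Gen j a b p) (Gen j b e q))"
  proof -
    have "val (Gen j a e (pcomp (fob D j) a b e p q)) = val (Join (Gen j a b p) (Gen j b e q))"
    proof (rule extensionalityI[OF val_ext val_ext])
      fix c assume c: "c : cocones"
      show "val (Gen j a e (pcomp (fob D j) a b e p q)) c = val (Join (Gen j a b p) (Gen j b e q)) c"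
        using c flow_map_pcomp[OF cocone_map[OF c j] a b e p q] by (simp add: cjoin_def gst_def)
    qed
    thus ?thesis by (simp add: tri_def)
  qed
  thus "rep (tri (Gen j a e (pcomp (fob D j) a b e p q))) =
      pcomp colim (est (gst j a)) (est (gst j b)) (est (gst j e)) (rep (tri (Gen j a b p))) (rep (tri (Gen j b e q)))"
    using pcomp_colim[OF ok(1,2)] by simp
qed

lemma leg_cocone: "is_cocone J (Flow haus) D colim leg" unfolding is_cocone_def
proof (intro conjI ballI)
  show "colim : Ob (Flow haus)" using is_flow_colim by simp
  fix j assume j: "j : Ob J"
  show "leg j : Hom (Flow haus) (fob D j) colim" using is_flow_map_leg[OF j] by simp
  fix k u assume k: "k : Ob J" and u: "u : Hom J j k"
  note fu = maps[OF j k u]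
  have "fcomp (fob D j) (leg k) (fmor D j k u) = leg j"
  proof (rule flow_map_eqI[OF is_flow_map_fcomp[OF flow[OF j] fu is_flow_map_leg[OF k]] is_flow_map_leg[OF j]])
    have g: "gst k (fst (fmor D j k u) a) = gst j a" if a: "a : states (fob D j)" for a
    proof (rule extensionalityI[of _ cocones])
      fix c assume c: "c : cocones"
      have "fst (fcomp (fob D j) (snd c k) (fmor D j k u)) a = fst (snd c j) a" using cocone_comp[OF c j k u] by simp
      thus "gst k (fst (fmor D j k u) a) c = gst j a c" using c a by (simp add: gst_def)
    qed (auto simp: gst_def)
    fix a assume a: "a : states (fob D j)"
    show "fst (fcomp (fob D j) (leg k) (fmor D j k u)) a = fst (leg j) a"
      using a flow_map_state[OF fu a] g[OF a] by (simp add: leg_def)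
    fix b p assume b: "b : states (fob D j)" and p: "p : topspace (paths (fob D j) a b)"
    have "val (Gen k (fst (fmor D j k u) a) (fst (fmor D j k u) b) (snd (fmor D j k u) a b p)) = val (Gen j a b p)"
    proof (rule extensionalityI[OF val_ext val_ext])
      fix c assume c: "c : cocones"
      have "snd (fcomp (fob D j) (snd c k) (fmor D j k u)) a b p = snd (snd c j) a b p" using cocone_comp[OF c j k u] by simp
      thus "val (Gen k (fst (fmor D j k u) a) (fst (fmor D j k u) b) (snd (fmor D j k u) a b p)) c = val (Gen j a b p) c"
        using c a b p by simp
    qed
    hence "tri (Gen k (fst (fmor D j k u) a) (fst (fmor D j k u) b) (snd (fmor D j k u) a b p)) = tri (Gen j a b p)"
      using g[OF a] g[OF b] by (simp add: tri_def)
    thus "snd (fcomp (fob D j) (leg k) (fmor D j k u)) a b p = snd (leg j) a b p"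
      using a b p flow_map_state[OF fu a] flow_map_state[OF fu b] flow_map_path[OF fu a b p] by (simp add: leg_def)
  qed
  thus "Cmp (Flow haus) (fob D j) (fob D k) colim (leg k) (fmor D j k u) = leg j" by simp
qed

lemma is_flow_map_desc: assumes c: "c : cocones" shows "is_flow_map colim (fst c) (desc c)" unfolding desc_def
proof (rule is_flow_map_fmap_on[OF is_flow_colim], unfold fst_conv snd_conv)
  fix A assume "A : states colim"
  thus "unst A c : states (fst c)" using stset_states[OF _ c] by (auto simp: colim_def)
next
  fix A B
  show "cmap (paths colim A B) (paths (fst c) (unst A c) (unst B c)) (%u. pval u c)"
    by (rule continuous_map_pval[OF c])
next
  fix A B C p q assume "p : topspace (paths colim A B)" "q : topspace (paths colim B C)"
  thus "pval (pcomp colim A B C p q) c = pcomp (fst c) (unst A c) (unst B c) (unst C c) (pval p c) (pval q c)"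
    using pval_pcomp(2)[OF _ _ c] by simp
qed

lemma desc_leg: assumes c: "c : cocones" and j: "j : Ob J" shows "fcomp (fob D j) (desc c) (leg j) = snd c j"
proof (rule flow_map_eqI[OF is_flow_map_fcomp[OF flow[OF j] is_flow_map_leg[OF j] is_flow_map_desc[OF c]] cocone_map[OF c j]])
  fix a assume a: "a : states (fob D j)"
  have la: "fst (leg j) a = est (gst j a)" "est (gst j a) : states colim" if "a : states (fob D j)" for a
    using that gst_in[OF j that] by (simp_all add: leg_def colim_def)
  show "fst (fcomp (fob D j) (desc c) (leg j)) a = fst (snd c j) a"
    using a c la[OF a] gst_in[OF j a] by (simp add: desc_def) (simp add: gst_def)
  fix b p assume b: "b : states (fob D j)" and p: "p : topspace (paths (fob D j) a b)"
  have ok: "ok (Gen j a b p)" using j a b p by simp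
  have "snd (leg j) a b p = rep (tri (Gen j a b p))" using a b p by (simp add: leg_def)
  hence "snd (fcomp (fob D j) (desc c) (leg j)) a b p =
      snd (desc c) (est (gst j a)) (est (gst j b)) (rep (tri (Gen j a b p)))" using a b p la[OF a] la[OF b] by simp
  also have "\<dots> = pval (rep (tri (Gen j a b p))) c"
    using la[OF a] la[OF b] gen_in[OF ok] by (simp add: desc_def)
  also have "\<dots> = snd (snd c j) a b p" using pval_rep[OF ok] c by simp
  finally show "snd (fcomp (fob D j) (desc c) (leg j)) a b p = snd (snd c j) a b p" .
qed

lemma desc_unique:
  assumes c: "c : cocones" and h: "is_flow_map colim (fst c) h"
    and hl: "!!j. j : Ob J ==> fcomp (fob D j) h (leg j) = snd c j"
  shows "h = desc c"
proof (rule flow_map_eqI[OF h is_flow_map_desc[OF c]])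
  have st: "fst h (est x) = x c" if x: "x : stset" for x
  proof -
    obtain j a where ja: "j : Ob J" "a : states (fob D j)" "x = gst j a" using x by (auto simp: stset_def)
    have "fst (fcomp (fob D j) h (leg j)) a = fst (snd c j) a" using hl[OF ja(1)] by simp
    thus ?thesis using ja c by (simp add: leg_def) (simp add: gst_def)
  qed
  have pt: "ok t ==> snd h (est (src t)) (est (tgt t)) (rep (tri t)) = val t c" for t
  proof (induction t)
    case (Gen j a b p)
    hence jab: "j : Ob J" "a : states (fob D j)" "b : states (fob D j)" "p : topspace (paths (fob D j) a b)" by auto
    have "snd (fcomp (fob D j) h (leg j)) a b p = snd (snd c j) a b p" using hl[OF jab(1)] by simp
    thus ?case using jab c by (simp add: leg_def)
  next
    case (Join s t)
    hence st': "ok s" "ok t" "tgt s = src t" by auto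
    note ins = src_tgt_in[OF st'(1)] src_tgt_in[OF st'(2)]
    have sc: "est (src s) : states colim" "est (tgt s) : states colim" "est (tgt t) : states colim"
      using ins by (auto simp: colim_def)
    have pin: "rep (tri s) : topspace (paths colim (est (src s)) (est (tgt s)))"
      "rep (tri t) : topspace (paths colim (est (tgt s)) (est (tgt t)))" using st' by (auto simp: pset_def)
    have "snd h (est (src s)) (est (tgt t)) (rep (tri (Join s t))) =
        pcomp (fst c) (src s c) (tgt s c) (tgt t c) (val s c) (val t c)"
      using flow_map_pcomp[OF h sc pin] Join.IH st' ins by (simp add: pcomp_colim[OF st', symmetric] st)
    thus ?case using c by (simp add: cjoin_def)
  qed
  fix A assume A: "A : states colim"
  then obtain x where x: "x : stset" "A = est x" by (auto simp: colim_def)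
  show "fst h A = fst (desc c) A" using A x st by (simp add: desc_def)
  fix B u assume B: "B : states colim" and u: "u : topspace (paths colim A B)"
  hence "u : pset A B" by simp
  then obtain t where t: "ok t" "u = rep (tri t)" "A = est (src t)" "B = est (tgt t)" "pval u = val t" by (rule psetE)
  have "snd h A B u = val t c" unfolding t(2-4) by (rule pt[OF t(1)])
  also have "\<dots> = snd (desc c) A B u" using A B u t(5) by (simp add: desc_def)
  finally show "snd h A B u = snd (desc c) A B u" .
qed

lemma is_colimit_colim: "is_colimit J (Flow haus) D colim leg" unfolding is_colimit_def
proof (intro conjI allI impI leg_cocone)
  fix Z \<mu> assume "is_cocone J (Flow haus) D Z \<mu>"
  hence c: "(Z, \<mu>) : cocones" by (simp add: cocones_def)
  show "\<exists>!h. h : Hom (Flow haus) colim Z & (\<forall>j\<in>Ob J. Cmp (Flow haus) (fob D j) colim Z h (leg j) = \<mu> j)"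
  proof (rule ex1I[of _ "desc (Z, \<mu>)"])
    show "desc (Z, \<mu>) : Hom (Flow haus) colim Z & (\<forall>j\<in>Ob J. Cmp (Flow haus) (fob D j) colim Z (desc (Z, \<mu>)) (leg j) = \<mu> j)"
      using is_flow_map_desc[OF c] desc_leg[OF c] by simp
    fix h assume "h : Hom (Flow haus) colim Z & (\<forall>j\<in>Ob J. Cmp (Flow haus) (fob D j) colim Z h (leg j) = \<mu> j)"
    thus "h = desc (Z, \<mu>)" using desc_unique[OF c, of h] by simp
  qed
qed

end

section \<open>Splitting natural d-paths at vertices\<close>

text \<open>The parts of a path before and after a vertex \<open>be\<close>, in the coordinates of the respective subcubes.\<close>

definition fpart :: "bool list => bool list => bool list => (real => nat => real) => real => nat => real" where
  "fpart al be ga \<eta> = (\<lambda>t\<in>{0..real (rise al be)}. \<lambda>k\<in>{..<rise al be}.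
     \<eta> t (pos_in (diff_coords al ga) (sorted_list_of_set (diff_coords al be) ! k)))"

definition spart :: "bool list => bool list => bool list => (real => nat => real) => real => nat => real" where
  "spart al be ga \<eta> = (\<lambda>t\<in>{0..real (rise be ga)}. \<lambda>k\<in>{..<rise be ga}.
     \<eta> (t + real (rise al be)) (pos_in (diff_coords al ga) (sorted_list_of_set (diff_coords be ga) ! k)))"

definition passes :: "bool list => bool list => bool list => (real => nat => real) => bool" where
  "passes al be ga \<eta> \<longleftrightarrow> \<eta> : natural_dpaths (rise al ga) \<and>
     (\<forall>i\<in>diff_coords al ga. \<eta> (real (rise al be)) (pos_in (diff_coords al ga) i) = of_bool (i : diff_coords al be))"

context
  fixes al be ga assumes ab: "vless al be" and bc: "vless be ga"
begin

abbreviation (input) "dD \<equiv> diff_coords al ga"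
abbreviation (input) "dD1 \<equiv> diff_coords al be"
abbreviation (input) "dD2 \<equiv> diff_coords be ga"

lemma N_comp_at:
  assumes "0 <= t" "t <= real (card dD)" "i : dD"
  shows "N_comp al be ga \<eta> \<theta> t (pos_in dD i) =
    moore (real (card dD1)) (in_subcube al be \<eta>) (in_subcube be ga \<theta>) t i"
  using assms sorted_nth_pos_in[OF finite_diff_coords assms(3)] by (simp add: N_comp_def)

lemma fpart_N_comp:
  assumes a: "\<eta> : natural_dpaths (card dD1)"
  shows "fpart al be ga (N_comp al be ga \<eta> \<theta>) = \<eta>"
proof (rule extensionalityI[OF _ ndp_ext[OF a]])
  fix t assume t: "t : {0..real (card dD1)}"
  show "fpart al be ga (N_comp al be ga \<eta> \<theta>) t = \<eta> t"
  proof (rule extensionalityI[OF _ ndp_ext'[OF a]])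
    fix k assume "k : {..<card dD1}"
    hence k: "k < card dD1" by simp
    note s = pos_in_nth[OF finite_diff_coords k]
    have "sorted_list_of_set dD1 ! k : dD" using s(1) diff_coords_Un[OF ab bc] by blast
    thus "fpart al be ga (N_comp al be ga \<eta> \<theta>) t k = \<eta> t k"
      using N_comp_at[of t "sorted_list_of_set dD1 ! k" \<eta> \<theta>] t k moore_subcube_fst[OF ab bc s(1)] s(2)
        card_diff_coords_add[OF ab bc] by (simp add: fpart_def)
  qed (use t in \<open>auto simp: fpart_def\<close>)
qed (simp add: fpart_def)

lemma spart_N_comp:
  assumes a: "\<theta> : natural_dpaths (card dD2)"
  shows "spart al be ga (N_comp al be ga \<eta> \<theta>) = \<theta>"
  proof (rule extensionalityI[OF _ ndp_ext[OF a]])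
    fix t assume t: "t : {0..real (card dD2)}"
    show "spart al be ga (N_comp al be ga \<eta> \<theta>) t = \<theta> t"
    proof (rule extensionalityI[OF _ ndp_ext'[OF a]])
      fix k assume "k : {..<card dD2}"
      hence k: "k < card dD2" by simp
      note s = pos_in_nth[OF finite_diff_coords k]
      have "sorted_list_of_set dD2 ! k : dD" using s(1) diff_coords_Un[OF ab bc] by blast
      thus "spart al be ga (N_comp al be ga \<eta> \<theta>) t k = \<theta> t k"
        using N_comp_at[of "t + real (card dD1)" "sorted_list_of_set dD2 ! k" \<eta> \<theta>] t k
          moore_subcube_snd[OF ab bc s(1)] s(2) ndp_0[OF a k]
          card_diff_coords_add[OF ab bc] by (auto simp: spart_def)
    qed (use t in \<open>auto simp: spart_def\<close>)
  qed (simp add: spart_def)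

context
  fixes \<eta> assumes pass: "passes al be ga \<eta>"
begin

lemma passes_natural: "\<eta> : natural_dpaths (card dD)" using pass by (simp add: passes_def)

lemma passes_len: "real (card dD) = real (card dD1) + real (card dD2)" by (simp add: card_diff_coords_add[OF ab bc])

lemma passes_pos: "i : dD ==> pos_in dD i < card dD" by (rule sorted_nth_pos_in) simp_all

lemma passes_before: assumes "0 <= t" "t <= real (card dD1)" "i : dD2" shows "\<eta> t (pos_in dD i) = 0"
proof -
  have i: "i : dD" "i ~: dD1" using assms diff_coords_Un[OF ab bc] diff_coords_Int[OF ab bc] by auto
  have "\<eta> t (pos_in dD i) <= \<eta> (real (card dD1)) (pos_in dD i)"
    using assms passes_len by (intro ndp_mono[OF passes_natural passes_pos[OF i(1)]]) auto
  moreover have "0 <= \<eta> t (pos_in dD i)"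
    using ndp_bounds[OF passes_natural _ _ passes_pos[OF i(1)], of t] assms passes_len by auto
  ultimately show ?thesis using pass i by (simp add: passes_def)
qed

lemma passes_after:
  assumes "real (card dD1) <= t" "t <= real (card dD)" "i : dD1" shows "\<eta> t (pos_in dD i) = 1"
proof -
  have i: "i : dD" using assms diff_coords_Un[OF ab bc] by auto
  have "\<eta> (real (card dD1)) (pos_in dD i) <= \<eta> t (pos_in dD i)"
    using assms passes_len by (intro ndp_mono[OF passes_natural passes_pos[OF i(1)]]) auto
  moreover have "\<eta> t (pos_in dD i) <= 1"
    using ndp_bounds[OF passes_natural _ _ passes_pos[OF i(1)], of t] assms passes_len by auto
  ultimately show ?thesis using pass i assms by (simp add: passes_def)
qed

lemma passes_sum:
  assumes "0 <= t" "t <= real (card dD)"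
  shows "(\<Sum>i\<in>dD1. \<eta> t (pos_in dD i)) + (\<Sum>i\<in>dD2. \<eta> t (pos_in dD i)) = t"
proof -
  have "(\<Sum>i\<in>dD1. \<eta> t (pos_in dD i)) + (\<Sum>i\<in>dD2. \<eta> t (pos_in dD i)) = (\<Sum>i\<in>dD. \<eta> t (pos_in dD i))"
    unfolding diff_coords_Un[OF ab bc] by (rule sum.union_disjoint[symmetric]) (auto simp: diff_coords_Int[OF ab bc])
  also have "\<dots> = t" using sum_pos_in[OF finite_diff_coords, of "\<eta> t" al ga] ndp_sum[OF passes_natural assms] by simp
  finally show ?thesis .
qed

lemma fpart_natural: "fpart al be ga \<eta> : natural_dpaths (card dD1)"
proof (rule natural_dpathsI)
  have s: "pos_in dD (sorted_list_of_set dD1 ! k) < card dD" if "k < card dD1" for k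
    using pos_in_nth(1)[OF finite_diff_coords that] diff_coords_Un[OF ab bc] by (intro passes_pos) auto
  {
    fix t assume t: "0 <= t" "t <= real (card dD1)"
    hence t': "t <= real (card dD)" using passes_len by simp
    have "(\<Sum>k<card dD1. fpart al be ga \<eta> t k) = (\<Sum>k<card dD1. \<eta> t (pos_in dD (sorted_list_of_set dD1 ! k)))"
      using t by (intro sum.cong) (auto simp: fpart_def)
    also have "\<dots> = (\<Sum>i\<in>dD1. \<eta> t (pos_in dD i))" by (rule sum_sorted_nth) simp
    also have "\<dots> = t" using passes_sum[OF t(1) t'] passes_before[OF t] by simp
    finally show "(\<Sum>k<card dD1. fpart al be ga \<eta> t k) = t" .
    show "0 <= fpart al be ga \<eta> t k & fpart al be ga \<eta> t k <= 1" if "k < card dD1" for k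
      using ndp_bounds[OF passes_natural t(1) t' s[OF that]] t that by (simp add: fpart_def)
  next
    fix k r t assume k: "k < card dD1" and t: "0 <= r" "r <= t" "t <= real (card dD1)"
    have "\<eta> r (pos_in dD (sorted_list_of_set dD1 ! k)) <= \<eta> t (pos_in dD (sorted_list_of_set dD1 ! k))"
      using t passes_len by (intro ndp_mono[OF passes_natural s[OF k]]) auto
    thus "fpart al be ga \<eta> r k <= fpart al be ga \<eta> t k" using t k by (simp add: fpart_def)
  }
qed (auto simp: fpart_def)

lemma spart_natural: "spart al be ga \<eta> : natural_dpaths (card dD2)"
proof (rule natural_dpathsI)
  let ?l = "real (card dD1)"
  have s: "pos_in dD (sorted_list_of_set dD2 ! k) < card dD" if "k < card dD2" for k
    using pos_in_nth(1)[OF finite_diff_coords that] diff_coords_Un[OF ab bc] by (intro passes_pos) auto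
  {
    fix t assume t: "0 <= t" "t <= real (card dD2)"
    hence t': "0 <= t + ?l" "t + ?l <= real (card dD)" using passes_len by simp_all
    have "(\<Sum>k<card dD2. spart al be ga \<eta> t k) = (\<Sum>k<card dD2. \<eta> (t + ?l) (pos_in dD (sorted_list_of_set dD2 ! k)))"
      using t by (intro sum.cong) (auto simp: spart_def)
    also have "\<dots> = (\<Sum>i\<in>dD2. \<eta> (t + ?l) (pos_in dD i))" by (rule sum_sorted_nth) simp
    also have "\<dots> = t" using passes_sum[OF t'] passes_after[OF _ t'(2)] t by simp
    finally show "(\<Sum>k<card dD2. spart al be ga \<eta> t k) = t" .
    show "0 <= spart al be ga \<eta> t k & spart al be ga \<eta> t k <= 1" if "k < card dD2" for k
      using ndp_bounds[OF passes_natural t' s[OF that]] t that by (simp add: spart_def)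
  next
    fix k r t assume k: "k < card dD2" and t: "0 <= r" "r <= t" "t <= real (card dD2)"
    have "\<eta> (r + ?l) (pos_in dD (sorted_list_of_set dD2 ! k)) <= \<eta> (t + ?l) (pos_in dD (sorted_list_of_set dD2 ! k))"
      using t passes_len by (intro ndp_mono[OF passes_natural s[OF k]]) auto
    thus "spart al be ga \<eta> r k <= spart al be ga \<eta> t k" using t k by (simp add: spart_def)
  }
qed (auto simp: spart_def)

lemma N_comp_parts: "N_comp al be ga (fpart al be ga \<eta>) (spart al be ga \<eta>) = \<eta>"
proof (rule ndp_eqI[OF N_comp_natural[OF ab bc fpart_natural spart_natural] passes_natural])
  fix t k assume t: "0 <= t" "t <= real (card dD)" and k: "k < card dD"
  let ?i = "sorted_list_of_set dD ! k" and ?l = "real (card dD1)"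
  note s = pos_in_nth[OF finite_diff_coords k]
  have "N_comp al be ga (fpart al be ga \<eta>) (spart al be ga \<eta>) t k =
      moore ?l (in_subcube al be (fpart al be ga \<eta>)) (in_subcube be ga (spart al be ga \<eta>)) t ?i"
    using N_comp_at[OF t s(1)] s(2) by simp
  also have "\<dots> = \<eta> t (pos_in dD ?i)"
  proof -
    have "?i : dD1 | ?i : dD2" using s(1) diff_coords_Un[OF ab bc] by blast
    thus ?thesis
    proof
      assume i: "?i : dD1"
      show ?thesis unfolding moore_subcube_fst[OF ab bc i]
        using sorted_nth_pos_in[OF finite_diff_coords i] passes_after[OF _ t(2) i] t by (simp add: fpart_def)
    next
      assume i: "?i : dD2"
      show ?thesis unfolding moore_subcube_snd[OF ab bc i]
        using sorted_nth_pos_in[OF finite_diff_coords i] passes_before[OF t(1) _ i] t passes_len by (simp add: spart_def)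
    qed
  qed
  finally show "N_comp al be ga (fpart al be ga \<eta>) (spart al be ga \<eta>) t k = \<eta> t k" using s(2) by simp
qed

end

end

text \<open>Coordinates that have moved stay moved, so the vertices on a path form a chain, and the later of two
  lies on the part after the earlier.\<close>

lemma passes_twice:
  assumes ab: "vless al be" and bd: "vless be de" and ac: "vless al ga" and cd: "vless ga de"
    and p: "passes al be de \<eta>" and q: "passes al ga de \<eta>" and le: "rise al be <= rise al ga"
  shows "be = ga | (vless be ga & passes be ga de (spart al be de \<eta>))"
proof (cases "be = ga")
  case False
  have len: "length be = length al" "length ga = length al" "length de = length al"
    using vless_length[OF ab] vless_length[OF ac] vless_length[OF cd] by auto
  let ?D = "diff_coords al de"
  have sub: "diff_coords al be \<subseteq> diff_coords al ga"
  proof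
    fix i assume i: "i : diff_coords al be"
    have iD: "i : ?D" using i diff_coords_Un[OF ab bd] by auto
    have "\<eta> (real (rise al ga)) (pos_in ?D i) = 1"
      using le card_diff_coords_add[OF ac cd] by (intro passes_after[OF ab bd p _ _ i]) auto
    thus "i : diff_coords al ga" using q iD by (auto simp: passes_def split: if_splits)
  qed
  have bc: "vless be ga"
  proof (rule vlessI)
    fix i assume i: "i < length be" "be ! i"
    show "ga ! i"
    proof (cases "al ! i")
      case True
      thus ?thesis using vless_nth[OF ac] i len by simp
    next
      case False
      hence "i : diff_coords al be" using mem_diff_coords[OF ab] i len by simp
      thus ?thesis using sub mem_diff_coords[OF ac] by blast
    qed
  qed (use False len in auto)
  have "passes be ga de (spart al be de \<eta>)" unfolding passes_def
  proof (intro conjI ballI spart_natural[OF ab bd p])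
    fix i assume i: "i : diff_coords be de"
    note s = sorted_nth_pos_in[OF finite_diff_coords i]
    have iD: "i : ?D" "i ~: diff_coords al be" using i diff_coords_Un[OF ab bd] diff_coords_Int[OF ab bd] by auto
    have "spart al be de \<eta> (real (rise be ga)) (pos_in (diff_coords be de) i) =
        \<eta> (real (rise be ga) + real (rise al be)) (pos_in ?D i)"
      using s card_diff_coords_add[OF bc cd] by (simp add: spart_def)
    also have "real (rise be ga) + real (rise al be) = real (rise al ga)"
      using card_diff_coords_add[OF ab bc] by simp
    also have "\<eta> (real (rise al ga)) (pos_in ?D i) = of_bool (i : diff_coords al ga)"
      using q iD(1) by (simp add: passes_def)
    also have "i : diff_coords al ga \<longleftrightarrow> i : diff_coords be ga"
      using iD(2) diff_coords_Un[OF ab bc] by blast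
    finally show "spart al be de \<eta> (real (rise be ga)) (pos_in (diff_coords be de) i) = of_bool (i : diff_coords be ga)" .
  qed
  thus ?thesis using bc by blast
qed simp

lemma finite_vert: "finite (vert n)"
  unfolding vert_def using finite_lists_length_eq[of "UNIV :: bool set" n] by simp

lemma bot_vless: "al : vert n ==> al ~= bot_vert n ==> vless (bot_vert n) al"
  by (rule vlessI) (auto simp: vert_def bot_vert_def)

lemma vless_top: "al : vert n ==> al ~= top_vert n ==> vless al (top_vert n)"
  by (rule vlessI) (auto simp: vert_def top_vert_def)

lemma diff_coords_bot: "al : vert n ==> diff_coords (bot_vert n) al = {i. i < n & al ! i}"
  by (auto simp: diff_coords_def bot_vert_def vert_def)

lemma diff_coords_bot_top [simp]: "diff_coords (bot_vert n) (top_vert n) = {..<n}"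
  by (auto simp: diff_coords_def bot_vert_def top_vert_def)

lemma pos_in_lessThan: "i < n ==> pos_in {..<n} i = i"
proof -
  assume "i < n"
  hence "{..<n} \<inter> {..<i} = {..<i}" by auto
  thus ?thesis by (simp add: pos_in_def)
qed

lemma passes_through:
  assumes "al : vert n"
  shows "passes (bot_vert n) al (top_vert n) \<eta> \<longleftrightarrow> \<eta> : through n (diff_coords (bot_vert n) al)"
  by (simp add: passes_def through_def pos_in_lessThan Ball_def)

lemma card_diff_coords_less:
  assumes v: "vless al be" and ab: "al : vert n" "be : vert n" and ne: "al ~= bot_vert n | be ~= top_vert n"
  shows "rise al be < n"
proof -
  have sub: "diff_coords al be \<subseteq> {..<n}" using ab by (auto simp: diff_coords_def vert_def)
  have "diff_coords al be ~= {..<n}"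
  proof
    assume e: "diff_coords al be = {..<n}"
    have "\<not> al ! i & be ! i" if "i < n" for i using that e mem_diff_coords[OF v, of i] by auto
    hence "al = bot_vert n" "be = top_vert n"
      using ab by (auto simp: vert_def bot_vert_def top_vert_def intro!: nth_equalityI)
    thus False using ne by simp
  qed
  hence "diff_coords al be \<subset> {..<n}" using sub by blast
  thus ?thesis using psubset_card_mono[of "{..<n}" "diff_coords al be"] by simp
qed

lemma homeomorphic_maps_npath_sub:
  assumes "S \<subseteq> topspace M"
  shows "homeomorphic_maps (subtopology M S) (subtopology (npath_top M) (NPath ` S)) NPath unNPath"
  unfolding homeomorphic_maps_def using continuous_map_from_subtopology[OF continuous_map_NPath[of M], of S]
    continuous_map_from_subtopology[OF continuous_map_unNPath[of M], of "NPath ` S"]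
  by (auto simp: continuous_map_in_subtopology)

text \<open>The subcube between two vertices of a face, and its vertices, lie in that face.\<close>

lemma face_map_comp:
  assumes f: "box_map m n \<phi>" and xy: "xs : vert m" "ys : vert m" "vless xs ys | xs = ys"
  shows "face_map (\<phi> xs) (\<phi> ys) = compose (vert (rise xs ys)) \<phi> (face_map xs ys)"
    and "rise (\<phi> xs) (\<phi> ys) = rise xs ys"
proof -
  obtain g where g: "coords_at m n \<phi> g" using box_map_coords[OF f] by blast
  let ?k = "rise xs ys"
  show c: "rise (\<phi> xs) (\<phi> ys) = ?k" by (rule card_diff_coords_coords_at[OF g xy(1,2)])
  have len: "length (\<phi> xs) = n" "length (\<phi> ys) = n" "length xs = m" "length ys = m"
    using coords_at_vert[OF g] xy by (auto simp: vert_def)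
  have xs: "vless (\<phi> xs) (\<phi> ys) | \<phi> xs = \<phi> ys" using xy vless_coords_at[OF g] by blast
  have 1: "box_map ?k n (face_map (\<phi> xs) (\<phi> ys))" using box_map_face_map[of "\<phi> xs" "\<phi> ys"] len c by simp
  have "box_map ?k m (face_map xs ys)" using box_map_face_map[of xs ys] len by simp
  from box_map.comp[OF this f] have 2: "box_map ?k n (compose (vert ?k) \<phi> (face_map xs ys))" .
  show "face_map (\<phi> xs) (\<phi> ys) = compose (vert ?k) \<phi> (face_map xs ys)"
    using fill_bot_top[OF xs] fill_bot_top[OF xy(3)] c
    by (intro box_map_eqI[OF 1 2]) (simp_all add: face_map_def compose_def)
qed

lemma face_map_middle:
  assumes ab: "vless al be" and bc: "vless be ga"
  obtains xs where "xs : vert (rise al ga)" "face_map al ga xs = be"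
    "vless (bot_vert (rise al ga)) xs" "vless xs (top_vert (rise al ga))"
proof -
  let ?m = "rise al ga" and ?\<phi> = "face_map al ga" and ?n = "length al"
  note ac = vless_trans[OF ab bc]
  have len: "length be = ?n" "length ga = ?n" using vless_length[OF ab] vless_length[OF ac] by auto
  have f: "box_map ?m ?n ?\<phi>" using box_map_face_map[of al ga] len by simp
  obtain g where g: "coords_at ?m ?n ?\<phi> g" using box_map_coords[OF f] by blast
  define xs where "xs = map (%i. be ! g i) [0..<?m]"
  have xs: "xs : vert ?m" by (simp add: xs_def vert_def)
  have bt: "?\<phi> (bot_vert ?m) = al" "?\<phi> (top_vert ?m) = ga" using face_map_bot_top[OF ac] by auto
  have e: "?\<phi> xs = be"
  proof (rule nth_equalityI)
    show "length (?\<phi> xs) = length be" using coords_at_vert[OF g xs] len by (simp add: vert_def)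
    fix j assume "j < length (?\<phi> xs)"
    hence j: "j < ?n" using coords_at_vert[OF g xs] by (simp add: vert_def)
    show "?\<phi> xs ! j = be ! j"
    proof (cases "j : g ` {..<?m}")
      case True
      then obtain i where "i < ?m" "j = g i" by auto
      thus ?thesis using coords_at_nth[OF g xs] by (simp add: xs_def)
    next
      case False
      hence c: "?\<phi> xs ! j = al ! j" "?\<phi> xs ! j = ga ! j"
        using coords_at_const[OF g xs bot_top_vert(1) j] coords_at_const[OF g xs bot_top_vert(2) j] bt by simp_all
      thus ?thesis using vless_nth[OF ab j] vless_nth[OF bc, of j] j len by auto
    qed
  qed
  show ?thesis
    using that[OF xs e] vless_coords_at[OF g bot_top_vert(1) xs] vless_coords_at[OF g xs bot_top_vert(2)] bt e ab bc
    by simp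
qed

section \<open>Lifting over the boundary of a cube\<close>

text \<open>A square from the inclusion of the boundary of the cube to a trivial fibration: \<open>f\<close> is the prescribed
  lift on the proper faces, \<open>w\<close> the map to be lifted.\<close>

locale cube_lifting =
  fixes haus :: bool and n :: nat and X Y :: "'a uflow" and p w :: "'a uflow_map"
    and f :: "nat => (bool list => bool list) => 'a uflow_map"
  assumes X: "is_flow haus X" and Y: "is_flow haus Y" and p: "is_flow_map X Y p"
    and fib: "m_fibration haus X Y p" and weq: "flow_weak_equivalence X Y p"
    and w: "is_flow_map (nat_cube n) Y w"
    and f: "!!m \<phi>. m < n ==> box_map m n \<phi> ==> is_flow_map (nat_cube m) X (f m \<phi>)"
    and f_nat: "!!l m \<psi> \<phi>. m < n ==> box_map l m \<psi> ==> box_map m n \<phi> ==>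
      f l (compose (vert l) \<phi> \<psi>) = fcomp (nat_cube l) (f m \<phi>) (nat_cube_map l m \<psi>)"
    and pf: "!!m \<phi>. m < n ==> box_map m n \<phi> ==>
      fcomp (nat_cube m) p (f m \<phi>) = fcomp (nat_cube m) w (nat_cube_map m n \<phi>)"
begin

definition hst :: "bool list => 'a univ" where
  "hst al = fst (f 0 (face_map al al)) (Vertex [])"

text \<open>Paths between two vertices are paths between the extreme vertices of the face that they span.\<close>

definition hp :: "bool list => bool list => 'a univ => 'a univ" where
  "hp al be = (let m = rise al be
     in snd (f m (face_map al be)) (Vertex (bot_vert m)) (Vertex (top_vert m)))"

abbreviation proper :: "bool list => bool list => bool" where
  "proper al be \<equiv> al : vert n & be : vert n & vless al be & (al ~= bot_vert n | be ~= top_vert n)"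

lemma f_state:
  assumes m: "m < n" and \<phi>: "box_map m n \<phi>" and xs: "xs : vert m"
  shows "fst (f m \<phi>) (Vertex xs) = hst (\<phi> xs)"
proof -
  have d: "rise xs xs = 0" by (simp add: diff_coords_def)
  have len: "length xs = m" using xs by (simp add: vert_def)
  have b: "box_map 0 m (face_map xs xs)" using box_map_face_map[of xs xs] d len by simp
  have "face_map (\<phi> xs) (\<phi> xs) = compose (vert 0) \<phi> (face_map xs xs)"
    using face_map_comp(1)[OF \<phi> xs xs] d by simp
  hence "f 0 (face_map (\<phi> xs) (\<phi> xs)) = fcomp (nat_cube 0) (f m \<phi>) (nat_cube_map 0 m (face_map xs xs))"
    using f_nat[OF m b \<phi>] by simp
  moreover have "Vertex [] : states (nat_cube 0 :: 'a uflow)" by (simp add: vert_def)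
  moreover have "face_map xs xs [] = xs"
    using fill_bot_top(1)[of xs xs] d by (simp add: face_map_def vert_def bot_vert_def)
  ultimately show ?thesis by (simp add: hst_def nat_cube_map_fst vert_def)
qed

lemma f_path:
  assumes m: "m < n" and \<phi>: "box_map m n \<phi>" and xy: "xs : vert m" "ys : vert m" "vless xs ys"
    and q: "q : topspace (paths (nat_cube m) (Vertex xs) (Vertex ys))"
  shows "snd (f m \<phi>) (Vertex xs) (Vertex ys) q = hp (\<phi> xs) (\<phi> ys) q"
proof -
  let ?k = "rise xs ys"
  let ?b = "bot_vert ?k" and ?t = "top_vert ?k"
  have len: "length xs = m" "length ys = m" using xy by (auto simp: vert_def)
  have b: "box_map ?k m (face_map xs ys)" using box_map_face_map[of xs ys] len by simp
  have bt: "face_map xs ys ?b = xs" "face_map xs ys ?t = ys" using face_map_bot_top[OF xy(3)] by auto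
  have v: "vless xs ys | xs = ys" using xy(3) by simp
  have "f ?k (face_map (\<phi> xs) (\<phi> ys)) = fcomp (nat_cube ?k) (f m \<phi>) (nat_cube_map ?k m (face_map xs ys))"
    using face_map_comp(1)[OF \<phi> xy(1,2) v] f_nat[OF m b \<phi>] by simp
  moreover have "q : topspace (paths (nat_cube ?k) (Vertex ?b) (Vertex ?t))"
    using q paths_nat_cube_face[OF b bot_top_vert(1) bot_top_vert(2)] bt by metis
  ultimately show ?thesis unfolding hp_def face_map_comp(2)[OF \<phi> xy(1,2) v] Let_def
    using bt by (simp add: nat_cube_map_fst nat_cube_map_snd)
qed

lemma f_face:
  assumes "proper al be"
  shows "rise al be < n" "box_map (rise al be) n (face_map al be)"
    "face_map al be (bot_vert (rise al be)) = al"
    "face_map al be (top_vert (rise al be)) = be"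
  using card_diff_coords_less[of al be n] box_map_face_map[of al be] face_map_bot_top[of al be] assms
  by (auto simp: vert_def)

lemma nat_cube_bot_top_paths:
  assumes "vless al be" "al : vert n" "be : vert n"
  shows "paths (nat_cube (rise al be)) (Vertex (bot_vert (rise al be)))
      (Vertex (top_vert (rise al be))) = (paths (nat_cube n) (Vertex al) (Vertex be) :: 'a univ topology)"
proof -
  have b: "box_map (rise al be) n (face_map al be)" using box_map_face_map[of al be] assms by (simp add: vert_def)
  show ?thesis
    using paths_nat_cube_face[OF b bot_top_vert(1) bot_top_vert(2), where 'a = 'a] face_map_bot_top[OF assms(1)] by simp
qed

lemma hp_cont:
  assumes ab: "proper al be"
  shows "cmap (paths (nat_cube n) (Vertex al) (Vertex be)) (paths X (hst al) (hst be)) (hp al be)"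
proof -
  let ?m = "rise al be"
  note F = f_face[OF ab]
  have "cmap (paths (nat_cube ?m) (Vertex (bot_vert ?m)) (Vertex (top_vert ?m)))
      (paths X (fst (f ?m (face_map al be)) (Vertex (bot_vert ?m))) (fst (f ?m (face_map al be)) (Vertex (top_vert ?m))))
      (hp al be)" unfolding hp_def Let_def by (rule flow_map_cont[OF f[OF F(1,2)]]) auto
  thus ?thesis using f_state[OF F(1,2) bot_top_vert(1)] f_state[OF F(1,2) bot_top_vert(2)] F(3,4)
      nat_cube_bot_top_paths[of al be] ab by simp
qed

lemma hst_state: assumes n: "0 < n" and a: "al : vert n"
  shows "hst al : states X" "fst p (hst al) = fst w (Vertex al)"
proof -
  have d: "rise al al = 0" by (simp add: diff_coords_def)
  have b: "box_map 0 n (face_map al al)" using box_map_face_map[of al al] d a by (simp add: vert_def)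
  have e: "face_map al al [] = al" using fill_bot_top(1)[of al al] d by (simp add: face_map_def vert_def bot_vert_def)
  have v: "Vertex [] : states (nat_cube 0 :: 'a uflow)" by (simp add: vert_def)
  show "hst al : states X" unfolding hst_def by (rule flow_map_state[OF f[OF n b] v])
  have "fst (fcomp (nat_cube 0) p (f 0 (face_map al al))) (Vertex []) =
      fst (fcomp (nat_cube 0) w (nat_cube_map 0 n (face_map al al))) (Vertex [])" using pf[OF n b] by simp
  thus "fst p (hst al) = fst w (Vertex al)" using v e by (simp add: hst_def nat_cube_map_fst vert_def)
qed

lemma p_hp:
  assumes ab: "proper al be" and q: "q : topspace (paths (nat_cube n) (Vertex al) (Vertex be))"
  shows "snd p (hst al) (hst be) (hp al be q) = snd w (Vertex al) (Vertex be) q"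
proof -
  let ?m = "rise al be"
  let ?b = "bot_vert ?m" and ?t = "top_vert ?m"
  note F = f_face[OF ab]
  have q': "q : topspace (paths (nat_cube ?m) (Vertex ?b) (Vertex ?t))"
    using q nat_cube_bot_top_paths[of al be] ab by simp
  have "snd (fcomp (nat_cube ?m) p (f ?m (face_map al be))) (Vertex ?b) (Vertex ?t) q =
      snd (fcomp (nat_cube ?m) w (nat_cube_map ?m n (face_map al be))) (Vertex ?b) (Vertex ?t) q"
    using pf[OF F(1,2)] by simp
  thus ?thesis using q' f_state[OF F(1,2) bot_top_vert(1)] f_state[OF F(1,2) bot_top_vert(2)] F(3,4)
    by (simp add: hp_def Let_def nat_cube_map_fst nat_cube_map_snd)
qed

lemma hp_pcomp:
  assumes ab: "vless al be" and bc: "vless be ga" and ac: "proper al ga" and b: "be : vert n"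
    and q: "q : topspace (paths (nat_cube n) (Vertex al) (Vertex be))"
    and r: "r : topspace (paths (nat_cube n) (Vertex be) (Vertex ga))"
  shows "hp al ga (pcomp (nat_cube n) (Vertex al) (Vertex be) (Vertex ga) q r) =
    pcomp X (hst al) (hst be) (hst ga) (hp al be q) (hp be ga r)"
proof -
  let ?m = "rise al ga"
  let ?b = "bot_vert ?m" and ?t = "top_vert ?m" and ?\<phi> = "face_map al ga"
  note F = f_face[OF ac]
  obtain xs where xs: "xs : vert ?m" "?\<phi> xs = be" "vless ?b xs" "vless xs ?t"
    using face_map_middle[OF ab bc] by blast
  obtain g where g: "coords_at ?m n ?\<phi> g" using box_map_coords[OF F(2)] by blast
  have N: "N_comp al be ga = N_comp ?b xs ?t"
    using N_comp_coords_at[OF g bot_top_vert(1) xs(1) bot_top_vert(2)] F(3,4) xs(2) by simp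
  have q': "q : topspace (paths (nat_cube ?m) (Vertex ?b) (Vertex xs))"
    using q paths_nat_cube_face[OF F(2) bot_top_vert(1) xs(1), where 'a = 'a] F(3) xs(2) by simp
  have r': "r : topspace (paths (nat_cube ?m) (Vertex xs) (Vertex ?t))"
    using r paths_nat_cube_face[OF F(2) xs(1) bot_top_vert(2), where 'a = 'a] F(4) xs(2) by simp
  have st: "Vertex ?b : states (nat_cube ?m :: 'a uflow)" "Vertex xs : states (nat_cube ?m :: 'a uflow)"
    "Vertex ?t : states (nat_cube ?m :: 'a uflow)" using xs(1) by auto
  have "hp al ga (pcomp (nat_cube n) (Vertex al) (Vertex be) (Vertex ga) q r) =
      snd (f ?m ?\<phi>) (Vertex ?b) (Vertex ?t) (pcomp (nat_cube ?m) (Vertex ?b) (Vertex xs) (Vertex ?t) q r)"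
    by (simp add: hp_def Let_def pcomp_nat_cube N)
  also have "\<dots> = pcomp X (fst (f ?m ?\<phi>) (Vertex ?b)) (fst (f ?m ?\<phi>) (Vertex xs)) (fst (f ?m ?\<phi>) (Vertex ?t))
      (snd (f ?m ?\<phi>) (Vertex ?b) (Vertex xs) q) (snd (f ?m ?\<phi>) (Vertex xs) (Vertex ?t) r)"
    by (rule flow_map_pcomp[OF f[OF F(1,2)] st q' r'])
  also have "\<dots> = pcomp X (hst al) (hst be) (hst ga) (hp al be q) (hp be ga r)"
    using f_state[OF F(1,2) bot_top_vert(1)] f_state[OF F(1,2) xs(1)] f_state[OF F(1,2) bot_top_vert(2)]
      f_path[OF F(1,2) bot_top_vert(1) xs(1) xs(3) q'] f_path[OF F(1,2) xs(1) bot_top_vert(2) xs(4) r'] F(3,4) xs(2)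
    by simp
  finally show ?thesis .
qed

abbreviation "bt \<equiv> bot_vert n"
abbreviation "tp \<equiv> top_vert n"

definition inner :: "bool list set" where
  "inner = {al : vert n. al ~= bt & al ~= tp}"

lemma inner_proper: "al : inner ==> proper bt al & proper al tp"
  using bot_vless[of al n] vless_top[of al n] by (auto simp: inner_def)

definition cut :: "bool list => 'a univ set" where
  "cut al = NPath ` {\<eta>. passes bt al tp \<eta>}"

definition broken_lift :: "bool list => 'a univ => 'a univ" where
  "broken_lift al q = pcomp X (hst bt) (hst al) (hst tp)
     (hp bt al (NPath (fpart bt al tp (unNPath q)))) (hp al tp (NPath (spart bt al tp (unNPath q))))"

abbreviation "top_paths \<equiv> npath_top (N n) :: 'a univ topology"

context
  assumes n: "0 < n"
begin

text \<open>The broken paths are covered by finitely many closed subspaces, on each of which the lift is a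
  continuous composite.\<close>

lemma broken_cut: "NPath ` broken n = (\<Union>al\<in>inner. cut al)"
proof (intro equalityI subsetI)
  fix q :: "'a univ" assume "q : NPath ` broken n"
  then obtain \<eta> where q: "q = NPath \<eta>" "\<eta> : broken n" by auto
  obtain S where S: "S \<subseteq> {..<n}" "card S : {1..<n}" "\<eta> : through n S" using q(2) by (rule brokenE)
  define al where "al = map (%i. i : S) [0..<n]"
  have a: "al : vert n" by (simp add: al_def vert_def)
  have "{i. i < n & al ! i} = {i. i < n & i : S}" by (auto simp: al_def)
  also have "\<dots> = S" using S(1) by auto
  finally have d: "diff_coords bt al = S" using diff_coords_bot[OF a] by simp
  have "al ~= bt" using d S(2) by (auto simp: diff_coords_def)
  moreover have "al ~= tp" using d S(2) by auto
  ultimately have "al : inner" using a by (simp add: inner_def)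
  moreover have "q : cut al" unfolding cut_def q(1) using passes_through[OF a, of \<eta>] d S(3) by auto
  ultimately show "q : (\<Union>al\<in>inner. cut al)" by blast
next
  fix q assume "q : (\<Union>al\<in>inner. cut al)"
  then obtain al \<eta> where a: "al : inner" and q: "q = NPath \<eta>" "passes bt al tp \<eta>" by (auto simp: cut_def)
  have av: "al : vert n" using a by (simp add: inner_def)
  have pr: "proper bt al" using inner_proper[OF a] by blast
  have "rise bt al : {1..<n}" using card_diff_coords_pos[of bt al] f_face(1)[OF pr] pr by simp
  hence "\<eta> : broken n" using q(2) passes_through[OF av, of \<eta>] by (intro through_broken) auto
  thus "q : NPath ` broken n" using q(1) by blast
qed

lemma broken_lift_cont:
  assumes a: "al : inner"
  shows "cmap (subtopology top_paths (cut al)) (paths X (hst bt) (hst tp)) (broken_lift al)"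
proof -
  have pr: "proper bt al" "proper al tp" using inner_proper[OF a] by auto
  have v: "vless bt al" "vless al tp" and av: "al : vert n" using pr by auto
  let ?T = "subtopology top_paths (cut al)"
  let ?k = "rise bt al" and ?l = "rise al tp"
  have th: "{\<eta>. passes bt al tp \<eta>} = through n (diff_coords bt al)" using passes_through[OF av] by auto
  have sub: "through n (diff_coords bt al) \<subseteq> natural_dpaths n" by (auto simp: through_def)
  have "delta_generated (subtopology (N n) (through n (diff_coords bt al)))"
  proof (rule delta_generated_N_convex[OF sub])
    fix ga \<theta> and c :: real
    assume "ga : through n (diff_coords bt al)" "\<theta> : through n (diff_coords bt al)" "0 <= c" "c <= 1"
    thus "mix n c ga \<theta> : through n (diff_coords bt al)"
      by (intro mix_through) (use av in \<open>auto simp: diff_coords_bot\<close>)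
  qed
  moreover have "through n (diff_coords bt al) \<subseteq> topspace (N n)" using sub by simp
  ultimately have dg: "delta_generated ?T"
    unfolding cut_def th by (intro delta_generated_homeomorphic_maps[OF homeomorphic_maps_npath_sub])
  have tT: "topspace ?T = cut al" using sub th by (auto simp: cut_def)
  have pass: "passes bt al tp (unNPath q)" if "q : cut al" for q using that by (auto simp: cut_def)
  have ev: "cmap ?T euclideanreal (%q. unNPath q t i)" if "0 <= t" "t <= real n" "i < n" for t i
    using continuous_map_compose[OF continuous_map_from_subtopology[OF continuous_map_unNPath] continuous_map_N_ev[of t n i]] that
    by (simp add: o_def)
  have len: "real n = real ?k + real ?l" using card_diff_coords_add[OF v] by simp
  have pos: "pos_in (diff_coords bt tp) i < n" if "i : diff_coords bt al | i : diff_coords al tp" for i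
    using that sorted_nth_pos_in(1)[of "diff_coords bt tp" i] diff_coords_Un[OF v] by auto
  have "cmap ?T (N ?k) (%q. fpart bt al tp (unNPath q))" unfolding continuous_map_N
  proof (intro conjI ballI allI impI)
    show "fpart bt al tp (unNPath q) : natural_dpaths ?k" if "q : topspace ?T" for q
      using fpart_natural[OF v pass] that tT by blast
    fix t i assume t: "t : {0..real ?k}" and i: "i < ?k"
    have "cmap ?T euclideanreal (%q. unNPath q t (pos_in (diff_coords bt tp) (sorted_list_of_set (diff_coords bt al) ! i)))"
      using t len pos_in_nth(1)[OF finite_diff_coords i] by (intro ev pos) auto
    thus "cmap ?T euclideanreal (%q. fpart bt al tp (unNPath q) t i)" using t i by (simp add: fpart_def)
  qed
  from continuous_map_compose[OF this continuous_map_NPath[where 'a = 'a]]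
  have F: "cmap ?T (paths (nat_cube n) (Vertex bt) (Vertex al) :: 'a univ topology) (%q. NPath (fpart bt al tp (unNPath q)))"
    using v av by (simp add: paths_nat_cube o_def)
  have "cmap ?T (N ?l) (%q. spart bt al tp (unNPath q))" unfolding continuous_map_N
  proof (intro conjI ballI allI impI)
    show "spart bt al tp (unNPath q) : natural_dpaths ?l" if "q : topspace ?T" for q
      using spart_natural[OF v pass] that tT by blast
    fix t i assume t: "t : {0..real ?l}" and i: "i < ?l"
    have "cmap ?T euclideanreal (%q. unNPath q (t + real ?k) (pos_in (diff_coords bt tp) (sorted_list_of_set (diff_coords al tp) ! i)))"
      using t len pos_in_nth(1)[OF finite_diff_coords i] by (intro ev pos) auto
    thus "cmap ?T euclideanreal (%q. spart bt al tp (unNPath q) t i)" using t i by (simp add: spart_def)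
  qed
  from continuous_map_compose[OF this continuous_map_NPath[where 'a = 'a]]
  have S: "cmap ?T (paths (nat_cube n) (Vertex al) (Vertex tp) :: 'a univ topology) (%q. NPath (spart bt al tp (unNPath q)))"
    using v av by (simp add: paths_nat_cube o_def)
  note hs = hst_state(1)[OF n bot_top_vert(1)] hst_state(1)[OF n av] hst_state(1)[OF n bot_top_vert(2)]
  from continuous_map_compose[OF continuous_map_into_delta_prod[OF dg continuous_map_compose[OF F hp_cont[OF pr(1)]]
        continuous_map_compose[OF S hp_cont[OF pr(2)]]] flow_pcomp_cont[OF X hs]]
  show ?thesis by (simp add: o_def broken_lift_def[abs_def])
qed

lemma cut_paths:
  assumes a: "al : inner" and q: "passes bt al tp \<eta>"
  shows "NPath (fpart bt al tp \<eta>) : topspace (paths (nat_cube n) (Vertex bt) (Vertex al) :: 'a univ topology)"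
    "NPath (spart bt al tp \<eta>) : topspace (paths (nat_cube n) (Vertex al) (Vertex tp) :: 'a univ topology)"
    "NPath \<eta> = pcomp (nat_cube n) (Vertex bt) (Vertex al) (Vertex tp) (NPath (fpart bt al tp \<eta>)) (NPath (spart bt al tp \<eta>) :: 'a univ)"
  using inner_proper[OF a] fpart_natural[OF _ _ q] spart_natural[OF _ _ q] N_comp_parts[OF _ _ q]
  by (auto simp: topspace_paths_nat_cube pcomp_nat_cube)

text \<open>A path through two vertices has been split into three; associativity of the composition
  makes the two values of the lift agree.\<close>

lemma broken_lift_agree:
  assumes a: "al : inner" and b: "be : inner" and q: "passes bt al tp \<eta>" "passes bt be tp \<eta>"
    and le: "rise bt al <= rise bt be"
  shows "broken_lift al (NPath \<eta>) = broken_lift be (NPath \<eta>)"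
proof (cases "al = be")
  case False
  have pa: "proper bt al" "proper al tp" and pb: "proper bt be" "proper be tp"
    using inner_proper[OF a] inner_proper[OF b] by auto
  have va: "vless bt al" "vless al tp" and vb: "vless bt be" "vless be tp"
    and av: "al : vert n" and bv: "be : vert n" using pa pb by auto
  have ab: "vless al be" and pass: "passes al be tp (spart bt al tp \<eta>)"
    using passes_twice[OF va vb q le] False by auto
  have pab: "proper al be" using ab av bv pa by (auto simp: vless_def)
  define a1 where "a1 = fpart bt al tp \<eta>"
  define b1 where "b1 = fpart al be tp (spart bt al tp \<eta>)"
  define b2 where "b2 = spart al be tp (spart bt al tp \<eta>)"
  have nat: "a1 : natural_dpaths (rise bt al)" "b1 : natural_dpaths (rise al be)"
    "b2 : natural_dpaths (rise be tp)" unfolding a1_def b1_def b2_def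
    by (rule fpart_natural[OF va q(1)] fpart_natural[OF ab vb(2) pass] spart_natural[OF ab vb(2) pass])+
  have sp: "spart bt al tp \<eta> = N_comp al be tp b1 b2"
    unfolding b1_def b2_def by (rule N_comp_parts[OF ab vb(2) pass, symmetric])
  have "\<eta> = N_comp bt al tp a1 (N_comp al be tp b1 b2)" using N_comp_parts[OF va q(1)] sp by (simp add: a1_def)
  also have "\<dots> = N_comp bt be tp (N_comp bt al be a1 b1) b2" by (rule N_comp_assoc[OF va(1) ab vb(2), symmetric])
  finally have e: "\<eta> = N_comp bt be tp (N_comp bt al be a1 b1) b2" .
  have fb: "fpart bt be tp \<eta> = N_comp bt al be a1 b1"
    unfolding e by (rule fpart_N_comp[OF vb N_comp_natural[OF va(1) ab nat(1,2)]])
  have sb: "spart bt be tp \<eta> = b2" unfolding e by (rule spart_N_comp[OF vb nat(3)])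
  have P: "NPath a1 : topspace (paths (nat_cube n) (Vertex bt) (Vertex al) :: 'a univ topology)"
    "NPath b1 : topspace (paths (nat_cube n) (Vertex al) (Vertex be) :: 'a univ topology)"
    "NPath b2 : topspace (paths (nat_cube n) (Vertex be) (Vertex tp) :: 'a univ topology)"
    using nat va ab vb av bv by (auto simp: topspace_paths_nat_cube)
  note hs = hst_state(1)[OF n bot_top_vert(1)] hst_state(1)[OF n av] hst_state(1)[OF n bv] hst_state(1)[OF n bot_top_vert(2)]
  note H = continuous_map_funspace[OF hp_cont[OF pa(1)] P(1)] continuous_map_funspace[OF hp_cont[OF pab] P(2)]
    continuous_map_funspace[OF hp_cont[OF pb(2)] P(3)]
  have "broken_lift al (NPath \<eta>) = pcomp X (hst bt) (hst al) (hst tp) (hp bt al (NPath a1)) (hp al tp (NPath (N_comp al be tp b1 b2)))"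
    by (simp add: broken_lift_def a1_def sp)
  also have "hp al tp (NPath (N_comp al be tp b1 b2)) = pcomp X (hst al) (hst be) (hst tp) (hp al be (NPath b1)) (hp be tp (NPath b2))"
    using hp_pcomp[OF ab vb(2) pa(2) bv P(2,3)] by (simp add: pcomp_nat_cube)
  also have "pcomp X (hst bt) (hst al) (hst tp) (hp bt al (NPath a1)) (pcomp X (hst al) (hst be) (hst tp) (hp al be (NPath b1)) (hp be tp (NPath b2))) =
      pcomp X (hst bt) (hst be) (hst tp) (pcomp X (hst bt) (hst al) (hst be) (hp bt al (NPath a1)) (hp al be (NPath b1))) (hp be tp (NPath b2))"
    by (rule flow_pcomp_assoc[OF X hs H, symmetric])
  also have "pcomp X (hst bt) (hst al) (hst be) (hp bt al (NPath a1)) (hp al be (NPath b1)) = hp bt be (NPath (N_comp bt al be a1 b1))"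
    using hp_pcomp[OF va(1) ab pb(1) av P(1,2)] by (simp add: pcomp_nat_cube)
  finally show ?thesis by (simp add: broken_lift_def fb sb)
qed simp

lemma paths_bt_tp: "paths (nat_cube n) (Vertex bt) (Vertex tp) = top_paths"
proof -
  have "bt ~= tp" using n by (simp add: bot_vert_def top_vert_def)
  hence "vless bt tp" using bot_vless[of tp n] by simp
  thus ?thesis by (simp add: paths_nat_cube)
qed

text \<open>The prescribed values on the broken paths are pasted, and the relative lifting property extends them.\<close>

lemma top_lift:
  obtains k where "cmap top_paths (paths X (hst bt) (hst tp)) k"
    "!!al \<eta>. al : inner ==> passes bt al tp \<eta> ==> k (NPath \<eta>) = broken_lift al (NPath \<eta>)"
    "!!q. q : topspace top_paths ==> snd p (hst bt) (hst tp) (k q) = snd w (Vertex bt) (Vertex tp) q"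
proof -
  let ?A = "NPath ` broken n :: 'a univ set"
  let ?E = "paths X (hst bt) (hst tp)" and ?B = "paths Y (fst p (hst bt)) (fst p (hst tp))"
  let ?X = "subtopology top_paths ?A"
  have tX: "topspace ?X = (\<Union>al\<in>inner. cut al)" unfolding broken_cut[symmetric] by (auto simp: broken_def)
  obtain u where u: "cmap ?X ?E u" "!!x al. [|al : inner; x : topspace ?X \<inter> cut al|] ==> u x = broken_lift al x"
  proof (rule pasting_lemma_exists_closed[of inner ?X cut ?E broken_lift])
    show "finite inner" by (rule finite_subset[OF _ finite_vert[of n]]) (auto simp: inner_def)
    show "topspace ?X \<subseteq> (\<Union>al\<in>inner. cut al)" using tX by simp
    fix al assume a: "al : inner"
    have sub: "cut al \<subseteq> ?A" using a broken_cut by blast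
    have av: "al : vert n" using a by (simp add: inner_def)
    show "closedin ?X (cut al)"
    proof -
      let ?S = "diff_coords bt al"
      have kn: "card ?S < n" using f_face(1)[of bt al] inner_proper[OF a] by blast
      have ev: "cmap top_paths euclideanreal (%q. unNPath q (real (card ?S)) i)" if "i < n" for i
        using continuous_map_compose[OF continuous_map_unNPath continuous_map_N_ev[of "real (card ?S)" n i]] that kn
        by (simp add: o_def)
      have "cmap top_paths euclideanreal (%q. \<Sum>i<n. \<bar>unNPath q (real (card ?S)) i - of_bool (i : ?S)\<bar>)"
        by (intro continuous_map_sum continuous_map_real_abs continuous_map_diff ev) auto
      hence "closedin top_paths {q : topspace top_paths. (\<Sum>i<n. \<bar>unNPath q (real (card ?S)) i - of_bool (i : ?S)\<bar>) : {0}}"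
        by (rule closedin_continuous_map_preimage) simp
      moreover have "{q : topspace top_paths. (\<Sum>i<n. \<bar>unNPath q (real (card ?S)) i - of_bool (i : ?S)\<bar>) : {0}} = cut al"
      proof -
        have "(\<Sum>i<n. \<bar>\<eta> (real (card ?S)) i - of_bool (i : ?S)\<bar>) = 0 \<longleftrightarrow> (\<forall>i<n. \<eta> (real (card ?S)) i = of_bool (i : ?S))"
          for \<eta> :: "real => nat => real" by (subst sum_nonneg_eq_0_iff) auto
        thus ?thesis unfolding cut_def using passes_through[OF av] by (auto simp: through_def)
      qed
      ultimately have "closedin top_paths (cut al)" by simp
      thus ?thesis using sub by (simp add: closedin_subset_topspace)
    qed
    have "subtopology ?X (cut al) = subtopology top_paths (cut al)"
      using sub by (simp add: subtopology_subtopology Int_absorb1)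
    thus "cmap (subtopology ?X (cut al)) ?E (broken_lift al)" using broken_lift_cont[OF a] by simp
    fix be x assume b: "be : inner" and x: "x : topspace ?X \<inter> cut al \<inter> cut be"
    then obtain \<eta> where e: "x = NPath \<eta>" "passes bt al tp \<eta>" "passes bt be tp \<eta>" by (auto simp: cut_def)
    show "broken_lift al x = broken_lift be x"
    proof (cases "rise bt al <= rise bt be")
      case True
      thus ?thesis unfolding e(1) by (rule broken_lift_agree[OF a b e(2,3)])
    next
      case False
      thus ?thesis unfolding e(1) by (intro broken_lift_agree[OF b a e(3,2), symmetric]) simp
    qed
  next
    fix g assume "cmap ?X ?E g" "!!x i. [|i : inner; x : topspace ?X \<inter> cut i|] ==> g x = broken_lift i x"
    thus thesis by (rule that)
  qed
  have uc: "u (NPath \<eta>) = broken_lift al (NPath \<eta>)" if "al : inner" "passes bt al tp \<eta>" for al \<eta>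
  proof (rule u(2)[OF that(1)])
    have "NPath \<eta> : cut al" using that(2) by (simp add: cut_def)
    thus "NPath \<eta> : topspace ?X \<inter> cut al" unfolding tX using that(1) by blast
  qed
  note hs = hst_state[OF n bot_top_vert(1)] hst_state[OF n bot_top_vert(2)]
  have lp: "lift_problem top_paths ?A ?E ?B (snd p (hst bt) (hst tp)) u (snd w (Vertex bt) (Vertex tp))"
    unfolding lift_problem_def
  proof (intro conjI ballI)
    show "cmap ?X ?E u" by (rule u(1))
    have "cmap (paths (nat_cube n) (Vertex bt) (Vertex tp)) (paths Y (fst w (Vertex bt)) (fst w (Vertex tp)))
        (snd w (Vertex bt) (Vertex tp))" by (rule flow_map_cont[OF w]) auto
    thus "cmap top_paths ?B (snd w (Vertex bt) (Vertex tp))" using hs paths_bt_tp by simp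
    fix q assume "q : ?A"
    then obtain al \<eta> where a: "al : inner" and q: "q = NPath \<eta>" "passes bt al tp \<eta>"
      unfolding broken_cut by (auto simp: cut_def)
    have av: "al : vert n" and pr: "proper bt al" "proper al tp" using inner_proper[OF a] by auto
    note C = cut_paths[OF a q(2)] and ha = hst_state[OF n av]
    note H = continuous_map_funspace[OF hp_cont[OF pr(1)] C(1)] continuous_map_funspace[OF hp_cont[OF pr(2)] C(2)]
    have st: "Vertex bt : states (nat_cube n :: 'a uflow)" "Vertex al : states (nat_cube n :: 'a uflow)"
      "Vertex tp : states (nat_cube n :: 'a uflow)" using av by auto
    have "snd p (hst bt) (hst tp) (u q) = pcomp Y (fst p (hst bt)) (fst p (hst al)) (fst p (hst tp))
        (snd p (hst bt) (hst al) (hp bt al (NPath (fpart bt al tp \<eta>)))) (snd p (hst al) (hst tp) (hp al tp (NPath (spart bt al tp \<eta>))))"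
      using flow_map_pcomp[OF p hs(1) ha(1) hs(3) H] uc[OF a q(2)] q(1) by (simp add: broken_lift_def)
    also have "\<dots> = pcomp Y (fst w (Vertex bt)) (fst w (Vertex al)) (fst w (Vertex tp))
        (snd w (Vertex bt) (Vertex al) (NPath (fpart bt al tp \<eta>))) (snd w (Vertex al) (Vertex tp) (NPath (spart bt al tp \<eta>)))"
      using p_hp[OF pr(1) C(1)] p_hp[OF pr(2) C(2)] hs ha by simp
    also have "\<dots> = snd w (Vertex bt) (Vertex tp) q"
      unfolding q(1) C(3) by (rule flow_map_pcomp[OF w st C(1,2), symmetric])
    finally show "snd p (hst bt) (hst tp) (u q) = snd w (Vertex bt) (Vertex tp) q" .
  qed
  have "Hurewicz_fibration haus ?E ?B (snd p (hst bt) (hst tp))" 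
    by (rule fib[unfolded m_fibration_def, rule_format, OF hs(1) hs(3)])
  moreover have "weak_homotopy_equivalence ?E ?B (snd p (hst bt) (hst tp))" 
    by (rule weq[unfolded flow_weak_equivalence_def, THEN conjunct2, rule_format, OF hs(1) hs(3)])
  ultimately have "rel_lifts top_paths ?A ?E ?B (snd p (hst bt) (hst tp))"
    by (rule rel_lifts_npath_broken) (use n in simp)
  hence "solvable top_paths ?A ?E (snd p (hst bt) (hst tp)) u (snd w (Vertex bt) (Vertex tp))"
    using lp by (simp add: rel_lifts_def)
  then obtain k where k: "cmap top_paths ?E k" "\<forall>a\<in>?A. k a = u a"
    "\<forall>q\<in>topspace top_paths. snd p (hst bt) (hst tp) (k q) = snd w (Vertex bt) (Vertex tp) q"
    unfolding solvable_def by blast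
  have "k (NPath \<eta>) = broken_lift al (NPath \<eta>)" if a: "al : inner" and q: "passes bt al tp \<eta>" for al \<eta>
  proof -
    have "NPath \<eta> : ?A" unfolding broken_cut using a q by (auto simp: cut_def)
    hence "k (NPath \<eta>) = u (NPath \<eta>)" by (rule k(2)[rule_format])
    thus ?thesis using uc[OF a q] by (rule trans)
  qed
  thus ?thesis using that k by blast
qed

lemma lift_pos:
  obtains h where "is_flow_map (nat_cube n) X h"
    "!!m \<phi>. m < n ==> box_map m n \<phi> ==> fcomp (nat_cube m) h (nat_cube_map m n \<phi>) = f m \<phi>"
    "fcomp (nat_cube n) p h = w"
proof -
  obtain k where k: "cmap top_paths (paths X (hst bt) (hst tp)) k"
    and kb: "!!al \<eta>. al : inner ==> passes bt al tp \<eta> ==> k (NPath \<eta>) = broken_lift al (NPath \<eta>)"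
    and pk: "!!q. q : topspace top_paths ==> snd p (hst bt) (hst tp) (k q) = snd w (Vertex bt) (Vertex tp) q"
    using top_lift by blast
  define hpp where "hpp al be = (if al = bt & be = tp then k else hp al be)" for al be
  define h where "h = fmap_on (nat_cube n) (%a. hst (unVertex a), %a b. hpp (unVertex a) (unVertex b))"
  have lt: "vless al be" if "al : vert n" "be : vert n" "q : topspace (paths (nat_cube n) (Vertex al) (Vertex be))" for al be and q :: "'a univ"
    using that by (auto simp: topspace_paths_nat_cube split: if_splits)
  have hpp_cont: "cmap (paths (nat_cube n) (Vertex al) (Vertex be)) (paths X (hst al) (hst be)) (hpp al be)"
    if ab: "al : vert n" "be : vert n" for al be
  proof (cases "al = bt & be = tp")
    case True
    thus ?thesis using k paths_bt_tp by (simp add: hpp_def)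
  next
    case False
    show ?thesis
    proof (cases "vless al be")
      case True
      hence pr: "proper al be" using False ab by blast
      have e: "hpp al be = hp al be" using False by (auto simp: hpp_def)
      show ?thesis unfolding e by (rule hp_cont[OF pr])
    next
      case nv: False
      thus ?thesis by (intro continuous_map_from_empty) (simp add: topspace_paths_nat_cube)
    qed
  qed
  have hpp_comp: "hpp al ga (pcomp (nat_cube n) (Vertex al) (Vertex be) (Vertex ga) q r) =
      pcomp X (hst al) (hst be) (hst ga) (hpp al be q) (hpp be ga r)"
    if abc: "al : vert n" "be : vert n" "ga : vert n" and q: "q : topspace (paths (nat_cube n) (Vertex al) (Vertex be))"
      and r: "r : topspace (paths (nat_cube n) (Vertex be) (Vertex ga))" for al be ga q r
  proof -
    have ab: "vless al be" and bc: "vless be ga" using lt[OF abc(1,2) q] lt[OF abc(2,3) r] by auto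
    have nbt: "be ~= bt"
    proof
      assume e: "be = bt"
      have "al ! i = be ! i" if "i < n" for i
        using ab abc(1) that unfolding e by (auto simp: vless_def list_all2_conv_all_nth bot_vert_def vert_def)
      hence "al = be" using abc by (intro nth_equalityI) (auto simp: vert_def)
      thus False using ab by (simp add: vless_def)
    qed
    have ntp: "be ~= tp" using bc abc(3) by (auto simp: vless_def list_all2_conv_all_nth top_vert_def vert_def intro!: nth_equalityI)
    have e: "hpp al be = hp al be" "hpp be ga = hp be ga" using nbt ntp by (auto simp: hpp_def)
    show ?thesis
    proof (cases "al = bt & ga = tp")
      case True
      hence bi: "be : inner" using nbt ntp abc by (simp add: inner_def)
      obtain \<eta> \<theta> where n1: "q = NPath \<eta>" "\<eta> : natural_dpaths (rise bt be)"
        and n2: "r = NPath \<theta>" "\<theta> : natural_dpaths (rise be tp)"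
        using q r ab bc abc True by (auto simp: topspace_paths_nat_cube)
      have v: "vless bt be" "vless be tp" using ab bc True by auto
      let ?c = "N_comp bt be tp \<eta> \<theta>"
      have fs: "fpart bt be tp ?c = \<eta>" "spart bt be tp ?c = \<theta>"
        by (rule fpart_N_comp[OF v n1(2)], rule spart_N_comp[OF v n2(2)])
      have "passes bt be tp ?c" unfolding passes_def
      proof (intro conjI ballI N_comp_natural[OF v n1(2) n2(2)])
        fix i assume i: "i : diff_coords bt tp"
        let ?l = "real (rise bt be)"
        have tl: "0 <= ?l" "?l <= real (rise bt tp)" using card_diff_coords_add[OF v] by simp_all
        show "?c ?l (pos_in (diff_coords bt tp) i) = of_bool (i : diff_coords bt be)" unfolding N_comp_at[OF v tl i]
        proof (cases "i : diff_coords bt be")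
          case True
          show "moore ?l (in_subcube bt be \<eta>) (in_subcube be tp \<theta>) ?l i = of_bool (i : diff_coords bt be)"
            unfolding moore_subcube_fst[OF v True]
            using True ndp_1[OF n1(2) sorted_nth_pos_in(1)[OF finite_diff_coords True]] by simp
        next
          case False
          hence i2: "i : diff_coords be tp" using i diff_coords_Un[OF v] by blast
          show "moore ?l (in_subcube bt be \<eta>) (in_subcube be tp \<theta>) ?l i = of_bool (i : diff_coords bt be)"
            unfolding moore_subcube_snd[OF v i2] using False by simp
        qed
      qed
      from kb[OF bi this] show ?thesis
        using True e n1(1) n2(1) by (simp add: hpp_def pcomp_nat_cube broken_lift_def fs)
    next
      case False
      hence ac: "proper al ga" using abc vless_trans[OF ab bc] by blast
      have "hpp al ga = hp al ga" using False by (auto simp: hpp_def)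
      thus ?thesis unfolding e by (simp only: hp_pcomp[OF ab bc ac abc(2) q r])
    qed
  qed
  have h: "is_flow_map (nat_cube n) X h" unfolding h_def
  proof (rule is_flow_map_fmap_on[OF is_flow_nat_cube], unfold fst_conv snd_conv)
    fix a :: "'a univ" assume "a : states (nat_cube n :: 'a uflow)"
    thus "hst (unVertex a) : states X" using hst_state[OF n] by auto
  next
    fix a b :: "'a univ" assume "a : states (nat_cube n :: 'a uflow)" "b : states (nat_cube n :: 'a uflow)"
    thus "cmap (paths (nat_cube n) a b) (paths X (hst (unVertex a)) (hst (unVertex b))) (hpp (unVertex a) (unVertex b))"
      using hpp_cont by auto
  next
    fix a b c q r :: "'a univ" assume "a : states (nat_cube n :: 'a uflow)" "b : states (nat_cube n :: 'a uflow)"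
      "c : states (nat_cube n :: 'a uflow)" "q : topspace (paths (nat_cube n) a b)" "r : topspace (paths (nat_cube n) b c)"
    thus "hpp (unVertex a) (unVertex c) (pcomp (nat_cube n) a b c q r) =
        pcomp X (hst (unVertex a)) (hst (unVertex b)) (hst (unVertex c)) (hpp (unVertex a) (unVertex b) q) (hpp (unVertex b) (unVertex c) r)"
      using hpp_comp by auto
  qed
  have hfst: "fst h (Vertex al) = hst al" if "al : vert n" for al using that by (simp add: h_def)
  have hsnd: "snd h (Vertex al) (Vertex be) q = hpp al be q"
    if "al : vert n" "be : vert n" "q : topspace (paths (nat_cube n) (Vertex al) (Vertex be))" for al be q
    using that by (simp add: h_def)
  have "fcomp (nat_cube m) h (nat_cube_map m n \<phi>) = f m \<phi>" if m: "m < n" and \<phi>: "box_map m n \<phi>" for m \<phi>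
  proof (rule flow_map_eqI[OF is_flow_map_fcomp[OF is_flow_nat_cube is_flow_map_nat_cube_map[OF \<phi>] h] f[OF m \<phi>]])
    fix a :: "'a univ" assume "a : states (nat_cube m :: 'a uflow)"
    then obtain xs where xs: "a = Vertex xs" "xs : vert m" by auto
    show "fst (fcomp (nat_cube m) h (nat_cube_map m n \<phi>)) a = fst (f m \<phi>) a"
      using xs f_state[OF m \<phi> xs(2)] hfst box_map_vert[OF \<phi>] by (simp add: nat_cube_map_fst)
    fix b q :: "'a univ" assume "b : states (nat_cube m :: 'a uflow)" and q: "q : topspace (paths (nat_cube m) a b)"
    then obtain ys where ys: "b = Vertex ys" "ys : vert m" by auto
    have q': "q : topspace (paths (nat_cube m) (Vertex xs) (Vertex ys))" using q xs ys by simp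
    hence v: "vless xs ys" using xs ys by (auto simp: topspace_paths_nat_cube split: if_splits)
    have qn: "q : topspace (paths (nat_cube n) (Vertex (\<phi> xs)) (Vertex (\<phi> ys)))"
      unfolding paths_nat_cube_face[OF \<phi> xs(2) ys(2)] by (rule q')
    have "hpp (\<phi> xs) (\<phi> ys) = hp (\<phi> xs) (\<phi> ys)" unfolding hpp_def
    proof (rule if_not_P, rule notI)
      assume e: "\<phi> xs = bt & \<phi> ys = tp"
      have "rise (\<phi> xs) (\<phi> ys) = rise xs ys" using face_map_comp(2)[OF \<phi> xs(2) ys(2)] v by blast
      moreover have "rise xs ys <= m"
        using card_mono[of "{..<m}" "diff_coords xs ys"] xs(2) by (auto simp: diff_coords_def vert_def)
      ultimately show False using e m by simp
    qed
    thus "snd (fcomp (nat_cube m) h (nat_cube_map m n \<phi>)) a b q = snd (f m \<phi>) a b q"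
      using xs ys q' f_path[OF m \<phi> xs(2) ys(2) v q'] hsnd[OF _ _ qn] box_map_vert[OF \<phi>]
      by (simp add: nat_cube_map_fst nat_cube_map_snd)
  qed
  moreover have "fcomp (nat_cube n) p h = w"
  proof (rule flow_map_eqI[OF is_flow_map_fcomp[OF is_flow_nat_cube h p] w])
    fix a :: "'a univ" assume "a : states (nat_cube n :: 'a uflow)"
    then obtain al where a: "a = Vertex al" "al : vert n" by auto
    show "fst (fcomp (nat_cube n) p h) a = fst w a" using a hfst hst_state(2)[OF n] by simp
    fix b q :: "'a univ" assume "b : states (nat_cube n :: 'a uflow)" and q: "q : topspace (paths (nat_cube n) a b)"
    then obtain be where b: "b = Vertex be" "be : vert n" by auto
    have q': "q : topspace (paths (nat_cube n) (Vertex al) (Vertex be))" using q a b by simp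
    have "snd p (hst al) (hst be) (hpp al be q) = snd w (Vertex al) (Vertex be) q"
    proof (cases "al = bt & be = tp")
      case True
      thus ?thesis using pk[of q] q' paths_bt_tp by (simp add: hpp_def)
    next
      case False
      have pr: "proper al be" using a b lt[OF a(2) b(2) q'] False by blast
      have "hpp al be = hp al be" using False by (auto simp: hpp_def)
      thus ?thesis by (simp only: p_hp[OF pr q'])
    qed
    thus "snd (fcomp (nat_cube n) p h) a b q = snd w a b q" using a b q' hfst hsnd[OF a(2) b(2) q'] by simp
  qed
  ultimately show ?thesis using that[OF h] by blast
qed

end

text \<open>In dimension 0 the boundary is empty, and a lift exists because trivial fibrations are surjective on
  states.\<close>

lemma cube_flow_lift:
  obtains h where "is_flow_map (nat_cube n) X h"
    "!!m \<phi>. m < n ==> box_map m n \<phi> ==> fcomp (nat_cube m) h (nat_cube_map m n \<phi>) = f m \<phi>"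
    "fcomp (nat_cube n) p h = w"
proof (cases "n = 0")
  case False
  thus ?thesis using lift_pos that by blast
next
  case True
  have v0: "vert n = {[]}" using True by (auto simp: vert_def)
  have np: "topspace (paths (nat_cube n) (Vertex []) (Vertex [])) = ({} :: 'a univ set)"
    by (simp add: topspace_paths_nat_cube vless_def)
  have "fst w (Vertex []) : states Y" using flow_map_state[OF w] v0 by simp
  moreover have "fst p ` states X = states Y" using weq by (simp add: flow_weak_equivalence_def bij_betw_def)
  ultimately have "fst w (Vertex []) : fst p ` states X" by simp
  then obtain x where x: "x : states X" "fst p x = fst w (Vertex [])" by (metis imageE)
  define h :: "'a uflow_map" where "h = fmap_on (nat_cube n) (%_. x, %_ _ _. undefined)"
  have h: "is_flow_map (nat_cube n) X h" unfolding h_def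
    by (rule is_flow_map_fmap_on[OF is_flow_nat_cube]) (use v0 np x in \<open>auto intro: continuous_map_from_empty\<close>)
  have "fcomp (nat_cube n) p h = w"
    by (rule flow_map_eqI[OF is_flow_map_fcomp[OF is_flow_nat_cube h p] w]) (use v0 np x in \<open>auto simp: h_def\<close>)
  thus ?thesis using that[OF h] True by simp
qed

end

section \<open>The natural realization as a functor\<close>

lemma Hom_Box [simp]: "\<phi> : Hom Box m n \<longleftrightarrow> box_map m n \<phi>" by (simp add: Box_def)

lemma Cmp_Box [simp]: "Cmp Box l m n \<psi> \<phi> = compose (vert l) \<psi> \<phi>" by (simp add: Box_def)

lemma Idn_Box [simp]: "Idn Box n = (\<lambda>xs\<in>vert n. xs)" by (simp add: Box_def)

lemma PreCub_simps [simp]: "K : Ob PreCub \<longleftrightarrow> is_precubical_set K" "f : Hom PreCub K L \<longleftrightarrow> is_precub_map K L f"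
  "Cmp PreCub K L M g f = (%n. compose (cells K n) (g n) (f n))" "Idn PreCub K = (%n. \<lambda>x\<in>cells K n. x)"
  by (simp_all add: PreCub_def)

context
  fixes K :: "'u precub" assumes K: "is_precubical_set K"
begin

lemma act_in: "box_map m n \<phi> ==> x : cells K n ==> act K m n \<phi> x : cells K m"
  using K unfolding is_precubical_set_def by fastforce

lemma act_id: "x : cells K n ==> act K n n (\<lambda>xs\<in>vert n. xs) x = x"
  using K unfolding is_precubical_set_def by simp

lemma act_comp: "box_map l m \<phi> ==> box_map m n \<psi> ==> x : cells K n ==>
    act K l n (compose (vert l) \<psi> \<phi>) x = act K l m \<phi> (act K m n \<psi> x)"
  using K unfolding is_precubical_set_def by simp

end

context
  fixes K L :: "'u precub" and f assumes f: "is_precub_map K L f"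
begin

lemma precub_map_in: "x : cells K n ==> f n x : cells L n" using f unfolding is_precub_map_def by blast

lemma precub_map_act: "box_map m n \<phi> ==> x : cells K n ==> f m (act K m n \<phi> x) = act L m n \<phi> (f n x)"
  using f unfolding is_precub_map_def by simp

lemma precub_map_ext: "f n : extensional (cells K n)" using f unfolding is_precub_map_def by (auto simp: PiE_def)

end

lemma is_precub_mapI:
  assumes "!!n. f n : extensional (cells K n)" "!!n x. x : cells K n ==> f n x : cells L n"
    "!!m n \<phi> x. box_map m n \<phi> ==> x : cells K n ==> f m (act K m n \<phi> x) = act L m n \<phi> (f n x)"
  shows "is_precub_map K L f" using assms unfolding is_precub_map_def by (auto simp: PiE_def)

lemma is_precub_map_comp:
  assumes K: "is_precubical_set K" and f: "is_precub_map K L f" and g: "is_precub_map L M g"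
  shows "is_precub_map K M (%n. compose (cells K n) (g n) (f n))" by (rule is_precub_mapI)
    (auto simp: compose_def precub_map_in[OF f] precub_map_in[OF g] precub_map_act[OF f] precub_map_act[OF g] act_in[OF K])

lemma is_precub_map_id: "is_precubical_set K ==> is_precub_map K K (%n. \<lambda>x\<in>cells K n. x)"
  by (rule is_precub_mapI) (auto simp: act_in)

lemma Ex1_unique: "\<exists>!x. P x ==> P a ==> P b ==> a = b" by blast

text \<open>A cocone over the cubes of \<open>K\<close>: one map out of a cube for each cell.\<close>

definition cubical_family :: "'a uprecub => 'a uflow => (nat => 'a univ => 'a uflow_map) => bool" where
  "cubical_family K X g \<longleftrightarrow> (\<forall>n. \<forall>x\<in>cells K n. is_flow_map (nat_cube n) X (g n x)) \<and>
     (\<forall>m n \<phi>. box_map m n \<phi> --> (\<forall>x\<in>cells K n.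
        fcomp (nat_cube m) (g n x) (nat_cube_map m n \<phi>) = g m (act K m n \<phi> x)))"

lemma cubical_familyD:
  assumes "cubical_family K X g" "x : cells K n"
  shows "is_flow_map (nat_cube n) X (g n x)"
    "box_map m n \<phi> ==> fcomp (nat_cube m) (g n x) (nat_cube_map m n \<phi>) = g m (act K m n \<phi> x)"
  using assms by (auto simp: cubical_family_def)

lemma cubical_family_post:
  assumes g: "cubical_family K X g" and f: "is_flow_map X Y f"
  shows "cubical_family K Y (%n x. fcomp (nat_cube n) f (g n x))" unfolding cubical_family_def
proof (intro conjI allI ballI impI)
  fix n x assume x: "x : cells K n"
  note G = cubical_familyD[OF g x]
  show "is_flow_map (nat_cube n) Y (fcomp (nat_cube n) f (g n x))"
    by (rule is_flow_map_fcomp[OF is_flow_nat_cube G(1) f])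
  fix m \<phi> assume b: "box_map m n \<phi>"
  show "fcomp (nat_cube m) (fcomp (nat_cube n) f (g n x)) (nat_cube_map m n \<phi>) =
      fcomp (nat_cube m) f (g m (act K m n \<phi> x))"
    unfolding G(2)[OF b, symmetric] by (rule fcomp_assoc[OF is_flow_map_nat_cube_map[OF b], symmetric])
qed

lemma cubical_family_pre:
  assumes g: "cubical_family L X g" and f: "is_precub_map K L f"
  shows "cubical_family K X (%n x. g n (f n x))" unfolding cubical_family_def
  using cubical_familyD[OF g precub_map_in[OF f]] precub_map_act[OF f] by simp

lemma is_cocone_cubes_of:
  "is_cocone (cubes_of K) (Flow haus) nat_diagram X \<iota> \<longleftrightarrow>
     is_flow haus X & cubical_family K X (%n x. \<iota> (n, x))" if K: "is_precubical_set K"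
proof -
  have "(\<forall>j\<in>Ob (cubes_of K). \<forall>k\<in>Ob (cubes_of K). \<forall>u\<in>Hom (cubes_of K) j k.
      fcomp (fob nat_diagram j) (\<iota> k) (fmor nat_diagram j k u) = \<iota> j) \<longleftrightarrow>
    (\<forall>m n \<phi>. box_map m n \<phi> --> (\<forall>x\<in>cells K n.
        fcomp (nat_cube m) (\<iota> (n, x)) (nat_cube_map m n \<phi>) = \<iota> (m, act K m n \<phi> x)))"
    using act_in[OF K] by (auto simp: cubes_of_def nat_diagram_def)
  moreover have "(\<forall>j\<in>Ob (cubes_of K). is_flow_map (fob nat_diagram j) X (\<iota> j)) \<longleftrightarrow>
      (\<forall>n. \<forall>x\<in>cells K n. is_flow_map (nat_cube n) X (\<iota> (n, x)))"
    by (auto simp: cubes_of_def nat_diagram_def)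
  ultimately show ?thesis by (simp add: is_cocone_def cubical_family_def)
qed

abbreviation real_flow :: "bool => 'a uprecub => 'a uflow" where
  "real_flow haus K \<equiv> fst (nat_colimit haus K)"

definition cell_map :: "bool => 'a uprecub => nat => 'a univ => 'a uflow_map" where
  "cell_map haus K n x = snd (nat_colimit haus K) (n, x)"

lemma nat_colimit_is_colimit:
  assumes K: "is_precubical_set K"
  shows "is_colimit (cubes_of K) (Flow haus) nat_diagram (real_flow haus K) (%(n, x). cell_map haus K n x)"
proof -
  let ?c = "%(n, x). upair (Vertex (replicate n True)) x :: 'a univ"
  interpret flow_diagram haus "cubes_of K" nat_diagram ?c
  proof
    show "inj ?c" by (rule injI) (auto simp: replicate_eq_replicate)
    show "is_flow haus (fob nat_diagram j)" for j by (simp add: nat_diagram_def is_flow_nat_cube case_prod_beta')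
    show "is_flow_map (fob nat_diagram j) (fob nat_diagram k) (fmor nat_diagram j k u)"
      if "u : Hom (cubes_of K) j k" for j k u
      using that by (cases j; cases k) (auto simp: nat_diagram_def cubes_of_def is_flow_map_nat_cube_map)
  qed
  have "\<exists>c. case c of (X, \<iota>) => is_colimit (cubes_of K) (Flow haus) nat_diagram X \<iota>"
    by (rule exI[of _ "(colim, leg)"]) (simp add: is_colimit_colim)
  from someI_ex[OF this] show ?thesis
    unfolding nat_colimit_def[symmetric] by (simp add: cell_map_def case_prod_beta')
qed

context
  fixes haus :: bool and K :: "'a uprecub" assumes K: "is_precubical_set K"
begin

lemma is_flow_real: "is_flow haus (real_flow haus K)"
  and cell_family: "cubical_family K (real_flow haus K) (cell_map haus K)"
  using nat_colimit_is_colimit[OF K, of haus] is_cocone_cubes_of[OF K, of haus] by (simp_all add: is_colimit_def)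

lemma ex1_real_map:
  assumes "is_flow haus X" "cubical_family K X g"
  shows "\<exists>!h. is_flow_map (real_flow haus K) X h & (\<forall>n. \<forall>x\<in>cells K n. fcomp (nat_cube n) h (cell_map haus K n x) = g n x)"
proof -
  have "is_cocone (cubes_of K) (Flow haus) nat_diagram X (%(n, x). g n x)"
    using is_cocone_cubes_of[OF K, of haus X] assms by simp
  hence "\<exists>!h. h : Hom (Flow haus) (real_flow haus K) X & (\<forall>j\<in>Ob (cubes_of K).
      Cmp (Flow haus) (fob nat_diagram j) (real_flow haus K) X h ((%(n, x). cell_map haus K n x) j) = (%(n, x). g n x) j)"
    using nat_colimit_is_colimit[OF K, of haus] unfolding is_colimit_def by blast
  moreover have "(\<forall>j\<in>Ob (cubes_of K).
      Cmp (Flow haus) (fob nat_diagram j) (real_flow haus K) X h ((%(n, x). cell_map haus K n x) j) = (%(n, x). g n x) j) \<longleftrightarrow>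
      (\<forall>n. \<forall>x\<in>cells K n. fcomp (nat_cube n) h (cell_map haus K n x) = g n x)" for h
    by (auto simp: cubes_of_def nat_diagram_def)
  ultimately show ?thesis by simp
qed

lemma real_mapE:
  assumes "is_flow haus X" "cubical_family K X g"
  obtains h where "is_flow_map (real_flow haus K) X h"
    "!!n x. x : cells K n ==> fcomp (nat_cube n) h (cell_map haus K n x) = g n x"
  using ex1_implies_ex[OF ex1_real_map[OF assms]] by blast

lemma real_map_eqI:
  fixes X :: "'a uflow"
  assumes X: "is_flow haus X" and h: "is_flow_map (real_flow haus K) X h" "is_flow_map (real_flow haus K) X k"
    and e: "!!n x. x : cells K n ==> fcomp (nat_cube n) h (cell_map haus K n x) = fcomp (nat_cube n) k (cell_map haus K n x)"
  shows "h = k"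
  by (rule Ex1_unique[OF ex1_real_map[OF X cubical_family_post[OF cell_family h(2)]]]) (use h e in auto)

end

abbreviation real_map :: "bool => 'a uprecub => 'a uprecub => (nat => 'a univ => 'a univ) => 'a uflow_map" where
  "real_map haus \<equiv> fmor (nat_realization haus)"

lemma fob_nat_realization [simp]: "fob (nat_realization haus) K = real_flow haus K"
  by (simp add: nat_realization_def)

lemma real_map:
  assumes K: "is_precubical_set K" and L: "is_precubical_set L" and f: "is_precub_map K L f"
  shows "is_flow_map (real_flow haus K) (real_flow haus L) (real_map haus K L f)"
    "x : cells K n ==> fcomp (nat_cube n) (real_map haus K L f) (cell_map haus K n x) = cell_map haus L n (f n x)"
proof -
  have "real_map haus K L f = (THE h. is_flow_map (real_flow haus K) (real_flow haus L) h \<and>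
      (\<forall>n. \<forall>x\<in>cells K n. fcomp (nat_cube n) h (cell_map haus K n x) = cell_map haus L n (f n x)))"
    by (simp add: nat_realization_def cell_map_def)
  note R = theI'[OF ex1_real_map[OF K is_flow_real[OF L] cubical_family_pre[OF cell_family[OF L] f], where haus = haus], folded this]
  show "is_flow_map (real_flow haus K) (real_flow haus L) (real_map haus K L f)"
    "x : cells K n ==> fcomp (nat_cube n) (real_map haus K L f) (cell_map haus K n x) = cell_map haus L n (f n x)"
    using R by auto
qed

lemma fcomp_real_map:
  assumes K: "is_precubical_set K" and L: "is_precubical_set L" and f: "is_precub_map K L f" and x: "x : cells K n"
  shows "fcomp (nat_cube n) (fcomp (real_flow haus K) h (real_map haus K L f)) (cell_map haus K n x) =
    fcomp (nat_cube n) h (cell_map haus L n (f n x))"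
  using fcomp_assoc[OF cubical_familyD(1)[OF cell_family[OF K] x], of h "real_map haus K L f" haus] real_map(2)[OF K L f x, of haus] by simp

lemma real_map_comp:
  assumes K: "is_precubical_set K" and L: "is_precubical_set L" and M: "is_precubical_set M"
    and f: "is_precub_map K L f" and g: "is_precub_map L M g"
  shows "real_map haus K M (%n. compose (cells K n) (g n) (f n)) =
    fcomp (real_flow haus K) (real_map haus L M g) (real_map haus K L f)"
proof (rule real_map_eqI[OF K is_flow_real[OF M]])
  note gf = is_precub_map_comp[OF K f g]
  show "is_flow_map (real_flow haus K) (real_flow haus M) (real_map haus K M (%n. compose (cells K n) (g n) (f n)))"
    by (rule real_map(1)[OF K M gf])
  show "is_flow_map (real_flow haus K) (real_flow haus M) (fcomp (real_flow haus K) (real_map haus L M g) (real_map haus K L f))"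
    by (rule is_flow_map_fcomp[OF is_flow_real[OF K] real_map(1)[OF K L f] real_map(1)[OF L M g]])
  show "fcomp (nat_cube n) (real_map haus K M (%n. compose (cells K n) (g n) (f n))) (cell_map haus K n x) =
      fcomp (nat_cube n) (fcomp (real_flow haus K) (real_map haus L M g) (real_map haus K L f)) (cell_map haus K n x)"
    if x: "x : cells K n" for n x
    unfolding fcomp_real_map[OF K L f x] real_map(2)[OF K M gf x] real_map(2)[OF L M g precub_map_in[OF f x]]
    using x by (simp add: compose_def)
qed

lemma real_map_id:
  assumes K: "is_precubical_set K"
  shows "real_map haus K K (%n. \<lambda>x\<in>cells K n. x) = fmap_on (real_flow haus K) (id, %_ _. id)"
proof (rule real_map_eqI[OF K is_flow_real[OF K] real_map(1)[OF K K is_precub_map_id[OF K]] is_flow_map_id[OF is_flow_real[OF K]]])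
  fix n x assume x: "x : cells K n"
  show "fcomp (nat_cube n) (real_map haus K K (%n. \<lambda>x\<in>cells K n. x)) (cell_map haus K n x) =
      fcomp (nat_cube n) (fmap_on (real_flow haus K) (id, %_ _. id)) (cell_map haus K n x)"
    unfolding real_map(2)[OF K K is_precub_map_id[OF K] x] fcomp_id_left[OF cubical_familyD(1)[OF cell_family[OF K] x]]
    using x by simp
qed

lemma is_functor_nat_realization: "is_functor PreCub (Flow haus) (nat_realization haus)"
  unfolding is_functor_def by (simp add: is_flow_real real_map(1) real_map_id real_map_comp)

section \<open>Preservation of colimits\<close>

text \<open>A subpresheaf through which all legs factor is everything: retracting the colimit onto it
  and including it back is the identity.\<close>

lemma precub_colimit_covered:
  assumes D: "!!j. j : Ob J ==> is_precubical_set (fob D j)" and colim: "is_colimit J PreCub D K \<iota>"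
    and E: "!!n. E n \<subseteq> cells K n" and act_E: "!!m n \<phi> x. box_map m n \<phi> ==> x : E n ==> act K m n \<phi> x : E m"
    and leg_E: "!!j n x. j : Ob J ==> x : cells (fob D j) n ==> \<iota> j n x : E n" and x: "x : cells K n"
  shows "x : E n"
proof -
  let ?E = "\<lparr>cells = E, act = act K\<rparr>"
  have co: "is_cocone J PreCub D K \<iota>"
    and un: "!!d \<mu>. is_cocone J PreCub D d \<mu> ==> \<exists>!h. h : Hom PreCub K d & (\<forall>j\<in>Ob J. Cmp PreCub (fob D j) K d h (\<iota> j) = \<mu> j)"
    using colim unfolding is_colimit_def by blast+
  have K: "is_precubical_set K" and leg: "!!j. j : Ob J ==> is_precub_map (fob D j) K (\<iota> j)"
    and nat: "!!j k u. j : Ob J ==> k : Ob J ==> u : Hom J j k ==>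
      (%n. compose (cells (fob D j) n) (\<iota> k n) (fmor D j k u n)) = \<iota> j"
    using co unfolding is_cocone_def by simp_all
  have PE: "is_precubical_set ?E"
    unfolding is_precubical_set_def using act_E act_id[OF K] act_comp[OF K] E by (auto simp: subset_iff)
  have "is_precub_map (fob D j) ?E (\<iota> j)" if "j : Ob J" for j
    by (rule is_precub_mapI) (use precub_map_ext[OF leg[OF that]] precub_map_act[OF leg[OF that]] leg_E[OF that] in auto)
  hence "is_cocone J PreCub D ?E \<iota>" unfolding is_cocone_def using PE nat by simp
  from ex1_implies_ex[OF un[OF this]] obtain r where r: "is_precub_map K ?E r"
    and ri: "!!j. j : Ob J ==> (%n. compose (cells (fob D j) n) (r n) (\<iota> j n)) = \<iota> j" by auto
  have "is_precub_map K K r"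
    by (rule is_precub_mapI) (use precub_map_ext[OF r] precub_map_act[OF r] precub_map_in[OF r] E in \<open>auto simp: subset_iff\<close>)
  moreover have "(%n. compose (cells (fob D j) n) (\<lambda>x\<in>cells K n. x) (\<iota> j n)) = \<iota> j" if j: "j : Ob J" for j
  proof
    fix n
    show "compose (cells (fob D j) n) (\<lambda>x\<in>cells K n. x) (\<iota> j n) = \<iota> j n"
      by (rule extensionalityI[OF compose_extensional precub_map_ext[OF leg[OF j]]])
        (simp add: compose_def precub_map_in[OF leg[OF j]])
  qed
  ultimately have "r = (%n. \<lambda>x\<in>cells K n. x)"
    by (intro Ex1_unique[OF un[OF co]]) (simp_all add: is_precub_map_id[OF K] ri)
  thus ?thesis using precub_map_in[OF r x] x by simp
qed

text \<open>A cocone of flows under the realizations of a diagram is a map from the diagram to the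
  presheaf of cubes of the target. The cells that occur in its image form a presheaf which fits into
  the universe; the universal property of the colimit of precubical sets applies to it.\<close>

lemma precub_colimit_family:
  fixes D :: "('a univ, 'a univ, 'a uprecub, nat => 'a univ => 'a univ) fctr"
  assumes D: "is_functor J PreCub D" and colim: "is_colimit J PreCub D K \<iota>"
    and \<nu>: "!!j. j : Ob J ==> cubical_family (fob D j) Z (\<nu> j)"
    and nat: "!!j k u n x. j : Ob J ==> k : Ob J ==> u : Hom J j k ==> x : cells (fob D j) n ==>
      \<nu> k n (fmor D j k u n x) = \<nu> j n x"
  obtains g where "cubical_family K Z g" "!!j n x. j : Ob J ==> x : cells (fob D j) n ==> g n (\<iota> j n x) = \<nu> j n x"
proof -
  have DP: "is_precubical_set (fob D j)" if "j : Ob J" for j using D that by (simp add: is_functor_def)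
  have DM: "is_precub_map (fob D j) (fob D k) (fmor D j k u)" if "j : Ob J" "k : Ob J" "u : Hom J j k" for j k u
    using D that by (simp add: is_functor_def)
  define A where "A n = (%jx. upair (fst jx) (snd jx)) ` {jx. fst jx : Ob J & snd jx : cells (fob D (fst jx)) n}" for n
  define dec where "dec n v = (let jx = SOME jx. v = upair (fst jx) (snd jx) in \<nu> (fst jx) n (snd jx))" for n v
  have dec: "dec n (upair j x) = \<nu> j n x" for n j x
  proof -
    define jx where "jx = (SOME jx. upair j x = upair (fst jx) (snd jx))"
    have "upair j x = upair (fst jx) (snd jx)" unfolding jx_def by (rule someI[of _ "(j, x)"]) simp
    hence "jx = (j, x)" by (simp add: prod_eq_iff)
    thus ?thesis unfolding dec_def jx_def[symmetric] Let_def by simp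
  qed
  define P where "P n = dec n ` A n" for n
  define code where "code n = inv_into (A n) (dec n)" for n
  have dc [simp]: "dec n (code n f) = f" if "f : P n" for n f
    using that unfolding P_def code_def by (rule f_inv_into_f)
  have P: "f : P n \<longleftrightarrow> (\<exists>j x. j : Ob J & x : cells (fob D j) n & f = \<nu> j n x)" for n f
    by (auto simp: P_def A_def image_image dec image_iff Bex_def)
  have PI: "\<nu> j n x : P n" if "j : Ob J" "x : cells (fob D j) n" for j n x using that P by blast
  have P_map: "is_flow_map (nat_cube n) Z f" if "f : P n" for n f
    using that cubical_familyD(1)[OF \<nu>] unfolding P by blast
  have P_act: "fcomp (nat_cube m) f (nat_cube_map m n \<phi>) : P m" if "f : P n" and b: "box_map m n \<phi>" for m n f \<phi>
  proof -
    from that(1) obtain j x where jx: "j : Ob J" "x : cells (fob D j) n" "f = \<nu> j n x" unfolding P by blast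
    show ?thesis unfolding jx(3) cubical_familyD(2)[OF \<nu>[OF jx(1)] jx(2) b] by (rule PI[OF jx(1) act_in[OF DP[OF jx(1)] b jx(2)]])
  qed
  define S where "S = \<lparr>cells = (%n. code n ` P n),
    act = (%m n \<phi> v. code m (fcomp (nat_cube m) (dec n v) (nat_cube_map m n \<phi>)))\<rparr>"
  have S: "is_precubical_set S" unfolding is_precubical_set_def
  proof (intro conjI allI ballI)
    fix m n \<phi> assume b: "\<phi> : Hom Box m n"
    show "act S m n \<phi> : cells S n \<rightarrow> cells S m" using b P_act by (auto simp: S_def)
  next
    fix n v assume "v : cells S n"
    then obtain f where f: "v = code n f" "f : P n" by (auto simp: S_def)
    show "act S n n (Idn Box n) v = v"
      using f fcomp_id_right[OF P_map[OF f(2)]] by (simp add: S_def nat_cube_map_id)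
  next
    fix l m n \<phi> \<psi> v assume b: "\<phi> : Hom Box l m" "\<psi> : Hom Box m n" and "v : cells S n"
    then obtain f where f: "v = code n f" "f : P n" by (auto simp: S_def)
    show "act S l n (Cmp Box l m n \<psi> \<phi>) v = act S l m \<phi> (act S m n \<psi> v)"
      using f b P_act[OF f(2)] nat_cube_map_comp[of l m \<phi> n \<psi>, where 'a = 'a]
      by (simp add: S_def fcomp_assoc[OF is_flow_map_nat_cube_map[of l m \<phi>, where 'a = 'a]])
  qed
  define \<sigma> where "\<sigma> j = (%n. \<lambda>x\<in>cells (fob D j) n. code n (\<nu> j n x))" for j
  have "is_precub_map (fob D j) S (\<sigma> j)" if j: "j : Ob J" for j
  proof (rule is_precub_mapI)
    fix m n \<phi> x assume b: "box_map m n \<phi>" and x: "x : cells (fob D j) n"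
    show "\<sigma> j m (act (fob D j) m n \<phi> x) = act S m n \<phi> (\<sigma> j n x)"
      using x act_in[OF DP[OF j] b x] PI[OF j x] cubical_familyD(2)[OF \<nu>[OF j] x b] by (simp add: \<sigma>_def S_def)
  qed (auto simp: \<sigma>_def S_def PI[OF j])
  moreover have "(%n. compose (cells (fob D j) n) (\<sigma> k n) (fmor D j k u n)) = \<sigma> j"
    if j: "j : Ob J" "k : Ob J" "u : Hom J j k" for j k u
    using nat[OF j] precub_map_in[OF DM[OF j]] by (auto simp: \<sigma>_def compose_def restrict_def fun_eq_iff)
  ultimately have "is_cocone J PreCub D S \<sigma>" using S by (simp add: is_cocone_def)
  hence "\<exists>!h. h : Hom PreCub K S & (\<forall>j\<in>Ob J. Cmp PreCub (fob D j) K S h (\<iota> j) = \<sigma> j)"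
    using colim unfolding is_colimit_def by blast
  from ex1_implies_ex[OF this] obtain h where h: "is_precub_map K S h"
    and hi: "!!j. j : Ob J ==> (%n. compose (cells (fob D j) n) (h n) (\<iota> j n)) = \<sigma> j" by auto
  have hP: "dec n (h n y) : P n" "code n (dec n (h n y)) = h n y" if "y : cells K n" for n y
    using precub_map_in[OF h that] by (auto simp: S_def)
  have "cubical_family K Z (%n y. dec n (h n y))" unfolding cubical_family_def
  proof (intro conjI allI ballI impI)
    fix n y assume y: "y : cells K n"
    show "is_flow_map (nat_cube n) Z (dec n (h n y))" by (rule P_map[OF hP(1)[OF y]])
    fix m \<phi> assume b: "box_map m n \<phi>"
    show "fcomp (nat_cube m) (dec n (h n y)) (nat_cube_map m n \<phi>) = dec m (h m (act K m n \<phi> y))"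
      using precub_map_act[OF h b y] P_act[OF hP(1)[OF y] b] by (simp add: S_def)
  qed
  moreover have "dec n (h n (\<iota> j n x)) = \<nu> j n x" if "j : Ob J" "x : cells (fob D j) n" for j n x
    using fun_cong[OF fun_cong[OF hi[OF that(1)], of n], of x] that PI[OF that] by (simp add: compose_def \<sigma>_def)
  ultimately show ?thesis by (rule that)
qed

lemma colimit_preserving_nat_realization: "colimit_preserving haus (nat_realization haus :: 'a upc_to_flow)"
  unfolding colimit_preserving_def
proof (intro allI impI, elim conjE)
  fix J :: "('a univ, 'a univ) cat" and D :: "('a univ, 'a univ, 'a uprecub, nat => 'a univ => 'a univ) fctr" and K \<iota>
  assume D: "is_functor J PreCub D" and colim: "is_colimit J PreCub D K \<iota>"
  let ?R = "real_flow haus" and ?F = "fctr_comp (nat_realization haus) D"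
  let ?\<iota> = "%j. real_map haus (fob D j) K (\<iota> j)"
  have DP: "is_precubical_set (fob D j)" if "j : Ob J" for j using D that by (simp add: is_functor_def)
  have DM: "is_precub_map (fob D j) (fob D k) (fmor D j k u)" if "j : Ob J" "k : Ob J" "u : Hom J j k" for j k u
    using D that by (simp add: is_functor_def)
  have K: "is_precubical_set K" and leg: "!!j. j : Ob J ==> is_precub_map (fob D j) K (\<iota> j)"
    and nat: "!!j k u. j : Ob J ==> k : Ob J ==> u : Hom J j k ==>
      (%n. compose (cells (fob D j) n) (\<iota> k n) (fmor D j k u n)) = \<iota> j"
    using colim unfolding is_colimit_def is_cocone_def by simp_all
  have F: "fob ?F j = ?R (fob D j)" "fmor ?F j k u = real_map haus (fob D j) (fob D k) (fmor D j k u)" for j k u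
    by (simp_all add: fctr_comp_def)
  note leg_map = real_map(1)[OF DP K leg, where haus = haus]
  note legK = fcomp_real_map[OF DP K leg, where haus = haus]
  have co: "is_cocone J (Flow haus) ?F (?R K) ?\<iota>" unfolding is_cocone_def
  proof (intro conjI ballI)
    fix j k u assume j: "j : Ob J" "k : Ob J" "u : Hom J j k"
    show "Cmp (Flow haus) (fob ?F j) (fob ?F k) (?R K) (?\<iota> k) (fmor ?F j k u) = ?\<iota> j"
      using real_map_comp[OF DP[OF j(1)] DP[OF j(2)] K DM[OF j] leg[OF j(2)], of haus] nat[OF j] by (simp add: F)
  qed (simp_all add: F is_flow_real[OF K] leg_map)
  have "\<exists>!h. h : Hom (Flow haus) (?R K) Z & (\<forall>j\<in>Ob J. Cmp (Flow haus) (fob ?F j) (?R K) Z h (?\<iota> j) = \<mu> j)"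
    if mu: "is_cocone J (Flow haus) ?F Z \<mu>" for Z \<mu>
  proof -
    have Z: "is_flow haus Z" and \<mu>: "!!j. j : Ob J ==> is_flow_map (?R (fob D j)) Z (\<mu> j)"
      and \<mu>_nat: "!!j k u. j : Ob J ==> k : Ob J ==> u : Hom J j k ==>
        fcomp (?R (fob D j)) (\<mu> k) (real_map haus (fob D j) (fob D k) (fmor D j k u)) = \<mu> j"
      using mu unfolding is_cocone_def by (simp_all add: F)
    let ?\<nu> = "%j n x. fcomp (nat_cube n) (\<mu> j) (cell_map haus (fob D j) n x)"
    obtain g where g: "cubical_family K Z g"
      and gi: "!!j n x. j : Ob J ==> x : cells (fob D j) n ==> g n (\<iota> j n x) = ?\<nu> j n x"
    proof (rule precub_colimit_family[OF D colim, of Z ?\<nu>])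
      show "cubical_family (fob D j) Z (?\<nu> j)" if "j : Ob J" for j
        by (rule cubical_family_post[OF cell_family[OF DP[OF that]] \<mu>[OF that]])
      show "?\<nu> k n (fmor D j k u n x) = ?\<nu> j n x"
        if j: "j : Ob J" "k : Ob J" "u : Hom J j k" and x: "x : cells (fob D j) n" for j k u n x
        using fcomp_real_map[OF DP[OF j(1)] DP[OF j(2)] DM[OF j] x, of haus "\<mu> k"] by (simp add: \<mu>_nat[OF j])
      fix g assume "cubical_family K Z g" "!!j n x. j : Ob J ==> x : cells (fob D j) n ==> g n (\<iota> j n x) = ?\<nu> j n x"
      thus thesis by (rule that)
    qed
    obtain H where H: "is_flow_map (?R K) Z H"
      and HK: "!!n x. x : cells K n ==> fcomp (nat_cube n) H (cell_map haus K n x) = g n x"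
      using real_mapE[OF K Z g] by blast
    have Hi: "fcomp (?R (fob D j)) H (?\<iota> j) = \<mu> j" if j: "j : Ob J" for j
    proof (rule real_map_eqI[OF DP[OF j] Z is_flow_map_fcomp[OF is_flow_real[OF DP[OF j]] leg_map[OF j j] H] \<mu>[OF j]])
      show "fcomp (nat_cube n) (fcomp (?R (fob D j)) H (?\<iota> j)) (cell_map haus (fob D j) n x) = ?\<nu> j n x"
        if x: "x : cells (fob D j) n" for n x
        unfolding legK[OF j j x] HK[OF precub_map_in[OF leg[OF j] x]] by (rule gi[OF j x])
    qed
    have uniq: "H' = H" if H': "is_flow_map (?R K) Z H'" and Hi': "!!j. j : Ob J ==> fcomp (?R (fob D j)) H' (?\<iota> j) = \<mu> j" for H'
    proof (rule real_map_eqI[OF K Z H' H])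
      fix n y assume y: "y : cells K n"
      define E where "E n = {y : cells K n. fcomp (nat_cube n) H' (cell_map haus K n y) = fcomp (nat_cube n) H (cell_map haus K n y)}" for n
      have "y : E n"
      proof (rule precub_colimit_covered[OF DP colim _ _ _ y])
        show "E n \<subseteq> cells K n" for n by (auto simp: E_def)
        show "act K m n \<phi> x : E m" if b: "box_map m n \<phi>" and x: "x : E n" for m n \<phi> x
        proof -
          have xK: "x : cells K n" using x by (simp add: E_def)
          show ?thesis
            using x act_in[OF K b xK] cubical_familyD(2)[OF cubical_family_post[OF cell_family[OF K] H'] xK b, symmetric]
              cubical_familyD(2)[OF cubical_family_post[OF cell_family[OF K] H] xK b, symmetric]
            by (simp add: E_def)
        qed
        show "\<iota> j n x : E n" if j: "j : Ob J" and x: "x : cells (fob D j) n" for j n x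
          using legK[OF j j x, of H] legK[OF j j x, of H'] precub_map_in[OF leg[OF j] x]
          by (simp add: E_def Hi[OF j] Hi'[OF j])
      qed
      thus "fcomp (nat_cube n) H' (cell_map haus K n y) = fcomp (nat_cube n) H (cell_map haus K n y)" by (simp add: E_def)
    qed
    show ?thesis
    proof (rule ex1I[of _ H])
      show "H : Hom (Flow haus) (?R K) Z & (\<forall>j\<in>Ob J. Cmp (Flow haus) (fob ?F j) (?R K) Z H (?\<iota> j) = \<mu> j)"
        using H Hi by (simp add: F)
    next
      fix H' assume "H' : Hom (Flow haus) (?R K) Z & (\<forall>j\<in>Ob J. Cmp (Flow haus) (fob ?F j) (?R K) Z H' (?\<iota> j) = \<mu> j)"
      thus "H' = H" by (intro uniq) (simp_all add: F)
    qed
  qed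
  thus "is_colimit J (Flow haus) ?F (fob (nat_realization haus) K) ?\<iota>"
    unfolding is_colimit_def using co by simp
qed

section \<open>Standard cubes and cofibrations\<close>

lemma std_cube_simps [simp]: "cells (std_cube n) m = {Face \<phi> | \<phi>. box_map m n \<phi>}"
  "act (std_cube n) l m \<phi> x = Face (compose (vert l) (unFace x) \<phi>)" by (auto simp: std_cube_def)

lemma std_cube_bdry_simps [simp]: "cells (std_cube_bdry n) m = {Face \<phi> | \<phi>. m < n & box_map m n \<phi>}"
  "act (std_cube_bdry n) l m \<phi> x = Face (compose (vert l) (unFace x) \<phi>)" by (auto simp: std_cube_bdry_def)

lemma compose_box:
  assumes "box_map l m \<phi>"
  shows "compose (vert l) (\<lambda>xs\<in>vert m. xs) \<phi> = \<phi>"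
    "compose (vert l) \<phi> (\<lambda>xs\<in>vert l. xs) = \<phi>"
    "compose (vert l) \<theta> (compose (vert l) \<psi> \<phi>) = compose (vert l) (compose (vert m) \<theta> \<psi>) \<phi>"
proof -
  show "compose (vert l) (\<lambda>xs\<in>vert m. xs) \<phi> = \<phi>"
    by (rule extensionalityI[OF compose_extensional box_map_ext[OF assms]]) (simp add: compose_def box_map_vert[OF assms])
  show "compose (vert l) \<phi> (\<lambda>xs\<in>vert l. xs) = \<phi>"
    by (rule extensionalityI[OF compose_extensional box_map_ext[OF assms]]) (simp add: compose_def)
  show "compose (vert l) \<theta> (compose (vert l) \<psi> \<phi>) = compose (vert l) (compose (vert m) \<theta> \<psi>) \<phi>"
    by (auto simp: compose_def fun_eq_iff restrict_def box_map_vert[OF assms])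
qed

lemma is_precubical_std_cube: "is_precubical_set (std_cube n)"
  unfolding is_precubical_set_def by (auto simp: compose_box box_map.comp)

lemma is_precubical_std_cube_bdry: "is_precubical_set (std_cube_bdry n)" unfolding is_precubical_set_def
  using box_map_le by (fastforce simp: compose_box intro: box_map.comp)

lemma is_precub_map_bdry_incl: "is_precub_map (std_cube_bdry n) (std_cube n) (bdry_incl n)"
  by (rule is_precub_mapI) (use box_map_le in \<open>fastforce simp: bdry_incl_def intro: box_map.comp\<close>)+

lemma is_precub_map_yoneda: "box_map m n \<phi> ==> is_precub_map (std_cube m) (std_cube n) (fmor yoneda m n \<phi>)"
  by (rule is_precub_mapI) (auto simp: yoneda_def compose_box intro: box_map.comp)

text \<open>The Yoneda lemma: any map out of the n-cube is the value on the top cell of a cubical family.\<close>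

lemma cubical_family_std_cube:
  assumes h: "is_flow_map (nat_cube n) X h"
  shows "cubical_family (std_cube n) X (%m x. fcomp (nat_cube m) h (nat_cube_map m n (unFace x)))"
  unfolding cubical_family_def
proof (intro conjI allI ballI impI)
  fix m x assume "x : cells (std_cube n) m"
  then obtain \<psi> where x: "x = Face \<psi>" "box_map m n \<psi>" by auto
  show "is_flow_map (nat_cube m) X (fcomp (nat_cube m) h (nat_cube_map m n (unFace x)))"
    using x by (simp add: is_flow_map_fcomp[OF is_flow_nat_cube is_flow_map_nat_cube_map h])
  fix l \<phi> assume b: "box_map l m \<phi>"
  show "fcomp (nat_cube l) (fcomp (nat_cube m) h (nat_cube_map m n (unFace x))) (nat_cube_map l m \<phi>) =
      fcomp (nat_cube l) h (nat_cube_map l n (unFace (act (std_cube n) l m \<phi> x)))"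
    using x by (simp add: nat_cube_map_comp[OF b x(2)] fcomp_assoc[OF is_flow_map_nat_cube_map[OF b]])
qed

abbreviation top_cell :: "bool => nat => 'a uflow_map" where
  "top_cell haus n \<equiv> cell_map haus (std_cube n) n (Face (\<lambda>xs\<in>vert n. xs))"

lemma top_cell: "is_flow_map (nat_cube n) (real_flow haus (std_cube n)) (top_cell haus n)"
  and cell_map_std_cube: "box_map m n \<phi> ==>
    cell_map haus (std_cube n) m (Face \<phi>) = fcomp (nat_cube m) (top_cell haus n) (nat_cube_map m n \<phi>)"
proof -
  have c: "Face (\<lambda>xs\<in>vert n. xs) : cells (std_cube n) n" by (auto intro: box_map.ident)
  note F = cubical_familyD[OF cell_family[OF is_precubical_std_cube] c]
  show "is_flow_map (nat_cube n) (real_flow haus (std_cube n)) (top_cell haus n)" by (rule F(1))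
  show "cell_map haus (std_cube n) m (Face \<phi>) = fcomp (nat_cube m) (top_cell haus n) (nat_cube_map m n \<phi>)"
    if b: "box_map m n \<phi>" using F(2)[OF b, of haus, symmetric] by (simp add: compose_box[OF b])
qed

text \<open>A map out of the realization of the boundary is a compatible family of maps on the proper faces, so
  that a square for the realized inclusion is a lifting problem for the cube.\<close>

lemma m_cofibration_bdry:
  "m_cofibration haus (real_flow haus (std_cube_bdry n)) (real_flow haus (std_cube n :: 'a uprecub))
     (real_map haus (std_cube_bdry n) (std_cube n) (bdry_incl n))"
  unfolding m_cofibration_def lifts_def Ob_Flow Hom_Flow Cmp_Flow
proof (intro conjI ballI impI)
  let ?A = "std_cube_bdry n :: 'a uprecub" and ?B = "std_cube n :: 'a uprecub"
  let ?i = "real_map haus ?A ?B (bdry_incl n)"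
  note PA = is_precubical_std_cube_bdry[of n, where 'a = 'a] and PB = is_precubical_std_cube[of n, where 'a = 'a]
    and I = is_precub_map_bdry_incl[of n, where 'a = 'a]
  show "is_flow haus (real_flow haus ?A)" "is_flow haus (real_flow haus ?B)"
    by (rule is_flow_real[OF PA], rule is_flow_real[OF PB])
  show i: "is_flow_map (real_flow haus ?A) (real_flow haus ?B) ?i" by (rule real_map(1)[OF PA PB I])
  fix X Y :: "'a uflow" and p u v
  assume "X : Ob (Flow haus)" "Y : Ob (Flow haus)" "p : Hom (Flow haus) X Y"
    and fw: "m_fibration haus X Y p & flow_weak_equivalence X Y p"
    and "u : Hom (Flow haus) (real_flow haus ?A) X" "v : Hom (Flow haus) (real_flow haus ?B) Y"
    and sq: "fcomp (real_flow haus ?A) p u = fcomp (real_flow haus ?A) v ?i"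
  hence X: "is_flow haus X" and Y: "is_flow haus Y" and p: "is_flow_map X Y p"
    and u: "is_flow_map (real_flow haus ?A) X u" and v: "is_flow_map (real_flow haus ?B) Y v" by simp_all
  let ?w = "fcomp (nat_cube n) v (top_cell haus n)"
  let ?f = "%m \<phi>. fcomp (nat_cube m) u (cell_map haus ?A m (Face \<phi>))"
  note fam = cubical_familyD[OF cubical_family_post[OF cell_family[OF PA] u]]
  have cA: "Face \<phi> : cells ?A m" if "m < n" "box_map m n \<phi>" for m \<phi> using that by simp
  have vc: "fcomp (nat_cube m) ?w (nat_cube_map m n \<phi>) = fcomp (nat_cube m) v (cell_map haus ?B m (Face \<phi>))"
    if b: "box_map m n \<phi>" for m \<phi>
    unfolding cell_map_std_cube[OF b] by (rule fcomp_assoc[OF is_flow_map_nat_cube_map[OF b], symmetric])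
  interpret cube_lifting haus n X Y p ?w ?f
  proof
    fix m \<phi> assume m: "m < n" and b: "box_map m n \<phi>"
    show "is_flow_map (nat_cube m) X (?f m \<phi>)" by (rule fam(1)[OF cA[OF m b]])
    have "fcomp (nat_cube m) p (?f m \<phi>) = fcomp (nat_cube m) (fcomp (real_flow haus ?A) p u) (cell_map haus ?A m (Face \<phi>))"
      by (rule fcomp_assoc[OF cubical_familyD(1)[OF cell_family[OF PA] cA[OF m b]]])
    also have "\<dots> = fcomp (nat_cube m) v (cell_map haus ?B m (bdry_incl n m (Face \<phi>)))"
      unfolding sq by (rule fcomp_real_map[OF PA PB I cA[OF m b]])
    also have "\<dots> = fcomp (nat_cube m) ?w (nat_cube_map m n \<phi>)" unfolding vc[OF b] using cA[OF m b] by (simp add: bdry_incl_def)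
    finally show "fcomp (nat_cube m) p (?f m \<phi>) = fcomp (nat_cube m) ?w (nat_cube_map m n \<phi>)" .
    fix l \<psi> assume "box_map l m \<psi>"
    from fam(2)[OF cA[OF m b] this]
    show "?f l (compose (vert l) \<phi> \<psi>) = fcomp (nat_cube l) (?f m \<phi>) (nat_cube_map l m \<psi>)" by simp
  qed (use X Y p fw is_flow_map_fcomp[OF is_flow_nat_cube top_cell v] in simp_all)
  obtain h0 where h0: "is_flow_map (nat_cube n) X h0"
    and hf: "!!m \<phi>. m < n ==> box_map m n \<phi> ==> fcomp (nat_cube m) h0 (nat_cube_map m n \<phi>) = ?f m \<phi>"
    and ph: "fcomp (nat_cube n) p h0 = ?w" using cube_flow_lift by blast
  obtain h where h: "is_flow_map (real_flow haus ?B) X h" and hc: "!!m x. x : cells ?B m ==>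
      fcomp (nat_cube m) h (cell_map haus ?B m x) = fcomp (nat_cube m) h0 (nat_cube_map m n (unFace x))"
    using real_mapE[OF PB X cubical_family_std_cube[OF h0]] by blast
  have "fcomp (real_flow haus ?A) h ?i = u"
  proof (rule real_map_eqI[OF PA X is_flow_map_fcomp[OF is_flow_real[OF PA] i h] u])
    fix m x assume x: "x : cells ?A m"
    then obtain \<phi> where \<phi>: "x = Face \<phi>" "m < n" "box_map m n \<phi>" by auto
    show "fcomp (nat_cube m) (fcomp (real_flow haus ?A) h ?i) (cell_map haus ?A m x) = fcomp (nat_cube m) u (cell_map haus ?A m x)"
      unfolding fcomp_real_map[OF PA PB I x] using hc[of x m] x \<phi> hf[OF \<phi>(2,3)] by (simp add: bdry_incl_def)
  qed
  moreover have "fcomp (real_flow haus ?B) p h = v"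
  proof (rule real_map_eqI[OF PB Y is_flow_map_fcomp[OF is_flow_real[OF PB] h p] v])
    fix m x assume x: "x : cells ?B m"
    then obtain \<phi> where \<phi>: "x = Face \<phi>" "box_map m n \<phi>" by auto
    have "fcomp (nat_cube m) (fcomp (real_flow haus ?B) p h) (cell_map haus ?B m x) =
        fcomp (nat_cube m) p (fcomp (nat_cube m) h0 (nat_cube_map m n \<phi>))"
      using fcomp_assoc[OF cubical_familyD(1)[OF cell_family[OF PB] x], of p h haus] hc[OF x] \<phi> by simp
    also have "\<dots> = fcomp (nat_cube m) ?w (nat_cube_map m n \<phi>)"
      unfolding ph[symmetric] by (rule fcomp_assoc[OF is_flow_map_nat_cube_map[OF \<phi>(2)]])
    finally show "fcomp (nat_cube m) (fcomp (real_flow haus ?B) p h) (cell_map haus ?B m x) = fcomp (nat_cube m) v (cell_map haus ?B m x)"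
      by (simp only: vc[OF \<phi>(2)] \<phi>(1))
  qed
  ultimately show "\<exists>h\<in>Hom (Flow haus) (real_flow haus ?B) X. fcomp (real_flow haus ?A) h ?i = u & fcomp (real_flow haus ?B) p h = v"
    using h by auto
qed

text \<open>A lift out of the realization of a precubical set is built one dimension at a time: on each cell
  it is already prescribed on the boundary.\<close>

lemma m_cofibrant_real:
  assumes K: "is_precubical_set (K :: 'a uprecub)"
  shows "m_cofibrant haus (real_flow haus K)"
proof -
  let ?R = "real_flow haus K" and ?e = "(%_. undefined, %_ _ _. undefined) :: 'a uflow_map"
  have E: "is_flow haus (empty_flow :: 'a uflow)" by (simp add: is_flow_def empty_flow_def)
  have eq: "f = g" if "is_flow_map (empty_flow :: 'a uflow) Z f" "is_flow_map empty_flow Z g" for Z :: "'a uflow" and f g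
    by (rule flow_map_eqI[OF that]) (simp_all add: empty_flow_def)
  have e: "is_flow_map (empty_flow :: 'a uflow) ?R ?e"
    by (auto simp: is_flow_map_def fmap_on_def empty_flow_def fun_eq_iff)
  have "\<exists>h. is_flow_map ?R X h & fcomp ?R p h = v"
    if X: "is_flow haus X" and Y: "is_flow haus Y" and p: "is_flow_map X Y p"
      and fib: "m_fibration haus X Y p" and weq: "flow_weak_equivalence X Y p" and v: "is_flow_map ?R Y v" for X Y :: "'a uflow" and p v
  proof -
    note fam = cubical_familyD[OF cubical_family_post[OF cell_family[OF K] v]]
    define lifted where "lifted N g \<longleftrightarrow> (\<forall>n<N. \<forall>x\<in>cells K n. is_flow_map (nat_cube n) X (g n x) \<and>
        fcomp (nat_cube n) p (g n x) = fcomp (nat_cube n) v (cell_map haus K n x) \<and>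
        (\<forall>m \<phi>. box_map m n \<phi> --> fcomp (nat_cube m) (g n x) (nat_cube_map m n \<phi>) = g m (act K m n \<phi> x)))" for N g
    have step: "\<exists>g'. lifted (Suc N) g' & (\<forall>n<N. g' n = g n)" if g: "lifted N g" for N g
    proof -
      have G: "is_flow_map (nat_cube n) X (g n x)" "fcomp (nat_cube n) p (g n x) = fcomp (nat_cube n) v (cell_map haus K n x)"
        "!!m \<phi>. box_map m n \<phi> ==> fcomp (nat_cube m) (g n x) (nat_cube_map m n \<phi>) = g m (act K m n \<phi> x)"
        if "n < N" "x : cells K n" for n x using g that unfolding lifted_def by blast+
      have "\<exists>h. is_flow_map (nat_cube N) X h \<and>
          (\<forall>m \<phi>. m < N --> box_map m N \<phi> --> fcomp (nat_cube m) h (nat_cube_map m N \<phi>) = g m (act K m N \<phi> x)) \<and>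
          fcomp (nat_cube N) p h = fcomp (nat_cube N) v (cell_map haus K N x)" if x: "x : cells K N" for x
      proof -
        interpret cube_lifting haus N X Y p "fcomp (nat_cube N) v (cell_map haus K N x)" "%m \<phi>. g m (act K m N \<phi> x)"
        proof
          fix m \<phi> assume m: "m < N" and b: "box_map m N \<phi>"
          note ax = act_in[OF K b x]
          show "is_flow_map (nat_cube m) X (g m (act K m N \<phi> x))" by (rule G(1)[OF m ax])
          show "fcomp (nat_cube m) p (g m (act K m N \<phi> x)) =
              fcomp (nat_cube m) (fcomp (nat_cube N) v (cell_map haus K N x)) (nat_cube_map m N \<phi>)"
            unfolding G(2)[OF m ax] fam(2)[OF x b] ..
          fix l \<psi> assume c: "box_map l m \<psi>"
          show "g l (act K l N (compose (vert l) \<phi> \<psi>) x) = fcomp (nat_cube l) (g m (act K m N \<phi> x)) (nat_cube_map l m \<psi>)"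
            unfolding act_comp[OF K c b x] G(3)[OF m ax c] ..
        qed (rule X Y p fib weq fam(1)[OF x])+
        show ?thesis
        proof (rule cube_flow_lift)
          fix h assume h: "is_flow_map (nat_cube N) X h" "fcomp (nat_cube N) p h = fcomp (nat_cube N) v (cell_map haus K N x)"
            and hf: "!!m \<phi>. m < N ==> box_map m N \<phi> ==> fcomp (nat_cube m) h (nat_cube_map m N \<phi>) = g m (act K m N \<phi> x)"
          show ?thesis by (intro exI[of _ h] conjI allI impI h hf)
        qed
      qed
      then obtain h where h: "!!x. x : cells K N ==> is_flow_map (nat_cube N) X (h x)"
        and hf: "!!x m \<phi>. x : cells K N ==> m < N ==> box_map m N \<phi> ==>
          fcomp (nat_cube m) (h x) (nat_cube_map m N \<phi>) = g m (act K m N \<phi> x)"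
        and ph: "!!x. x : cells K N ==> fcomp (nat_cube N) p (h x) = fcomp (nat_cube N) v (cell_map haus K N x)"
        by metis
      have "lifted (Suc N) (g(N := h))" unfolding lifted_def
      proof (intro allI ballI impI)
        fix n x assume n: "n < Suc N" and x: "x : cells K n"
        show "is_flow_map (nat_cube n) X ((g(N := h)) n x) \<and>
            fcomp (nat_cube n) p ((g(N := h)) n x) = fcomp (nat_cube n) v (cell_map haus K n x) \<and>
            (\<forall>m \<phi>. box_map m n \<phi> --> fcomp (nat_cube m) ((g(N := h)) n x) (nat_cube_map m n \<phi>) = (g(N := h)) m (act K m n \<phi> x))"
        proof (cases "n = N")
          case False
          hence n: "n < N" using n by simp
          have "m ~= N" if "box_map m n \<phi>" for m \<phi> using box_map_le[OF that] n by simp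
          thus ?thesis using G[OF n x] n by auto
        next
          case True
          hence x: "x : cells K N" using x by simp
          have "fcomp (nat_cube m) (h x) (nat_cube_map m N \<phi>) = (g(N := h)) m (act K m N \<phi> x)" if b: "box_map m N \<phi>" for m \<phi>
          proof (cases "m = N")
            case True
            have id: "\<phi> = (\<lambda>xs\<in>vert N. xs)" using b unfolding True by (rule box_map_endo)
            show ?thesis unfolding True id nat_cube_map_id fcomp_id_right[OF h[OF x]] act_id[OF K x] by simp
          next
            case False
            thus ?thesis using box_map_le[OF b] hf[OF x _ b] by simp
          qed
          thus ?thesis using h[OF x] ph[OF x] True by simp
        qed
      qed
      thus ?thesis by (intro exI[of _ "g(N := h)"]) simp
    qed
    have "\<exists>G. \<forall>N. lifted N (G N) & (\<forall>n<N. G (Suc N) n = G N n)"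
      by (rule dependent_nat_choice) (use step in \<open>auto simp: lifted_def\<close>)
    then obtain G where G: "!!N. lifted N (G N)" and GS: "!!N n. n < N ==> G (Suc N) n = G N n" by blast
    define g where "g n = G (Suc n) n" for n
    have Gg: "G N n = g n" if "n < N" for N n using that by (induction N) (auto simp: GS g_def less_Suc_eq)
    have L: "is_flow_map (nat_cube n) X (g n x)" "fcomp (nat_cube n) p (g n x) = fcomp (nat_cube n) v (cell_map haus K n x)"
      "box_map m n \<phi> ==> fcomp (nat_cube m) (g n x) (nat_cube_map m n \<phi>) = g m (act K m n \<phi> x)" if "x : cells K n" for m n \<phi> x
      using G[of "Suc n", unfolded lifted_def, rule_format, OF lessI that] box_map_le[of m n \<phi>] by (simp_all add: Gg)
    have "cubical_family K X g" unfolding cubical_family_def using L by blast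
    then obtain h where h: "is_flow_map ?R X h" and hc: "!!n x. x : cells K n ==> fcomp (nat_cube n) h (cell_map haus K n x) = g n x"
      using real_mapE[OF K X] by blast
    have "fcomp ?R p h = v"
    proof (rule real_map_eqI[OF K Y is_flow_map_fcomp[OF is_flow_real[OF K] h p] v])
      fix n x assume x: "x : cells K n"
      show "fcomp (nat_cube n) (fcomp ?R p h) (cell_map haus K n x) = fcomp (nat_cube n) v (cell_map haus K n x)"
        using fcomp_assoc[OF cubical_familyD(1)[OF cell_family[OF K] x], of p h haus] hc[OF x] L(2)[OF x] by simp
    qed
    thus ?thesis using h by blast
  qed
  hence "\<exists>h. is_flow_map ?R X h & fcomp empty_flow h ?e = u & fcomp ?R p h = v"
    if "is_flow haus X" "is_flow haus Y" "is_flow_map X Y p" "m_fibration haus X Y p & flow_weak_equivalence X Y p"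
      "is_flow_map empty_flow X u" "is_flow_map ?R Y v" for X Y :: "'a uflow" and p u v
    using that eq[OF is_flow_map_fcomp[OF E e]] by meson
  thus ?thesis unfolding m_cofibrant_def m_cofibration_def lifts_def Ob_Flow Hom_Flow Cmp_Flow
    using E e is_flow_real[OF K] by (simp add: Bex_def)
qed

section \<open>Comparison with the cubes as posets\<close>

text \<open>Any two points are joined by a path that depends continuously on them and is constant if they are
  equal.\<close>

definition equiconnected :: "'a topology => bool" where
  "equiconnected X \<longleftrightarrow> (\<exists>m. cmap (prod_topology (prod_topology X X) unit_ivl) X (%z. m (fst (fst z)) (snd (fst z)) (snd z)) \<and>
     (\<forall>x\<in>topspace X. \<forall>y\<in>topspace X. m x y 0 = x & m x y 1 = y & (\<forall>t\<in>{0..1}. m x x t = x)))"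

lemma continuous_map_along:
  assumes "cmap (prod_topology (prod_topology X X) unit_ivl) X (%z. m (fst (fst z)) (snd (fst z)) (snd z))"
    "cmap Z X f" "cmap Z X g" "cmap Z unit_ivl c"
  shows "cmap Z X (%z. m (f z) (g z) (c z))"
  using continuous_map_compose[OF _ assms(1), of Z "%z. ((f z, g z), c z)"] assms(2-4) by (simp add: o_def continuous_map_paired)

lemma equiconnected_discrete: "equiconnected (discrete_topology {a})"
  unfolding equiconnected_def by (intro exI[of _ "%_ _ _. a"]) simp

lemma equiconnected_N: "equiconnected (N n)" unfolding equiconnected_def
proof (intro exI[of _ "%x y t. mix n t x y"] conjI ballI)
  let ?P = "prod_topology (prod_topology (N n) (N n)) unit_ivl"
  have "cmap ?P unit_ivl snd" by (rule continuous_map_snd)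
  thus "cmap ?P (N n) (%z. mix n (snd z) (fst (fst z)) (snd (fst z)))" unfolding continuous_map_unit_ivl
    by (intro continuous_map_mix continuous_map_compose[OF continuous_map_fst continuous_map_fst, unfolded o_def]
        continuous_map_compose[OF continuous_map_fst continuous_map_snd, unfolded o_def]) auto
  fix ga \<theta> assume g: "ga : topspace (N n)" "\<theta> : topspace (N n)"
  show "mix n 0 ga \<theta> = ga" "mix n 1 ga \<theta> = \<theta>" using g by (simp_all add: mix_0 mix_1)
  fix t :: real assume t: "t : {0..1}"
  thus "mix n t ga ga = ga" using g by (intro ndp_eqI[OF mix_natural]) (auto simp: mix_def algebra_simps)
qed

lemma equiconnected_retract:
  assumes X: "equiconnected X" and f: "cmap X Y f" and g: "cmap Y X g"
    and fg: "!!y. y : topspace Y ==> f (g y) = y"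
  shows "equiconnected Y"
proof -
  obtain m where cm: "cmap (prod_topology (prod_topology X X) unit_ivl) X (%z. m (fst (fst z)) (snd (fst z)) (snd z))"
    and m: "!!x y. x : topspace X ==> y : topspace X ==> m x y 0 = x & m x y 1 = y"
      "!!x t. x : topspace X ==> t : {0..1} ==> m x x t = x" using X unfolding equiconnected_def by blast
  show ?thesis unfolding equiconnected_def
  proof (intro exI[of _ "%x y t. f (m (g x) (g y) t)"] conjI ballI)
    let ?P = "prod_topology (prod_topology Y Y) unit_ivl"
    have "cmap ?P X (%z. m (g (fst (fst z))) (g (snd (fst z))) (snd z))"
      by (intro continuous_map_along[OF cm] continuous_map_snd
          continuous_map_compose[OF continuous_map_compose[OF continuous_map_fst continuous_map_fst] g, unfolded o_def]
          continuous_map_compose[OF continuous_map_compose[OF continuous_map_fst continuous_map_snd] g, unfolded o_def])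
    from continuous_map_compose[OF this f]
    show "cmap ?P Y (%z. f (m (g (fst (fst z))) (g (snd (fst z))) (snd z)))" by (simp add: o_def)
  qed (use m continuous_map_funspace[OF g] fg in auto)
qed

text \<open>Moving two maps of a cube into each other along the chosen paths keeps fixed the points where they
  agree; so all homotopy groups are trivial.\<close>

lemma
  assumes X: "equiconnected X" and a: "a : topspace X"
  shows path_components_equiconnected: "path_components_of X = {topspace X}"
    and homotopy_classes_equiconnected: "homotopy_classes n X a = {sphere_maps n X a}"
    and sphere_htpy_equiconnected: "g : sphere_maps n X a ==> sphere_htpy n X a `` {g} = sphere_maps n X a"
proof -
  obtain m where cm: "cmap (prod_topology (prod_topology X X) unit_ivl) X (%z. m (fst (fst z)) (snd (fst z)) (snd z))"
    and m: "!!x y. x : topspace X ==> y : topspace X ==> m x y 0 = x & m x y 1 = y"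
      "!!x t. x : topspace X ==> t : {0..1} ==> m x x t = x" using X unfolding equiconnected_def by blast
  have pc: "path_component_of X x y" if "x : topspace X" "y : topspace X" for x y
    unfolding path_component_of_def pathin_def
    by (intro exI[of _ "%t. m x y t"] conjI continuous_map_along[OF cm]) (use m(1)[OF that] that in auto)
  hence "path_component_of_set X x = topspace X" if "x : topspace X" for x
    using that path_component_of_subset_topspace[of X x] by auto
  thus "path_components_of X = {topspace X}" using a by (auto simp: path_components_of_def)
  have h: "(g, h) : sphere_htpy n X a" if g: "g : sphere_maps n X a" and h: "h : sphere_maps n X a" for g h
  proof (rule sphere_htpyI[of n X "%(t, z). m (g z) (h z) t"])
    have c: "cmap (cube_top n) X g" "cmap (cube_top n) X h" using g h by (simp_all add: sphere_maps_def)
    show "cmap (prod_topology unit_ivl (cube_top n)) X (%(t, z). m (g z) (h z) t)" unfolding case_prod_beta'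
      by (intro continuous_map_along[OF cm] continuous_map_fst continuous_map_compose[OF continuous_map_snd c(1), unfolded o_def]
          continuous_map_compose[OF continuous_map_snd c(2), unfolded o_def])
    show "(case (0, z) of (t, z) => m (g z) (h z) t) = g z" "(case (1, z) of (t, z) => m (g z) (h z) t) = h z"
      if "z : topspace (cube_top n)" for z
      using m(1) continuous_map_funspace[OF c(1) that] continuous_map_funspace[OF c(2) that] by simp_all
    show "(case (t, z) of (t, z) => m (g z) (h z) t) = a" if "0 <= t" "t <= 1" "z : cube_bdry n" for t z
      using g h m(2)[OF a, of t] that by (simp add: sphere_maps_def)
  qed (rule g h)+
  thus cl: "sphere_htpy n X a `` {g} = sphere_maps n X a" if "g : sphere_maps n X a" for g
    using that by (auto simp: sphere_htpy_def)
  have "(%_. a) : sphere_maps n X a" using a by (simp add: sphere_maps_def)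
  thus "homotopy_classes n X a = {sphere_maps n X a}" unfolding homotopy_classes_def quotient_def using cl by auto
qed

lemma weak_homotopy_equivalence_equiconnected:
  assumes X: "equiconnected X" and Y: "equiconnected Y" and f: "cmap X Y f" and ne: "topspace X ~= {}"
  shows "weak_homotopy_equivalence X Y f" unfolding weak_homotopy_equivalence_def
proof (intro conjI allI impI ballI f)
  obtain a where a: "a : topspace X" using ne by blast
  note fa = continuous_map_funspace[OF f]
  have "path_component_of_set Y y = topspace Y" if y: "y : topspace Y" for y
  proof -
    have "path_component_of_set Y y : path_components_of Y" using y by (auto simp: path_components_of_def)
    thus ?thesis using path_components_equiconnected[OF Y y] by simp
  qed
  thus "bij_betw (%C. \<Union>x\<in>C. path_component_of_set Y (f x)) (path_components_of X) (path_components_of Y)"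
    using path_components_equiconnected[OF X a] path_components_equiconnected[OF Y fa[OF a]] fa a
    by (auto simp: bij_betw_def)
  fix n x assume x: "x : topspace X"
  have "f \<circ> g : sphere_maps n Y (f x)" if "g : sphere_maps n X x" for g
    using that f by (auto simp: sphere_maps_def intro: continuous_map_compose)
  hence "sphere_htpy n Y (f x) `` ((%g. f \<circ> g) ` sphere_maps n X x) = (\<Union>g\<in>sphere_maps n X x. sphere_maps n Y (f x))"
    using sphere_htpy_equiconnected[OF Y fa[OF x], of _ n] by blast
  moreover have "(%_. x) : sphere_maps n X x" using x by (simp add: sphere_maps_def)
  ultimately have "sphere_htpy n Y (f x) `` ((%g. f \<circ> g) ` sphere_maps n X x) = sphere_maps n Y (f x)" by auto
  thus "bij_betw (%C. sphere_htpy n Y (f x) `` ((%g. f \<circ> g) ` C)) (homotopy_classes n X x) (homotopy_classes n Y (f x))"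
    unfolding homotopy_classes_equiconnected[OF X x] homotopy_classes_equiconnected[OF Y fa[OF x]]
    by (simp add: bij_betw_def)
qed

lemma weak_homotopy_equivalence_empty:
  assumes "topspace X = {}" "topspace Y = {}" shows "weak_homotopy_equivalence X Y f"
  using assms by (auto simp: weak_homotopy_equivalence_def continuous_map_def path_components_of_def bij_betw_def)

lemma natural_dpaths_nonempty: "natural_dpaths n ~= {}"
proof -
  have "(\<lambda>t\<in>{0..real n}. \<lambda>i\<in>{..<n}. t / real n) : natural_dpaths n"
    by (rule natural_dpathsI) (auto simp: divide_right_mono divide_le_eq)
  thus ?thesis by blast
qed

lemma states_cube_poset [simp]: "states (fob cube_poset n) = Vertex ` vert n"
  by (simp add: cube_poset_def poset_flow_def)

lemma paths_cube_poset:
  "al : vert n ==> be : vert n ==> paths (fob cube_poset n) (Vertex al) (Vertex be) =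
    discrete_topology (if vless al be then {Vertex []} else {})" by (simp add: cube_poset_def poset_flow_def)

lemma pcomp_cube_poset: "pcomp (fob cube_poset n) a b c p q = Vertex []"
  by (simp add: cube_poset_def poset_flow_def)

lemma is_flow_cube_poset: "is_flow haus (fob cube_poset n :: 'a uflow)" unfolding is_flow_def
proof (intro conjI ballI)
  let ?P = "fob cube_poset n :: 'a uflow"
  fix a b :: "'a univ" assume "a : states ?P" "b : states ?P"
  then obtain al be where ab: "a = Vertex al" "b = Vertex be" "al : vert n" "be : vert n" by auto
  show "in_Top haus (paths ?P a b)" unfolding ab(1,2) paths_cube_poset[OF ab(3,4)] by (rule in_Top_discrete)
  fix c :: "'a univ" assume "c : states ?P"
  then obtain ga where c: "c = Vertex ga" "ga : vert n" by auto
  show "cmap (delta_prod (paths ?P a b) (paths ?P b c)) (paths ?P a c) (%(p, q). pcomp ?P a b c p q)"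
  proof (cases "vless al be & vless be ga")
    case True
    hence "vless al ga" using vless_trans by blast
    thus ?thesis using ab c by (simp add: paths_cube_poset pcomp_cube_poset case_prod_beta')
  next
    case False
    thus ?thesis using ab c by (intro continuous_map_from_empty) (auto simp: paths_cube_poset)
  qed
qed (simp add: pcomp_cube_poset)

definition collapse :: "nat => 'a uflow_map" where
  "collapse n = fmap_on (nat_cube n) (%a. a, %_ _ _. Vertex [])"

lemma is_flow_map_collapse: "is_flow_map (nat_cube n :: 'a uflow) (fob cube_poset n) (collapse n)"
  unfolding collapse_def
proof (rule is_flow_map_fmap_on[OF is_flow_nat_cube], unfold fst_conv snd_conv)
  fix a b :: "'a univ" assume "a : states (nat_cube n :: 'a uflow)" "b : states (nat_cube n :: 'a uflow)"
  then obtain al be where ab: "a = Vertex al" "b = Vertex be" "al : vert n" "be : vert n" by auto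
  show "cmap (paths (nat_cube n) a b) (paths (fob cube_poset n) a b) (%_. Vertex [])"
  proof (cases "vless al be")
    case False
    thus ?thesis using ab by (intro continuous_map_from_empty) (simp add: topspace_paths_nat_cube)
  qed (use ab in \<open>simp add: paths_cube_poset\<close>)
qed (auto simp: pcomp_cube_poset)

lemma fmor_cube_poset:
  assumes b: "box_map m n \<phi>"
  shows "is_flow_map (fob cube_poset m :: 'a uflow) (fob cube_poset n) (fmor cube_poset m n \<phi>)"
    "fcomp (nat_cube m) (fmor cube_poset m n \<phi>) (collapse m) = (fcomp (nat_cube m) (collapse n) (nat_cube_map m n \<phi>) :: 'a uflow_map)"
proof -
  have e: "(fmor cube_poset m n \<phi> :: 'a uflow_map) = fmap_on (fob cube_poset m) (%a. Vertex (\<phi> (unVertex a)), %_ _ p. p)"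
    by (simp add: cube_poset_def Let_def)
  obtain g where g: "coords_at m n \<phi> g" using box_map_coords[OF b] by blast
  note v = box_map_vert[OF b] and vl = vless_coords_at[OF g]
  show F: "is_flow_map (fob cube_poset m :: 'a uflow) (fob cube_poset n) (fmor cube_poset m n \<phi>)" unfolding e
    by (rule is_flow_map_fmap_on[OF is_flow_cube_poset]) (auto simp: v paths_cube_poset vl pcomp_cube_poset)
  show "fcomp (nat_cube m) (fmor cube_poset m n \<phi>) (collapse m) = (fcomp (nat_cube m) (collapse n) (nat_cube_map m n \<phi>) :: 'a uflow_map)"
  proof (rule flow_map_eqI)
    show "is_flow_map (nat_cube m) (fob cube_poset n) (fcomp (nat_cube m) (fmor cube_poset m n \<phi>) (collapse m) :: 'a uflow_map)"
      by (rule is_flow_map_fcomp[OF is_flow_nat_cube is_flow_map_collapse F])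
    show "is_flow_map (nat_cube m) (fob cube_poset n) (fcomp (nat_cube m) (collapse n) (nat_cube_map m n \<phi>) :: 'a uflow_map)"
      by (rule is_flow_map_fcomp[OF is_flow_nat_cube is_flow_map_nat_cube_map[OF b] is_flow_map_collapse])
  next
    fix a :: "'a univ" assume "a : states (nat_cube m :: 'a uflow)"
    thus "fst (fcomp (nat_cube m) (fmor cube_poset m n \<phi>) (collapse m)) a =
        fst (fcomp (nat_cube m) (collapse n) (nat_cube_map m n \<phi>)) a"
      by (auto simp: collapse_def e nat_cube_map_fst v)
  next
    fix a b q :: "'a univ"
    assume "a : states (nat_cube m :: 'a uflow)" "b : states (nat_cube m :: 'a uflow)" and q: "q : topspace (paths (nat_cube m) a b)"
    then obtain al be where ab: "a = Vertex al" "b = Vertex be" "al : vert m" "be : vert m" by auto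
    have "vless al be" using q ab by (simp add: topspace_paths_nat_cube split: if_splits)
    thus "snd (fcomp (nat_cube m) (fmor cube_poset m n \<phi>) (collapse m)) a b q =
        snd (fcomp (nat_cube m) (collapse n) (nat_cube_map m n \<phi>)) a b q"
      using ab q paths_nat_cube_face[OF b ab(3,4), where 'a = 'a]
      by (simp add: collapse_def e nat_cube_map_fst nat_cube_map_snd v paths_cube_poset)
  qed
qed

text \<open>The realization of a standard cube is the flow of natural d-paths itself, by the Yoneda lemma.\<close>

lemma real_std_cube_iso:
  obtains r where "is_flow_map (real_flow haus (std_cube n :: 'a uprecub)) (nat_cube n) r"
    "fcomp (nat_cube n) r (top_cell haus n) = fmap_on (nat_cube n) (id, %_ _. id)"
    "fcomp (real_flow haus (std_cube n)) (top_cell haus n) r = fmap_on (real_flow haus (std_cube n)) (id, %_ _. id)"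
    "!!m \<phi>. box_map m n \<phi> ==> fcomp (nat_cube m) r (cell_map haus (std_cube n) m (Face \<phi>)) = nat_cube_map m n \<phi>"
proof -
  let ?K = "std_cube n :: 'a uprecub" and ?id = "fmap_on (nat_cube n) (id, %_ _. id) :: 'a uflow_map"
  note K = is_precubical_std_cube[of n, where 'a = 'a]
  obtain r where r: "is_flow_map (real_flow haus ?K) (nat_cube n) r" and rc: "!!m x. x : cells ?K m ==>
      fcomp (nat_cube m) r (cell_map haus ?K m x) = fcomp (nat_cube m) ?id (nat_cube_map m n (unFace x))"
    using real_mapE[OF K is_flow_nat_cube cubical_family_std_cube[OF is_flow_map_id[OF is_flow_nat_cube]]] by blast
  have rm: "fcomp (nat_cube m) r (cell_map haus ?K m (Face \<phi>)) = nat_cube_map m n \<phi>" if b: "box_map m n \<phi>" for m \<phi>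
    using rc[of "Face \<phi>" m] b by (simp add: fcomp_id_left[OF is_flow_map_nat_cube_map[OF b]])
  have re: "fcomp (nat_cube n) r (top_cell haus n) = ?id" using rm[OF box_map.ident] by (simp add: nat_cube_map_id)
  have "fcomp (real_flow haus ?K) (top_cell haus n) r = fmap_on (real_flow haus ?K) (id, %_ _. id)"
  proof (rule real_map_eqI[OF K is_flow_real[OF K] is_flow_map_fcomp[OF is_flow_real[OF K] r top_cell] is_flow_map_id[OF is_flow_real[OF K]]])
    fix m x assume x: "x : cells ?K m"
    then obtain \<phi> where \<phi>: "x = Face \<phi>" "box_map m n \<phi>" by auto
    note c = cubical_familyD(1)[OF cell_family[OF K] x, of haus]
    show "fcomp (nat_cube m) (fcomp (real_flow haus ?K) (top_cell haus n) r) (cell_map haus ?K m x) =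
        fcomp (nat_cube m) (fmap_on (real_flow haus ?K) (id, %_ _. id)) (cell_map haus ?K m x)"
      unfolding fcomp_id_left[OF c] fcomp_assoc[OF c, symmetric] unfolding \<phi>(1) rm[OF \<phi>(2)]
      by (rule cell_map_std_cube[OF \<phi>(2), symmetric])
  qed
  thus ?thesis using that[OF r re] rm by blast
qed

lemma fmap_id_fst: "fcomp X g f = fmap_on X (id, %_ _. id) ==> al : states X ==> fst g (fst f al) = al"
  by (metis fcomp_fst fmap_on_fst fst_conv id_apply)

lemma fmap_id_snd: "fcomp X g f = fmap_on X (id, %_ _. id) ==> al : states X ==> be : states X ==>
    q : topspace (paths X al be) ==> snd g (fst f al) (fst f be) (snd f al be q) = q"
  by (metis fcomp_snd fmap_on_snd snd_conv id_apply)

text \<open>Nonempty path spaces are equiconnected on both sides, and empty ones correspond.\<close>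

lemma flow_weak_equivalence_collapse:
  assumes r: "is_flow_map X (nat_cube n :: 'a uflow) r" and e: "is_flow_map (nat_cube n) X e"
    and re: "fcomp (nat_cube n) r e = fmap_on (nat_cube n) (id, %_ _. id)" and er: "fcomp X e r = fmap_on X (id, %_ _. id)"
    and X: "is_flow haus (X :: 'a uflow)"
  shows "flow_weak_equivalence X (fob cube_poset n) (fcomp X (collapse n) r)" unfolding flow_weak_equivalence_def
proof (intro conjI ballI)
  have cr: "fst (fcomp X (collapse n) r) a = fst r a" if "a : states X" for a
    using that flow_map_state[OF r that] by (simp add: collapse_def)
  show "bij_betw (fst (fcomp X (collapse n) r)) (states X) (states (fob cube_poset n))"
    by (rule bij_betw_byWitness[where f' = "fst e"])
      (use cr fmap_id_fst[OF re] fmap_id_fst[OF er] flow_map_state[OF r] flow_map_state[OF e] in \<open>auto simp: collapse_def\<close>)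
  fix a b assume a: "a : states X" and b: "b : states X"
  then obtain al be where ab: "fst r a = Vertex al" "fst r b = Vertex be" "al : vert n" "be : vert n"
    using flow_map_state[OF r a] flow_map_state[OF r b] by auto
  let ?f = "snd (fcomp X (collapse n) r) a b" and ?P = "paths (fob cube_poset n) (Vertex al) (Vertex be) :: 'a univ topology"
  have eab: "fst e (Vertex al) = a" "fst e (Vertex be) = b" using fmap_id_fst[OF er a] fmap_id_fst[OF er b] ab by auto
  have rc: "cmap (paths X a b) (paths (nat_cube n) (Vertex al) (Vertex be)) (snd r a b)"
    using flow_map_cont[OF r a b] ab by simp
  have ec: "cmap (paths (nat_cube n) (Vertex al) (Vertex be)) (paths X a b) (snd e (Vertex al) (Vertex be))"
    using flow_map_cont[OF e, of "Vertex al" "Vertex be"] ab eab by simp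
  have "weak_homotopy_equivalence (paths X a b) ?P ?f"
  proof (cases "vless al be")
    case True
    let ?N = "N (rise al be)"
    have N: "paths (nat_cube n) (Vertex al) (Vertex be) = (npath_top ?N :: 'a univ topology)" using True ab by (simp add: paths_nat_cube)
    have "equiconnected (npath_top ?N :: 'a univ topology)"
      by (rule equiconnected_retract[OF equiconnected_N continuous_map_NPath continuous_map_unNPath]) auto
    hence eq: "equiconnected (paths X a b)"
      by (rule equiconnected_retract[OF _ ec[unfolded N] rc[unfolded N]]) (use fmap_id_snd[OF er a b] ab in simp)
    have "topspace (npath_top ?N :: 'a univ topology) ~= {}" by (simp add: natural_dpaths_nonempty)
    hence ne: "topspace (paths X a b) ~= {}" using continuous_map_funspace[OF ec[unfolded N]] by blast
    have f: "cmap (paths X a b) ?P ?f"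
      using flow_map_cont[OF is_flow_map_fcomp[OF X r is_flow_map_collapse] a b] by (simp only: cr[OF a] cr[OF b] ab(1,2))
    show ?thesis
      by (rule weak_homotopy_equivalence_equiconnected[OF eq _ f ne]) (use True ab in \<open>simp add: paths_cube_poset equiconnected_discrete\<close>)
  next
    case False
    hence "q ~: topspace (paths X a b)" for q
      using continuous_map_funspace[OF rc, of q] ab by (auto simp: topspace_paths_nat_cube)
    hence "topspace (paths X a b) = {}" by blast
    thus ?thesis by (rule weak_homotopy_equivalence_empty) (use False ab in \<open>simp add: paths_cube_poset\<close>)
  qed
  thus "weak_homotopy_equivalence (paths X a b)
      (paths (fob cube_poset n) (fst (fcomp X (collapse n) r) a) (fst (fcomp X (collapse n) r) b)) ?f"
    by (simp only: cr[OF a] cr[OF b] ab(1,2))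
qed

lemma std_cube_comparison:
  "\<exists>\<tau> :: nat => 'a uflow_map.
     (\<forall>n. is_flow_map (real_flow haus (std_cube n)) (fob cube_poset n) (\<tau> n) \<and>
        flow_weak_equivalence (real_flow haus (std_cube n)) (fob cube_poset n) (\<tau> n)) \<and>
     (\<forall>m n. \<forall>\<phi>\<in>Hom Box m n.
        fcomp (real_flow haus (std_cube m)) (\<tau> n) (real_map haus (std_cube m) (std_cube n) (fmor yoneda m n \<phi>)) =
        fcomp (real_flow haus (std_cube m)) (fmor cube_poset m n \<phi>) (\<tau> m))"
proof -
  let ?R = "%n. real_flow haus (std_cube n :: 'a uprecub)" and ?id = "%X. fmap_on X (id, %_ _. id) :: 'a uflow_map"
  note K = is_precubical_std_cube[where 'a = 'a]
  have "\<forall>n. \<exists>r. is_flow_map (?R n) (nat_cube n) r & fcomp (nat_cube n) r (top_cell haus n) = ?id (nat_cube n) \<and>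
      fcomp (?R n) (top_cell haus n) r = ?id (?R n) \<and>
      (\<forall>m \<phi>. box_map m n \<phi> --> fcomp (nat_cube m) r (cell_map haus (std_cube n) m (Face \<phi>)) = nat_cube_map m n \<phi>)"
    using real_std_cube_iso by metis
  then obtain r where r: "!!n. is_flow_map (?R n) (nat_cube n) (r n)"
    and re: "!!n. fcomp (nat_cube n) (r n) (top_cell haus n) = ?id (nat_cube n)"
    and er: "!!n. fcomp (?R n) (top_cell haus n) (r n) = ?id (?R n)"
    and rc: "!!n m \<phi>. box_map m n \<phi> ==> fcomp (nat_cube m) (r n) (cell_map haus (std_cube n) m (Face \<phi>)) = nat_cube_map m n \<phi>"
    by metis
  define \<tau> where "\<tau> n = fcomp (?R n) (collapse n) (r n)" for n
  have t: "is_flow_map (?R n) (fob cube_poset n) (\<tau> n)" for n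
    unfolding \<tau>_def by (rule is_flow_map_fcomp[OF is_flow_real[OF K] r is_flow_map_collapse])
  have tc: "fcomp (nat_cube k) (\<tau> n) (cell_map haus (std_cube n) k (Face \<psi>)) = fcomp (nat_cube k) (collapse n) (nat_cube_map k n \<psi>)"
    if b: "box_map k n \<psi>" for n k \<psi>
  proof -
    have c: "Face \<psi> : cells (std_cube n) k" using b by simp
    show ?thesis
      unfolding \<tau>_def fcomp_assoc[OF cubical_familyD(1)[OF cell_family[OF K] c], symmetric] rc[OF b] ..
  qed
  have "flow_weak_equivalence (?R n) (fob cube_poset n) (\<tau> n)" for n
    unfolding \<tau>_def by (rule flow_weak_equivalence_collapse[OF r top_cell re er is_flow_real[OF K]])
  moreover have "fcomp (?R m) (\<tau> n) (real_map haus (std_cube m) (std_cube n) (fmor yoneda m n \<phi>)) =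
      fcomp (?R m) (fmor cube_poset m n \<phi>) (\<tau> m)" if b: "box_map m n \<phi>" for m n \<phi>
  proof -
    note y = is_precub_map_yoneda[OF b, where 'a = 'a]
    show ?thesis
    proof (rule real_map_eqI[OF K is_flow_cube_poset is_flow_map_fcomp[OF is_flow_real[OF K] real_map(1)[OF K K y] t]
          is_flow_map_fcomp[OF is_flow_real[OF K] t fmor_cube_poset(1)[OF b]]])
      fix k x assume x: "x : cells (std_cube m :: 'a uprecub) k"
      then obtain \<psi> where \<psi>: "x = Face \<psi>" "box_map k m \<psi>" by auto
      note N = is_flow_map_nat_cube_map[OF \<psi>(2), where 'a = 'a]
      have "fcomp (nat_cube k) (fcomp (?R m) (\<tau> n) (real_map haus (std_cube m) (std_cube n) (fmor yoneda m n \<phi>))) (cell_map haus (std_cube m) k x) =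
          fcomp (nat_cube k) (\<tau> n) (cell_map haus (std_cube n) k (Face (compose (vert k) \<phi> \<psi>)))"
        unfolding fcomp_real_map[OF K K y x] using x \<psi> by (simp add: yoneda_def)
      also have "\<dots> = fcomp (nat_cube k) (fcomp (nat_cube m) (collapse n) (nat_cube_map m n \<phi>)) (nat_cube_map k m \<psi>)"
        unfolding tc[OF box_map.comp[OF \<psi>(2) b]] nat_cube_map_comp[OF \<psi>(2) b] by (rule fcomp_assoc[OF N])
      also have "\<dots> = fcomp (nat_cube k) (fmor cube_poset m n \<phi>) (fcomp (nat_cube k) (collapse m) (nat_cube_map k m \<psi>))"
        unfolding fmor_cube_poset(2)[OF b, symmetric] by (rule fcomp_assoc[OF N, symmetric])
      also have "\<dots> = fcomp (nat_cube k) (fcomp (?R m) (fmor cube_poset m n \<phi>) (\<tau> m)) (cell_map haus (std_cube m) k x)"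
        unfolding tc[OF \<psi>(2), symmetric] \<psi>(1)[symmetric] by (rule fcomp_assoc[OF cubical_familyD(1)[OF cell_family[OF K] x]])
      finally show "fcomp (nat_cube k) (fcomp (?R m) (\<tau> n) (real_map haus (std_cube m) (std_cube n) (fmor yoneda m n \<phi>))) (cell_map haus (std_cube m) k x) =
          fcomp (nat_cube k) (fcomp (?R m) (fmor cube_poset m n \<phi>) (\<tau> m)) (cell_map haus (std_cube m) k x)" .
    qed
  qed
  ultimately show ?thesis using t by (intro exI[of _ \<tau>] conjI allI ballI) simp_all
qed

theorem theorem5p9:
  fixes haus :: bool
  shows "m_realization_functor haus (nat_realization haus :: 'a upc_to_flow) \<and>
    (\<forall>K :: 'a uprecub. is_precubical_set K \<longrightarrow>
       m_cofibrant haus (fob (nat_realization haus) K))"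
proof -
  have y: "fmor (fctr_comp (nat_realization haus) yoneda) m n \<phi> =
      (real_map haus (std_cube m) (std_cube n) (fmor yoneda m n \<phi>) :: 'a uflow_map)" for m n \<phi>
    by (simp add: fctr_comp_def yoneda_def)
  show ?thesis
    unfolding m_realization_functor_def
    using std_cube_comparison[of haus, where 'a = 'a]
    by (simp add: y is_functor_nat_realization colimit_preserving_nat_realization m_cofibration_bdry m_cofibrant_real)
qed

end
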